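(* Let $\hat S$ be the positively step-reinforced random walk with reinforcement parameter $p$ built from i.i.d. variables $X_1,X_2,\dots$ with $\mathbb{E}(X_1^2)<\infty$; let $m_1=\mathbb{E}(X_1)$, $\sigma^2=\mathrm{Var}(X_1)$, and assume $\sigma>0$. (1) If $p\in(0,1/2)$, then there exists a richer probability space with a standard Brownian motion $\{W(t),t\ge0\}$ such that, as $n\to\infty$, $$\frac{1}{\sqrt{n^{1-2p}\log\log n}}\left|\frac{\sqrt{1-2p}}{\sigma}\,\frac{\hat S(n)-m_1n}{n^{p}}-W(n^{1-2p})\right|\to0\quad\text{a.s.}$$ and $$\max_{0\le t\le1}\left|\frac{\sqrt{1-2p}}{\sigma}\,\frac{\hat S([nt])-m_1[nt]}{\sqrt n}-\frac{t^{p}\,W((nt)^{1-2p})}{\sqrt{n^{1-2p}}}\right|\to0\quad\text{in probability.}$$ (2) If $p=1/2$, then there exists a richer probability space with a standard Brownian motion $\{W(t),t\ge0\}$ such that, as $n\to\infty$, $$\frac{1}{\sqrt{\log n\,\log\log\log n}}\left|\frac{\hat S(n)-m_1n}{\sigma\sqrt n}-W(\log n)\right|\to0\quad\text{a.s.}$$ and $$\frac{1}{\sqrt{\log n}}\max_{1/n\le t\le1}\left|\frac{\hat S([nt])-m_1[nt]}{\sigma\sqrt{[nt]}}-W(\log(nt))\right|\to0\quad\text{in probability.}$$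
   Context: Let $\{X_n,n\ge1\}$ be i.i.d. real random variables, $\{\varepsilon_n,n\ge2\}$ i.i.d. Bernoulli variables with parameter $p$ (so $\mathbb{P}(\varepsilon_n=1)=p$), and for $n\ge2$ let $U_n$ be uniformly distributed on $\{1,\dots,n-1\}$; all the variables $X_1,X_2,\varepsilon_2,U_2,X_3,\varepsilon_3,U_3,\dots$ are independent. Positively step-reinforced walk: $\hat X_1=X_1$ and for $n\ge2$, $\hat X_n=X_n$ if $\varepsilon_n=0$, $\hat X_n=\hat X_{U_n}$ if $\varepsilon_n=1$; $\hat S(n)=\hat X_1+\dots+\hat X_n$, $\hat S(0)=0$. $[x]$ is the integer part of $x$; "max" over an interval of $t$ means supremum. "There exists a richer probability space with a standard Brownian motion" means: there is a probability space carrying a copy of the process (with the same law) together with a standard Brownian motion $W$ such that the stated convergences hold for them jointly. *)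

theory Defs
  imports "HOL-Probability.Probability"
begin

text \<open>
  The coins have values in \<^typ>\<open>bool\<close>, with \<^term>\<open>True\<close> for the value 1.
  Joint independence of the real, Boolean and natural-number valued variables is expressed by
  \<open>indep_vars\<close> after composing the latter two with the injections \<^const>\<open>of_bool\<close> and
  \<^const>\<open>of_nat\<close> into the reals, which does not change the generated sigma-algebras.
  Only the indices \<open>n \<ge> 1\<close> of \<open>X\<close> and \<open>n \<ge> 2\<close> of \<open>\<epsilon>\<close> and \<open>U\<close> are meaningful.
\<close>

locale step_reinforcement = prob_space M
  for M :: "'a measure"
    and X :: "nat \<Rightarrow> 'a \<Rightarrow> real"
    and \<epsilon> :: "nat \<Rightarrow> 'a \<Rightarrow> bool"
    and U :: "nat \<Rightarrow> 'a \<Rightarrow> nat"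
    and p :: real +
  assumes X_measurable: "\<And>n. 1 \<le> n \<Longrightarrow> X n \<in> borel_measurable M"
    and X_identically_distributed: "\<And>n. 1 \<le> n \<Longrightarrow> distr M borel (X n) = distr M borel (X 1)"
    and p_range: "0 \<le> p" "p \<le> 1"
    and \<epsilon>_measurable: "\<And>n. 2 \<le> n \<Longrightarrow> \<epsilon> n \<in> measurable M (count_space UNIV)"
    and \<epsilon>_bernoulli:
      "\<And>n. 2 \<le> n \<Longrightarrow> distr M (count_space UNIV) (\<epsilon> n) = measure_pmf (bernoulli_pmf p)"
    and U_measurable: "\<And>n. 2 \<le> n \<Longrightarrow> U n \<in> measurable M (count_space UNIV)"
    and U_uniform:
      "\<And>n. 2 \<le> n \<Longrightarrow> distr M (count_space UNIV) (U n) = measure_pmf (pmf_of_set {1..n - 1})"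
    and independent:
      "indep_vars (\<lambda>_. borel)
         (case_sum X (case_sum (\<lambda>n \<omega>. of_bool (\<epsilon> n \<omega>)) (\<lambda>n \<omega>. real (U n \<omega>))))
         ({1..} <+> ({2..} <+> {2..}))"

text \<open>
  The reinforced steps are defined pathwise. The test \<open>u n \<in> {1..n - 1}\<close> makes the recursion
  total; it forces \<open>n \<ge> 2\<close>, and for \<open>n \<ge> 2\<close> it holds almost surely when \<open>u n\<close> is
  uniform on \<open>{1..n - 1}\<close>.
\<close>

fun reinforced_step :: "(nat \<Rightarrow> real) \<Rightarrow> (nat \<Rightarrow> bool) \<Rightarrow> (nat \<Rightarrow> nat) \<Rightarrow> nat \<Rightarrow> real" where
  "reinforced_step x e u n =
     (if e n \<and> u n \<in> {1..n - 1} then reinforced_step x e u (u n) else x n)"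

declare reinforced_step.simps [simp del]

definition reinforced_walk ::
    "(nat \<Rightarrow> 'a \<Rightarrow> real) \<Rightarrow> (nat \<Rightarrow> 'a \<Rightarrow> bool) \<Rightarrow> (nat \<Rightarrow> 'a \<Rightarrow> nat) \<Rightarrow> nat \<Rightarrow> 'a \<Rightarrow> real" where
  "reinforced_walk X \<epsilon> U n \<omega> =
     (\<Sum>k = 1..n. reinforced_step (\<lambda>i. X i \<omega>) (\<lambda>i. \<epsilon> i \<omega>) (\<lambda>i. U i \<omega>) k)"

text \<open>Only the times \<open>t \<ge> 0\<close> of \<open>W\<close> are meaningful.\<close>

locale standard_brownian_motion = prob_space M
  for M :: "'a measure"
    and W :: "real \<Rightarrow> 'a \<Rightarrow> real" +
  assumes W_measurable: "\<And>t. 0 \<le> t \<Longrightarrow> W t \<in> borel_measurable M"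
    and W_zero: "\<And>\<omega>. \<omega> \<in> space M \<Longrightarrow> W 0 \<omega> = 0"
    and W_continuous: "\<And>\<omega>. \<omega> \<in> space M \<Longrightarrow> continuous_on {0..} (\<lambda>t. W t \<omega>)"
    and W_increment_normal:
      "\<And>s t. 0 \<le> s \<Longrightarrow> s < t \<Longrightarrow>
         distributed M lborel (\<lambda>\<omega>. W t \<omega> - W s \<omega>) (normal_density 0 (sqrt (t - s)))"
    and W_increments_independent:
      "\<And>(k::nat) (\<tau> :: nat \<Rightarrow> real).
         0 \<le> \<tau> 0 \<Longrightarrow> (\<And>i. i < k \<Longrightarrow> \<tau> i \<le> \<tau> (Suc i)) \<Longrightarrow>
         indep_vars (\<lambda>_. borel) (\<lambda>i \<omega>. W (\<tau> (Suc i)) \<omega> - W (\<tau> i) \<omega>) {..<k}"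

text \<open>
  A coupling of a copy \<open>S'\<close> of a real process \<open>S\<close> with a Brownian motion has its joint law on the
  Polish space of pairs of a real sequence and a continuous path on the half line. Every such law is
  realized on some \<open>M' :: (nat \<Rightarrow> real) measure\<close>, so quantifying over measures on this type stands
  for quantifying over all probability spaces, which HOL cannot do directly.
\<close>

definition same_process_law ::
    "'a measure \<Rightarrow> (nat \<Rightarrow> 'a \<Rightarrow> real) \<Rightarrow> 'b measure \<Rightarrow> (nat \<Rightarrow> 'b \<Rightarrow> real) \<Rightarrow> bool" where
  "same_process_law M S M' S' \<longleftrightarrow>
     (\<forall>n. S n \<in> borel_measurable M) \<and> (\<forall>n. S' n \<in> borel_measurable M') \<and>
     distr M (\<Pi>\<^sub>M n\<in>UNIV. borel) (\<lambda>\<omega> n. S n \<omega>) = distr M' (\<Pi>\<^sub>M n\<in>UNIV. borel) (\<lambda>\<omega> n. S' n \<omega>)"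

text \<open>
  Measurability is part of the definition because \<^const>\<open>measure\<close> is 0 on non-measurable sets.
\<close>

definition tendsto_zero_in_probability :: "'a measure \<Rightarrow> (nat \<Rightarrow> 'a \<Rightarrow> real) \<Rightarrow> bool" where
  "tendsto_zero_in_probability M Z \<longleftrightarrow>
     (\<forall>n. Z n \<in> borel_measurable M) \<and>
     (\<forall>e>0. (\<lambda>n. measure M {\<omega> \<in> space M. \<bar>Z n \<omega>\<bar> > e}) \<longlonglongrightarrow> 0)"

end

theory Submission
  imports Defs "HOL-Probability.Probability" "HOL-Real_Asymp.Real_Asymp"
begin

text \<open>With \<open>b n\<close> of order \<open>n powr (- p)\<close>, \<open>b n * (S n - m n)\<close> is a martingale up to a
summable error. It is embedded into a Brownian motion step by step: given the past, a pair of jumps of opposite signs is drawn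
from the truncated law of the next step, and the motion, observed on a grid of tiny mesh, runs until it leaves the
interval between them. A uniform variable independent of the motion corrects the bias caused by the overshoot, so
that the walk has exactly the required law. The strong law shows that the time used is asymptotic to the variance,
and the modulus of continuity of Brownian motion turns this into the two approximations.\<close>

text \<open>Observing the motion on grids reduces every stopping argument to a countable sum over
  grid indices and to inductions on the first Gaussian increment. The price is the overshoot. A copy
  must have the same law and not merely a close one, so the bias cannot be left as an error: the
  correcting coin makes the value exact, and only the agreement between value and motion is
  approximate, with mean error at most \<open>(1/2) ^ k\<close> at step \<open>k\<close>. The grids
  are nested, so that the stopping place of one step is a grid point for the next. Mesh and cap must
  suit all intervals of a step at once, which is why the values are truncated at size
  \<open>sqrt (k + 1)\<close>; under a finite second moment almost surely only finitely many
  truncations matter. As for the scale: given \<open>n\<close> steps, the next one has mean (1-p) m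
  + p S(n)/n, so the centred sum is multiplied in mean by 1 + p/n, and n^(-p) cancels this factor to
  first order. The conditional variances of the scaled steps then add up to n^(1-2p), or to ln n for
  p = 1/2, which is the time that the motion has used.\<close>

notation (input) LIMSEQ (infix "---->" 60) and pair_measure (infixr "><" 80) and measurable (infixr "->M" 60)

abbreviation (input) ev_seq :: "(nat => bool) => bool" (binder "EV " 10) where "ev_seq P == eventually P sequentially"

abbreviation Hist :: "(nat => real) measure" where "Hist == \<Pi>\<^sub>M i\<in>UNIV. borel"

lemmas bint_add = Bochner_Integration.integrable_add and bint_bound = Bochner_Integration.integrable_bound
 and bint_diff = Bochner_Integration.integrable_diff and bochner_add = Bochner_Integration.integral_add

section \<open>Exit of a Gaussian walk from an interval\<close>

text \<open>The parameter is the variance, so that the mesh of a time grid is the parameter of its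
  increments.\<close>

definition gauss :: "real => real measure" where
 "gauss v = density lborel (%x. ennreal (normal_density 0 (sqrt v) x))"

lemma sets_gauss [measurable_cong, simp]: "sets (gauss v) = sets borel" by (simp add: gauss_def)

lemma space_gauss [simp]: "space (gauss v) = UNIV" by (simp add: gauss_def)

lemma prob_space_gauss: "v > 0 ==> prob_space (gauss v)" unfolding gauss_def by (rule prob_space_normal_density) simp

lemma nn_integral_gauss:
 "f : borel_measurable borel ==> nn_integral (gauss v) f = nn_integral lborel (%x. ennreal (normal_density 0 (sqrt v) x) * f x)"
 unfolding gauss_def by (subst nn_integral_density) auto

lemma integral_gauss:
 fixes f :: "real => real"
 shows "f : borel_measurable borel ==> (LINT x|gauss v. f x) = (LINT x|lborel. normal_density 0 (sqrt v) x * f x)"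
 unfolding gauss_def by (subst integral_density) auto

lemma integrable_gauss:
 fixes f :: "real => real"
 shows "f : borel_measurable borel ==> integrable (gauss v) f \<longleftrightarrow> integrable lborel (%x.
   normal_density 0 (sqrt v) x * f x)"
 unfolding gauss_def by (subst integrable_density) auto

lemma gauss_moment1:
 assumes "v > 0" shows "integrable (gauss v) (%x. x)" "(LINT x|gauss v. x) = 0"
 using integrable_normal_moment_nz_1[of "sqrt v" 0] integral_normal_moment_nz_1[of "sqrt v" 0] assms
 by (auto simp: integrable_gauss integral_gauss)

lemma gauss_moment2:
 assumes "v > 0" shows "integrable (gauss v) (%x. x^2)" "(LINT x|gauss v. x^2) = v"
 using integrable_normal_moment[of "sqrt v" 0 2] integral_normal_moment_even[of "sqrt v" 0 1] assms
 by (auto simp: integrable_gauss integral_gauss)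

lemma gauss_shift_moment2:
 assumes "v > 0" shows "nn_integral (gauss v) (%x. ennreal ((c + x)^2)) = ennreal (c^2 + v)"
proof -
 interpret prob_space "gauss v" using prob_space_gauss[OF assms] .
 have "nn_integral (gauss v) (%x. ennreal ((c + x)^2)) = ennreal (LINT x|gauss v. (c + x)^2)"
 proof (intro nn_integral_eq_integral)
  show "integrable (gauss v) (%x. (c + x)^2)"
   using gauss_moment1[OF assms] gauss_moment2[OF assms] by (simp add: power2_sum)
 qed auto
 also have "(LINT x|gauss v. (c + x)^2) = c^2 + v"
  using gauss_moment1[OF assms] gauss_moment2[OF assms] by (simp add: power2_sum prob_space[unfolded space_gauss])
 finally show ?thesis .
qed

lemma gauss_uminus: "v > 0 ==> distr (gauss v) borel uminus = gauss v"
proof -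
 assume v: "v > 0"
 interpret prob_space "gauss v" using prob_space_gauss[OF v] .
 have "distributed (gauss v) lborel (%x. x) (normal_density 0 (sqrt v))"
  unfolding distributed_def gauss_def by (auto simp: distr_id2)
 from normal_density_affine[OF this, of "-1" 0] v
 have "distributed (gauss v) lborel uminus (normal_density 0 (sqrt v))" by simp
 then show ?thesis unfolding distributed_def by (auto simp: gauss_def cong: distr_cong)
qed

text \<open>For the standard normal density \<open>\<phi>\<close> and \<open>c \<ge> 0\<close> one has
 \<open>(y - c)\<^sup>2 \<le> (y - c) * y\<close> on \<open>y \<ge> c\<close>, and \<open>(y - c) * y * \<phi> y - \<phi>
   y\<close> is the derivative of \<open>- (y - c) * \<phi> y\<close>.\<close>

lemma gauss_residual:
 assumes v: "v > 0" and c: "c >= 0"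
 shows "nn_integral (gauss v) (%y. ennreal ((y - c)^2) * indicator {c..} y) <= ennreal v * emeasure (gauss v) {c..}"
proof -
 let ?A = "%y c. (y - c) * y"
 let ?B = "integrable (gauss v)"
 let ?C = "%c. LINT y:{c..}|gauss v. (y - c) * y"
 let ?D = "%c. indicator {c..}"
 interpret prob_space "gauss v" using prob_space_gauss[OF v] .
 let ?\<phi> = "normal_density 0 (sqrt v)"
 have [derivative_intros]: "(?\<phi> has_real_derivative - y / v * ?\<phi> y) (at y)" for y
  unfolding normal_density_def using v by (auto intro!: derivative_eq_intros simp: field_simps power2_eq_square)
 have int2: "integrable lborel (%y. ?\<phi> y * (?A y c))"
 proof -
  have "?B (%y. y^2 - c * y)" using gauss_moment1[OF v] gauss_moment2[OF v] by auto
  then show ?thesis by (simp add: integrable_gauss algebra_simps power2_eq_square)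
 qed
 have int0: "integrable lborel (%y. ?\<phi> y * v)" using v by auto
 have lim: "((%y. - v * (y - c) * ?\<phi> y) \<longlongrightarrow> 0) at_top"
  unfolding normal_density_def using v by simp real_asymp
 have eq: "(LBINT y=ereal c..\<infinity>. ?\<phi> y * (?A y c) - ?\<phi> y * v) = 0 - 0"
 proof (rule interval_integral_FTC_integrable[where F="%y. - v * (y - c) * ?\<phi> y"])
  show "set_integrable lborel (einterval (ereal c) \<infinity>) (%y. ?\<phi> y * (?A y c) - ?\<phi> y * v)"
   using int2 int0 unfolding set_integrable_def by (intro integrable_mult_indicator) auto
  show "((%y. - v * (y - c) * ?\<phi> y) has_vector_derivative ?\<phi> y * (?A y c) - ?\<phi> y * v) (at y)" for y
   using v by (auto simp: has_real_derivative_iff_has_vector_derivative[symmetric] field_simps intro!: derivative_eq_intros)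
  show "(((%y. - v * (y - c) * ?\<phi> y) \<circ> real_of_ereal) \<longlongrightarrow> 0) (at_right (ereal c))"
  proof -
   have "isCont (%y. - v * (y - c) * ?\<phi> y) c"
    unfolding normal_density_def using v by (auto intro!: continuous_intros)
   then have "((%y. - v * (y - c) * ?\<phi> y) \<longlongrightarrow> 0) (at_right c)"
    by (auto simp: isCont_def dest: tendsto_within_subset)
   then show ?thesis by (simp add: ereal_tendsto_simps1)
  qed
  show "(((%y. - v * (y - c) * ?\<phi> y) \<circ> real_of_ereal) \<longlongrightarrow> 0) (at_left \<infinity>)"
   using lim by (simp add: ereal_tendsto_simps1)
  show "isCont (%y. ?\<phi> y * (?A y c) - ?\<phi> y * v) y" for y
   unfolding normal_density_def using v by (auto intro!: continuous_intros)
 qed auto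
 have I: "set_integrable lborel {c..} (%y. ?\<phi> y * (?A y c))" "set_integrable lborel {c..} (%y. ?\<phi> y * v)"
  unfolding set_integrable_def by (rule integrable_mult_indicator[OF _ int2], simp) (rule integrable_mult_indicator[OF _ int0],
    simp)
 have "(LINT y:{c..}|lborel. ?\<phi> y * (?A y c)) = (LINT y:{c..}|lborel. ?\<phi> y * v)"
 proof -
  have "(LINT y:{c..}|lborel. ?\<phi> y * (?A y c) - ?\<phi> y * v) = (LINT y:{c<..}|lborel.
    ?\<phi> y * (?A y c) - ?\<phi> y * v)"
   unfolding set_lebesgue_integral_def
  proof (rule integral_cong_AE)
   show "AE y in lborel. ?D c y *\<^sub>R (?\<phi> y * (?A y c) - ?\<phi> y * v) = indicator {c<..} y *\<^sub>R (?\<phi> y * (?A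
     y c) - ?\<phi> y * v)"
    using AE_lborel_singleton[of c] by eventually_elim (auto split: split_indicator)
  qed auto
  also have "... = 0" using eq by (simp add: interval_integral_to_infinity_eq)
  finally show ?thesis using I by simp
 qed
 then have *: "(?C c) = v * measure (gauss v) {c..}"
 proof -
  have "(?C c) = (LINT y:{c..}|lborel. ?\<phi> y * (?A y c))"
   unfolding set_lebesgue_integral_def by (subst integral_gauss) (auto simp: ac_simps)
  also have "... = (LINT y|gauss v. ?D c y * v)"
   unfolding set_lebesgue_integral_def \<open>(LINT y:{c..}|lborel. ?\<phi> y * ((y - c) * y))
     = _\<close>[unfolded set_lebesgue_integral_def]
   by (subst integral_gauss) (auto simp: ac_simps)
  finally show ?thesis by simp
 qed
 have "nn_integral (gauss v) (%y. ennreal ((y - c)^2) * ?D c y) <= nn_integral (gauss v) (%y. ennreal ((?A y c) * ?D c y))"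
  using c by (intro nn_integral_mono) (auto simp: power2_eq_square split: split_indicator intro!: ennreal_leI mult_left_mono)
 also have "... = ennreal (?C c)" unfolding set_lebesgue_integral_def
 proof (subst nn_integral_eq_integral)
  have "?B (%y. (y - c) * y)" using int2 by (subst integrable_gauss) auto
  then have "?B (%y. ?D c y *\<^sub>R (?A y c))"
   by (intro integrable_mult_indicator) auto
  then show "?B (%y. (y - c) * y * ?D c y)" by (simp add: ac_simps)
 qed (use c in \<open>auto simp: ac_simps split: split_indicator\<close>)
 also have "... = ennreal v * emeasure (gauss v) {c..}" using v by (simp add: * ennreal_mult emeasure_eq_measure)
 finally show ?thesis .
qed

text \<open>For \<open>- a <= b\<close> this is the distance of \<open>y\<close> from the closed
  interval with these ends.\<close>

definition overshoot :: "real => real => real => real" where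
 "overshoot a b y = max 0 (max (y - b) (- a - y))"

lemma measurable_overshoot [measurable (raw)]:
 assumes [measurable]: "A : borel_measurable N" "B : borel_measurable N" "Y : borel_measurable N"
 shows "(%w. overshoot (A w) (B w) (Y w)) : borel_measurable N" unfolding overshoot_def by measurable

text \<open>A jump that leaves the interval passes the threshold \<open>b - x\<close> upwards or,
  after reflection, \<open>a + x\<close>. Both thresholds are nonnegative, so
  \<open>gauss_residual\<close> applies on each side, and the probabilities of the two disjoint
  tails add up.\<close>

lemma gauss_overshoot:
 assumes v: "v > 0" and x: "- a < x" "x < b"
 shows "nn_integral (gauss v) (%y. ennreal ((overshoot a b (x + y))^2) * indicator {y. ~ (- a < x + y & x + y < b)} y)
   <= ennreal v * emeasure (gauss v) {y. ~ (- a < x + y & x + y < b)}"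
proof -
 let ?U = "{b - x..}" and ?D = "{..- a - x}"
 let ?A = "emeasure (gauss v)"
 let ?B = "nn_integral (gauss v)"
 have UD: "{y. ~ (- a < x + y & x + y < b)} = ?U \<union> ?D" "?U \<inter> ?D = {}" using x by auto
 have flip: "?B (%y. f (- y)) = ?B f" if "f : borel_measurable borel" for f :: "real => ennreal"
  by (subst (2) gauss_uminus[OF v, symmetric], subst nn_integral_distr) (use that in auto)
 have "?B (%y. ennreal ((overshoot a b (x + y))^2) * indicator {y. ~ (- a < x + y & x + y < b)} y) = ?B (%y.
   ennreal ((y - (b - x))^2) * indicator ?U y + ennreal ((- y - (a + x))^2) * indicator {a + x..} (- y))"
  using x by (intro nn_integral_cong) (auto simp: overshoot_def max_def algebra_simps split: split_indicator)
 also have "... = ?B (%y. ennreal ((y - (b - x))^2) * indicator ?U y) + ?B (%y. ennreal ((y - (a + x))^2) * indicator {a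
   + x..} y)"
  by (subst nn_integral_add) (auto intro!: arg_cong2[where f="(+)"] flip)
 also have "... <= ennreal v * ?A ?U + ennreal v * ?A {a + x..}"
  using x v by (intro add_mono gauss_residual) auto
 also have "?A {a + x..} = ?A ?D"
  by (subst gauss_uminus[OF v, symmetric], subst emeasure_distr) (auto simp: vimage_def intro!: arg_cong2[where f=emeasure])
 also have "ennreal v * ?A ?U + ennreal v * ?A ?D = ennreal v * ?A (?U \<union> ?D)"
  using UD(2) by (subst plus_emeasure[symmetric]) (auto simp: distrib_left)
 finally show ?thesis unfolding UD(1) .
qed

section \<open>The capped exit of a walk with independent Gaussian increments\<close>

definition gauss_seq :: "real => (nat => real) measure" where
 "gauss_seq v = (\<Pi>\<^sub>M i\<in>UNIV. gauss v)"

lemma sets_gauss_seq [measurable_cong, simp]: "sets (gauss_seq v) = sets Hist"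
 unfolding gauss_seq_def by (intro sets_PiM_cong) auto

lemma space_gauss_seq [simp]: "space (gauss_seq v) = UNIV" by (simp add: gauss_seq_def space_PiM)

lemma prob_space_gauss_seq: "v > 0 ==> prob_space (gauss_seq v)"
 unfolding gauss_seq_def by (intro prob_space_PiM prob_space_gauss)

lemma sequence_space_gauss: "v > 0 ==> sequence_space (gauss v)"
 by (simp add: sequence_space_def product_prob_space_def product_prob_space_axioms_def
   prob_space_gauss product_sigma_finite_def prob_space_imp_sigma_finite)

lemma distr_gauss_seq_Suc:
 assumes "v > 0" shows "distr (gauss v >< gauss_seq v) (gauss_seq v) (%(s, g). case_nat s g) = gauss_seq v"
 using sequence_space.PiM_iter[OF sequence_space_gauss[OF assms]] by (simp add: gauss_seq_def)

lemma measurable_case_nat_pair [measurable]: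
 "(%(s, g). case_nat s g) : gauss v >< gauss_seq v ->M Hist"
 by (rule measurable_PiM_single') (auto simp: split_beta' split: nat.split)

text \<open>Splitting off the first increment: the tool for the inductions on the cap.\<close>

lemma nn_integral_gauss_seq_Suc:
 assumes v: "v > 0" and F [measurable]: "F : borel_measurable Hist"
 shows "nn_integral (gauss_seq v) F = nn_integral (gauss v) (%s. nn_integral (gauss_seq v) (%g. F (case_nat s g)))"
proof -
 interpret S: prob_space "gauss_seq v" using prob_space_gauss_seq[OF v] .
 show ?thesis by (subst distr_gauss_seq_Suc[OF v, symmetric], subst nn_integral_distr)
    (auto simp: S.nn_integral_fst[symmetric] split_beta')
qed

lemma integral_gauss_seq_Suc:
 fixes F :: "_ => real"
 assumes v: "v > 0" and F [measurable]: "F : borel_measurable Hist"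
  and int: "integrable (gauss_seq v) F"
 shows "(LINT g|gauss_seq v. F g) = (LINT s|gauss v. (LINT g|gauss_seq v. F (case_nat s g)))"
proof -
 interpret S: prob_space "gauss_seq v" using prob_space_gauss_seq[OF v] .
 interpret N: prob_space "gauss v" using prob_space_gauss[OF v] .
 interpret pair_sigma_finite "gauss v" "gauss_seq v" ..
 have "integrable (gauss v >< gauss_seq v) (%p. F (case p of (s, g) => case_nat s g))"
  using int by (subst (asm) distr_gauss_seq_Suc[OF v, symmetric]) (subst (asm) integrable_distr_eq, auto)
 from integral_fst'[OF this]
 have "(LINT s|gauss v. (LINT g|gauss_seq v. F (case_nat s g))) = (LINT p|(gauss v >< gauss_seq v). F (case p of (s, g)
   => case_nat s g))"
  by (simp add: split_beta')
 also have "... = (LINT g|gauss_seq v. F g)"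
  by (subst (2) distr_gauss_seq_Suc[OF v, symmetric], subst integral_distr) auto
 finally show ?thesis ..
qed

text \<open>The position is tested before each move, and the ends count as outside. The cap
  \<open>K\<close> bounds the number of steps, so that the moments in question are finite at once;
  that it is rarely reached is a separate estimate.\<close>

fun exit_steps :: "nat => real => real => real => (nat => real) => nat" where
 "exit_steps 0 a b x g = 0"
| "exit_steps (Suc K) a b x g = (if - a < x & x < b then Suc (exit_steps K a b (x + g 0) (%i. g (Suc i))) else 0)"

definition exit_pos :: "nat => real => real => real => (nat => real) => real" where
 "exit_pos K a b x g = x + (\<Sum>i<exit_steps K a b x g. g i)"

lemma exit_pos_0 [simp]: "exit_pos 0 a b x g = x" by (simp add: exit_pos_def)

lemma exit_pos_Suc:
 "exit_pos (Suc K) a b x g = (if - a < x & x < b then exit_pos K a b (x + g 0) (%i. g (Suc i)) else x)"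
 by (simp add: exit_pos_def sum.lessThan_Suc_shift del: sum.lessThan_Suc)

lemma exit_steps_le: "exit_steps K a b x g <= K" by (induction K arbitrary: x g) auto

lemma exit_steps_outside: "~ (- a < x & x < b) ==> exit_steps K a b x g = 0" by (cases K) auto

lemma exit_pos_outside: "~ (- a < x & x < b) ==> exit_pos K a b x g = x"
 by (simp add: exit_pos_def exit_steps_outside)

lemma exit_steps_eq_max: "- a < exit_pos K a b x g ==> exit_pos K a b x g < b ==> exit_steps K a b x g = K"
 by (induction K arbitrary: x g) (auto simp: exit_pos_Suc split: if_splits)

text \<open>The stopping-time property in pathwise form: the count depends only on the increments
  that were used.\<close>

lemma exit_steps_cong:
 "(!!i. i < exit_steps K a b x g ==> g i = g' i) ==> exit_steps K a b x g' = exit_steps K a b x g"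
proof (induction K arbitrary: x g g')
 case (Suc K)
 show ?case
 proof (cases "- a < x & x < b")
  case True
  with Suc.prems[of 0] have 0: "g 0 = g' 0" by auto
  have "exit_steps K a b (x + g 0) (%i. g' (Suc i)) = exit_steps K a b (x + g 0) (%i. g (Suc i))"
   using True Suc.prems[of "Suc _"] by (intro Suc.IH) auto
  with True 0 show ?thesis by simp
 qed auto
qed simp

lemma measurable_shift_seq [measurable (raw)]:
 assumes [measurable]: "G : N ->M Hist" shows "(%w. (%i. G w (Suc i))) : N ->M Hist"
 by (rule measurable_PiM_single') (auto simp: space_PiM)

lemma measurable_exit_steps [measurable (raw)]:
 assumes "A : borel_measurable N" "B : borel_measurable N" "X : borel_measurable N"
  "G : N ->M Hist" shows "(%w. exit_steps K (A w) (B w) (X w) (G w)) : N ->M count_space UNIV" using assms(3,4)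
proof (induction K arbitrary: X G)
 case (Suc K)
 note [measurable] = assms(1,2) Suc.prems
 have "(%w. exit_steps K (A w) (B w) (X w + G w 0) (%i. G w (Suc i))) : N ->M count_space UNIV"
  by (rule Suc.IH) measurable
 note [measurable] = this
 show ?case by simp
qed simp

lemma measurable_exit_pos [measurable (raw)]:
 assumes "A : borel_measurable N" "B : borel_measurable N" "X : borel_measurable N"
  "G : N ->M Hist" shows "(%w. exit_pos K (A w) (B w) (X w) (G w)) : borel_measurable N" using assms(3,4)
proof (induction K arbitrary: X G)
 case (Suc K)
 note [measurable] = assms(1,2) Suc.prems
 have "(%w. exit_pos K (A w) (B w) (X w + G w 0) (%i. G w (Suc i))) : borel_measurable N" by (rule Suc.IH) measurable
 note [measurable] = this
 show ?case by (simp add: exit_pos_Suc)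
qed simp

context
 fixes v a b :: real
 assumes v: "v > 0"
begin

interpretation S: prob_space "gauss_seq v" using prob_space_gauss_seq[OF v] .
interpretation N: prob_space "gauss v" using prob_space_gauss[OF v] .

abbreviation (input) "inI x == - a < x & x < b"
abbreviation (input) "EJ K x == nn_integral (gauss_seq v) (%g. of_nat (exit_steps K a b x g))"

text \<open>First-step analysis: from an inner point the rest is a fresh walk with cap
  \<open>K\<close> started at \<open>x + s\<close>.\<close>

lemma Suc_cong:
 assumes "inI x" and [measurable]: "(%(j, y). F j y) : borel_measurable (count_space UNIV >< borel)"
 shows "nn_integral (gauss_seq v) (%g. F (exit_steps (Suc K) a b x g) (exit_pos (Suc K) a b x g)) = nn_integral (gauss v) (%s.
   nn_integral (gauss_seq v) (%g. F (Suc (exit_steps K a b (x + s) g)) (exit_pos K a b (x + s) g)))"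
 using assms(1) by (subst nn_integral_gauss_seq_Suc[OF v]) (auto simp: exit_pos_Suc)

lemma exit_EJ_Suc:
 assumes "inI x" shows "EJ (Suc K) x = 1 + nn_integral (gauss v) (%s. EJ K (x + s))"
 by (subst Suc_cong[OF assms, where F="%j y. of_nat j"])
   (auto simp: nn_integral_add S.emeasure_space_1[simplified] N.emeasure_space_1[simplified])

text \<open>Wald's second identity. Each move from an inner point adds \<open>v\<close> to the mean
  square, since \<open>(x + s)^2\<close> has mean \<open>x^2 + v\<close>, and \<open>EJ\<close>
  counts the moves.\<close>

lemma exit_second_moment:
 "nn_integral (gauss_seq v) (%g. ennreal ((exit_pos K a b x g)^2)) = ennreal (x^2) + ennreal v * EJ K x"
proof (induction K arbitrary: x)
 case 0
 then show ?case by (simp add: S.emeasure_space_1[simplified])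
next
 case (Suc K)
 show ?case
 proof (cases "inI x")
  case True
  have "nn_integral (gauss_seq v) (%g. ennreal ((exit_pos (Suc K) a b x g)^2)) = nn_integral (gauss v) (%s. ennreal ((x + s)^2)
    + ennreal v * EJ K (x + s))"
   by (subst Suc_cong[OF True, where F="%j y. ennreal (y^2)"]) (auto simp: Suc.IH)
  also have "... = ennreal (x^2 + v) + ennreal v * nn_integral (gauss v) (%s. EJ K (x + s))"
   by (subst nn_integral_add) (auto simp: gauss_shift_moment2[OF v] nn_integral_cmult)
  also have "... = ennreal (x^2) + ennreal v * EJ (Suc K) x"
   using v by (subst exit_EJ_Suc[OF True]) (auto simp: ennreal_plus distrib_left ac_simps simp del: ennreal_plus[symmetric])
  finally show ?thesis .
 qed (auto simp: exit_pos_outside S.emeasure_space_1[simplified])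
qed

text \<open>Only the jump that leaves the interval overshoots. By \<open>gauss_overshoot\<close> a
  first jump to the outside contributes at most \<open>v\<close> times its probability; on the
  complementary event the induction hypothesis gives the factor \<open>v\<close> again.\<close>

lemma exit_overshoot:
 assumes "inI x" shows "nn_integral (gauss_seq v) (%g. ennreal ((overshoot a b (exit_pos K a b x g))^2)) <= ennreal v"
 using assms
proof (induction K arbitrary: x)
 case 0
 then show ?case by (simp add: overshoot_def S.emeasure_space_1[simplified])
next
 let ?A = "overshoot a b"
 let ?B = "%K x s. nn_integral (gauss_seq v) (%g. ennreal ((?A (exit_pos K a b (x + s) g))^2))"
 let ?C = "emeasure (gauss v)"
 let ?D = "nn_integral (gauss v)"
 case (Suc K)
 let ?O = "{y. ~ (- a < x + y & x + y < b)}"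
 have "nn_integral (gauss_seq v) (%g. ennreal ((?A (exit_pos (Suc K) a b x g))^2)) = ?D (%s. ?B K x s)"
  by (subst Suc_cong[OF Suc.prems, where F="%j y. ennreal ((?A y)^2)"]) auto
 also have "... <= ?D (%s. ennreal ((?A (x + s))^2) * indicator ?O s + ennreal v * indicator (- ?O) s)"
 proof (intro nn_integral_mono)
  fix s
  show "?B K x s <= ennreal ((?A (x + s))^2) * indicator ?O s + ennreal v * indicator (- ?O) s"
   using Suc.IH[of "x + s"] by (cases "inI (x + s)") (auto simp: exit_pos_outside S.emeasure_space_1[simplified])
 qed
 also have "... = ?D (%s. ennreal ((?A (x + s))^2) * indicator ?O s) + ennreal v * ?C (- ?O)"
  by (subst nn_integral_add) (auto simp: nn_integral_cmult_indicator)
 also have "... <= ennreal v * ?C ?O + ennreal v * ?C (- ?O)"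
  using gauss_overshoot[OF v, of a x b] Suc.prems by (intro add_mono) auto
 also have "... = ennreal v * ?C (?O \<union> - ?O)"
  by (subst plus_emeasure[symmetric]) (auto simp: distrib_left)
 also have "... = ennreal v" using N.emeasure_space_1 by (simp add: Compl_partition)
 finally show ?case .
qed

text \<open>The count is split as 1 plus the remaining count. Every step made thus contributes once
  the mean squared overshoot seen from its starting point, which is at most \<open>v\<close> by
  \<open>exit_overshoot\<close>.\<close>

lemma exit_steps_overshoot:
 "nn_integral (gauss_seq v) (%g. of_nat (exit_steps K a b x g) * ennreal ((overshoot a b (exit_pos K a b x g))^2))
   <= ennreal v * EJ K x"
proof (induction K arbitrary: x)
 let ?A = "nn_integral (gauss_seq v)"
 let ?B = "nn_integral (gauss v)"
 let ?C = "overshoot a b"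
 case (Suc K)
 show ?case
 proof (cases "inI x")
  case True
  let ?F = "%s g. ennreal ((?C (exit_pos K a b (x + s) g))^2)"
  have "?A (%g. of_nat (exit_steps (Suc K) a b x g) * ennreal ((?C (exit_pos (Suc K) a b x g))^2)) = ?B (%s. ?A (%g. ?F s g
    + of_nat (exit_steps K a b (x + s) g) * ?F s g))"
   by (subst Suc_cong[OF True, where F="%j y. of_nat j * ennreal ((?C y)^2)"]) (auto simp: distrib_right)
  also have "... = ?B (%s. ?A (%g. ?F s g)) + ?B (%s. ?A (%g. of_nat (exit_steps K a b (x + s) g) * ?F s g))"
   by (simp add: nn_integral_add)
  also have "?B (%s. ?A (%g. ?F s g)) = ?A (%g. ennreal ((?C (exit_pos (Suc K) a b x g))^2))"
   by (subst Suc_cong[OF True, where F="%j y. ennreal ((?C y)^2)"]) auto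
  also have "... <= ennreal v" by (rule exit_overshoot[OF True])
  also have "?B (%s. ?A (%g. of_nat (exit_steps K a b (x + s) g) * ?F s g)) <= ?B (%s. ennreal v * EJ K (x + s))"
   by (intro nn_integral_mono Suc.IH)
  also have "... = ennreal v * ?B (%s. EJ K (x + s))" by (simp add: nn_integral_cmult)
  also have "ennreal v + ... = ennreal v * EJ (Suc K) x" by (subst exit_EJ_Suc[OF True]) (simp add: distrib_left)
  finally show ?thesis by (simp add: add_mono)
 qed auto
qed simp

text \<open>With \<open>j\<close> steps remaining after the first,
  \<open>(1 + j)^2 = 1 + 2 * j + j^2\<close>. Times \<open>v\<close>, the mean of
  \<open>1 + 2 * j\<close> is at most twice the mean squared final position, by
  \<open>exit_second_moment\<close>; collecting this over the steps produces the product of the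
  count and the squared position.\<close>

lemma exit_steps_square:
 "ennreal v * nn_integral (gauss_seq v) (%g. (of_nat (exit_steps K a b x g))^2) <= 2 * nn_integral (gauss_seq v) (%g.
   of_nat (exit_steps K a b x g) * ennreal ((exit_pos K a b x g)^2))"
proof (induction K arbitrary: x)
 let ?A = "nn_integral (gauss_seq v)"
 let ?B = "nn_integral (gauss v)"
 let ?C = "%x. ennreal (x^2)"
 case (Suc K)
 show ?case
 proof (cases "inI x")
  case True
  let ?J = "%s g. of_nat (exit_steps K a b (x + s) g) :: ennreal"
  let ?G = "%s g. ennreal ((exit_pos K a b (x + s) g)^2)"
  let ?e = "?B (%s. EJ K (x + s))"
  have "?A (%g. (of_nat (exit_steps (Suc K) a b x g))^2) = ?B (%s. ?A (%g. 1 + 2 * ?J s g + (?J s g)^2))"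
   by (subst Suc_cong[OF True, where F="%j y. (of_nat j)^2"])
     (auto simp: power2_eq_square distrib_left distrib_right mult_2 ac_simps intro!: nn_integral_cong)
  also have "... = 1 + 2 * ?e + ?B (%s. ?A (%g. (?J s g)^2))"
   by (simp add: nn_integral_add nn_integral_cmult S.emeasure_space_1[simplified] N.emeasure_space_1[simplified])
  finally have 1: "ennreal v * ?A (%g. (of_nat (exit_steps (Suc K) a b x g))^2) = ennreal v * (1 + 2 * ?e) + ?B (%s.
    ennreal v * ?A (%g. (?J s g)^2))"
   by (simp add: distrib_left nn_integral_cmult)
  also have "... <= 2 * (?C x + ennreal v * (1 + ?e)) + ?B (%s. 2 * ?A (%g. ?J s g * ?G s g))"
  proof (intro add_mono nn_integral_mono Suc.IH)
   have "ennreal v * (1 + 2 * ?e) <= ennreal v * (2 * (1 + ?e))"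
    by (intro mult_left_mono) (auto simp: distrib_left intro!: add_mono)
   also have "... <= 2 * ?C x + ..." by simp
   finally show "ennreal v * (1 + 2 * ?e) <= 2 * (?C x + ennreal v * (1 + ?e))"
    by (simp add: distrib_left ac_simps)
  qed
  also have "?C x + ennreal v * (1 + ?e) = ?A (%g. ennreal ((exit_pos (Suc K) a b x g)^2))"
   by (subst exit_second_moment) (simp only: exit_EJ_Suc[OF True])
  also have "... = ?B (%s. ?A (%g. ?G s g))"
   by (subst Suc_cong[OF True, where F="%j y. ?C y"]) auto
  also have "2 * ... + ?B (%s. 2 * ?A (%g. ?J s g * ?G s g)) = 2 * ?B (%s. ?A (%g. ?G s g + ?J s g * ?G s g))"
   by (simp add: nn_integral_add nn_integral_cmult distrib_left)
  also have "?B (%s. ?A (%g. ?G s g + ?J s g * ?G s g)) = ?A (%g. of_nat (exit_steps (Suc K) a b x g) * ennreal ((exit_pos (Suc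
    K) a b x g)^2))"
   by (subst Suc_cong[OF True, where F="%j y. of_nat j * ?C y"]) (auto simp: distrib_right)
  finally show ?thesis .
 qed auto
qed simp

lemma exit_EJ_le: "EJ K x <= of_nat K"
proof -
 have "EJ K x <= nn_integral (gauss_seq v) (%g. of_nat K)" by (intro nn_integral_mono) (simp add: exit_steps_le)
 then show ?thesis by (simp add: S.emeasure_space_1[simplified])
qed

lemma exit_pos_integrable:
 "integrable (gauss_seq v) (%g. (exit_pos K a b x g)^2)" "integrable (gauss_seq v) (exit_pos K a b x)"
proof -
 have "EJ K x < top" using exit_EJ_le[of K x] of_nat_less_top[of K] by (rule le_less_trans)
 then have "ennreal v * EJ K x < \<infinity>" by (simp add: ennreal_mult_less_top)
 then show 1: "integrable (gauss_seq v) (%g. (exit_pos K a b x g)^2)"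
  by (intro integrableI_nonneg) (auto simp: exit_second_moment)
 show "integrable (gauss_seq v) (exit_pos K a b x)" by (rule S.square_integrable_imp_integrable[OF _ 1]) auto
qed

lemma exit_mean: "(LINT g|gauss_seq v. exit_pos K a b x g) = x"
proof (induction K arbitrary: x)
 case 0
 then show ?case by (simp add: S.prob_space[simplified])
next
 case (Suc K)
 show ?case
 proof (cases "inI x")
  case True
  have "(LINT g|gauss_seq v. exit_pos (Suc K) a b x g) = (LINT s|gauss v. (LINT g|gauss_seq v. exit_pos K a b (x + s) g))"
   using True by (subst integral_gauss_seq_Suc[OF v]) (auto intro!: exit_pos_integrable simp: exit_pos_Suc)
  also have "... = x" using gauss_moment1[OF v] by (simp add: Suc.IH N.prob_space[simplified])
  finally show ?thesis .
 qed (auto simp: exit_pos_outside S.prob_space[simplified])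
qed

end

section \<open>The exit corrected by an independent uniform variable\<close>

definition U01 :: "real measure" where
 "U01 = uniform_measure lborel {0<..<1}"

lemma sets_U01 [measurable_cong, simp]: "sets U01 = sets borel" by (simp add: U01_def)

lemma space_U01 [simp]: "space U01 = UNIV" by (simp add: U01_def)

lemma prob_space_U01: "prob_space U01" unfolding U01_def by (rule prob_space_uniform_measure) auto

lemma emeasure_U01_less:
 assumes "0 <= c" "c <= 1" shows "emeasure U01 {..<c} = ennreal c"
proof -
 have "{0<..<1} \<inter> {..<c} = {0<..<c}" using assms by auto
 then show ?thesis using assms by (simp add: U01_def emeasure_uniform_measure divide_ennreal flip: ennreal_1)
qed

lemma nn_integral_U01_less:
 assumes "0 <= c" "c <= 1"
 shows "nn_integral U01 (%u. (if u < c then x else y)) = ennreal c * x + ennreal (1 - c) * y"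
proof -
 interpret prob_space U01 by (rule prob_space_U01)
 have "emeasure U01 {c..} = ennreal (1 - c)"
 proof -
  have "emeasure U01 {c..} = emeasure U01 (space U01 - {..<c})" by (intro arg_cong2[where f=emeasure]) auto
  also have "... = 1 - ennreal c"
   using assms by (subst emeasure_compl) (auto simp: emeasure_U01_less emeasure_space_1[simplified])
  finally show ?thesis using assms by (simp add: ennreal_minus flip: ennreal_1)
 qed
 moreover have "nn_integral U01 (%u. (if u < c then x else y)) = nn_integral U01 (%u. x * indicator {..<c} u
   + y * indicator {c..} u)"
  by (intro nn_integral_cong) auto
 ultimately show ?thesis
  using assms by (simp add: nn_integral_add nn_integral_cmult_indicator emeasure_U01_less ac_simps)
qed

lemma sets_exit_up [measurable]: "{g. b <= exit_pos K a b 0 g} : sets Hist"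
proof -
 have "{g : space Hist. b <= exit_pos K a b 0 g} : sets Hist" by measurable
 then show ?thesis by (simp add: space_PiM)
qed

lemma sets_exit_steps_eq [measurable]: "{g. exit_steps K a b 0 g = j} : sets Hist"
proof -
 have "{g : space Hist. exit_steps K a b 0 g = j} : sets Hist" by measurable
 then show ?thesis by (simp add: space_PiM)
qed

text \<open>The walk leaves \<open>(-a, b)\<close> upwards with a probability that differs slightly from \<open>a / (a
  + b)\<close>;
 a comparison of an independent uniform variable with \<open>exit_bias\<close> corrects this.\<close>

definition exit_prob :: "real => nat => real => real => real" where
 "exit_prob v K a b = measure (gauss_seq v) {g. b <= exit_pos K a b 0 g}"

text \<open>If the walk goes up too often, upward exits are kept with probability
  \<open>q / q'\<close>; if too rarely, the other paths are sent up with probability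
  \<open>(q - q') / (1 - q')\<close>. The coin interferes on one side only, hence as seldom as its
  mean allows.\<close>

definition exit_bias :: "real => nat => real => real => (nat => real) => real" where
 "exit_bias v K a b g = (let q = a / (a + b); q' = exit_prob v K a b in if b <= exit_pos K a b 0 g then (if q
   <= q' then q / q' else 1) else (if q <= q' then 0 else (q - q') / (1 - q')))"

lemma measurable_exit_prob [measurable (raw)]:
 assumes v: "v > 0" and [measurable]: "A : borel_measurable N" "B : borel_measurable N"
 shows "(%w. exit_prob v K (A w) (B w)) : borel_measurable N"
proof -
 \<comment> \<open>The probability is rewritten as the integral of an indicator, so that
   measurability in the ends of the interval is that of a parametrised integral.\<close>
 let ?A = "%w. enn2real (nn_integral (gauss_seq v) (%g. indicator {g. B w <= exit_pos K (A w) (B w) 0 g} g))"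
 interpret prob_space "gauss_seq v" using prob_space_gauss_seq[OF v] .
 have "?A : borel_measurable N"
  by measurable
 also have "?A = (%w. exit_prob v K (A w) (B w))"
  unfolding exit_prob_def measure_def by (intro ext arg_cong[where f=enn2real] nn_integral_indicator) simp
 finally show ?thesis .
qed

lemma measurable_exit_bias [measurable (raw)]:
 assumes v: "v > 0" and [measurable]: "A : borel_measurable N" "B : borel_measurable N"
  "G : N ->M Hist" shows "(%w. exit_bias v K (A w) (B w) (G w)) : borel_measurable N"
 using v unfolding exit_bias_def Let_def by measurable

lemma exit_prob_bounds: "v > 0 ==> 0 <= exit_prob v K a b & exit_prob v K a b <= 1"
 unfolding exit_prob_def using prob_space.prob_le_1[OF prob_space_gauss_seq] by auto

lemma exit_bias_bounds:
 assumes "v > 0" "0 <= a" "0 <= b" shows "0 <= exit_bias v K a b g" "exit_bias v K a b g <= 1"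
proof -
 have q: "0 <= a / (a + b)" "a / (a + b) <= 1" using assms by (auto simp: divide_le_eq_1)
 show "0 <= exit_bias v K a b g" "exit_bias v K a b g <= 1"
  using q exit_prob_bounds[OF assms(1), of K a b] unfolding exit_bias_def Let_def
  by (auto simp: divide_le_eq_1 not_le simp del: divide_divide_eq_left intro!: divide_nonneg_nonneg)
qed

context
 fixes v a b R :: real and K :: nat
 assumes v: "v > 0" and ab: "0 < a" "0 < b" "a <= R" "b <= R"
begin

interpretation S: prob_space "gauss_seq v" using prob_space_gauss_seq[OF v] .

abbreviation (input) "steps == %g. real (exit_steps K a b 0 g)"
abbreviation (input) "endpos == exit_pos K a b 0"
abbreviation (input) "excess == %g. overshoot a b (exit_pos K a b 0 g)"
abbreviation (input) "bias == exit_bias v K a b"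
abbreviation (input) "fair_up == a / (a + b)"
abbreviation (input) "mu_up == exit_prob v K a b"
abbreviation (input) "stay_prob == measure (gauss_seq v) {g. exit_steps K a b 0 g = K}"

lemma exit_int_indicator: "A : sets Hist ==> integrable (gauss_seq v) (%g. indicator A g :: real)"
 by (rule integrable_real_indicator) (auto simp: less_top[symmetric])

lemma exit_int_J: "integrable (gauss_seq v) steps" "integrable (gauss_seq v) (%g. (steps g)^2)"
 by (rule S.integrable_const_bound[where B="real K"]; simp add: exit_steps_le)
   (rule S.integrable_const_bound[where B="(real K)^2"]; simp add: exit_steps_le power_mono)

lemma exit_int_G: "integrable (gauss_seq v) (%g. (endpos g)^2)" "integrable (gauss_seq v) endpos"
 using exit_pos_integrable[OF v] by auto

lemma overshoot_abs_le: "abs(overshoot a b y) <= abs y" using ab by (auto simp: overshoot_def max_def)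

lemma overshoot_nonneg: "0 <= overshoot a b y" by (auto simp: overshoot_def max_def)

lemma exit_int_O: "integrable (gauss_seq v) excess" "integrable (gauss_seq v) (%g. (excess g)^2)"
  by (rule bint_bound[OF exit_int_G(2)]; simp add: overshoot_abs_le)
   (rule bint_bound[OF exit_int_G(1)]; simp add: overshoot_abs_le flip: abs_le_square_iff)

lemma exit_int_JG: "integrable (gauss_seq v) (%g. steps g * (endpos g)^2)" "integrable (gauss_seq v) (%g. steps g * (excess g)^2)"
 using exit_steps_le[of K a b 0]
 by (intro bint_bound[OF integrable_mult_right[OF exit_int_G(1), of "real K"]]
      bint_bound[OF integrable_mult_right[OF exit_int_O(2), of "real K"]];
   auto simp: abs_mult intro!: mult_right_mono)+

lemma exit_real_moments:
 "(LINT g|gauss_seq v. (endpos g)^2) = v * (LINT g|gauss_seq v. steps g)"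
 "(LINT g|gauss_seq v. (excess g)^2) <= v"
 "(LINT g|gauss_seq v. steps g * (excess g)^2) <= v * (LINT g|gauss_seq v. steps g)"
 "v * (LINT g|gauss_seq v. (steps g)^2) <= 2 * (LINT g|gauss_seq v. steps g * (endpos g)^2)"
proof -
 let ?A = "nn_integral (gauss_seq v)"
 let ?B = "LINT g|gauss_seq v. steps g * (endpos g)^2"
 let ?C = "LINT g|gauss_seq v. steps g"
 let ?D = "%g. of_nat (exit_steps K a b 0 g)"
 let ?E = "LINT g|gauss_seq v. (endpos g)^2"
 let ?F = "LINT g|gauss_seq v. (steps g)^2"
 let ?G = "LINT g|gauss_seq v. steps g * (excess g)^2"
 have steps: "?A (%g. ?D g) = ennreal ?C"
  using nn_integral_eq_integral[OF exit_int_J(1)] by (simp add: ennreal_of_nat_eq_real_of_nat)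
 have J2: "?A (%g. (?D g)^2) = ennreal ?F"
  using nn_integral_eq_integral[OF exit_int_J(2)] by (simp add: ennreal_of_nat_eq_real_of_nat ennreal_power)
 have endpos: "?A (%g. ennreal ((endpos g)^2)) = ennreal ?E"
  using nn_integral_eq_integral[OF exit_int_G(1)] by simp
 have O: "?A (%g. ennreal ((excess g)^2)) = ennreal (LINT g|gauss_seq v. (excess g)^2)"
  using nn_integral_eq_integral[OF exit_int_O(2)] by simp
 have JG: "?A (%g. ?D g * ennreal ((endpos g)^2)) = ennreal ?B"
  using nn_integral_eq_integral[OF exit_int_JG(1)] by (simp add: ennreal_of_nat_eq_real_of_nat ennreal_mult)
 have JO: "?A (%g. ?D g * ennreal ((excess g)^2)) = ennreal ?G"
  using nn_integral_eq_integral[OF exit_int_JG(2)] by (simp add: ennreal_of_nat_eq_real_of_nat ennreal_mult)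
 have pos: "0 <= ?C" "0 <= ?F" "0 <= ?E"
   "0 <= ?B" by auto
 show "?E = v * ?C"
  using exit_second_moment[OF v, where K=K and a=a and b=b and x=0] v pos unfolding steps endpos by (simp flip: ennreal_mult)
 show "(LINT g|gauss_seq v. (excess g)^2) <= v"
  using exit_overshoot[OF v, where K=K and a=a and b=b and x=0] v ab pos unfolding O by simp
 show "?G <= v * ?C"
  using exit_steps_overshoot[OF v, where K=K and a=a and b=b and x=0] v pos unfolding JO steps by (simp flip: ennreal_mult)
 have "(2::ennreal) = ennreal 2" by simp
 then show "v * ?F <= 2 * ?B"
  using exit_steps_square[OF v, where K=K and a=a and b=b and x=0] v pos unfolding J2 JG
  by (simp flip: ennreal_mult ennreal_numeral)
qed

lemma exit_mean_overshoot: "(LINT g|gauss_seq v. excess g) <= sqrt v"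
proof -
 have "(LINT g|gauss_seq v. excess g)^2 <= (LINT g|gauss_seq v. (excess g)^2)"
  using S.variance_positive[of excess] S.variance_eq[OF exit_int_O] by simp
 also have "... <= v" by (rule exit_real_moments)
 finally show ?thesis using real_le_rsqrt by blast
qed

lemma abs_exit_pos_le: "abs(endpos g) <= max a b + excess g" using ab by (auto simp: overshoot_def max_def)

text \<open>Markov's inequality for the count: reaching the cap means \<open>K\<close> steps, and
  \<open>v\<close> times the mean count is the mean squared final position, which is controlled by
  \<open>(R + excess)^2\<close>.\<close>

lemma exit_not_exited: "K > 0 ==> stay_prob <= (2 * R^2 + 2 * v) / (v * real K)"
proof -
 assume K: "K > 0"
 have "real K * stay_prob = (LINT g|gauss_seq v. real K * indicator {g. exit_steps K a b 0 g = K} g)" by simp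
 also have "... <= (LINT g|gauss_seq v. steps g)"
  by (intro integral_mono exit_int_J integrable_mult_right exit_int_indicator) (auto split: split_indicator)
 finally have "v * (real K * stay_prob) <= (LINT g|gauss_seq v. (endpos g)^2)"
  using v by (simp add: exit_real_moments)
 also have "... <= (LINT g|gauss_seq v. 2 * R^2 + 2 * (excess g)^2)"
 proof (intro integral_mono exit_int_G)
  fix g
  have "abs(endpos g) <= R + excess g" using abs_exit_pos_le[of g] ab by auto
  then have "(endpos g)^2 <= (R + excess g)^2" by (simp add: abs_le_square_iff[symmetric])
  also have "... <= 2 * R^2 + 2 * (excess g)^2" using sum_squares_bound[of R "excess g"] by (simp add: power2_sum)
  finally show "(endpos g)^2 <= 2 * R^2 + 2 * (excess g)^2" .
 qed (use exit_int_O in auto)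
 also have "... <= 2 * R^2 + 2 * v" using exit_int_O exit_real_moments by (simp add: S.prob_space[simplified])
 finally show ?thesis using v K by (simp add: field_simps)
qed

text \<open>The displacement from the stopping place to the end assigned to the walk. A path stopped
  inside by the cap is assigned to \<open>- a\<close>, in agreement with \<open>exit_prob\<close>,
  which counts only \<open>b <= endpos\<close> as upward.\<close>

definition exit_gap :: "(nat => real) => real" where
 "exit_gap g = (if b <= endpos g then b else - a) - endpos g"

text \<open>After a genuine exit the gap is the overshoot. A path that is still inside has used up
  the cap, and its gap is at most the length \<open>a + b <= 2 * R\<close>.\<close>

lemma exit_gap_abs_le: "abs(exit_gap g) <= excess g + 2 * R * indicator {g. exit_steps K a b 0 g = K} g"
 using exit_steps_eq_max[of a K b 0 g] ab by (auto simp: exit_gap_def overshoot_def max_def split: split_indicator)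

lemma exit_int_gap: "integrable (gauss_seq v) exit_gap" unfolding exit_gap_def[abs_def]
 by (intro bint_diff exit_int_G S.integrable_const_bound[where B="a + b"]) (use ab in auto)

lemma exit_gap_mean: "(LINT g|gauss_seq v. abs(exit_gap g)) <= sqrt v + 2 * R * stay_prob"
proof -
 have "(LINT g|gauss_seq v. abs(exit_gap g)) <= (LINT g|gauss_seq v. excess g + 2 * R * indicator {g. exit_steps K a b 0 g
   = K} g)"
  by (intro integral_mono exit_gap_abs_le integrable_abs exit_int_gap
     bint_add exit_int_O integrable_mult_right exit_int_indicator) simp
 also have "... = (LINT g|gauss_seq v. excess g) + 2 * R * stay_prob"
  using exit_int_O by (subst bochner_add) (auto intro!: exit_int_indicator)
 finally show ?thesis using exit_mean_overshoot by simp
qed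

text \<open>The stopped walk has mean 0, so the mean gap is \<open>(a + b) * mu_up - a\<close>: it
  measures the deviation of the exit probability from the gambler's ruin value.\<close>

lemma exit_prob_close: "(a + b) * abs(mu_up - fair_up) <= (LINT g|gauss_seq v. abs(exit_gap g))"
proof -
 have "(LINT g|gauss_seq v. exit_gap g) = (LINT g|gauss_seq v. - a + (a + b) * indicator {g. b
   <= endpos g} g) - (LINT g|gauss_seq v. endpos g)"
  unfolding exit_gap_def by (subst Bochner_Integration.integral_diff[symmetric])
    (use exit_int_G in \<open>auto intro!: Bochner_Integration.integral_cong bint_diff exit_int_indicator split:
      split_indicator\<close>)
 also have "... = (a + b) * mu_up - a" using exit_mean[OF v, of K a b 0]
  by (subst bochner_add) (auto simp: S.prob_space[simplified] exit_prob_def intro!: exit_int_indicator)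
 also have "... = (a + b) * (mu_up - fair_up)" using ab by (simp add: field_simps)
 finally have "abs((a + b) * (mu_up - fair_up)) <= (LINT g|gauss_seq v. abs(exit_gap g))"
  using integral_abs_bound[of "gauss_seq v" exit_gap] by simp
 then show ?thesis using ab by (simp add: abs_mult)
qed

text \<open>The bias takes one value on upward exits and one on all other paths, so both means are
  elementary. The second is the probability that the coin overrules the walk.\<close>

lemma exit_bias_mean: "(LINT g|gauss_seq v. bias g) = fair_up"
 and exit_bias_miss: "(LINT g|gauss_seq v. (if b <= endpos g then 1 - bias g else bias g)) = abs(mu_up - fair_up)"
proof -
 let ?A = "LINT g|gauss_seq v. (if b <= endpos g then 1 - bias g else bias g)"
 let ?B = "%c d. LINT g|gauss_seq v. (if b <= endpos g then c else d)"
 define \<alpha> where "\<alpha> = (if fair_up <= mu_up then fair_up / mu_up else 1)"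
 define \<beta> where "\<beta> = (if fair_up <= mu_up then 0 else (fair_up - mu_up) / (1 - mu_up))"
 have fair_up: "0 < fair_up" "fair_up < 1" using ab by auto
 have bias: "bias g = (if b <= endpos g then \<alpha> else \<beta>)" for g
  by (simp add: exit_bias_def \<alpha>_def \<beta>_def Let_def)
 have *: "(?B c d) = mu_up * c + (1 - mu_up) * d" for c d
 proof -
  have "(?B c d) = (LINT g|gauss_seq v. d + (c - d) * indicator {g. b <= endpos g} g)"
   by (intro Bochner_Integration.integral_cong) (auto split: split_indicator)
  also have "... = d + (c - d) * mu_up"
   by (subst bochner_add) (auto simp: S.prob_space[simplified] exit_prob_def intro!: exit_int_indicator)
  finally show ?thesis by (simp add: algebra_simps)
 qed
 have 1: "y * (if x <= y then x / y else 1) + (1 - y) * (if x <= y then 0 else (x - y) / (1 - y)) = x"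
  if "0 < x" "x < 1" for x y :: real using that by auto
 have 2: "y * (1 - (if x <= y then x / y else 1)) + (1 - y) * (if x <= y then 0 else (x - y) / (1 - y)) = abs(y - x)"
  if "0 < x" "x < 1" for x y :: real using that by (cases "x <= y") (simp add: right_diff_distrib, simp)
 show "(LINT g|gauss_seq v. bias g) = fair_up" unfolding bias * \<alpha>_def \<beta>_def using 1[OF fair_up] .
 have "(%g. if b <= endpos g then 1 - bias g else bias g) = (%g. if b <= endpos g then 1 - \<alpha> else \<beta>)"
  by (auto simp: bias)
 then have "?A = mu_up * (1 - \<alpha>) + (1 - mu_up) * \<beta>"
  by (simp only: *)
 also have "... = abs(mu_up - fair_up)" unfolding \<alpha>_def \<beta>_def by (rule 2[OF fair_up])
 finally show "?A = abs(mu_up - fair_up)" .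
qed

end

text \<open>\<open>\<gamma> * F b + (1 - \<gamma>) * F (- a)\<close> with \<open>\<gamma>
  = exit_bias v K a b g\<close> is the mean of \<open>F\<close> at
 the corrected exit value, given the walk.\<close>

definition exit_good :: "real => real => nat => real => real => bool" where
 "exit_good \<epsilon> v K a b \<longleftrightarrow> (LINT g|gauss_seq v. exit_bias v K a b g) * (a + b) = a
   & (LINT g|gauss_seq v. exit_bias v K a b g * abs(b - exit_pos K a b 0 g) + (1 - exit_bias v K a b g) * abs(- a - exit_pos K a
   b 0 g)) <= \<epsilon> & abs(v * (LINT g|gauss_seq v. real (exit_steps K a b 0 g)) - a * b) <= \<epsilon>
   & v^2 * (LINT g|gauss_seq v. (real (exit_steps K a b 0 g))^2) <= 6 * (a * b * (a^2 - a * b + b^2)) + \<epsilon>"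

lemma exit_good_mono: "exit_good \<epsilon> v K a b ==> \<epsilon> <= \<epsilon>' ==> exit_good \<epsilon>' v K a b"
 unfolding exit_good_def by auto

context
 fixes v a b R :: real and K :: nat
 assumes v: "v > 0" and ab: "0 < a" "0 < b" "a <= R" "b <= R"
begin

interpretation S: prob_space "gauss_seq v" using prob_space_gauss_seq[OF v] .

text \<open>Origin of the constants. The mean gap is at most \<open>2 * sqrt v\<close>, half from
  the overshoot and half from the cap; overruling adds the same amount, hence
  \<open>4 * sqrt v\<close>. Replacing the squared position by the squared end costs
  \<open>e\<close>, the sum of \<open>2 * R * (4 * sqrt v)\<close>, \<open>2 * R * sqrt v\<close>
  and \<open>v\<close>. The last terms bound what remains of
  \<open>4 * (M^2 + v) * (a * b + e)\<close>, with \<open>M\<close> the longer side, once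
  \<open>4 * M^2 * (a * b)\<close> is taken out.\<close>

lemma exit_good_pos:
 assumes K: "2 * R * ((2 * R^2 + 2 * v) / (v * real K)) <= sqrt v" "K > 0"
 defines "e == 10 * R * sqrt v + v" shows "exit_good (4 * sqrt v + e + 4 * R^2 * e + 4 * v * (R^2 + e)) v K a b"
proof -
 let ?A = "a * b * (a^2 - a * b + b^2)"
 note rm = exit_real_moments[OF v ab, of K]
 let ?J = "%g. real (exit_steps K a b 0 g)" and ?G = "exit_pos K a b 0"
  and ?O = "%g. overshoot a b (exit_pos K a b 0 g)" and ?\<gamma> = "exit_bias v K a b" and ?q = "a / (a + b)"
 let ?L = "%g. ?\<gamma> g * abs(b - ?G g) + (1 - ?\<gamma> g) * abs(- a - ?G g)"
 define m where "m = (LINT g|gauss_seq v. abs(exit_gap a b K g))"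
 note [measurable] = measurable_exit_bias[OF v]
 have R: "R > 0" using ab by simp
 have e: "e >= 0" unfolding e_def using R v by simp
 have \<gamma>: "0 <= ?\<gamma> g" "?\<gamma> g <= 1" for g using exit_bias_bounds[OF v] ab by auto
 have O: "0 <= ?O g" for g using overshoot_nonneg[OF v ab] by auto
 note intG = exit_int_G[OF v ab, of K] and intO = exit_int_O[OF v ab, of K] and intgap = exit_int_gap[OF v ab, of K]
 have m: "m <= 2 * sqrt v"
 proof -
  have "2 * R * measure (gauss_seq v) {g. exit_steps K a b 0 g = K} <= 2 * R * ((2 * R^2 + 2 * v) / (v * real K))"
   using exit_not_exited[OF v ab K(2)] R by (intro mult_left_mono) auto
  then show ?thesis using exit_gap_mean[OF v ab, of K] K unfolding m_def by simp
 qed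
 have L_int: "integrable (gauss_seq v) ?L"
 proof (rule bint_bound)
  show "integrable (gauss_seq v) (%g. abs(b - ?G g) + abs(- a - ?G g))"
   using intG by (intro bint_add integrable_abs bint_diff) auto
  show "AE g in gauss_seq v. norm (?L g) <= norm (abs(b - ?G g) + abs(- a - ?G g))"
   using \<gamma> by (intro AE_I2) (auto simp: abs_mult intro!: add_mono mult_left_le_one_le order_trans[OF abs_triangle_ineq])
 qed measurable
 have L_nonneg: "?L g >= 0" for g using \<gamma>[of g] by auto
 have miss_int: "integrable (gauss_seq v) (%g. if b <= ?G g then 1 - ?\<gamma> g else ?\<gamma> g)"
  using \<gamma> by (intro S.integrable_const_bound[where B=1]) (auto simp: abs_le_iff intro: order_trans)
 \<comment> \<open>If coin and walk agree, the distance to the chosen end is the gap; otherwise the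
   chosen end is at most \<open>a + b\<close> further away.\<close>
 have L_le: "?L g <= abs(exit_gap a b K g) + (a + b) * (if b <= ?G g then 1 - ?\<gamma> g else ?\<gamma> g)" for g
 proof (cases "b <= ?G g")
  case True
  have "(1 - ?\<gamma> g) * abs(- a - ?G g) <= (1 - ?\<gamma> g) * (abs(b - ?G g) + (a + b))"
   using \<gamma>[of g] ab by (intro mult_left_mono) auto
  with True show ?thesis by (simp add: exit_gap_def[OF v ab] algebra_simps)
 next
  case False
  have "?\<gamma> g * abs(b - ?G g) <= ?\<gamma> g * (abs(- a - ?G g) + (a + b))"
   using \<gamma>[of g] ab by (intro mult_left_mono) auto
  with False show ?thesis by (simp add: exit_gap_def[OF v ab] algebra_simps)
 qed
 have EL: "(LINT g|gauss_seq v. ?L g) <= 4 * sqrt v"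
 proof -
  have "(LINT g|gauss_seq v. ?L g) <= (LINT g|gauss_seq v. abs(exit_gap a b K g) + (a + b) * (if b
    <= ?G g then 1 - ?\<gamma> g else ?\<gamma> g))"
   using intgap miss_int by (intro integral_mono L_le L_int) auto
  also have "... = m + (a + b) * abs(exit_prob v K a b - ?q)"
   using intgap miss_int exit_bias_miss[OF v ab, of K] unfolding m_def by (subst bochner_add) auto
  also have "... <= 2 * m" using exit_prob_close[OF v ab, of K] unfolding m_def by simp
  finally show ?thesis using m by simp
 qed
 have int\<gamma>: "integrable (gauss_seq v) ?\<gamma>"
  using \<gamma> by (intro S.integrable_const_bound[where B=1]) (auto simp: abs_le_iff intro: order_trans)
 \<comment> \<open>The mean count is accessible through the mean squared position.
   \<open>?D2\<close> is the mean square of the corrected exit value given the walk, with total mean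
   \<open>a * b\<close>; the difference of the squares factors into the distance to an end and a
   bounded sum.\<close>
 have third: "abs(v * (LINT g|gauss_seq v. ?J g) - a * b) <= e"
 proof -
  let ?D2 = "%g. ?\<gamma> g * b^2 + (1 - ?\<gamma> g) * a^2"
  have "(LINT g|gauss_seq v. ?D2 g) = ?q * b^2 + (1 - ?q) * a^2"
   using int\<gamma> exit_bias_mean[OF v ab, of K] by (simp add: S.prob_space[simplified])
  also have "... = a * b"
  proof -
   have "1 - ?q = b / (a + b)" using ab by (simp add: field_simps)
   then show ?thesis using ab by (simp add: divide_simps power2_eq_square) (simp add: algebra_simps)
  qed
  finally have D2: "(LINT g|gauss_seq v. ?D2 g) = a * b" .
  have D2_int: "integrable (gauss_seq v) ?D2" using int\<gamma> by auto
  have *: "abs((?G g)^2 - ?D2 g) <= 2 * R * ?L g + (2 * R * ?O g + (?O g)^2)" for g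
  proof -
   have G: "abs(?G g) <= R + ?O g" using abs_exit_pos_le[OF v ab, of K g] ab by auto
   have "abs((?G g)^2 - ?D2 g) = abs(?\<gamma> g * ((?G g)^2 - b^2) + (1 - ?\<gamma> g) * ((?G g)^2 - a^2))"
    by (simp add: algebra_simps)
   also have "... <= ?\<gamma> g * abs((?G g)^2 - b^2) + (1 - ?\<gamma> g) * abs((?G g)^2 - a^2)"
    using \<gamma>[of g] by (intro order_trans[OF abs_triangle_ineq]) (simp add: abs_mult)
   also have "... <= ?\<gamma> g * (abs(b - ?G g) * (2 * R + ?O g)) + (1 - ?\<gamma> g) * (abs(- a - ?G g) * (2 * R + ?O g))"
   proof (intro add_mono mult_left_mono)
    have "abs((?G g)^2 - b^2) = abs(b - ?G g) * abs(?G g + b)"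
     by (simp add: power2_eq_square square_diff_square_factored abs_mult abs_minus_commute ac_simps)
    also have "... <= abs(b - ?G g) * (2 * R + ?O g)" using G ab by (intro mult_left_mono) auto
    finally show "abs((?G g)^2 - b^2) <= abs(b - ?G g) * (2 * R + ?O g)" .
    have "abs((?G g)^2 - a^2) = abs(?G g + a) * abs(?G g - a)"
     by (simp add: power2_eq_square square_diff_square_factored abs_mult abs_minus_commute ac_simps)
    also have "abs(?G g + a) = abs(- a - ?G g)" by simp
    also have "abs(- a - ?G g) * abs(?G g - a) <= abs(- a - ?G g) * (2 * R + ?O g)"
     using G ab by (intro mult_left_mono) auto
    finally show "abs((?G g)^2 - a^2) <= abs(- a - ?G g) * (2 * R + ?O g)" .
   qed (use \<gamma>[of g] in auto)
   also have "... = ?L g * (2 * R + ?O g)" by (simp add: algebra_simps)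
   also have "... = 2 * R * ?L g + ?L g * ?O g" by (simp add: algebra_simps)
   also have "?L g * ?O g <= (2 * R + ?O g) * ?O g"
   proof (intro mult_right_mono O)
    have "?L g <= ?\<gamma> g * (2 * R + ?O g) + (1 - ?\<gamma> g) * (2 * R + ?O g)"
     using G ab \<gamma>[of g] by (intro add_mono mult_left_mono) auto
    also have "... = 2 * R + ?O g" by (simp add: algebra_simps)
    finally show "?L g <= 2 * R + ?O g" .
   qed
   finally show ?thesis by (simp add: algebra_simps power2_eq_square)
  qed
  have "abs(v * (LINT g|gauss_seq v. ?J g) - a * b) = abs((LINT g|gauss_seq v. (?G g)^2 - ?D2 g))"
   using intG D2_int by (simp add: rm D2)
  also have "... <= (LINT g|gauss_seq v. abs((?G g)^2 - ?D2 g))" by (rule integral_abs_bound)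
  also have "... <= (LINT g|gauss_seq v. 2 * R * ?L g + (2 * R * ?O g + (?O g)^2))"
  proof (rule integral_mono)
   show "integrable (gauss_seq v) (%g. abs((?G g)^2 - ?D2 g))"
    by (rule integrable_abs, rule bint_diff[OF intG(1) D2_int])
   show "integrable (gauss_seq v) (%g. 2 * R * ?L g + (2 * R * ?O g + (?O g)^2))"
    by (rule bint_add[OF integrable_mult_right[OF L_int] bint_add[OF integrable_mult_right[OF intO(1)] intO(2)]])
  qed (rule *)
  also have "... = 2 * R * (LINT g|gauss_seq v. ?L g) + (2 * R * (LINT g|gauss_seq v. ?O g) + (LINT g|gauss_seq v. (?O g)^2))"
   by (subst bochner_add[OF integrable_mult_right[OF L_int] bint_add[OF integrable_mult_right[OF intO(1)] intO(2)]],
     subst bochner_add[OF integrable_mult_right[OF intO(1)] intO(2)]) simp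
  also have "... <= 2 * R * (4 * sqrt v) + (2 * R * sqrt v + v)"
   using R EL exit_mean_overshoot[OF v ab, of K] by (intro add_mono mult_left_mono rm) auto
  finally show ?thesis by (simp add: e_def)
 qed
 have fourth: "v^2 * (LINT g|gauss_seq v. (?J g)^2) <= 6 * ?A + (4 * R^2 * e + 4 * v * (R^2 + e))"
 proof -
  let ?M = "max a b"
  let ?j = "v * (LINT g|gauss_seq v. ?J g)"
  have "(LINT g|gauss_seq v. ?J g * (?G g)^2) <= (LINT g|gauss_seq v. 2 * ?M^2 * ?J g + 2 * (?J g * (?O g)^2))"
  proof (rule integral_mono)
   fix g
   have "(?G g)^2 <= (?M + ?O g)^2" using abs_exit_pos_le[OF v ab, of K g] by (simp add: abs_le_square_iff[symmetric])
   also have "... <= 2 * ?M^2 + 2 * (?O g)^2" using sum_squares_bound[of ?M "?O g"] by (simp add: power2_sum)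
   finally have "?J g * (?G g)^2 <= ?J g * (2 * ?M^2 + 2 * (?O g)^2)" by (intro mult_left_mono) auto
   then show "?J g * (?G g)^2 <= 2 * ?M^2 * ?J g + 2 * (?J g * (?O g)^2)" by (simp add: algebra_simps)
  qed (use exit_int_JG[OF v ab, of K] exit_int_J[OF v ab, of K] in auto)
  also have "... = 2 * ?M^2 * (LINT g|gauss_seq v. ?J g) + 2 * (LINT g|gauss_seq v. ?J g * (?O g)^2)"
   using exit_int_JG[OF v ab, of K] exit_int_J[OF v ab, of K] by simp
  also have "... <= 2 * ?M^2 * (LINT g|gauss_seq v. ?J g) + 2 * (v * (LINT g|gauss_seq v. ?J g))"
   by (intro add_mono mult_left_mono rm) auto
  finally have "v * (v * (LINT g|gauss_seq v. (?J g)^2)) <= v * (2 * (2 * ?M^2 * (LINT g|gauss_seq v. ?J g) + 2 * ?j))"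
   using v rm(4) by (intro mult_left_mono) auto
  then have "v^2 * (LINT g|gauss_seq v. (?J g)^2) <= 4 * (?M^2 + v) * ?j"
   by (simp add: power2_eq_square algebra_simps)
  also have "... <= 4 * (?M^2 + v) * (a * b + e)" using third v by (intro mult_left_mono) auto
  also have "... = 4 * (?M^2 * (a * b)) + 4 * ?M^2 * e + 4 * v * (a * b + e)" by (simp add: algebra_simps)
  also have "... <= 6 * ?A + 4 * R^2 * e + 4 * v * (R^2 + e)"
  proof (intro add_mono mult_left_mono mult_right_mono)
   \<comment> \<open>The origin of the 6: the fair law on \<open>- a\<close> and \<open>b\<close>
     has fourth moment \<open>a * b * (a^2 - a * b + b^2)\<close>, and completing the square bounds
     the last factor from below by three quarters of the square of either side.\<close>
   have "4 * ?M^2 <= 6 * (a^2 - a * b + b^2)"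
   proof -
    have *: "4 * x^2 <= 6 * (y^2 - x * y + x^2)" for x y :: real
    proof -
     have "6 * (y^2 - x * y + x^2) = 4 * x^2 + x^2 / 2 + 6 * (y - x / 2)^2"
      by (simp add: power2_eq_square algebra_simps)
     then show ?thesis using zero_le_power2[of "y - x/2"] zero_le_power2[of x] by linarith
    qed
    show ?thesis using *[of b a] *[of a b] by (cases "a <= b") (simp_all add: max_def ac_simps)
   qed
   from mult_right_mono[OF this, of "a * b"]
   show "4 * (?M^2 * (a * b)) <= 6 * ?A" using ab by (simp add: ac_simps)
   show "a * b <= R^2" using ab by (simp add: power2_eq_square mult_mono)
   show "?M^2 <= R^2" using ab by (intro power_mono) auto
  qed (use v e R in auto)
  finally show ?thesis by simp
 qed
 have first: "(LINT g|gauss_seq v. ?\<gamma> g) * (a + b) = a" using exit_bias_mean[OF v ab, of K] ab by simp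
 have nn: "0 <= 4 * sqrt v" "0 <= 4 * R^2 * e + 4 * v * (R^2 + e)" using v e by auto
 show ?thesis unfolding exit_good_def using first EL third fourth nn e by (intro conjI) linarith+
qed

end

text \<open>With a vanishing side the walk starts at an end and takes no step, so everything is
  exact. This case does occur, since a step may have displacement 0; for \<open>a = b = 0\<close>
  the convention \<open>0 / 0 = 0\<close> enters.\<close>

lemma exit_good_degenerate:
 assumes v: "v > 0" and \<epsilon>: "\<epsilon> >= 0" and ab: "0 <= a" "0 <= b" "a = 0 | b = 0"
 shows "exit_good \<epsilon> v K a b"
proof -
 interpret S: prob_space "gauss_seq v" using prob_space_gauss_seq[OF v] .
 have 0: "~ (- a < 0 & 0 < b)" using ab by auto
 have J: "exit_steps K a b 0 g = 0" and G: "exit_pos K a b 0 g = 0" for g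
  using exit_steps_outside[OF 0] exit_pos_outside[OF 0] by auto
 have q': "exit_prob v K a b = (if b = 0 then 1 else 0)" using ab S.prob_space unfolding exit_prob_def G by auto
 have \<gamma>: "exit_bias v K a b = (%_. if b = 0 & a ~= 0 then 1 else 0)"
  using ab by (auto simp: exit_bias_def G q' Let_def fun_eq_iff)
 show ?thesis using ab \<epsilon> unfolding exit_good_def \<gamma> J G by (auto simp: S.prob_space[simplified])
qed

text \<open>The mesh is chosen first and the cap afterwards, both uniformly over all intervals with
  sides up to \<open>R\<close>. This uniformity is what permits the interval of a step to be
  random.\<close>

lemma exit_good_eventually:
 assumes R: "R >= 0" and \<epsilon>: "\<epsilon> > 0"
 shows "EX v0>0. ALL v. 0 < v & v <= v0 --> (EX K. ALL a b. 0 <= a & a <= R & 0 <= b & b <= R --> exit_good \<epsilon> v K a b)"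
proof -
 define f where "f = (%v. let e = 10 * R * sqrt v + v in 4 * sqrt v + e + 4 * R^2 * e + 4 * v * (R^2 + e))"
 have "isCont f 0" unfolding f_def Let_def by (intro continuous_intros)
 then have "(f \<longlongrightarrow> f 0) (at_right 0)" by (auto simp: isCont_def dest: tendsto_within_subset)
 then have "eventually (%v. f v < \<epsilon>) (at_right 0)"
  using \<epsilon> by (intro order_tendstoD(2)[of f "f 0"]) (auto simp: f_def)
 then obtain v1 where v1: "v1 > 0" "!!v. 0 < v ==> v < v1 ==> f v < \<epsilon>"
  by (auto simp: eventually_at_right_field)
 show ?thesis
 proof (intro exI[of _ "v1 / 2"] conjI allI impI)
  show "0 < v1 / 2" using v1 by simp
  fix v assume "0 < v & v <= v1 / 2"
  then have v: "v > 0" "f v < \<epsilon>" using v1 by auto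
  \<comment> \<open>The cap is so large that the bound on the probability of reaching it, times
    \<open>2 * R\<close>, is at most \<open>sqrt v\<close>.\<close>
  obtain K :: nat where K: "2 * R * (2 * R^2 + 2 * v) / (v * sqrt v) < real K" using reals_Archimedean2 by blast
  have "0 <= 2 * R * (2 * R^2 + 2 * v) / (v * sqrt v)" using R v by auto
  with K have K0: "K > 0" by (metis of_nat_0_less_iff order_le_less_trans)
  from K K0 v have "2 * R * ((2 * R^2 + 2 * v) / (v * real K)) <= sqrt v" by (simp add: field_simps)
  note K' = this K0
  show "EX K. ALL a b. 0 <= a & a <= R & 0 <= b & b <= R --> exit_good \<epsilon> v K a b"
  proof (intro exI[of _ K] allI impI)
   fix a b assume ab: "0 <= a & a <= R & 0 <= b & b <= R"
   show "exit_good \<epsilon> v K a b"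
   proof (cases "a = 0 | b = 0")
    case True
    then show ?thesis using ab v \<epsilon> by (intro exit_good_degenerate) auto
   next
    case False
    with ab have "0 < a" "0 < b" "a <= R" "b <= R" by auto
    from exit_good_pos[OF v(1) this K'] have "exit_good (f v) v K a b" by (simp add: f_def Let_def)
    then show ?thesis using v by (elim exit_good_mono) auto
   qed
  qed
 qed
qed

section \<open>One step of the embedding\<close>

text \<open>Outside the open unit interval the set may be empty or unbounded below, where
  \<open>Inf\<close> carries no information; the default 0 avoids this.\<close>

definition quantile :: "(real => real) => real => real" where
 "quantile C u = (if 0 < u & u < 1 then Inf {x. u <= C x} else 0)"

lemma quantile_le_iff:
 assumes "real_distribution \<mu>" "0 < u" "u < 1"
 shows "quantile (cdf \<mu>) u <= x \<longleftrightarrow> u <= cdf \<mu> x"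
proof -
 interpret real_distribution \<mu> by fact
 interpret cdf_distribution \<mu> ..
 show ?thesis using assms pseudoinverse[of u x] by (simp add: quantile_def)
qed

text \<open>The Galois connection \<open>quantile_le_iff\<close> turns a sublevel set into a
  comparison of \<open>u\<close> with a value of the distribution function, which depends measurably
  on \<open>w\<close>.\<close>

lemma measurable_quantile:
 fixes N :: "'a measure"
 assumes d: "!!w. w : space N ==> real_distribution (\<mu> w)"
  and m [measurable]: "!!x. (%w. cdf (\<mu> w) x) : borel_measurable N"
 shows "(%(w, u). quantile (cdf (\<mu> w)) u) : borel_measurable (N >< borel)"
proof (rule borel_measurableI_le)
 fix x
 have "{p : space (N >< borel). (case p of (w, u) => quantile (cdf (\<mu> w)) u) <= x} = {p : space (N >< borel). if 0 < snd p
   & snd p < 1 then snd p <= cdf (\<mu> (fst p)) x else 0 <= x}"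
 proof (intro Collect_cong conj_cong refl)
  fix p :: "'a \<times> real" assume "p : space (N >< borel)"
  then have "fst p : space N" by (auto simp: space_pair_measure)
  from quantile_le_iff[OF d[OF this], of "snd p" x]
  show "((case p of (w, u) => quantile (cdf (\<mu> w)) u) <= x) \<longleftrightarrow> (if 0 < snd p & snd p < 1 then snd p
    <= cdf (\<mu> (fst p)) x else 0 <= x)"
   by (cases p) (auto simp: quantile_def)
 qed
 also have "... : sets (N >< borel)" by measurable
 finally show "{p : space (N >< borel). (case p of (w, u) => quantile (cdf (\<mu> w)) u) <= x} : sets (N >< borel)" .
qed

lemma measurable_quantile_const [measurable]:
 assumes "real_distribution \<mu>" shows "quantile (cdf \<mu>) : borel_measurable borel"
proof -
 have "(%(w, u). quantile (cdf \<mu>) u) : borel_measurable (count_space (UNIV :: unit set) >< borel)"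
  by (rule measurable_quantile) (use assms in auto)
 from measurable_compose[OF measurable_Pair1'[of "()"] this] show ?thesis by simp
qed

lemma distr_quantile:
 assumes "real_distribution \<mu>" shows "distr U01 borel (quantile (cdf \<mu>)) = \<mu>"
proof -
 let ?A = "%U01. distr U01 borel (quantile (cdf \<mu>))"
 interpret real_distribution \<mu> by fact
 note [measurable] = measurable_quantile_const[OF assms]
 interpret U: prob_space U01 by (rule prob_space_U01)
 have U: "real_distribution (?A U01)"
  unfolding real_distribution_def real_distribution_axioms_def by (auto intro!: U.prob_space_distr)
 show ?thesis
 proof (rule cdf_unique[OF U assms], rule ext)
  fix x
  let ?c = "cdf \<mu> x"
  have c: "0 <= ?c" "?c <= 1" using cdf_nonneg cdf_bounded_prob by auto
  have "cdf (?A U01) x = measure U01 {u. quantile (cdf \<mu>) u <= x}"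
   unfolding cdf_def[of "distr _ _ _"] by (subst measure_distr) (auto simp: vimage_def)
  also have "... = measure U01 {..?c}"
  proof -
   have "AE u in U01. 0 < u & u < 1" unfolding U01_def by (subst AE_uniform_measure) auto
   then show ?thesis by (intro measure_eq_AE) (auto simp: quantile_le_iff[OF assms])
  qed
  also have "... = ?c"
  proof -
   have "AE u in U01. u ~= ?c" unfolding U01_def using AE_lborel_singleton[of ?c] by (subst AE_uniform_measure) auto
   then have "measure U01 {..?c} = measure U01 {..<?c}" by (intro measure_eq_AE) auto
   then show ?thesis using c by (simp add: measure_def emeasure_U01_less)
  qed
  finally show "cdf (?A U01) x = ?c" .
 qed
qed

section \<open>The noise of one step and the randomly drawn pair of values\<close>

lemma space_Hist [simp]: "space Hist = UNIV" by (simp add: space_PiM)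

lemma const_Hist [measurable]: "(%x. w) : N ->M Hist" by simp

text \<open>In this order: two uniform variables for the candidate, one for its partner, the
  increments of the motion, and one for the corrected exit.\<close>

definition step_noise :: "real => (real \<times> real \<times> real \<times> (nat => real) \<times> real) measure" where
 "step_noise v = U01 >< U01 >< U01 >< gauss_seq v >< U01"

lemma sets_step_noise [measurable_cong, simp]:
 "sets (step_noise v) = sets (borel >< borel >< borel >< Hist >< borel)"
 unfolding step_noise_def by (intro sets_pair_measure_cong) auto

lemma space_step_noise [simp]: "space (step_noise v) = UNIV"
 using sets_eq_imp_space_eq[OF sets_step_noise] by (simp add: space_pair_measure space_PiM)

lemma prob_space_step_noise: "v > 0 ==> prob_space (step_noise v)"
 unfolding step_noise_def by (intro prob_space_pair prob_space_U01 prob_space_gauss_seq)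

lemma nn_integral_step_noise:
 assumes v: "v > 0" and [measurable]: "f : borel_measurable (borel >< borel >< borel >< Hist >< borel)"
 shows "nn_integral (step_noise v) f = nn_integral U01 (%u0. nn_integral U01 (%u1. nn_integral U01 (%u2.
   nn_integral (gauss_seq v) (%g. nn_integral U01 (%u3. f (u0, u1, u2, g, u3))))))"
proof -
 interpret U: prob_space U01 by (rule prob_space_U01)
 interpret S: prob_space "gauss_seq v" by (rule prob_space_gauss_seq[OF v])
 interpret GU: prob_space "gauss_seq v >< U01" by (intro prob_space_pair U.prob_space_axioms S.prob_space_axioms)
 interpret UGU: prob_space "U01 >< gauss_seq v >< U01" by (intro prob_space_pair U.prob_space_axioms S.prob_space_axioms)
 interpret UUGU: prob_space "U01 >< U01 >< gauss_seq v >< U01" by (intro prob_space_pair U.prob_space_axioms S.prob_space_axioms)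
 have [measurable]: "f : borel_measurable (U01 >< U01 >< U01 >< gauss_seq v >< U01)"
  using sets_step_noise[of v] unfolding step_noise_def by (subst measurable_cong_sets[OF _ refl]) auto
 show ?thesis unfolding step_noise_def
  by (simp add: UUGU.nn_integral_fst[symmetric] UGU.nn_integral_fst[symmetric] GU.nn_integral_fst[symmetric]
    U.nn_integral_fst[symmetric])
qed

text \<open>\<open>cand w u0 u1\<close> is the next value given the history \<open>w\<close>, and
  \<open>d w x\<close> is the displacement that the motion should make for the value
  \<open>x\<close>. The two are kept apart because \<open>d w\<close> need not be injective:
  truncation identifies all large values, while the value itself must have its exact law.\<close>

locale embedding_step =
 fixes cand :: "(nat => real) => real => real => real" and d :: "(nat => real) => real => real"
  and R \<epsilon> v :: real and K :: nat
 assumes cand [measurable]: "(%(w, u0, u1). cand w u0 u1) : borel_measurable (Hist >< borel >< borel)"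
  and d [measurable]: "(%(w, x). d w x) : borel_measurable (Hist >< borel)"
  and d_bound: "!!w x. abs(d w x) <= R"
  and centered: "!!w. (LINT u|(U01 >< U01). d w (cand w (fst u) (snd u))) = 0"
  and v: "v > 0"
  and good: "!!a b. 0 <= a ==> a <= R ==> 0 <= b ==> b <= R ==> exit_good \<epsilon> v K a b"
begin

lemma cand' [measurable (raw)]:
 assumes [measurable]: "W : N ->M Hist" "A : borel_measurable N" "B : borel_measurable N"
 shows "(%x. cand (W x) (A x) (B x)) : borel_measurable N"
 using measurable_compose[OF _ cand, of "%x. (W x, A x, B x)" N] by simp

lemma d' [measurable (raw)]:
 assumes [measurable]: "W : N ->M Hist" "A : borel_measurable N" shows "(%x. d (W x) (A x)) : borel_measurable N"
 using measurable_compose[OF _ d, of "%x. (W x, A x)" N] by simp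

definition kern :: "(nat => real) => real measure" where
 "kern w = distr (U01 >< U01) borel (%u. cand w (fst u) (snd u))"

sublocale U: prob_space U01 by (rule prob_space_U01)
sublocale UU: prob_space "U01 >< U01" by (intro prob_space_pair prob_space_U01)
sublocale S: prob_space "gauss_seq v" by (rule prob_space_gauss_seq[OF v])

lemma sets_kern [measurable_cong, simp]: "sets (kern w) = sets borel" by (simp add: kern_def)

lemma space_kern [simp]: "space (kern w) = UNIV" by (simp add: kern_def)

lemma prob_space_kern: "prob_space (kern w)" unfolding kern_def by (rule UU.prob_space_distr) simp

lemma nn_integral_kern:
 assumes [measurable]: "f : borel_measurable borel"
 shows "nn_integral (kern w) f = nn_integral U01 (%u0. nn_integral U01 (%u1. f (cand w u0 u1)))"
 unfolding kern_def by (subst nn_integral_distr) (auto simp: U.nn_integral_fst[symmetric])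

lemma measurable_nn_integral_kern [measurable (raw)]:
 assumes [measurable]: "W : N ->M Hist" and f [measurable]: "(%(z, y). f z y) : borel_measurable (N >< borel)"
 shows "(%z. nn_integral (kern (W z)) (%y. f z y)) : borel_measurable N"
proof -
 have "(%z. nn_integral U01 (%u0. nn_integral U01 (%u1. f z (cand (W z) u0 u1)))) : borel_measurable N" by measurable
 also have "?this \<longleftrightarrow> ?thesis" by (intro measurable_cong, subst nn_integral_kern) auto
 finally show ?thesis .
qed

definition mass :: "(nat => real) => ennreal" where
 "mass w = nn_integral (kern w) (%y. ennreal (d w y))"

lemma measurable_mass [measurable (raw)]:
 assumes [measurable]: "W : N ->M Hist" shows "(%x. mass (W x)) : borel_measurable N" unfolding mass_def by measurable

lemma R_nonneg: "R >= 0" using d_bound[of undefined undefined] by linarith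

lemma mass_finite: "mass w < \<infinity>"
proof -
 interpret prob_space "kern w" by (rule prob_space_kern)
 have "mass w <= nn_integral (kern w) (%y. ennreal R)"
  unfolding mass_def using d_bound[of w] R_nonneg by (intro nn_integral_mono ennreal_leI) (auto simp: abs_le_iff)
 then show ?thesis by (auto simp: emeasure_space_1[simplified] intro: le_less_trans)
qed

lemma mass_neg: "nn_integral (kern w) (%y. ennreal (- d w y)) = mass w"
proof -
 interpret prob_space "kern w" by (rule prob_space_kern)
 have int: "integrable (kern w) (%y. d w y)" using d_bound[of w] by (intro integrable_const_bound[where B=R]) auto
 have intp: "integrable (kern w) (%y. max 0 (d w y))" and intn: "integrable (kern w) (%y. max 0 (- d w y))"
  using int by auto
 have "(LINT y|kern w. d w y) = 0" unfolding kern_def using centered[of w] by (subst integral_distr) auto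
 also have "(LINT y|kern w. d w y) = (LINT y|kern w. max 0 (d w y) - max 0 (- d w y))"
  by (intro Bochner_Integration.integral_cong) auto
 also have "... = (LINT y|kern w. max 0 (d w y)) - (LINT y|kern w. max 0 (- d w y))" using intp intn by simp
 finally show ?thesis
  unfolding mass_def using nn_integral_eq_integral[OF intp] nn_integral_eq_integral[OF intn] by simp
qed

text \<open>The law of the next value weighted by the part of the displacement that has the sign of
  the second component; by centring, both parts have the same total \<open>mass\<close>. The point
  mass at 0 fills the cases in which, up to a null set, no partner is used.\<close>

definition partner_law :: "(nat => real) \<times> real => real measure" where
 "partner_law p = (if mass (fst p) = 0 | snd p = 0 then return borel 0 else density (kern (fst p)) (%y.
   ennreal (sgn (snd p) * d (fst p) y) / mass (fst p)))"

lemma partner_law_sgn: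
 assumes "mass w ~= 0" "s ~= 0" and [measurable]: "f : borel_measurable borel"
 shows "nn_integral (partner_law (w, s)) f = nn_integral (kern w) (%y. ennreal (sgn s * d w y) / mass w * f y)"
 using assms unfolding partner_law_def by (simp, subst nn_integral_density) auto

lemma real_distribution_partner_law: "real_distribution (partner_law p)"
proof (cases "mass (fst p) = 0 | snd p = 0")
 case True
 then show ?thesis
  by (auto simp: partner_law_def real_distribution_def real_distribution_axioms_def intro: prob_space_return)
next
 let ?A = "nn_integral (kern (fst p)) (%y. ennreal (sgn (snd p) * d (fst p) y))"
 let ?B = "mass (fst p)"
 case False
 have "emeasure (partner_law p) UNIV = nn_integral (kern (fst p)) (%y. ennreal (sgn (snd p) * d (fst p) y) / ?B)"
  using False unfolding partner_law_def by (simp, subst emeasure_density) auto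
 also have "... = ?A / ?B"
  by (simp add: nn_integral_divide)
 also have "?A = ?B"
  using False mass_neg[of "fst p"] by (auto simp: sgn_real_def mass_def)
 also have "?B / ?B = 1" using False mass_finite[of "fst p"] by (intro ennreal_divide_self) auto
 finally show ?thesis
  using False by (auto simp: partner_law_def real_distribution_def real_distribution_axioms_def intro!: prob_spaceI)
qed

definition partner :: "(nat => real) => real => real => real" where
 "partner w s u = quantile (cdf (partner_law (w, s))) u"

lemma measurable_partner [measurable (raw)]:
 assumes [measurable]: "W : N ->M Hist" "A : borel_measurable N" "B : borel_measurable N"
 shows "(%x. partner (W x) (A x) (B x)) : borel_measurable N"
proof -
 let ?A = "%p x. nn_integral (kern (fst p)) (%y. ennreal (sgn (snd p) * d (fst p) y) / mass (fst p) * indicator {..x} y)"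
 let ?B = "%p. cdf (partner_law p)"
 have "(%p. ?B p x) = (%p. if mass (fst p) = 0 | snd p = 0 then indicator {..x} (0::real) else enn2real (?A p x))" for x
 proof
  fix p
  have "emeasure (density (kern (fst p)) (%y. ennreal (sgn (snd p) * d (fst p) y) / mass (fst p))) {..x} = ?A p x"
   by (rule emeasure_density) auto
  then show "?B p x = (if mass (fst p) = 0 | snd p = 0 then indicator {..x} (0::real) else enn2real (?A p x))"
   by (auto simp: partner_law_def cdf_def measure_return measure_def[of "density _ _"])
 qed
 also have "... x : borel_measurable (Hist >< borel)" for x by measurable
 finally have "(%p. ?B p x) : borel_measurable (Hist >< borel)" for x .
 from measurable_quantile[OF real_distribution_partner_law this]
 have "(%(p, u). quantile (?B p) u) : borel_measurable ((Hist >< borel) >< borel)" .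
 from measurable_compose[OF _ this, of "%x. ((W x, A x), B x)" N]
 show ?thesis unfolding partner_def by simp
qed

lemma nn_integral_partner:
 assumes [measurable]: "f : borel_measurable borel"
 shows "nn_integral U01 (%u. f (partner w s u)) = nn_integral (partner_law (w, s)) f" unfolding partner_def
 by (subst (2) distr_quantile[OF real_distribution_partner_law, symmetric], subst nn_integral_distr)
   (auto intro!: measurable_quantile_const real_distribution_partner_law simp: measurable_cong_sets[OF sets_U01 refl])

text \<open>The upper value comes first. Completing a candidate of either sign by a weighted partner
  of the opposite sign gives the ordered pair \<open>(y, z)\<close> the density
  \<open>(d w y - d w z) / mass w\<close> with respect to two independent copies of the step law:
  the pair law of Skorokhod's embedding.\<close>

definition draw :: "(nat => real) => real => real => real => real \<times> real" where
 "draw w u0 u1 u2 = (let y = cand w u0 u1; z = partner w (- d w y) u2 in if d w y > 0 then (y, z) else if d w y < 0 then (z,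
   y) else (y, y))"

text \<open>The outer \<open>max 0\<close> acts only if a partner has the wrong sign, a null event;
  it makes the sides of the interval nonnegative without exception.\<close>

definition up_size :: "(nat => real) => real => real => real => real" where
 "up_size w u0 u1 u2 = max 0 (d w (fst (draw w u0 u1 u2)))"

definition down_size :: "(nat => real) => real => real => real => real" where
 "down_size w u0 u1 u2 = max 0 (- d w (snd (draw w u0 u1 u2)))"

lemma measurable_draw [measurable (raw)]:
 assumes [measurable]: "W : N ->M Hist" "A : borel_measurable N" "B : borel_measurable N" "C : borel_measurable N"
 shows "(%x. draw (W x) (A x) (B x) (C x)) : N ->M borel >< borel"
  "(%x. up_size (W x) (A x) (B x) (C x)) : borel_measurable N"
  "(%x. down_size (W x) (A x) (B x) (C x)) : borel_measurable N"
proof -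
 show [measurable]: "(%x. draw (W x) (A x) (B x) (C x)) : N ->M borel >< borel"
  unfolding draw_def Let_def by measurable
 show "(%x. up_size (W x) (A x) (B x) (C x)) : borel_measurable N"
  "(%x. down_size (W x) (A x) (B x) (C x)) : borel_measurable N" unfolding up_size_def down_size_def by measurable
qed

fun step_value :: "(nat => real) => real \<times> real \<times> real \<times> (nat => real) \<times> real => real" where
 "step_value w (u0, u1, u2, g, u3) = (if u3 < exit_bias v K (down_size w u0 u1 u2) (up_size w u0 u1 u2) g then fst (draw w u0 u1
   u2) else snd (draw w u0 u1 u2))"

fun step_count :: "(nat => real) => real \<times> real \<times> real \<times> (nat => real) \<times> real => nat" where
 "step_count w (u0, u1, u2, g, u3) = exit_steps K (down_size w u0 u1 u2) (up_size w u0 u1 u2) 0 g"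

fun step_gain :: "(nat => real) => real \<times> real \<times> real \<times> (nat => real) \<times> real => real" where
 "step_gain w (u0, u1, u2, g, u3) = exit_pos K (down_size w u0 u1 u2) (up_size w u0 u1 u2) 0 g"

abbreviation (input) "Noise == borel >< borel >< borel >< Hist >< (borel :: real measure)"

lemma measurable_step [measurable (raw)]:
 assumes [measurable]: "W : N ->M Hist" "Y : N ->M Noise" shows "(%x. step_value (W x) (Y x)) : borel_measurable N"
  "(%x. step_count (W x) (Y x)) : N ->M count_space UNIV"
  "(%x. step_gain (W x) (Y x)) : borel_measurable N"
proof -
 let ?A = "%y. snd (snd (snd y))"
 note [measurable (raw)] = measurable_exit_bias[OF v]
 have 1: "(%(w, y). step_value w y) : borel_measurable (Hist >< Noise)"
  unfolding split_beta' step_value.simps[of _ "fst y" "fst (snd y)" "fst (snd (snd y))" "fst (?A y)" "snd (?A y)" for y,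
    simplified prod.collapse]
  by measurable
 have 2: "(%(w, y). step_count w y) : Hist >< Noise ->M count_space UNIV"
  unfolding split_beta' step_count.simps[of _ "fst y" "fst (snd y)" "fst (snd (snd y))" "fst (?A y)" "snd (?A y)" for y,
    simplified prod.collapse]
  by measurable
 have 3: "(%(w, y). step_gain w y) : borel_measurable (Hist >< Noise)"
  unfolding split_beta' step_gain.simps[of _ "fst y" "fst (snd y)" "fst (snd (snd y))" "fst (?A y)" "snd (?A y)" for y,
    simplified prod.collapse]
  by measurable
 have [measurable]: "(%x. (W x, Y x)) : N ->M Hist >< Noise" by measurable
 show "(%x. step_value (W x) (Y x)) : borel_measurable N"
  "(%x. step_count (W x) (Y x)) : N ->M count_space UNIV"
  "(%x. step_gain (W x) (Y x)) : borel_measurable N"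
  using measurable_compose[OF _ 1, of "%x. (W x, Y x)" N] measurable_compose[OF _ 2, of "%x. (W x, Y x)" N]
   measurable_compose[OF _ 3, of "%x. (W x, Y x)" N] by simp_all
qed

text \<open>The relation between the drawn pair and the size of the interval, which fails only on a null set.\<close>

definition proper :: "(nat => real) => real => real => real => bool" where
 "proper w u0 u1 u2 \<longleftrightarrow> d w (fst (draw w u0 u1 u2)) = up_size w u0 u1 u2 & d w (snd (draw w u0 u1 u2))
   = - down_size w u0 u1 u2 & (up_size w u0 u1 u2 + down_size w u0 u1 u2 = 0 --> fst (draw w u0 u1 u2) = snd (draw w u0 u1 u2))"

lemma AE_kern_mass_0: "mass w = 0 ==> AE y in kern w. d w y = 0"
proof -
 assume 0: "mass w = 0"
 have "AE y in kern w. ennreal (d w y) = 0" using 0 unfolding mass_def by (subst (asm) nn_integral_0_iff_AE) auto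
 moreover have "AE y in kern w. ennreal (- d w y) = 0"
  using 0 unfolding mass_neg[symmetric] by (subst (asm) nn_integral_0_iff_AE) auto
 ultimately show ?thesis by eventually_elim (auto simp: ennreal_eq_0_iff)
qed

lemma AE_partner_law:
 assumes "mass w ~= 0" "s ~= 0" shows "AE z in partner_law (w, s). sgn s * d w z > 0"
proof -
 let ?A = "%w s. density (kern w) (%y. ennreal (sgn s * d w y) / mass w)"
 have AE: "AE z in ?A w s . sgn s * d w z > 0"
  by (subst AE_density) (auto intro!: AE_I2 simp: ennreal_zero_less_divide)
 have eq: "partner_law (w, s) = ?A w s"
  using assms by (simp add: partner_law_def)
 show ?thesis unfolding eq by (rule AE)
qed

text \<open>A weighted partner almost surely has the required sign, because its density vanishes
  elsewhere; and if the mass is 0, the displacement itself is almost surely 0.\<close>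

lemma AE_proper: "AE u0 in U01. AE u1 in U01. AE u2 in U01. proper w u0 u1 u2"
proof -
 have *: "AE u2 in U01. proper w u0 u1 u2" if "d w (cand w u0 u1) = 0 | mass w ~= 0" for u0 u1
 proof (cases "d w (cand w u0 u1) = 0")
  case True
  then show ?thesis by (intro AE_I2) (auto simp: proper_def up_size_def down_size_def draw_def Let_def)
 next
  case False
  with that have m: "mass w ~= 0" by simp
  let ?s = "- d w (cand w u0 u1)"
  have "AE z in distr U01 borel (quantile (cdf (partner_law (w, ?s)))). sgn ?s * d w z > 0"
   unfolding distr_quantile[OF real_distribution_partner_law] using AE_partner_law[OF m, of ?s] False by simp
  then have "AE u2 in U01. sgn ?s * d w (partner w ?s u2) > 0" unfolding partner_def
   by (subst (asm) AE_distr_iff) (auto intro!: measurable_quantile_const real_distribution_partner_law simp: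
     measurable_cong_sets[OF sets_U01 refl])
  then show ?thesis
  proof eventually_elim
   case (elim u2)
   then show ?case
    by (cases "d w (cand w u0 u1) > 0") (auto simp: proper_def up_size_def down_size_def draw_def Let_def sgn_real_def split:
      if_splits)
  qed
 qed
 show ?thesis
 proof (cases "mass w = 0")
  case False
  then show ?thesis using * by auto
 next
  case True
  have 0: "AE u in U01 >< U01. d w (cand w (fst u) (snd u)) = 0"
   using AE_kern_mass_0[OF True] unfolding kern_def by (subst (asm) AE_distr_iff) auto
  interpret P: pair_sigma_finite U01 U01 ..
  from P.AE_pair[OF 0] have "AE u0 in U01. AE u1 in U01. d w (cand w u0 u1) = 0" by simp
  then show ?thesis using * by auto
 qed
qed

lemma draw_sizes: "0 <= up_size w u0 u1 u2" "up_size w u0 u1 u2 <= R" "0 <= down_size w u0 u1 u2" "down_size w u0 u1 u2 <= R"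
 using d_bound[of w] R_nonneg by (auto simp: up_size_def down_size_def abs_le_iff)

definition up_prob :: "(nat => real) => real => real => real => real" where
 "up_prob w u0 u1 u2 = (LINT g|gauss_seq v. exit_bias v K (down_size w u0 u1 u2) (up_size w u0 u1 u2) g)"

lemma up_prob:
 "0 <= up_prob w u0 u1 u2" "up_prob w u0 u1 u2 <= 1"
 "up_prob w u0 u1 u2 * (down_size w u0 u1 u2 + up_size w u0 u1 u2) = down_size w u0 u1 u2"
proof -
 let ?A = "up_prob w u0 u1 u2"
 let ?B = "down_size w u0 u1 u2"
 note [measurable (raw)] = measurable_exit_bias[OF v]
 let ?\<gamma> = "exit_bias v K (?B) (up_size w u0 u1 u2)"
 have \<gamma>: "0 <= ?\<gamma> g" "?\<gamma> g <= 1" for g using exit_bias_bounds[OF v] draw_sizes by auto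
 show "0 <= ?A" unfolding up_prob_def using \<gamma> by (intro integral_nonneg_AE) auto
 have "?A <= (LINT g|gauss_seq v. 1)" unfolding up_prob_def
  using \<gamma> by (intro integral_mono S.integrable_const_bound[where B=1]) (auto simp: abs_le_iff intro: order_trans)
 then show "?A <= 1" by (simp add: S.prob_space[simplified])
 show "?A * (?B + up_size w u0 u1 u2) = ?B"
  using good draw_sizes unfolding up_prob_def exit_good_def by blast
qed

text \<open>For a fixed pair the law of the chosen value depends on the walk only through the mean
  of the bias, and that mean is exact whatever the overshoot.\<close>

lemma inner_value:
 assumes [measurable]: "f : borel_measurable borel"
 shows "nn_integral (gauss_seq v) (%g. nn_integral U01 (%u3. f (step_value w (u0, u1, u2, g, u3))))
   = ennreal (up_prob w u0 u1 u2) * f (fst (draw w u0 u1 u2)) + ennreal (1 - up_prob w u0 u1 u2) * f (snd (draw w u0 u1 u2))"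
proof -
 let ?A = "nn_integral (gauss_seq v)"
 let ?B = "draw w u0 u1 u2"
 note [measurable (raw)] = measurable_exit_bias[OF v]
 let ?\<gamma> = "exit_bias v K (down_size w u0 u1 u2) (up_size w u0 u1 u2)"
 have \<gamma>: "0 <= ?\<gamma> g" "?\<gamma> g <= 1" for g using exit_bias_bounds[OF v] draw_sizes by auto
 have int: "integrable (gauss_seq v) ?\<gamma>"
  using \<gamma> by (intro S.integrable_const_bound[where B=1]) (auto simp: abs_le_iff intro: order_trans)
 have "?A (%g. nn_integral U01 (%u3. f (step_value w (u0, u1, u2, g, u3)))) = ?A (%g. ennreal (?\<gamma> g) * f (fst ?B)
   + ennreal (1 - ?\<gamma> g) * f (snd ?B))"
  by (intro nn_integral_cong) (simp add: if_distrib[of f] nn_integral_U01_less \<gamma>)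
 also have "... = ?A (%g. ennreal (?\<gamma> g)) * f (fst ?B) + ?A (%g. ennreal (1 - ?\<gamma> g)) * f (snd ?B)"
  by (subst nn_integral_add) (auto simp: nn_integral_multc)
 also have "?A (%g. ennreal (?\<gamma> g)) = ennreal (up_prob w u0 u1 u2)"
  unfolding up_prob_def using \<gamma> int by (intro nn_integral_eq_integral) auto
 also have "?A (%g. ennreal (1 - ?\<gamma> g)) = ennreal (1 - up_prob w u0 u1 u2)"
  unfolding up_prob_def using \<gamma> int by (subst nn_integral_eq_integral) (auto simp: S.prob_space[simplified])
 finally show ?thesis .
qed

text \<open>Exactness of the step. A pair with sides \<open>a\<close> and \<open>b\<close> has
  density \<open>(a + b) / mass w\<close>, and its upper value is taken with probability
  \<open>a / (a + b)\<close>. The weight left on the upper value is \<open>a / mass w\<close>, which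
  integrates to 1 over the lower value; the other side is symmetric.\<close>

lemma step_value_law:
 assumes f [measurable]: "f : borel_measurable borel"
 shows "nn_integral (step_noise v) (%y. f (step_value w y)) = nn_integral (kern w) f"
proof -
 let ?A = "nn_integral (kern w)"
 let ?B = "%u0 u1. nn_integral U01 (%u2. ennreal (up_prob w u0 u1 u2) * f (fst (draw w u0 u1 u2))
   + ennreal (1 - up_prob w u0 u1 u2) * f (snd (draw w u0 u1 u2)))"
 let ?C = "%z. ennreal (- d w z)"
 let ?D = "%z. ennreal (d w z)"
 let ?E = "nn_integral U01"
 let ?F = "%a b. ennreal a + ennreal b"
 let ?G = "%N. borel_measurable N"
 note [measurable (raw)] = measurable_exit_bias[OF v]
 interpret \<kappa>: prob_space "kern w" by (rule prob_space_kern)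
 interpret \<kappa>\<kappa>: pair_sigma_finite "kern w" "kern w" ..
 define upp where "upp a b = (LINT g|gauss_seq v. exit_bias v K a b g)" for a b
 have upp [measurable (raw)]: "(%x. upp (A x) (B x)) : ?G N"
  if [measurable]: "A : ?G N" "B : ?G N" for A B and N :: "'x measure"
  unfolding upp_def by measurable
 define H where "H y z = ennreal (upp (max 0 (- d w z)) (max 0 (d w y))) * f y + ennreal (1 - upp (max 0 (- d w z)) (max 0 (d w
   y))) * f z" for y z
 have H [measurable (raw)]: "(%x. H (A x) (B x)) : ?G N"
  if [measurable]: "A : ?G N" "B : ?G N" for A B and N :: "'x measure"
  unfolding H_def by measurable
 \<comment> \<open>The mean given the candidate \<open>y\<close>; a candidate with displacement 0 is
   kept.\<close>
 define L where "L y = (if d w y > 0 then nn_integral (partner_law (w, - d w y)) (%z. H y z) else if d w y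
   < 0 then nn_integral (partner_law (w, - d w y)) (%z. H z y) else f y)" for y
 have L_eq: "L y = (if d w y > 0 then ?E (%u2. H y (partner w (- d w y) u2)) else if d w y < 0 then ?E (%u2.
   H (partner w (- d w y) u2) y) else f y)" for y
  unfolding L_def using nn_integral_partner[of "%z. H z y"] nn_integral_partner[of "H y"] by simp
 have L [measurable]: "L : borel_measurable borel" unfolding L_eq by measurable
 have "nn_integral (step_noise v) (%y. f (step_value w y)) = ?E (%u0. ?E (%u1. ?B u0 u1))"
  by (subst nn_integral_step_noise[OF v]) (auto simp only: inner_value f, measurable)
 also have "... = ?E (%u0. ?E (%u1. L (cand w u0 u1)))"
 proof (intro nn_integral_cong)
  fix u0 u1
  consider "d w (cand w u0 u1) > 0" | "d w (cand w u0 u1) < 0" | "d w (cand w u0 u1) = 0" by linarith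
  then show "?B u0 u1 = L (cand w u0 u1)"
  proof cases
   case 3
   have "ennreal (up_prob w u0 u1 u2) * f (cand w u0 u1) + ennreal (1 - up_prob w u0 u1 u2) * f (cand w u0 u1)
     = f (cand w u0 u1)" for u2
    using up_prob[of w u0 u1 u2] by (simp add: distrib_right[symmetric] flip: ennreal_plus)
   with 3 show ?thesis by (simp add: L_eq draw_def Let_def U.emeasure_space_1[simplified])
  qed (simp_all add: L_eq draw_def Let_def H_def up_prob_def up_size_def down_size_def upp_def)
 qed
 also have "... = ?A (%y. L y)" by (simp add: nn_integral_kern)
 also have "... = ?A f"
 proof (cases "mass w = 0")
  case True
  from AE_kern_mass_0[OF this] show ?thesis by (intro nn_integral_cong_AE) (auto simp: L_def)
 next
  case m: False
  let ?m = "mass w"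
  let ?P = "%y. if d w y > 0 then 1 else 0 :: ennreal" and ?N = "%y. if d w y < 0 then 1 else 0 :: ennreal"
   and ?Z = "%y. if d w y = 0 then 1 else 0 :: ennreal"
  have mm: "?m / ?m = 1" using m mass_finite[of w] by (intro ennreal_divide_self) auto
  have "L y = ?Z y * f y + (?P y * ?A (%z. ?C z / ?m * H y z) + ?N y * ?A (%z. ?D z / ?m * H z y))" for y
   using m by (auto simp: L_def partner_law_sgn)
  then have "?A (%y. L y) = ?A (%y. ?Z y * f y) + (?A (%y. ?A (%z. ?P y * (?C z / ?m * H y z))) + ?A (%y. ?A (%z.
    ?N y * (?D z / ?m * H z y))))"
   by (simp add: nn_integral_add nn_integral_cmult)
  \<comment> \<open>For negative candidates the order of integration is exchanged. Then
    \<open>y\<close> is the upper value in both contributions, and their densities can be added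
    pointwise.\<close>
  also have "?A (%y. ?A (%z. ?N y * (?D z / ?m * H z y))) = ?A (%z. ?A (%y. ?N y * (?D z / ?m * H z y)))"
   by (rule \<kappa>\<kappa>.Fubini') measurable
  also have "?A (%y. ?A (%z. ?P y * (?C z / ?m * H y z))) + ... = ?A (%y. ?A (%z. ?P y * (?C z / ?m * H y z)
    + ?N z * (?D y / ?m * H y z)))"
   by (simp add: nn_integral_add)
  also have "... = ?A (%y. ?A (%z. ?P y * f y * (?C z / ?m) + ?D y / ?m * (?N z * f z)))"
  proof (intro nn_integral_cong)
   fix y z
   show "?P y * (?C z / ?m * H y z) + ?N z * (?D y / ?m * H y z) = ?P y * f y * (?C z / ?m) + ?D y / ?m * (?N z * f z)"
   proof (cases "d w y > 0 & d w z < 0")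
    case True
    define a b where "a = - d w z" and "b = d w y"
    have ab: "a > 0" "b > 0" using True by (auto simp: a_def b_def)
    have aR: "a <= R" "b <= R" using d_bound[of w y] d_bound[of w z] by (auto simp: a_def b_def abs_le_iff)
    have "upp a b * (a + b) = a" using good[of a b] ab aR unfolding upp_def exit_good_def by auto
    then have q: "upp a b = a / (a + b)" using ab by (simp add: field_simps)
    have H: "H y z = ennreal (a / (a + b)) * f y + ennreal (b / (a + b)) * f z"
    proof -
     have "1 - a / (a + b) = b / (a + b)" using ab by (simp add: field_simps)
     then show ?thesis using ab by (simp add: H_def q flip: a_def b_def)
    qed
    have 1: "ennreal (a / (a + b)) * (?F a b) = ennreal a" "ennreal (b / (a + b)) * (?F a b) = ennreal b"
     using ab by (simp_all flip: ennreal_plus ennreal_mult)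
    have "?P y * (?C z / ?m * H y z) + ?N z * (?D y / ?m * H y z) = (?F a b) * H y z / ?m"
     using True by (simp add: a_def b_def distrib_left distrib_right divide_ennreal_def ac_simps)
    also have "(?F a b) * H y z = (ennreal (a / (a + b)) * (?F a b)) * f y + (ennreal (b / (a + b)) * (?F a b)) * f z"
     unfolding H by (simp add: distrib_left ac_simps)
    also have "... = ennreal a * f y + ennreal b * f z" unfolding 1 ..
    also have "... / ?m = ?P y * f y * (?C z / ?m) + ?D y / ?m * (?N z * f z)"
     using True by (simp add: a_def b_def divide_ennreal_def distrib_left distrib_right ac_simps)
    finally show ?thesis .
   qed (auto simp: ennreal_neg)
  qed
  also have "... = ?A (%y. ?P y * f y) * (mass w / ?m) + (mass w / ?m) * ?A (%z. ?N z * f z)"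
   by (simp add: nn_integral_add nn_integral_cmult nn_integral_multc nn_integral_divide mass_neg flip: mass_def)
  also have "... = ?A (%y. ?P y * f y) + ?A (%z. ?N z * f z)" by (simp add: mm)
  also have "?A (%y. ?Z y * f y) + ... = ?A (%y. ?Z y * f y + (?P y * f y + ?N y * f y))"
   by (simp add: nn_integral_add)
  also have "... = ?A f" by (intro nn_integral_cong) auto
  finally show ?thesis .
 qed
 finally show ?thesis .
qed

lemma step_average:
 assumes F [measurable]: "F : borel_measurable Noise" and F' [measurable]: "F' : borel_measurable Noise"
  and le: "!!u0 u1 u2. proper w u0 u1 u2 ==> nn_integral (gauss_seq v) (%g. nn_integral U01 (%u3. F (u0, u1, u2, g, u3)))
    <= nn_integral (gauss_seq v) (%g. nn_integral U01 (%u3. F' (u0, u1, u2, g, u3)))"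
 shows "nn_integral (step_noise v) F <= nn_integral (step_noise v) F'"
 unfolding nn_integral_step_noise[OF v F] nn_integral_step_noise[OF v F']
proof (rule nn_integral_mono_AE, use AE_proper[of w] in eventually_elim)
 case (elim u0)
 show ?case
 proof (rule nn_integral_mono_AE, use elim in eventually_elim)
  case (elim u1)
  show ?case by (rule nn_integral_mono_AE, use elim in eventually_elim) (rule le)
 qed
qed

lemma exit_good_draw: "exit_good \<epsilon> v K (down_size w u0 u1 u2) (up_size w u0 u1 u2)"
 using good draw_sizes by blast

text \<open>Fairness, in the form that \<open>up_prob\<close> times the upper side equals
  \<open>1 - up_prob\<close> times the lower side, reduces these moments of the two-point law to
  polynomials in the sides.\<close>

lemma up_prob_pow:
 assumes "proper w u0 u1 u2"
 shows "up_prob w u0 u1 u2 * (up_size w u0 u1 u2)^2 + (1 - up_prob w u0 u1 u2) * (down_size w u0 u1 u2)^2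
   = down_size w u0 u1 u2 * up_size w u0 u1 u2"
  "up_prob w u0 u1 u2 * (up_size w u0 u1 u2)^4 + (1 - up_prob w u0 u1 u2) * (down_size w u0 u1 u2)^4
    = down_size w u0 u1 u2 * up_size w u0 u1 u2 * ((down_size w u0 u1 u2)^2 - down_size w u0 u1 u2 * up_size w u0 u1 u2
    + (up_size w u0 u1 u2)^2)"
proof -
 let ?A = "down_size w u0 u1 u2"
 let ?B = "up_size w u0 u1 u2"
 let ?C = "up_prob w u0 u1 u2"
 define a b q where "a = ?A" and "b = ?B" and "q = ?C"
 have q: "q * (a + b) = a" and ab: "0 <= a" "0 <= b"
  using up_prob[of w u0 u1 u2] draw_sizes by (auto simp: a_def b_def q_def)
 have "q * b^2 + (1 - q) * a^2 = a * b & q * b^4 + (1 - q) * a^4 = a * b * (a^2 - a * b + b^2)"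
 proof (cases "a + b = 0")
  case True
  then have "a = 0" "b = 0" using ab by auto
  then show ?thesis by simp
 next
  case False
  have 1: "q * b = (1 - q) * a" using q by (simp add: algebra_simps)
  have "q * b^2 + (1 - q) * a^2 = (q * b) * b + ((1 - q) * a) * a" by (simp add: power2_eq_square)
  also have "... = ((1 - q) * a) * (a + b)" unfolding 1 by (simp add: algebra_simps)
  also have "... = ((a + b) - q * (a + b)) * a" by (simp add: algebra_simps)
  also have "... = a * b" unfolding q by (simp add: algebra_simps)
  finally have 2: "q * b^2 + (1 - q) * a^2 = a * b" .
  have "q * b^4 + (1 - q) * a^4 = (q * b) * b^3 + ((1 - q) * a) * a^3" by (simp add: power4_eq_xxxx power3_eq_cube)
  also have "... = ((1 - q) * a) * (a + b) * (a^2 - a * b + b^2)"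
   unfolding 1 by (simp add: algebra_simps power2_eq_square power3_eq_cube)
  also have "((1 - q) * a) * (a + b) = ((a + b) - q * (a + b)) * a" by (simp add: algebra_simps)
  also have "... = a * b" unfolding q by (simp add: algebra_simps)
  finally show ?thesis using 2 by simp
 qed
 then show "?C * (?B)^2 + (1 - ?C) * (?A)^2 = ?A * ?B"
  "?C * (?B)^4 + (1 - ?C) * (?A)^4 = ?A * ?B * ((?A)^2 - ?A * ?B + (?B)^2)"
  by (simp_all add: a_def b_def q_def)
qed

lemma inner_pow:
 assumes "proper w u0 u1 u2"
 shows "nn_integral (gauss_seq v) (%g. nn_integral U01 (%u3. ennreal ((d w (step_value w (u0, u1, u2, g, u3)))^2)))
   = ennreal (down_size w u0 u1 u2 * up_size w u0 u1 u2)"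
  "nn_integral (gauss_seq v) (%g. nn_integral U01 (%u3. ennreal ((d w (step_value w (u0, u1, u2, g, u3)))^4)))
    = ennreal (down_size w u0 u1 u2 * up_size w u0 u1 u2 * ((down_size w u0 u1 u2)^2 - down_size w u0 u1 u2 * up_size w u0 u1 u2
    + (up_size w u0 u1 u2)^2))"
proof -
 let ?A = "down_size w u0 u1 u2"
 let ?B = "up_size w u0 u1 u2"
 note p = assms[unfolded proper_def]
 have q: "0 <= up_prob w u0 u1 u2" "0 <= 1 - up_prob w u0 u1 u2" using up_prob[of w u0 u1 u2] by auto
 show "nn_integral (gauss_seq v) (%g. nn_integral U01 (%u3. ennreal ((d w (step_value w (u0, u1, u2, g, u3)))^2)))
   = ennreal (?A * ?B)"
  using q p by (subst inner_value) (auto simp: up_prob_pow[OF assms, symmetric] simp flip: ennreal_mult ennreal_plus)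
 show "nn_integral (gauss_seq v) (%g. nn_integral U01 (%u3. ennreal ((d w (step_value w (u0, u1, u2, g, u3)))^4)))
   = ennreal (?A * ?B * ((?A)^2 - ?A * ?B + (?B)^2))"
  unfolding up_prob_pow(2)[OF assms, symmetric]
  using q p by (subst inner_value) (auto simp flip: ennreal_mult ennreal_plus)
qed

lemma \<epsilon>_nonneg: "\<epsilon> >= 0"
 using good[of 0 0] R_nonneg unfolding exit_good_def by (auto intro: order_trans[OF abs_ge_zero])

text \<open>The motion stops at \<open>step_gain\<close>, whereas the chosen value stands for an end
  of the interval. Their mean distance is what the second clause of \<open>exit_good\<close>
  bounds.\<close>

lemma step_gain_close:
 "nn_integral (step_noise v) (%y. ennreal (abs(d w (step_value w y) - step_gain w y))) <= ennreal \<epsilon>"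
proof -
 let ?A = "%u0 u1 u2. %g. nn_integral U01 (%u3. ennreal (abs(d w (step_value w (u0, u1, u2, g, u3)) - step_gain w (u0, u1, u2, g,
   u3))))"
 let ?B = "ennreal \<epsilon>"
 let ?C = "%gauss_seq v. nn_integral (gauss_seq v)"
 interpret \<rho>: prob_space "step_noise v" by (rule prob_space_step_noise[OF v])
 have "nn_integral (step_noise v) (%y. ennreal (abs(d w (step_value w y) - step_gain w y))) <= nn_integral (step_noise v) (%y.
   ?B)"
 proof (rule step_average)
  fix u0 u1 u2 assume p: "proper w u0 u1 u2"
  note [measurable (raw)] = measurable_exit_bias[OF v]
  define a b where "a = down_size w u0 u1 u2" and "b = up_size w u0 u1 u2"
  let ?\<gamma> = "exit_bias v K a b" and ?G = "exit_pos K a b 0"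
  have ab: "0 <= a" "0 <= b" using draw_sizes by (auto simp: a_def b_def)
  have \<gamma>: "0 <= ?\<gamma> g" "?\<gamma> g <= 1" for g using exit_bias_bounds[OF v ab] by auto
  have "integrable (gauss_seq v) (%g. ?\<gamma> g * abs(b - ?G g) + (1 - ?\<gamma> g) * abs(- a - ?G g))"
  proof (rule bint_bound)
   show "integrable (gauss_seq v) (%g. abs(b - ?G g) + abs(- a - ?G g))"
    using exit_pos_integrable[OF v] by (intro bint_add integrable_abs bint_diff) auto
   show "AE g in gauss_seq v. norm (?\<gamma> g * abs(b - ?G g) + (1 - ?\<gamma> g) * abs(- a - ?G g)) <= norm (abs(b - ?G g)
     + abs(- a - ?G g))"
    using \<gamma> by (intro AE_I2) (auto simp: abs_mult intro!: add_mono mult_left_le_one_le order_trans[OF abs_triangle_ineq])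
  qed measurable
  then have "?C gauss_seq v (%g. ennreal (?\<gamma> g * abs(b - ?G g) + (1 - ?\<gamma> g) * abs(- a - ?G g)))
    = ennreal (LINT g|gauss_seq v. ?\<gamma> g * abs(b - ?G g) + (1 - ?\<gamma> g) * abs(- a - ?G g))"
   using \<gamma> by (intro nn_integral_eq_integral) auto
  also have "... <= ?B"
   using exit_good_draw[of w u0 u1 u2] unfolding exit_good_def a_def[symmetric] b_def[symmetric]
   by (intro ennreal_leI) blast
  finally have *: "?C gauss_seq v (%g. ennreal (?\<gamma> g * abs(b - ?G g) + (1 - ?\<gamma> g) * abs(- a - ?G g))) <= ?B" .
  have "?C gauss_seq v (?A u0 u1 u2) = ?C gauss_seq v (%g. nn_integral U01 (%u3. (if u3
    < ?\<gamma> g then ennreal (abs(b - ?G g)) else ennreal (abs(- a - ?G g)))))"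
   using p unfolding proper_def by (intro nn_integral_cong) (auto simp: a_def b_def)
  also have "... = ?C gauss_seq v (%g. ennreal (?\<gamma> g * abs(b - ?G g) + (1 - ?\<gamma> g) * abs(- a - ?G g)))"
   using \<gamma> by (intro nn_integral_cong) (simp add: nn_integral_U01_less ennreal_mult)
  also note *
  finally show "?C gauss_seq v (?A u0 u1 u2) <= ?C gauss_seq v (%g. nn_integral U01 (%u3. ?B))"
   by (simp add: U.emeasure_space_1[simplified] S.emeasure_space_1[simplified])
 qed auto
 then show ?thesis by (simp add: \<rho>.emeasure_space_1[simplified])
qed

lemma inner_count:
 "nn_integral (gauss_seq v) (%g. nn_integral U01 (%u3. ennreal (v * real (step_count w (u0, u1, u2, g, u3)))))
   = ennreal (v * (LINT g|gauss_seq v. real (exit_steps K (down_size w u0 u1 u2) (up_size w u0 u1 u2) 0 g)))"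
 "nn_integral (gauss_seq v) (%g. nn_integral U01 (%u3. ennreal ((v * real (step_count w (u0, u1, u2, g, u3)))^2)))
   = ennreal (v^2 * (LINT g|gauss_seq v. (real (exit_steps K (down_size w u0 u1 u2) (up_size w u0 u1 u2) 0 g))^2))"
proof -
 let ?J = "%g. real (exit_steps K (down_size w u0 u1 u2) (up_size w u0 u1 u2) 0 g)"
 have "integrable (gauss_seq v) ?J" "integrable (gauss_seq v) (%g. (?J g)^2)"
  by (rule S.integrable_const_bound[where B="real K"]; simp add: exit_steps_le)
    (rule S.integrable_const_bound[where B="(real K)^2"]; simp add: exit_steps_le power_mono)
 then show "nn_integral (gauss_seq v) (%g. nn_integral U01 (%u3. ennreal (v * real (step_count w (u0, u1, u2, g, u3)))))
   = ennreal (v * (LINT g|gauss_seq v. ?J g))"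
  "nn_integral (gauss_seq v) (%g. nn_integral U01 (%u3. ennreal ((v * real (step_count w (u0, u1, u2, g, u3)))^2)))
    = ennreal (v^2 * (LINT g|gauss_seq v. (?J g)^2))"
  using v by (auto simp: U.emeasure_space_1[simplified] power_mult_distrib nn_integral_eq_integral)
qed

text \<open>\<open>v\<close> times the count is the time for which the motion runs. Given the pair,
  its mean is close to the product of the sides, and that product is also the mean square of the
  displacement.\<close>

lemma step_count_mean:
 "nn_integral (step_noise v) (%y. ennreal (v * real (step_count w y))) <= nn_integral (kern w) (%x. ennreal ((d w x)^2))
   + ennreal \<epsilon>"
 "nn_integral (kern w) (%x. ennreal ((d w x)^2)) <= nn_integral (step_noise v) (%y. ennreal (v * real (step_count w y)))
   + ennreal \<epsilon>"
proof -
 let ?A = "%u0 u1 u2. LINT g|gauss_seq v. real (exit_steps K (down_size w u0 u1 u2) (up_size w u0 u1 u2) 0 g)"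
 let ?B = "nn_integral (step_noise v)"
 let ?C = "ennreal \<epsilon>"
 let ?D = "nn_integral (kern w) (%x. ennreal ((d w x)^2))"
 let ?E = "%y. ennreal (v * real (step_count w y))"
 let ?F = "nn_integral (gauss_seq v)"
 let ?G = "%y. ennreal ((d w (step_value w y))^2)"
 let ?H = "nn_integral U01"
 interpret \<rho>: prob_space "step_noise v" by (rule prob_space_step_noise[OF v])
 have e: "?D = ?B (%y. ?G y)"
  by (subst step_value_law[symmetric]) auto
 have th: "abs(v * (?A u0 u1 u2) - down_size w u0 u1 u2 * up_size w u0 u1 u2) <= \<epsilon>" for u0 u1 u2
  using exit_good_draw[of w u0 u1 u2] unfolding exit_good_def by blast
 have sz: "0 <= down_size w u0 u1 u2 * up_size w u0 u1 u2" for u0 u1 u2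
  using draw_sizes by (intro mult_nonneg_nonneg) auto
 have nn: "0 <= v * (?A u0 u1 u2)" for u0 u1 u2
  using v by (intro mult_nonneg_nonneg integral_nonneg_AE) auto
 have "?B (%y. ?E y) <= ?B (%y. ?G y + ?C)"
 proof (rule step_average)
  fix u0 u1 u2 assume p: "proper w u0 u1 u2"
  have "ennreal (v * (?A u0 u1 u2)) <= ennreal (down_size w u0 u1 u2 * up_size w u0 u1 u2 + \<epsilon>)"
   using th[of u0 u1 u2] by (intro ennreal_leI) linarith
  also have "... = ennreal (down_size w u0 u1 u2 * up_size w u0 u1 u2) + ?C"
   using sz \<epsilon>_nonneg by (rule ennreal_plus)
  finally show "?F (%g. ?H (%u3. ennreal (v * real (step_count w (u0, u1, u2, g, u3))))) <= ?F (%g. ?H (%u3.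
    ennreal ((d w (step_value w (u0, u1, u2, g, u3)))^2) + ?C))"
   by (simp add: nn_integral_add inner_pow[OF p] inner_count U.emeasure_space_1[simplified] S.emeasure_space_1[simplified]
     del: step_value.simps step_count.simps)
 qed auto
 then show "?B (%y. ?E y) <= ?D + ?C"
  unfolding e by (simp add: nn_integral_add \<rho>.emeasure_space_1[simplified])
 have "?B (%y. ?G y) <= ?B (%y. ?E y + ?C)"
 proof (rule step_average)
  fix u0 u1 u2 assume p: "proper w u0 u1 u2"
  have "ennreal (down_size w u0 u1 u2 * up_size w u0 u1 u2) <= ennreal (v * (?A u0 u1 u2) + \<epsilon>)"
   using th[of u0 u1 u2] by (intro ennreal_leI) linarith
  also have "... = ennreal (v * (?A u0 u1 u2)) + ?C"
   using nn \<epsilon>_nonneg by (rule ennreal_plus)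
  finally show "?F (%g. ?H (%u3. ennreal ((d w (step_value w (u0, u1, u2, g, u3)))^2))) <= ?F (%g. ?H (%u3.
    ennreal (v * real (step_count w (u0, u1, u2, g, u3))) + ?C))"
   using inner_count(1)[of w u0 u1 u2]
   by (simp add: nn_integral_add inner_pow[OF p] U.emeasure_space_1[simplified] S.emeasure_space_1[simplified]
     del: step_value.simps step_count.simps)
 qed auto
 then show "?D <= ?B (%y. ?E y) + ?C"
  unfolding e by (simp add: nn_integral_add \<rho>.emeasure_space_1[simplified])
qed

lemma step_count_square:
 "nn_integral (step_noise v) (%y. ennreal ((v * real (step_count w y))^2)) <= 6 * nn_integral (kern w) (%x. ennreal ((d w x)^4))
   + ennreal \<epsilon>"
proof -
 let ?A = "%u0 u1 u2. (down_size w u0 u1 u2)^2 - down_size w u0 u1 u2 * up_size w u0 u1 u2 + (up_size w u0 u1 u2)^2"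
 let ?B = "nn_integral (step_noise v)"
 interpret \<rho>: prob_space "step_noise v" by (rule prob_space_step_noise[OF v])
 have e: "nn_integral (kern w) (%x. ennreal ((d w x)^4)) = ?B (%y. ennreal ((d w (step_value w y))^4))"
  by (subst step_value_law[symmetric]) auto
 have th: "v^2 * (LINT g|gauss_seq v. (real (exit_steps K (down_size w u0 u1 u2) (up_size w u0 u1 u2) 0 g))^2)
   <= 6 * (down_size w u0 u1 u2 * up_size w u0 u1 u2 * (?A u0 u1 u2)) + \<epsilon>" for u0 u1 u2
  using exit_good_draw[of w u0 u1 u2] unfolding exit_good_def by blast
 have "?B (%y. ennreal ((v * real (step_count w y))^2)) <= ?B (%y. 6 * ennreal ((d w (step_value w y))^4) + ennreal \<epsilon>)"
 proof (rule step_average)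
  fix u0 u1 u2 assume p: "proper w u0 u1 u2"
  let ?q = "down_size w u0 u1 u2 * up_size w u0 u1 u2 * (?A u0 u1 u2)"
  have "0 <= ?q"
   unfolding up_prob_pow(2)[OF p, symmetric] using up_prob[of w u0 u1 u2] by (auto intro!: add_nonneg_nonneg mult_nonneg_nonneg)
  then have "ennreal (6 * ?q + \<epsilon>) = 6 * ennreal ?q + ennreal \<epsilon>"
   using \<epsilon>_nonneg by (simp add: ennreal_mult ennreal_plus)
  then show "nn_integral (gauss_seq v) (%g. nn_integral U01 (%u3. ennreal ((v * real (step_count w (u0, u1, u2, g, u3)))^2)))
    <= nn_integral (gauss_seq v) (%g. nn_integral U01 (%u3. 6 * ennreal ((d w (step_value w (u0, u1, u2, g, u3)))^4)
    + ennreal \<epsilon>))"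
   using ennreal_leI[OF th[of u0 u1 u2]] p
   by (simp add: nn_integral_add nn_integral_cmult inner_pow inner_count U.emeasure_space_1[simplified]
     S.emeasure_space_1[simplified]
     del: step_value.simps step_count.simps)
 qed auto
 then show ?thesis unfolding e by (simp add: nn_integral_add nn_integral_cmult \<rho>.emeasure_space_1[simplified])
qed

end

text \<open>Stated for maps measurable with respect to generated sigma-algebras, because the past of
  a stopped process is known only in that form.\<close>

lemma (in prob_space) distr_pair_disjoint_blocks:
 assumes ind: "indep_vars (%_. borel :: real measure) X UNIV"
  and AB: "A \<inter> B = {}"
  and f: "f : sigma (space M) (\<Union>c\<in>A. {X c -` S \<inter> space M | S. S : sets borel}) ->M N1"
  and g: "g : sigma (space M) (\<Union>c\<in>B. {X c -` S \<inter> space M | S. S : sets borel}) ->M N2"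
 shows "distr M N1 f >< distr M N2 g = distr M (N1 >< N2) (%z. (f z, g z))"
proof -
 let ?E = "%c. {X c -` S \<inter> space M | S. S : sets borel}"
 let ?I = "case_bool A B"
 let ?A = "sigma_sets (space M)"
 let ?B = "?A (\<Union>c\<in>A. ?E c)"
 let ?C = "?A (\<Union>c\<in>B. ?E c)"
 let ?D = "%S T. emeasure (distr M (N1 >< N2) (%z. (f z, g z))) (S \<times> T)"
 have rv: "random_variable borel (X c)" for c using ind unfolding indep_vars_def2 by auto
 have "indep_sets ?E (\<Union>(?I ` UNIV))" using ind unfolding indep_vars_def2 by (auto intro: indep_sets_mono_index)
 then have "indep_sets (%j. ?A (\<Union>c\<in>?I j. ?E c)) UNIV"
 proof (rule indep_sets_collect_sigma)
  show "Int_stable (?E c)" for c unfolding Int_stable_def by (safe, rule_tac x="S \<inter> Sa" in exI) auto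
  show "disjoint_family_on ?I UNIV" using AB by (auto simp: disjoint_family_on_def split: bool.splits)
 qed
 then have 1: "indep_set (?B) (?C)"
  unfolding indep_set_def by (rule indep_sets_cong[THEN iffD1, rotated -1]) (auto split: bool.splits)
 have sub: "(\<Union>c\<in>C. ?E c) \<subseteq> Pow (space M)" for C by auto
 have sig: "?A (\<Union>c\<in>C. ?E c) \<subseteq> events" for C
  using rv by (intro sets.sigma_sets_subset) (auto intro: measurable_sets)
 have rvf: "random_variable N1 f"
  by (rule measurableI) (use measurable_space[OF f] measurable_sets[OF f] sig[of A] sub in \<open>auto simp: sets_measure_of
    space_measure_of\<close>)
 have rvg: "random_variable N2 g"
  by (rule measurableI) (use measurable_space[OF g] measurable_sets[OF g] sig[of B] sub in \<open>auto simp: sets_measure_of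
    space_measure_of\<close>)
 have f': "?A {f -` S \<inter> space M | S. S : sets N1} \<subseteq> ?B"
  using measurable_sets[OF f] sub by (intro sigma_sets_mono) (auto simp: sets_measure_of space_measure_of)
 have g': "?A {g -` S \<inter> space M | S. S : sets N2} \<subseteq> ?C"
  using measurable_sets[OF g] sub by (intro sigma_sets_mono) (auto simp: sets_measure_of space_measure_of)
 note [measurable] = rvf rvg
 interpret F: prob_space "distr M N1 f" by (rule prob_space_distr) simp
 interpret G: prob_space "distr M N2 g" by (rule prob_space_distr) simp
 interpret FG: pair_sigma_finite "distr M N1 f" "distr M N2 g" ..
 show ?thesis
 proof (rule pair_measure_eqI)
  fix S T assume "S : sets (distr M N1 f)" "T : sets (distr M N2 g)"
  then have ST [measurable]: "S : sets N1" "T : sets N2" by auto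
  have S: "f -` S \<inter> space M : ?B"
   using ST by (intro subsetD[OF f'] sigma_sets.Basic) auto
  have T: "g -` T \<inter> space M : ?C"
   using ST by (intro subsetD[OF g'] sigma_sets.Basic) auto
  have "?D S T = emeasure M ((f -` S \<inter> space M) \<inter> (g -` T \<inter> space M))"
   by (subst emeasure_distr) (auto intro!: arg_cong2[where f=emeasure])
  also have "... = emeasure M (f -` S \<inter> space M) * emeasure M (g -` T \<inter> space M)"
   using indep_setD[OF 1 S T] by (simp add: emeasure_eq_measure ennreal_mult)
  finally show "emeasure (distr M N1 f) S * emeasure (distr M N2 g) T = ?D S T"
   by (simp add: emeasure_distr)
 qed (auto intro!: F.sigma_finite_measure_axioms G.sigma_finite_measure_axioms)
qed

lemma (in prob_space) indep_vars_reindex_inj: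
 assumes ind: "indep_vars (%_. N) X UNIV" and f: "inj f" shows "indep_vars (%_. N) (%j. X (f j)) UNIV"
 unfolding indep_vars_def2 indep_sets_def
proof (intro conjI ballI allI impI)
 note ind' = ind[unfolded indep_vars_def2 indep_sets_def]
 show "random_variable N (X (f j))" for j using ind' by auto
 show "{X (f j) -` A \<inter> space M | A. A : sets N} \<subseteq> events" for j using ind' by auto
 fix J A assume J: "J \<subseteq> UNIV" "J ~= {}" "finite J" and A: "A : (\<Pi> j\<in>J. {X (f j) -` A \<inter> space M | A. A
   : sets N})"
 define A' where "A' = (%c. A (inv f c))"
 have A': "A' (f j) = A j" for j using f by (simp add: A'_def)
 have "prob (\<Inter>c\<in>f ` J. A' c) = (\<Prod>c\<in>f ` J. prob (A' c))"
 proof (intro ind'[THEN conjunct2, THEN conjunct2, rule_format])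
  show "A' : (\<Pi> i\<in>f ` J. {X i -` A \<inter> space M |A. A : sets N})"
  proof
   fix i assume "i : f ` J"
   then obtain j where j: "j : J" "i = f j" by blast
   show "A' i : {X i -` A \<inter> space M |A. A : sets N}" using Pi_mem[OF A j(1)] by (simp add: A' j(2))
  qed
 qed (use J in auto)
 then show "prob (\<Inter>j\<in>J. A j) = (\<Prod>j\<in>J. prob (A j))"
  using f by (simp add: A' prod.reindex inj_on_subset)
qed

section \<open>Iteration along a Brownian motion\<close>

text \<open>Independence of motion and uniform variables is expressed through the increments on each
  regular grid, the form in which the embedding consumes it.\<close>

locale bm_noise = standard_brownian_motion M W for M :: "'a measure" and W +
 fixes V :: "nat => 'a => real"
 assumes noise_indep: "!!h. h > 0 ==> indep_vars (%_. borel) (case_sum (%i z. W (real (Suc i) * h) z - W (real i * h) z) V) UNIV"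
  and V_law: "!!n. distr M borel (V n) = U01"
begin

definition incr :: "real => nat => 'a => real" where
 "incr h i z = W (real (Suc i) * h) z - W (real i * h) z"

definition src :: "real => nat + nat => 'a => real" where
 "src h = case_sum (incr h) V"

lemma src_indep: "h > 0 ==> indep_vars (%_. borel) (src h) UNIV"
 using noise_indep[of h] by (simp add: src_def incr_def[abs_def])

lemma src_simps [simp]: "src h (Inl i) = incr h i" "src h (Inr j) = V j" by (auto simp: src_def)

lemma measurable_src: "h > 0 ==> src h c : borel_measurable M" using src_indep[of h] unfolding indep_vars_def2 by auto

definition blk :: "real => (nat + nat) set => 'a measure" where
 "blk h C = sigma (space M) (\<Union>c\<in>C. {src h c -` S \<inter> space M | S. S : sets borel})"

lemma space_blk [simp]: "space (blk h C) = space M" unfolding blk_def by (rule space_measure_of) auto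

lemma sets_blk: "sets (blk h C) = sigma_sets (space M) (\<Union>c\<in>C. {src h c -` S \<inter> space M | S. S : sets borel})"
 unfolding blk_def by (rule sets_measure_of) auto

lemma measurable_blk: "c : C ==> src h c : borel_measurable (blk h C)" by (rule measurableI) (auto simp: sets_blk)

lemma blk_least:
 assumes "space N = space M" "!!c. c : C ==> src h c : borel_measurable N" shows "sets (blk h C) \<subseteq> sets N"
 unfolding sets_blk assms(1)[symmetric] by (rule sets.sigma_sets_subset) (use assms(2)[THEN measurable_sets] in auto)

lemma measurable_blk_mono: "f : blk h C ->M N ==> sets (blk h C) \<subseteq> sets M' ==> space M' = space M ==> f : M' ->M N"
 by (auto simp: measurable_def)

lemma blk_subset: "h > 0 ==> sets (blk h C) \<subseteq> sets M" by (rule blk_least) (auto intro: measurable_src)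

lemma measurable_blkD: "h > 0 ==> f : blk h C ->M N ==> f : M ->M N"
 by (rule measurable_blk_mono[OF _ blk_subset]) auto

lemma blk_indep:
 assumes "h > 0" "A \<inter> B = {}" "f : blk h A ->M N1" "g : blk h B ->M N2"
 shows "distr M N1 f >< distr M N2 g = distr M (N1 >< N2) (%z. (f z, g z))"
 using distr_pair_disjoint_blocks[OF src_indep[OF assms(1)] assms(2)] assms(3,4) unfolding blk_def by blast

definition past_blk :: "real => nat => nat => 'a measure" where
 "past_blk h m i = blk h (Inl ` {..<i} \<union> Inr ` {..<m})"

lemma incr_refine:
 "incr (real q * h) i z = (\<Sum>l<q. incr h (i * q + l) z)"
proof -
 have "(\<Sum>l<q. incr h (i * q + l) z) = (\<Sum>l<q. W (real (i * q + Suc l) * h) z - W (real (i * q + l) * h) z)"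
  by (simp add: incr_def)
 also have "... = W (real (i * q + q) * h) z - W (real (i * q) * h) z" by (subst sum_lessThan_telescope) auto
 finally show ?thesis by (simp add: incr_def algebra_simps)
qed

text \<open>A coarse increment is the sum of \<open>q\<close> fine ones, so the information up to
  index \<open>i\<close> of the coarse grid is contained in that up to \<open>i * q\<close> of the
  fine one.\<close>

lemma past_blk_refine:
 assumes "m <= m'" "i * q <= i'" shows "sets (past_blk (real q * h) m i) \<subseteq> sets (past_blk h m' i')"
 unfolding past_blk_def
proof (rule blk_least)
 let ?A = "%Inl Inr. borel_measurable (blk h (Inl ` {..<i'} \<union> Inr ` {..<m'}))"
 fix c :: "nat + nat" assume c: "c : Inl ` {..<i} \<union> Inr ` {..<m}"
 show "src (real q * h) c : ?A Inl Inr"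
 proof (cases c)
  case (Inl j)
  with c have j: "j < i" by auto
  have "incr h (j * q + l) : ?A Inl Inr" if "l < q" for l
  proof -
   have "j * q + l < Suc j * q" using that by simp
   also have "... <= i * q" using j by (intro mult_le_mono) auto
   finally have "Inl (j * q + l) : Inl ` {..<i'} \<union> Inr ` {..<m'}" using assms by auto
   from measurable_blk[OF this, of h] show ?thesis by simp
  qed
  then have "(%z. \<Sum>l<q. incr h (j * q + l) z) : ?A Inl Inr"
   by (intro borel_measurable_sum) auto
  then show ?thesis by (simp add: Inl incr_refine[abs_def])
 next
  case (Inr j)
  with c assms have "c : Inl ` {..<i'} \<union> Inr ` {..<m'}" by auto
  from measurable_blk[OF this, of h] show ?thesis by (simp add: Inr)
 qed
qed simp

text \<open>Each step consumes four uniform variables, so \<open>m\<close> is \<open>4 * k\<close>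
  at step \<open>k\<close>; the motion is read from grid index \<open>i\<close> on.\<close>

definition noise_at :: "real => nat => nat => 'a => real \<times> real \<times> real \<times> (nat => real) \<times> real" where
 "noise_at h m i z = (V m z, V (m + 1) z, V (m + 2) z, (%j. incr h (i + j) z), V (m + 3) z)"

lemma distr_incr:
 assumes "h > 0" shows "distr M borel (incr h i) = gauss h"
proof -
 have "distributed M lborel (%z. W (real (Suc i) * h) z - W (real i * h) z) (normal_density 0 (sqrt (real (Suc i) * h - real i *
   h)))"
  using assms by (intro W_increment_normal) auto
 also have "real (Suc i) * h - real i * h = h" by (simp add: algebra_simps)
 finally have "distr M lborel (incr h i) = density lborel (%x. ennreal (normal_density 0 (sqrt h) x))"
  by (auto simp: distributed_def incr_def[abs_def])
 then show ?thesis unfolding gauss_def by (simp cong: distr_cong)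
qed

lemma distr_incr_seq:
 assumes h: "h > 0" shows "distr M Hist (%z j. incr h (i + j) z) = gauss_seq h"
proof -
 have "indep_vars (%_. borel) (%j. src h (Inl (i + j))) UNIV"
  by (rule indep_vars_reindex_inj[OF src_indep[OF h]]) (auto simp: inj_def)
 then have "indep_vars (%_. borel) (%j. incr h (i + j)) UNIV" by simp
 from indep_vars_iff_distr_eq_PiM[THEN iffD1, OF _ _ this]
 have "distr M Hist (%z. \<lambda>j\<in>UNIV. incr h (i + j) z) = (\<Pi>\<^sub>M j\<in>UNIV. distr M borel (incr h (i + j)))"
  using measurable_src[OF h, of "Inl _"] by simp
 then show ?thesis by (simp add: distr_incr[OF h] gauss_seq_def restrict_UNIV)
qed

definition future_blk :: "real => nat => nat => 'a measure" where
 "future_blk h m i = blk h (Inl ` {i..} \<union> Inr ` {m..})"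

lemma measurable_future_blk:
 assumes h: "h > 0" shows "noise_at h m i : future_blk h m i ->M borel >< borel >< borel >< Hist >< borel"
proof -
 let ?A = "borel_measurable (future_blk h m i)"
 have [measurable]: "V (m + j) : ?A" for j
  unfolding future_blk_def using measurable_blk[of "Inr (m + j)" "Inl ` {i..} \<union> Inr ` {m..}" h] by auto
 have [measurable]: "V m : ?A"
  unfolding future_blk_def using measurable_blk[of "Inr m" "Inl ` {i..} \<union> Inr ` {m..}" h] by auto
 have [measurable]: "incr h (i + j) : ?A" for j
  unfolding future_blk_def using measurable_blk[of "Inl (i + j)" "Inl ` {i..} \<union> Inr ` {m..}" h] by auto
 have [measurable]: "(%z j. incr h (i + j) z) : future_blk h m i ->M Hist" by (rule measurable_PiM_single') auto
 show ?thesis unfolding noise_at_def by measurable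
qed

lemma distr_V_pair:
 assumes h: "h > 0" and f: "f : blk h C ->M N" and j: "Inr j ~: C"
 shows "distr M (borel >< N) (%z. (V j z, f z)) = U01 >< distr M N f"
proof -
 have "V j : borel_measurable (blk h {Inr j})" using measurable_blk[of "Inr j" "{Inr j}" h] by simp
 from blk_indep[OF h _ this f] j show ?thesis by (simp add: V_law)
qed

lemma distr_noise_at:
 assumes h: "h > 0" shows "distr M (borel >< borel >< borel >< Hist >< borel) (noise_at h m i) = step_noise h"
proof -
 let ?A = "%g. %z. (V (m + 1) z, V (m + 2) z, g z, V (m + 3) z)"
 define g where "g = (%z j. incr h (i + j) z)"
 have V: "V j : borel_measurable (blk h C)" if "Inr j : C" for j C using measurable_blk[OF that, of h] by simp
 have g: "g : blk h C ->M Hist" if "range Inl \<subseteq> C" for C unfolding g_def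
 proof (rule measurable_PiM_single')
  show "(%z. incr h (i + j) z) : borel_measurable (blk h C)" for j
   using measurable_blk[of "Inl (i + j)" C h] that by auto
 qed auto
 have 1: "distr M (Hist >< borel) (%z. (g z, V (m + 3) z)) = gauss_seq h >< U01"
  using blk_indep[OF h, of "range Inl" "{Inr (m + 3)}" g Hist "V (m + 3)" borel] V g
  by (auto simp: V_law distr_incr_seq[OF h] g_def image_iff)
 have g3: "(%z. (g z, V (m + 3) z)) : blk h C ->M Hist >< borel" if "range Inl \<subseteq> C" "Inr (m + 3) : C" for C
  using g[OF that(1)] V[OF that(2)] by measurable
 have 2: "distr M (borel >< Hist >< borel) (%z. (V (m + 2) z, g z, V (m + 3) z)) = U01 >< gauss_seq h >< U01"
  by (subst distr_V_pair[OF h g3[of "range Inl \<union> {Inr (m + 3)}"]]) (auto simp: 1)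
 have g2: "(%z. (V (m + 2) z, g z, V (m + 3) z)) : blk h C ->M borel >< Hist >< borel"
  if "range Inl \<subseteq> C" "Inr (m + 3) : C" "Inr (m + 2) : C" for C
  using g3[OF that(1,2)] V[OF that(3)] by measurable
 have 3: "distr M (borel >< borel >< Hist >< borel) (?A g) = U01 >< U01 >< gauss_seq h >< U01"
  by (subst distr_V_pair[OF h g2[of "range Inl \<union> {Inr (m + 2), Inr (m + 3)}"]]) (auto simp: 2[simplified])
 have g1: "(?A g) : blk h C ->M borel >< borel >< Hist >< borel"
  if "range Inl \<subseteq> C" "Inr (m + 3) : C" "Inr (m + 2) : C" "Inr (m + 1) : C" for C
  using g2[OF that(1,2,3)] V[OF that(4)] by measurable
 have 4: "distr M (borel >< borel >< borel >< Hist >< borel) (%z. (V m z, V (m + 1) z, V (m + 2) z, g z, V (m + 3) z))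
   = U01 >< U01 >< U01 >< gauss_seq h >< U01"
  by (subst distr_V_pair[OF h g1[of "range Inl \<union> {Inr (m + 1), Inr (m + 2), Inr (m + 3)}"]]) (auto simp: 3[simplified])
 show ?thesis using 4 unfolding step_noise_def noise_at_def[abs_def] g_def .
qed

text \<open>The Markov property at a deterministic grid index: past and future noise are functions
  of disjoint groups of independent sources.\<close>

lemma past_future_nn_integral:
 assumes h: "h > 0"
  and g: "g : past_blk h m i ->M N"
  and f [measurable]: "f : borel_measurable (N >< (borel >< borel >< borel >< Hist >< borel))"
 shows "nn_integral M (%z. f (g z, noise_at h m i z)) = nn_integral M (%z. nn_integral (step_noise h) (%y. f (g z, y)))"
proof -
 let ?Y = "borel >< borel >< borel >< Hist >< borel :: (real \<times> real \<times> real \<times> (nat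
   => real) \<times> real) measure"
 let ?A = "noise_at h m i"
 let ?B = "step_noise h"
 interpret Y: prob_space "?B" by (rule prob_space_step_noise[OF h])
 have [measurable]: "g : M ->M N" using g unfolding past_blk_def by (rule measurable_blkD[OF h])
 have [measurable]: "?A : M ->M ?Y"
  using measurable_future_blk[OF h] unfolding future_blk_def by (rule measurable_blkD[OF h])
 have "distr M N g >< distr M ?Y (?A) = distr M (N >< ?Y) (%z. (g z, ?A z))"
  by (rule blk_indep[OF h _ g[unfolded past_blk_def] measurable_future_blk[OF h, unfolded future_blk_def]]) auto
 then have eq: "distr M N g >< ?B = distr M (N >< ?Y) (%z. (g z, ?A z))"
  by (simp add: distr_noise_at[OF h])
 have "nn_integral M (%z. f (g z, ?A z)) = nn_integral (distr M N g >< ?B) f"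
  unfolding eq by (subst nn_integral_distr) auto
 also have "... = nn_integral (distr M N g) (%x. nn_integral (?B) (%y. f (x, y)))"
  by (subst Y.nn_integral_fst[symmetric]) (auto cong: measurable_cong_sets)
 also have "... = nn_integral M (%z. nn_integral (?B) (%y. f (g z, y)))" by (subst nn_integral_distr) auto
 finally show ?thesis .
qed

end

text \<open>By \<open>refine\<close> the grids are nested: multiplied by \<open>q k\<close>, the
  index at which a step stops becomes an index of the next, finer grid.\<close>

locale embedded_walk = bm_noise M W V for M :: "'a measure" and W V +
 fixes cand :: "nat => (nat => real) => real => real => real" and d :: "nat => (nat => real) => real => real"
  and R \<epsilon> h :: "nat => real" and K q :: "nat => nat"
 assumes step: "!!k. embedding_step (cand k) (d k) (R k) (\<epsilon> k) (h k) (K k)"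
  and refine: "!!k. h k = real (q k) * h (Suc k)"
begin

sublocale step: embedding_step "cand k" "d k" "R k" "\<epsilon> k" "h k" "K k" for k by (rule step)

abbreviation (input) "Noise == borel >< borel >< borel >< Hist >< (borel :: real measure)"

lemma h_pos: "h k > 0" by (rule step.v)

text \<open>Values are stored from index 1 on, index 0 keeping its default 0, whereas the counts
  start at index 0. The last component is the time used so far in units of the current mesh, hence
  the factor \<open>q k\<close>.\<close>

primrec path :: "nat => 'a => (nat => real) \<times> (nat => real) \<times> nat" where
 "path 0 z = (%_. 0, %_. 0, 0)"
| "path (Suc k) z = (case path k z of (x, c, i) => (x(Suc k := step.step_value k x (noise_at (h k) (4 * k) i z)), c(k
  := real (step.step_count k x (noise_at (h k) (4 * k) i z))), (i + step.step_count k x (noise_at (h k) (4 * k) i z)) * q k))"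

definition hist :: "nat => 'a => nat => real" where "hist k z = fst (path k z)"
definition counts :: "nat => 'a => nat => real" where "counts k z = fst (snd (path k z))"
definition pos :: "nat => 'a => nat" where "pos k z = snd (snd (path k z))"
definition noise :: "nat => 'a => real \<times> real \<times> real \<times> (nat => real) \<times> real" where
 "noise k z = noise_at (h k) (4 * k) (pos k z) z"
definition past :: "nat => 'a => (nat => real) \<times> (nat => real)" where "past k z = (hist k z, counts k z)"

lemma path_eq: "path k z = (hist k z, counts k z, pos k z)" by (simp add: hist_def counts_def pos_def)

lemma hist_0 [simp]: "hist 0 z = (%_. 0)" and counts_0 [simp]: "counts 0 z = (%_. 0)" and pos_0 [simp]: "pos 0 z = 0"
 by (simp_all add: hist_def counts_def pos_def)

lemma hist_Suc: "hist (Suc k) z = (hist k z)(Suc k := step.step_value k (hist k z) (noise k z))"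
 and counts_Suc: "counts (Suc k) z = (counts k z)(k := real (step.step_count k (hist k z) (noise k z)))"
 and pos_Suc: "pos (Suc k) z = (pos k z + step.step_count k (hist k z) (noise k z)) * q k"
 by (simp_all add: hist_def[of "Suc k"] counts_def[of "Suc k"] pos_def[of "Suc k"] path_eq[of k z] noise_def)

text \<open>A step that uses \<open>j\<close> increments does not look at the later ones.\<close>

definition cut :: "nat => real \<times> real \<times> real \<times> (nat => real) \<times> real
  => real \<times> real \<times> real \<times> (nat => real) \<times> real" where
 "cut j y = (case y of (u0, u1, u2, g, u3) => (u0, u1, u2, (%l. if l < j then g l else 0), u3))"

text \<open>An equivalence, so that the event of stopping after exactly \<open>j\<close> increments
  can be decided from these \<open>j\<close> alone.\<close>

lemma step_count_cut: "step.step_count k w (cut j y) = j \<longleftrightarrow> step.step_count k w y = j"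
proof -
 let ?A = "exit_steps (K k)"
 obtain u0 u1 u2 g u3 where y: "y = (u0, u1, u2, g, u3)" by (cases y)
 let ?a = "step.down_size k w u0 u1 u2" and ?b = "step.up_size k w u0 u1 u2" and ?g = "%l. if l < j then g l else 0"
 have "?A ?a ?b 0 ?g = j \<longleftrightarrow> ?A ?a ?b 0 g = j"
 proof
  assume j: "?A ?a ?b 0 ?g = j"
  have "?A ?a ?b 0 g = ?A ?a ?b 0 ?g" by (rule exit_steps_cong) (simp add: j)
  with j show "?A ?a ?b 0 g = j" by simp
 next
  assume j: "?A ?a ?b 0 g = j"
  have "?A ?a ?b 0 ?g = ?A ?a ?b 0 g" by (rule exit_steps_cong) (simp add: j)
  with j show "?A ?a ?b 0 ?g = j" by simp
 qed
 then show ?thesis by (simp add: y cut_def)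
qed

lemma step_value_cut:
 assumes "step.step_count k w y = j" shows "step.step_value k w (cut j y) = step.step_value k w y"
proof -
 obtain u0 u1 u2 g u3 where y: "y = (u0, u1, u2, g, u3)" by (cases y)
 let ?a = "step.down_size k w u0 u1 u2" and ?b = "step.up_size k w u0 u1 u2" and ?g = "%l. if l < j then g l else 0"
 have j: "exit_steps (K k) ?a ?b 0 g = j" using assms by (simp add: y)
 have "exit_steps (K k) ?a ?b 0 ?g = exit_steps (K k) ?a ?b 0 g" by (rule exit_steps_cong) (auto simp: j)
 then have "exit_pos (K k) ?a ?b 0 ?g = exit_pos (K k) ?a ?b 0 g" by (simp add: exit_pos_def j)
 then have "exit_bias (h k) (K k) ?a ?b ?g = exit_bias (h k) (K k) ?a ?b g" by (simp add: exit_bias_def)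
 then show ?thesis by (simp add: y cut_def)
qed

lemma measurable_cut_noise:
 assumes "4 * k + 4 <= m" "i + j <= i'"
 shows "(%z. cut j (noise_at (h k) (4 * k) i z)) : past_blk (h k) m i' ->M Noise"
proof -
 let ?A = "borel_measurable (past_blk (h k) m i')"
 have V: "V n : ?A" if "n < m" for n
  unfolding past_blk_def using measurable_blk[of "Inr n" _ "h k"] that by auto
 have g: "incr (h k) (i + l) : ?A" if "l < j" for l
  unfolding past_blk_def using measurable_blk[of "Inl (i + l)" _ "h k"] that assms by auto
 have [measurable]: "(%z l. if l < j then incr (h k) (i + l) z else 0) : past_blk (h k) m i' ->M Hist"
 proof (rule measurable_PiM_single')
  show "(%z. if l < j then incr (h k) (i + l) z else 0) : ?A" for l
   using g[of l] by (cases "l < j") auto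
 qed auto
 have [measurable]: "V (4 * k) : ?A" "V (4 * k + 1) : ?A"
  "V (4 * k + 2) : ?A" "V (4 * k + 3) : ?A"
  using assms by (auto intro!: V)
 show ?thesis unfolding cut_def noise_at_def split by measurable
qed

lemma measurable_Hist_upd [measurable (raw)]:
 assumes [measurable]: "F : N ->M Hist" "v : borel_measurable N" shows "(%x. (F x)(j := v x)) : N ->M Hist"
proof (rule measurable_PiM_single')
 show "(%x. ((F x)(j := v x)) i) : borel_measurable N" for i by (cases "i = j") auto
qed auto

text \<open>\<open>pos k\<close> is a stopping index. In place of a stopped sigma-algebra, the
  events that \<open>pos k\<close> equals a given \<open>i\<close> are treated one by one: on such
  an event the past coincides with a map measurable for the information up to
  \<open>i\<close>.\<close>

lemma past_adapted:
 "{z : space M. pos k z = i} : sets (past_blk (h k) (4 * k) i) & (EX g : past_blk (h k) (4 * k) i ->M Hist >< Hist.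
   ALL z:space M. pos k z = i --> past k z = g z)"
proof (induction k arbitrary: i)
 case 0
 have sp: "space (past_blk (h 0) (4 * 0) i) = space M" by (simp add: past_blk_def)
 show ?case by (intro conjI bexI[of _ "%_. (%_. 0, %_. 0)"])
    (auto simp: past_def sp[symmetric] simp del: past_blk_def)
next
 case (Suc k i')
 let ?H = "%i. past_blk (h k) (4 * k) i" and ?H' = "past_blk (h (Suc k)) (4 * Suc k) i'"
 have sp [simp]: "space (past_blk h' m' j') = space M" for h' m' j' by (simp add: past_blk_def)
 from Suc.IH have "ALL i. EX g. g : ?H i ->M Hist >< Hist & (ALL z:space M. pos k z = i --> past k z = g z)" by blast
 then obtain g where g: "!!i. g i : ?H i ->M Hist >< Hist" "!!i z. z : space M ==> pos k z = i ==> past k z = g i z"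
  by metis
 \<comment> \<open>The new index equals \<open>i'\<close> exactly on the union of these events over
   the pairs with \<open>(i + j) * q k = i'\<close>.\<close>
 define E where "E i j = {z : space M. pos k z = i & step.step_count k (hist k z) (noise k z) = j}" for i j
 define Y where "Y i j z = cut j (noise_at (h k) (4 * k) i z)" for i j z
 define f where "f i j z = ((fst (g i z))(Suc k := step.step_value k (fst (g i z)) (Y i j z)), (snd (g i z))(k := real j))"
   for i j z
 have sub: "sets (past_blk (h k) m (i + j)) \<subseteq> sets ?H'" if "(i + j) * q k = i'" "m <= 4 * Suc k" for i j m
  using that unfolding refine[of k] by (intro past_blk_refine) auto
 have sub0: "sets (?H i) \<subseteq> sets ?H'" if "(i + j) * q k = i'" for i j
  using that unfolding refine[of k] by (intro past_blk_refine) (auto simp: algebra_simps)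
 have meas: "\<phi> : ?H' ->M N" if "\<phi> : past_blk (h k) m j' ->M N" "sets (past_blk (h k) m j') \<subseteq> sets ?H'"
   for \<phi> m j' and N :: "'x measure"
  using that by (auto simp: measurable_def)
 have gH: "g i : ?H' ->M Hist >< Hist" if "(i + j) * q k = i'" for i j by (rule meas[OF g(1) sub0[OF that]])
 have YH: "Y i j : ?H' ->M Noise" if "(i + j) * q k = i'" for i j
  unfolding Y_def by (rule meas[OF measurable_cut_noise sub[OF that]]) auto
 have posH: "{z : space M. pos k z = i} : sets ?H'" if "(i + j) * q k = i'" for i j
  using Suc.IH[of i] sub0[OF that] by auto
 have E_eq: "E i j = {z : space M. pos k z = i} \<inter> {z : space ?H'. step.step_count k (fst (g i z)) (Y i j z) = j}" for i j
 proof -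
  have "fst (g (pos k z) z) = hist k z" if "z : space M" for z
   using g(2)[OF that refl] by (simp add: past_def flip: g(2)[OF that refl])
  then show ?thesis by (auto simp: E_def Y_def step_count_cut noise_def)
 qed
 have E_sets: "E i j : sets ?H'" if "(i + j) * q k = i'" for i j
 proof -
  note [measurable] = gH[OF that] YH[OF that] posH[OF that]
  show ?thesis unfolding E_eq by measurable
 qed
 have pos_E: "pos (Suc k) z = (i + j) * q k" if "z : E i j" for z i j using that by (auto simp: E_def pos_Suc)
 have P_eq: "{z : space M. pos (Suc k) z = i'} = (\<Union>(i, j)\<in>{(i, j). (i + j) * q k = i'}. E i j)"
  by (auto simp: E_def pos_Suc)
 have P: "{z : space M. pos (Suc k) z = i'} : sets ?H'" unfolding P_eq
 proof (rule sets.countable_UN'')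
  fix x assume "x : {(i, j). (i + j) * q k = i'}"
  then show "(case x of (i, j) => E i j) : sets ?H'" using E_sets[of "fst x" "snd x"]
    by (auto simp only: mem_Collect_eq split_beta' fst_conv snd_conv)
 qed simp
 have f_eq: "past (Suc k) z = f i j z" if "z : E i j" for z i j
 proof -
  from that have "past k z = g i z" using g(2) by (auto simp: E_def)
  then show ?thesis
   using that by (auto simp: past_def f_def hist_Suc counts_Suc Y_def E_def noise_def step_value_cut prod_eq_iff)
 qed
 have f_meas: "f i j : ?H' ->M Hist >< Hist" if "(i + j) * q k = i'" for i j
 proof -
  note [measurable] = gH[OF that] YH[OF that]
  show ?thesis unfolding f_def by measurable
 qed
 \<comment> \<open>A countable cover: piece 0 is the event that the new index differs from
   \<open>i'\<close>, and piece \<open>Suc n\<close> is \<open>E i j\<close> for the pair coded by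
   \<open>n\<close>, or empty if that pair does not lead to \<open>i'\<close>.\<close>
 define A where "A n = (case n of 0 => {z : space M. pos (Suc k) z ~= i'} | Suc n => (case prod_decode n of (i, j) => if (i
   + j) * q k = i' then E i j else {}))" for n
 define G where "G z = (if pos (Suc k) z = i' then past (Suc k) z else (%_. 0, %_. 0))" for z
 have A_sets: "A n : sets ?H'" for n
 proof -
  have eq: "{z : space M. pos (Suc k) z ~= i'} = space ?H' - {z : space M. pos (Suc k) z = i'}" by auto
  have "{z : space M. pos (Suc k) z ~= i'} : sets ?H'" unfolding eq by (rule sets.compl_sets[OF P])
  then show ?thesis using E_sets[of "fst (prod_decode (n - 1))" "snd (prod_decode (n - 1))"] unfolding A_def
   by (cases n) (auto split: prod.split)
 qed
 have "G : ?H' ->M Hist >< Hist"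
 proof (rule measurable_piecewise_restrict2[of A])
  fix n
  show "A n : sets ?H'" by (rule A_sets)
  show "EX h:?H' ->M Hist >< Hist. ALL x:A n. G x = h x"
  proof (cases n)
   case 0
   then show ?thesis by (intro bexI[of _ "%_. (%_. 0, %_. 0)"]) (auto simp: A_def G_def)
  next
   case (Suc m)
   obtain i j where ij: "prod_decode m = (i, j)" by fastforce
   show ?thesis
   proof (cases "(i + j) * q k = i'")
    case True
    then show ?thesis by (intro bexI[of _ "f i j"] f_meas) (auto simp: A_def Suc ij G_def f_eq pos_E)
   next
    case False
    then show ?thesis by (intro bexI[of _ "%_. (%_. 0, %_. 0)"]) (auto simp: A_def Suc ij)
   qed
  qed
 next
  show "space ?H' = (\<Union>n. A n)"
  proof (intro equalityI subsetI)
   fix z assume z: "z : space ?H'"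
   show "z : (\<Union>n. A n)"
   proof (cases "pos (Suc k) z = i'")
    case False
    then have "z : A 0" using z by (simp add: A_def)
    then show ?thesis by blast
   next
    case True
    define i j where "i = pos k z" and "j = step.step_count k (hist k z) (noise k z)"
    with True z have "(i + j) * q k = i'" "z : E i j" by (auto simp: E_def pos_Suc)
    then have "z : A (Suc (prod_encode (i, j)))" by (simp add: A_def)
    then show ?thesis by blast
   qed
  qed (use A_sets[THEN sets.sets_into_space] in blast)
 qed
 with P show ?case by (intro conjI bexI[of _ G]) (auto simp: G_def)
qed

lemma past_measurable [measurable]: "past k : M ->M Hist >< Hist"
 and pos_measurable [measurable]: "pos k : M ->M count_space UNIV"
proof -
 have P: "{z : space M. pos k z = i} : sets M" for i
  using past_adapted[of k i] blk_subset[OF h_pos] unfolding past_blk_def by blast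
 show "pos k : M ->M count_space UNIV"
  using P by (subst measurable_count_space_eq2_countable) (auto simp: vimage_def Int_def conj_commute)
 show "past k : M ->M Hist >< Hist"
 proof (rule measurable_piecewise_restrict2[of "%i. {z : space M. pos k z = i}"])
  fix i
  obtain g where "g : past_blk (h k) (4 * k) i ->M Hist >< Hist" "ALL z:space M. pos k z = i --> past k z = g z"
   using past_adapted by blast
  then show "EX g:M ->M Hist >< Hist. ALL x:{z : space M. pos k z = i}. past k x = g x"
   unfolding past_blk_def by (auto intro!: bexI[of _ g] measurable_blkD[OF h_pos])
 qed (use P in auto)
qed

lemma hist_measurable [measurable]: "hist k : M ->M Hist" and counts_measurable [measurable]: "counts k : M ->M Hist"
 using measurable_compose[OF past_measurable measurable_fst, of k] measurable_compose[OF past_measurable measurable_snd, of k]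
 by (simp_all add: past_def)

lemma noise_at_measurable [measurable]: "noise_at (h k) m i : M ->M Noise"
 using measurable_future_blk[OF h_pos] unfolding future_blk_def by (rule measurable_blkD[OF h_pos])

lemma noise_measurable [measurable]: "noise k : M ->M Noise"
proof (rule measurable_piecewise_restrict2[of "%i. {z : space M. pos k z = i}"])
 fix i
 show "EX g:M ->M Noise. ALL x:{z : space M. pos k z = i}. noise k x = g x"
  by (intro bexI[of _ "noise_at (h k) (4 * k) i"]) (auto simp: noise_def)
qed auto

text \<open>The strong Markov property at the grid-valued time \<open>pos k * h k\<close>, by summing over its values.\<close>

lemma past_noise_nn_integral:
 assumes f [measurable]: "f : borel_measurable ((Hist >< Hist) >< Noise)"
 shows "nn_integral M (%z. f (past k z, noise k z)) = nn_integral M (%z. nn_integral (step_noise (h k)) (%y. f (past k z, y)))"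
proof -
 let ?A = "nn_integral M"
 let ?B = "%z. nn_integral (step_noise (h k)) (%y. f (past k z, y))"
 let ?C = "%z. f (past k z, noise k z)"
 interpret Y: prob_space "step_noise (h k)" by (rule prob_space_step_noise[OF h_pos])
 let ?I = "%i z. indicator {z : space M. pos k z = i} z :: ennreal"
 have split: "?A F = (\<Sum>i. ?A (%z. ?I i z * F z))" if [measurable]: "F : borel_measurable M" for F
 proof -
  have "?A F = ?A (%z. (\<Sum>i. ?I i z * F z))"
  proof (rule nn_integral_cong)
   fix z assume z: "z : space M"
   have "(\<Sum>i. ?I i z * F z) = (\<Sum>i\<in>{pos k z}. ?I i z * F z)"
    by (rule suminf_finite) (auto simp: indicator_def)
   then show "F z = (\<Sum>i. ?I i z * F z)" using z by simp
  qed
  also have "... = (\<Sum>i. ?A (%z. ?I i z * F z))" by (rule nn_integral_suminf) measurable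
  finally show ?thesis .
 qed
 have "?A (%z. ?C z) = (\<Sum>i. ?A (%z. ?I i z * ?C z))"
  by (rule split) measurable
 also have "... = (\<Sum>i. ?A (%z. ?I i z * ?B z))"
 proof (rule suminf_cong)
  fix i
  let ?H = "past_blk (h k) (4 * k) i"
  obtain g where g: "g : ?H ->M Hist >< Hist" "!!z. z : space M ==> pos k z = i ==> past k z = g z"
   using past_adapted by blast
  have P: "{z : space M. pos k z = i} : sets ?H" using past_adapted by blast
  have "?I i : borel_measurable ?H" using P by measurable
  with g(1) have gI: "(%z. (?I i z, g z)) : ?H ->M borel >< (Hist >< Hist)" by measurable
  have "?A (%z. ?I i z * ?C z) = ?A (%z. ?I i z * f (g z, noise_at (h k) (4 * k) i z))"
   by (intro nn_integral_cong) (auto simp: indicator_def noise_def g(2))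
  also have "... = ?A (%z. nn_integral (step_noise (h k)) (%y. ?I i z * f (g z, y)))"
   using past_future_nn_integral[OF h_pos gI, of "%p. fst (fst p) * f (snd (fst p), snd p)"] by simp
  also have "... = ?A (%z. ?I i z * ?B z)"
   by (intro nn_integral_cong) (auto simp: indicator_def g(2))
  finally show "?A (%z. ?I i z * ?C z) = ?A (%z. ?I i z * ?B z)" .
 qed
 also have "... = ?A (%z. ?B z)"
  by (rule split[symmetric]) measurable
 finally show ?thesis .
qed

lemma distr_past_noise:
 "distr M ((Hist >< Hist) >< Noise) (%z. (past k z, noise k z)) = distr M (Hist >< Hist) (past k) >< step_noise (h k)"
proof (rule measure_eqI)
 let ?A = "distr M ((Hist >< Hist) >< Noise) (%z. (past k z, noise k z))"
 let ?B = "distr M (Hist >< Hist) (past k) >< step_noise (h k)"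
 interpret Y: prob_space "step_noise (h k)" by (rule prob_space_step_noise[OF h_pos])
 show "sets ?A = sets ?B"
  by simp
 fix A assume "A : sets ?A"
 then have A [measurable]: "A : sets ((Hist >< Hist) >< Noise)" by simp
 have "emeasure ?A A = nn_integral ?A (%p. indicator A p)"
  by simp
 also have "... = nn_integral M (%z. indicator A (past k z, noise k z))" by (rule nn_integral_distr) measurable
 also have "... = nn_integral M (%z. nn_integral (step_noise (h k)) (%y. indicator A (past k z, y)))"
  by (rule past_noise_nn_integral) measurable
 also have "... = nn_integral (distr M (Hist >< Hist) (past k)) (%x. nn_integral (step_noise (h k)) (%y. indicator A (x, y)))"
  by (subst nn_integral_distr) auto
 also have "... = emeasure ?B A"
  by (subst Y.emeasure_pair_measure) auto
 finally show "emeasure ?A A = emeasure ?B A" .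
qed

lemma W_step:
 assumes "z : space M"
 shows "W (real (pos (Suc k) z) * h (Suc k)) z - W (real (pos k z) * h k) z = step.step_gain k (hist k z) (noise k z)"
proof -
 let ?j = "step.step_count k (hist k z) (noise k z)" and ?i = "pos k z"
 have t: "real (pos (Suc k) z) * h (Suc k) = real (?i + ?j) * h k" by (simp add: pos_Suc refine[of k])
 have "step.step_gain k (hist k z) (noise k z) = (\<Sum>l<?j. incr (h k) (?i + l) z)"
  by (simp add: noise_def noise_at_def exit_pos_def)
 also have "... = (\<Sum>l<?j. W (real (?i + Suc l) * h k) z - W (real (?i + l) * h k) z)" by (simp add: incr_def)
 also have "... = W (real (?i + ?j) * h k) z - W (real ?i * h k) z" by (subst sum_lessThan_telescope) auto
 finally show ?thesis unfolding t by simp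
qed

lemma time_step: "real (pos (Suc k) z) * h (Suc k) = real (pos k z) * h k + h k * real (step.step_count k (hist k z) (noise k z))"
 by (simp add: pos_Suc refine[of k] algebra_simps)

end

section \<open>Existence and oscillation of Brownian motion\<close>

lemma gauss_1: "gauss 1 = density lborel (%x. ennreal (std_normal_density x))" by (simp add: gauss_def)

lemma real_distribution_gauss: "v > 0 ==> real_distribution (gauss v)"
 by (simp add: real_distribution_def real_distribution_axioms_def prob_space_gauss)

text \<open>For \<open>x >= l >= 0\<close> one has \<open>x^2 >= l^2 + (x - l)^2\<close>, so the
  density is at most \<open>exp (- l^2 / (2 * v))\<close> times the normal density centred at
  \<open>l\<close>. The other tail is symmetric.\<close>

lemma gauss_tail:
 assumes v: "v > 0" and l: "l >= 0" shows "measure (gauss v) {x. l <= abs x} <= 2 * exp (- l\<^sup>2 / (2 * v))"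
proof -
 let ?A = "exp (- l\<^sup>2 / (2 * v))"
 let ?B = "%x. ennreal (normal_density l (sqrt v) x)"
 let ?C = "measure (gauss v)"
 let ?D = "emeasure (gauss v)"
 let ?E = "nn_integral lborel"
 let ?F = "normal_density 0 (sqrt v)"
 interpret prob_space "gauss v" by (rule prob_space_gauss[OF v])
 have 1: "?D {l..} <= ennreal (?A)"
 proof -
  have "?D {l..} = ?E (%x. ennreal (?F x) * indicator {l..} x)"
   unfolding gauss_def by (subst emeasure_density) auto
  also have "... <= ?E (%x. ennreal (?A) * ?B x)"
  proof (intro nn_integral_mono)
   fix x
   show "ennreal (?F x) * indicator {l..} x <= ennreal (?A) * ?B x"
   proof (cases "x >= l")
    case True
    have "l * l <= l * x" using True l by (intro mult_left_mono) auto
    then have "- x\<^sup>2 <= - l\<^sup>2 + - (x - l)\<^sup>2" by (simp add: power2_eq_square algebra_simps)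
    then have "- x\<^sup>2 / (2 * v) <= (- l\<^sup>2 + - (x - l)\<^sup>2) / (2 * v)"
     using v by (intro divide_right_mono) auto
    then have "- x\<^sup>2 / (2 * v) <= - l\<^sup>2 / (2 * v) + - (x - l)\<^sup>2 / (2 * v)"
     by (simp only: add_divide_distrib)
    then have "exp (- x\<^sup>2 / (2 * v)) <= ?A * exp (- (x - l)\<^sup>2 / (2 * v))"
     unfolding exp_add[symmetric] by simp
    then have "?F x <= ?A * normal_density l (sqrt v) x"
     using v by (simp add: normal_density_def divide_right_mono)
    then show ?thesis using True by (simp add: ennreal_mult'[symmetric] ennreal_leI)
   qed auto
  qed
  also have "... = ennreal (?A) * ?E (%x. ?B x)"
   by (rule nn_integral_cmult) auto
  also have "?E (%x. ?B x) = 1"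
   using v by (subst nn_integral_eq_integral) auto
  finally show ?thesis by simp
 qed
 have 2: "?D {..-l} = ?D {l..}"
  by (subst gauss_uminus[OF v, symmetric], subst emeasure_distr) (auto simp: vimage_def intro!: arg_cong2[where f=emeasure])
 have m1: "?C {l..} <= ?A" using 1 by (simp add: emeasure_eq_measure)
 have "?C {x. l <= abs x} <= ?C ({l..} \<union> {..-l})"
  by (intro finite_measure_mono) auto
 also have "... <= ?C {l..} + ?C {..-l}" by (intro measure_Un_le) auto
 also have "?C {..-l} = ?C {l..}" using 2 by (simp add: measure_def)
 finally show ?thesis using m1 by simp
qed

section \<open>Rotation invariance and the midpoint step\<close>

lemma std_normal_density_rotate:
 "std_normal_density ((u + w) / sqrt 2) * std_normal_density ((u - w) / sqrt 2) = std_normal_density u * std_normal_density w"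
proof -
 have "- ((u + w) / sqrt 2)\<^sup>2 / 2 + - ((u - w) / sqrt 2)\<^sup>2 / 2 = - u\<^sup>2 / 2 + - w\<^sup>2 / 2"
  by (simp add: power_divide power2_sum power2_diff field_simps)
 then have "exp (- ((u + w) / sqrt 2)\<^sup>2 / 2) * exp (- ((u - w) / sqrt 2)\<^sup>2 / 2)
   = exp (- u\<^sup>2 / 2) * exp (- w\<^sup>2 / 2)"
  unfolding exp_add[symmetric] by simp
 then show ?thesis by (simp add: std_normal_density_def)
qed

text \<open>The orthogonal change of variables is carried out as two affine substitutions in one
  variable with an exchange of the integrals in between. The factors \<open>sqrt 2\<close> and
  \<open>1 / sqrt 2\<close> cancel, and the product density is invariant.\<close>

lemma nn_integral_gauss_rotate:
 assumes [measurable]: "(%(x, y). f x y) : borel_measurable (borel >< borel)"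
 shows "nn_integral (gauss 1) (%s. nn_integral (gauss 1) (%t. f ((s + t) / sqrt 2) ((s - t) / sqrt 2)))
   = nn_integral (gauss 1) (%s. nn_integral (gauss 1) (%t. f s t))"
proof -
 let ?n = "%x. ennreal (std_normal_density x)"
 let ?A = "nn_integral lborel"
 let ?B = "%u. ?A (%t. ?n (sqrt 2 * u - t) * (?n t * f u (u - sqrt 2 * t)))"
 let ?C = "nn_integral (gauss 1)"
 let ?D = "%t. ?A (%u. ?n (sqrt 2 * u - t) * (?n t * f u (u - sqrt 2 * t)))"
 let ?E = "%s t. f ((s + t) / sqrt 2) ((s - t) / sqrt 2)"
 let ?F = "%u. ?A (%w. ?n u * (?n w * f u w))"
 let ?G = "ennreal (sqrt 2)"
 let ?H = "%u. ?A (%w. ?n ((u + w) / sqrt 2) * (?n ((u - w) / sqrt 2) * f u w))"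
 let ?I = "ennreal (abs(- 1 / sqrt 2))"
 have n [measurable]: "std_normal_density : borel_measurable borel" by simp
 have G: "?C (%s. ?C (%t. F s t)) = ?A (%s. ?A (%t. ?n s * (?n t * F s t)))"
  if [measurable]: "(%(x, y). F x y) : borel_measurable (borel >< borel)" for F
 proof -
  have "?C (%s. ?C (%t. F s t)) = ?C (%s. ?A (%t. ?n t * F s t))"
   by (simp add: nn_integral_gauss)
  also have "... = ?A (%s. ?n s * ?A (%t. ?n t * F s t))"
   by (subst nn_integral_gauss) auto
  finally show ?thesis by (simp add: nn_integral_cmult)
 qed
 have "?C (%s. ?C (%t. ?E s t)) = ?A (%s. ?A (%t. ?n s * (?n t * ?E s t)))"
  by (rule G) measurable
 also have "... = ?A (%t. ?A (%s. ?n s * (?n t * ?E s t)))"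
  by (rule lborel_pair.Fubini') measurable
 also have "... = ?A (%t. ?G * ?D t)"
 proof (intro nn_integral_cong)
  fix t :: real
  have e: "(- t + sqrt 2 * u + t) / sqrt 2 = u" "(- t + sqrt 2 * u - t) / sqrt 2 = u - sqrt 2 * t" for u
   by (simp_all add: field_simps)
  show "?A (%s. ?n s * (?n t * ?E s t)) = ?G * ?D t"
   by (subst nn_integral_real_affine[where c="sqrt 2" and t="- t"]) (auto simp only: e, auto)
 qed
 also have "... = ?G * ?A (%t. ?D t)"
  by (rule nn_integral_cmult) measurable
 also have "... = ?G * ?A (%u. ?B u)"
  by (intro arg_cong2[where f="(*)"] refl lborel_pair.Fubini') measurable
 also have "... = ?A (%u. ?F u)"
 proof -
  have "?G * ?B u = ?F u" for u
  proof -
   have e: "sqrt 2 * u - (u - w) / sqrt 2 = (u + w) / sqrt 2"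
    "u / sqrt 2 + (- 1 / sqrt 2) * w = (u - w) / sqrt 2" "u - sqrt 2 * ((u - w) / sqrt 2) = w" for w
    by (simp_all add: field_simps)
   have "?B u = ?I * ?H u"
    by (subst nn_integral_real_affine[where c="- 1 / sqrt 2" and t="u / sqrt 2"]) (auto simp only: e, auto)
   also have "?H u = ?F u"
    by (intro nn_integral_cong) (simp only: mult.assoc[symmetric] ennreal_mult'[symmetric] normal_density_nonneg
      std_normal_density_rotate)
   finally have *: "?B u = ?I * ?F u" .
   have "?G * ?I = 1" by (simp flip: ennreal_mult)
   then show ?thesis unfolding * by (simp add: mult.assoc[symmetric])
  qed
  then show ?thesis by (subst nn_integral_cmult[symmetric]) auto
 qed
 also have "... = ?C (%s. ?C (%t. f s t))" by (rule G[symmetric]) measurable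
 finally show ?thesis .
qed

text \<open>Levy's midpoint construction in unit scale: the increment \<open>x\<close> over a cell
  and a fresh normal variable \<open>z\<close> yield the increments over the two halves, rescaled to
  variance 1.\<close>

definition interleave :: "(nat => real) => (nat => real) => nat => real" where
 "interleave x z j = (if even j then (x (j div 2) + z (j div 2)) / sqrt 2 else (x (j div 2) - z (j div 2)) / sqrt 2)"

lemma measurable_interleave [measurable (raw)]:
 assumes [measurable]: "X : N ->M Hist" "Z : N ->M Hist" shows "(%w. interleave (X w) (Z w)) : N ->M Hist"
 by (rule measurable_PiM_single') (auto simp: interleave_def)

lemma measurable_interleave_component [measurable (raw)]:
 assumes [measurable]: "X : N ->M Hist" "Z : N ->M Hist" shows "(%w. interleave (X w) (Z w) j) : borel_measurable N"
 unfolding interleave_def by measurable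

text \<open>The coordinates 0 and 1 involve only the first entries of the two sequences. There the
  rotation applies, and the remaining coordinates form the same problem again.\<close>

lemma emeasure_interleave_box:
 assumes "!!j. E j : sets borel"
 shows "nn_integral (gauss_seq 1) (%x. nn_integral (gauss_seq 1) (%z. (\<Prod>j<2*n. indicator (E j) (interleave x z j))))
   = (\<Prod>j<2*n. emeasure (gauss 1) (E j))"
 using assms
proof (induction n arbitrary: E)
 case 0
 interpret S: prob_space "gauss_seq 1" by (rule prob_space_gauss_seq) simp
 show ?case by (simp add: S.emeasure_space_1[simplified])
next
 let ?A = "nn_integral (gauss_seq 1)"
 let ?B = "%E s. nn_integral (gauss 1) (%t. indicator (E 0) ((s + t) / sqrt 2) * indicator (E 1) ((s - t) / sqrt 2))"
 let ?C = "nn_integral (gauss 1)"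
 let ?D = "emeasure (gauss 1)"
 let ?E = "%s x t z. interleave (case_nat s x) (case_nat t z)"
 case (Suc n)
 interpret S: prob_space "gauss_seq 1" by (rule prob_space_gauss_seq) simp
 note [measurable] = Suc.prems
 let ?P = "%x z. \<Prod>j<2*n. indicator (E (Suc (Suc j))) (interleave x z j) :: ennreal"
 have P [measurable]: "(%(x, z). ?P x z) : borel_measurable (Hist >< Hist)" by measurable
 have prod: "(\<Prod>j<2*Suc n. indicator (E j) (?E s x t z j)) = indicator (E 0) ((s
   + t) / sqrt 2) * indicator (E 1) ((s - t) / sqrt 2) * ?P x z" for s t x z
 proof -
  have "?E s x t z (Suc (Suc j)) = interleave x z j" for j by (simp add: interleave_def)
  moreover have "2 * Suc n = Suc (Suc (2 * n))" by simp
  ultimately show ?thesis by (simp only: prod.lessThan_Suc_shift) (simp add: interleave_def mult.assoc)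
 qed
 have "?A (%x. ?A (%z. (\<Prod>j<2*Suc n. indicator (E j) (interleave x z j)))) = ?C (%s. ?A (%x. ?C (%t. ?A (%z.
   (\<Prod>j<2*Suc n. indicator (E j) (?E s x t z j))))))"
 proof -
  let ?Q = "%x z. \<Prod>j<2*Suc n. indicator (E j) (interleave x z j) :: ennreal"
  have Q [measurable]: "(%(x, z). ?Q x z) : borel_measurable (Hist >< Hist)" by measurable
  have Q1: "(%x. ?A (%z. ?Q x z)) : borel_measurable Hist" by measurable
  have Q2: "?Q x : borel_measurable Hist" for x by measurable
  show ?thesis unfolding nn_integral_gauss_seq_Suc[OF zero_less_one Q1]
   by (intro nn_integral_cong nn_integral_gauss_seq_Suc[OF zero_less_one Q2])
 qed
 also have "... = ?C (%s. ?A (%x. ?C (%t. ?A (%z. indicator (E 0) ((s + t) / sqrt 2) * indicator (E 1) ((s - t) / sqrt 2) * ?P x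
   z))))"
  by (simp only: prod)
 also have "... = ?C (%s. ?A (%x. ?B E s * ?A (%z. ?P x z)))"
  by (simp add: nn_integral_cmult nn_integral_multc)
 also have "... = ?C (%s. ?B E s) * ?A (%x. ?A (%z. ?P x z))"
 proof -
  have PP: "(%x. ?A (%z. ?P x z)) : borel_measurable (gauss_seq 1)" by measurable
  interpret N: prob_space "gauss 1" by (rule prob_space_gauss) simp
  have c: "(%s. ?B E s :: ennreal) : borel_measurable (gauss 1)"
   by measurable
  show ?thesis unfolding nn_integral_cmult[OF PP] by (rule nn_integral_multc[OF c])
 qed
 also have "?C (%s. ?B E s) = (?C (%s. ?C (%t. indicator (E 0) s * indicator (E 1) t)) :: ennreal)"
  by (rule nn_integral_gauss_rotate) measurable
 also have "... = ?D (E 0) * ?D (E 1)"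
  by (simp add: nn_integral_cmult nn_integral_multc)
 also have "?A (%x. ?A (%z. ?P x z)) = (\<Prod>j<2*n. ?D (E (Suc (Suc j))))"
  by (rule Suc.IH) (rule Suc.prems)
 also have "?D (E 0) * ?D (E 1) * ... = (\<Prod>j<2*Suc n. ?D (E j))"
 proof -
  have "2 * Suc n = Suc (Suc (2 * n))" by simp
  then show ?thesis by (simp only: prod.lessThan_Suc_shift) (simp add: mult.assoc)
 qed
 finally show ?case .
qed

lemma distr_interleave:
 "distr (gauss_seq 1 >< gauss_seq 1) Hist (%(x, z). interleave x z) = gauss_seq 1"
proof -
 let ?A = "%interleave. distr (gauss_seq 1 >< gauss_seq 1) Hist (%(x, z). interleave x z)"
 let ?B = "%n E. {x. ALL j<2*n. x j : E j}"
 let ?C = "nn_integral (gauss_seq 1)"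
 let ?D = "emeasure (gauss 1)"
 interpret G: product_prob_space "%_::nat. gauss 1" UNIV
  using sequence_space_gauss[of 1] by (simp add: sequence_space_def)
 interpret S: prob_space "gauss_seq 1" by (rule prob_space_gauss_seq) simp
 show ?thesis unfolding gauss_seq_def[of 1, symmetric]
 proof (subst gauss_seq_def, rule G.PiM_eq)
  show "sets (?A interleave) = sets (\<Pi>\<^sub>M i\<in>UNIV. gauss 1)"
   by (simp add: gauss_seq_def[symmetric])
  fix J :: "nat set" and F assume J: "finite J" "J \<subseteq> UNIV" and F: "!!j. j : J ==> F j : sets (gauss 1)"
  define E where "E j = (if j : J then F j else UNIV)" for j
  have E [measurable]: "E j : sets borel" for j using F by (auto simp: E_def)
  obtain n where n: "!!j. j : J ==> j < 2 * n"
  proof -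
   obtain m where "J \<subseteq> {..<m}" using finite_nat_bounded[OF J(1)] by blast
   then show ?thesis by (intro that[of m]) force
  qed
  have box: "prod_emb UNIV (%_. gauss 1) J (\<Pi>\<^sub>E j\<in>J. F j) = (?B n E)"
   using n by (force simp: prod_emb_def E_def PiE_iff split: if_splits)
  have B: "(?B n E) : sets Hist"
  proof -
   have "{x : space Hist. ALL j<2*n. x j : E j} : sets Hist" by measurable
   then show ?thesis by simp
  qed
  have "emeasure (?A interleave) (?B n E) = nn_integral (?A interleave) (%p. indicator (?B n E) p)"
   using B by simp
  also have "... = nn_integral (gauss_seq 1 >< gauss_seq 1) (%p. indicator (?B n E) (case p of (x, z) => interleave x z))"
   using B by (subst nn_integral_distr) auto
  also have "... = ?C (%x. ?C (%z. indicator (?B n E) (interleave x z)))"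
   using B by (subst S.nn_integral_fst[symmetric]) auto
  also have "... = ?C (%x. ?C (%z. (\<Prod>j<2*n. indicator (E j) (interleave x z j))))"
   by (intro nn_integral_cong) (auto simp: indicator_def prod_zero_iff not_less)
  also have "... = (\<Prod>j<2*n. ?D (E j))" by (rule emeasure_interleave_box[OF E])
  also have "... = (\<Prod>j\<in>J. ?D (F j))"
  proof (rule prod.mono_neutral_cong_right)
   show "ALL i:{..<2*n} - J. ?D (E i) = 1" using G.M.emeasure_space_1 by (auto simp: E_def)
  qed (use n in \<open>auto simp: E_def\<close>)
  finally show "emeasure (?A interleave) (prod_emb UNIV (%_. gauss 1) J (\<Pi>\<^sub>E j\<in>J. F j)) = (\<Prod>j\<in>J.
    ?D (F j))"
   unfolding box .
 qed
qed

section \<open>Dyadic paths and their continuous limit\<close>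

definition dyadic_path :: "(nat => nat => real) => nat => real => real" where
 "dyadic_path a m t = (\<Sum>i<nat (floor(t * 2 ^ m)). a m i)"

text \<open>The rate \<open>9/10\<close> lies between \<open>1 / sqrt 2\<close>, the factor by which
  the standard deviation shrinks from level to level, and 1: large enough to be exceeded only
  finitely often, small enough to be summable.\<close>

definition dyadic_small :: "(nat => nat => real) => bool" where
 "dyadic_small a \<longleftrightarrow> (ALL N. EX m0. ALL m>=m0. ALL i<N * 2 ^ m. abs(a m i) <= (9/10) ^ m)"

lemma floor_double:
 fixes t :: real assumes "t >= 0"
 shows "nat (floor(t * 2 ^ Suc m)) = 2 * nat (floor(t * 2 ^ m)) | nat (floor(t * 2 ^ Suc m)) = Suc (2 * nat (floor(t * 2 ^ m)))"
proof -
 define x where "x = t * 2 ^ m"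
 have x: "x >= 0" using assms by (simp add: x_def)
 have e: "t * 2 ^ Suc m = 2 * x" by (simp add: x_def)
 have "floor(2 * x) = 2 * floor x | floor(2 * x) = 2 * floor x + 1" by linarith
 moreover have "floor x >= 0" using x by simp
 ultimately show ?thesis unfolding e x_def[symmetric] by (auto simp: nat_mult_distrib nat_add_distrib)
qed

context
 fixes a :: "nat => nat => real"
 assumes refine: "!!m i. a m i = a (Suc m) (2 * i) + a (Suc m) (Suc (2 * i))"
begin

lemma sum_dyadic_refine: "(\<Sum>i<2 * k. a (Suc m) i) = (\<Sum>i<k. a m i)"
 by (induction k) (auto simp: refine[of m])

lemma dyadic_path_Suc:
 assumes "t >= 0"
 shows "dyadic_path a (Suc m) t = dyadic_path a m t | dyadic_path a (Suc m) t = dyadic_path a m t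
   + a (Suc m) (2 * nat (floor(t * 2 ^ m)))"
 using floor_double[OF assms, of m] by (auto simp: dyadic_path_def sum_dyadic_refine simp del: power_Suc)

lemma dyadic_path_grid: "m <= n ==> dyadic_path a n (real k / 2 ^ m) = (\<Sum>i<k. a m i)"
proof (induction n rule: dec_induct)
 case base
 then show ?case by (simp add: dyadic_path_def)
next
 case (step n)
 have p: "(2::real) ^ n = 2 ^ m * 2 ^ (n - m)" using step.hyps by (simp add: power_add[symmetric])
 have "real k / 2 ^ m * 2 ^ n = real (k * 2 ^ (n - m))" by (simp add: p)
 then have 1: "nat (floor(real k / 2 ^ m * 2 ^ n)) = k * 2 ^ (n - m)" by (metis floor_of_nat nat_int)
 have "real k / 2 ^ m * 2 ^ Suc n = real (2 * (k * 2 ^ (n - m)))" by (simp add: p)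
 then have 2: "nat (floor(real k / 2 ^ m * 2 ^ Suc n)) = 2 * (k * 2 ^ (n - m))" by (metis floor_of_nat nat_int)
 show ?case using step.IH unfolding dyadic_path_def 1 2 sum_dyadic_refine .
qed

context
 assumes small: "dyadic_small a"
begin

text \<open>Passing to the next level adds at most one increment, and the geometric series with
  ratio \<open>9/10\<close> contributes the factor 10.\<close>

lemma dyadic_path_cauchy:
 obtains m0 where "!!m n t. m0 <= m ==> m <= n ==> 0 <= t ==> t < real N ==> abs(dyadic_path a n t - dyadic_path a m t)
   <= 10 * (9/10) ^ m"
  "!!m i. m0 <= m ==> i < N * 2 ^ m ==> abs(a m i) <= (9/10) ^ m"
proof -
 let ?A = "%t n. nat (floor(t * 2 ^ n))"
 obtain m0 where m0: "!!m i. m0 <= m ==> i < N * 2 ^ m ==> abs(a m i) <= (9/10) ^ m"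
  using small unfolding dyadic_small_def by blast
 \<comment> \<open>The difference of two powers, instead of the first alone, lets the induction on
   \<open>n\<close> close.\<close>
 have "abs(dyadic_path a n t - dyadic_path a m t) <= 10 * ((9/10) ^ m - (9/10) ^ n)"
  if "m0 <= m" "m <= n" "0 <= t" "t < real N" for m n t using that(2)
 proof (induction n rule: dec_induct)
  case (step n)
  have "2 * ?A t n < N * 2 ^ Suc n"
  proof -
   have "real (?A t n) <= t * 2 ^ n" using that by simp
   also have "... < real N * 2 ^ n" using that by simp
   finally have "real (?A t n) < real (N * 2 ^ n)" by simp
   then show ?thesis by (simp only: of_nat_less_iff) simp
  qed
  then have "abs(a (Suc n) (2 * ?A t n)) <= (9/10) ^ Suc n" using that step.hyps by (intro m0) auto
  then have "abs(dyadic_path a (Suc n) t - dyadic_path a n t) <= (9/10) ^ Suc n"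
   using dyadic_path_Suc[OF that(3), of n] by auto
  moreover have "(9/10 :: real) ^ Suc n <= 10 * ((9/10) ^ n - (9/10) ^ Suc n)" by simp
  moreover have "abs(X - Y) <= C ==> C <= 10 * (B - C) ==> abs(Y - Z) <= 10 * (A - B) ==> abs(X - Z) <= 10 * (A - C)"
    for X Y Z A B C :: real
   by (smt (verit))
  ultimately show ?case using step.IH by blast
 qed simp
 moreover have "10 * ((9/10) ^ m - (9/10) ^ n) <= 10 * (9/10 :: real) ^ m" for m n :: nat by simp
 ultimately show ?thesis using m0 that by (meson order_trans)
qed

lemma dyadic_path_converges:
 assumes "t >= 0" shows "(%m. dyadic_path a m t) ----> lim (%m. dyadic_path a m t)"
proof -
 let ?A = "%n. dyadic_path a n t"
 obtain N :: nat where N: "t < real N" using reals_Archimedean2 by blast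
 obtain m0 where m0: "!!m n. m0 <= m ==> m <= n ==> abs(?A n - ?A m) <= 10 * (9/10) ^ m"
  using dyadic_path_cauchy[of N] assms N by metis
 have "Cauchy (%m. ?A m)"
 proof (rule CauchyI')
  fix e :: real assume "e > 0"
  then obtain M where "(9/10 :: real) ^ M < e / 10" using real_arch_pow_inv[of "e/10" "9/10"] by auto
  then have M: "10 * (9/10 :: real) ^ M < e" by simp
  show "EX M. ALL m>=M. ALL n>m. dist (?A m) (?A n) < e"
  proof (intro exI[of _ "max M m0"] allI impI)
   fix m n assume "max M m0 <= m" "m < n"
   then have "abs(?A n - ?A m) <= 10 * (9/10) ^ m" by (intro m0) auto
   also have "... <= 10 * (9/10) ^ M"
    using \<open>max M m0 \<le> m\<close> by (intro mult_left_mono power_decreasing) auto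
   finally show "dist (?A m) (?A n) < e" using M by (simp add: dist_real_def abs_minus_commute)
  qed
 qed
 then show ?thesis using convergent_LIMSEQ_iff Cauchy_convergent_iff by blast
qed

lemma continuous_on_dyadic_lim: "continuous_on {0..} (%t. lim (%m. dyadic_path a m t))"
proof -
 let ?L = "%t. lim (%m. dyadic_path a m t)"
 let ?A = "dyadic_path a"
 let ?B = "%s m. floor(s * 2 ^ m)"
 show ?thesis
 proof (rule continuous_onI)
  fix x e :: real assume x: "x : {0..}" and e: "e > 0"
  obtain N :: nat where N: "x + 1 < real N" using reals_Archimedean2 by blast
  obtain m0 where m0: "!!m n t. m0 <= m ==> m <= n ==> 0 <= t ==> t < real N ==> abs(?A n t - ?A m t)
    <= 10 * (9/10) ^ m" and m0': "!!m i. m0 <= m ==> i < N * 2 ^ m ==> abs(a m i) <= (9/10) ^ m"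
   using dyadic_path_cauchy[of N] by blast
  \<comment> \<open>21 is 10 + 10 + 1: two distances between the limit and level \<open>m\<close>,
    and one increment of level \<open>m\<close> between neighbouring points.\<close>
  obtain M where "(9/10 :: real) ^ M < e / 21" using e real_arch_pow_inv[of "e/21" "9/10"] by auto
  then have M: "21 * (9/10 :: real) ^ M < e" by simp
  define m where "m = max M m0"
  have m: "m0 <= m" "21 * (9/10 :: real) ^ m < e"
  proof -
   have "(9/10 :: real) ^ m <= (9/10) ^ M" by (rule power_decreasing) (auto simp: m_def)
   then show "21 * (9/10 :: real) ^ m < e" using M by linarith
  qed (simp add: m_def)
  have L: "abs(?L t - ?A m t) <= 10 * (9/10) ^ m" if "0 <= t" "t < real N" for t
  proof -
   have "(%n. abs(?A n t - ?A m t)) ----> abs(?L t - ?A m t)"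
    by (intro tendsto_intros dyadic_path_converges that)
   then show ?thesis by (rule LIMSEQ_le_const2) (use m0 m that in blast)
  qed
  have near: "abs(?A m t - ?A m s) <= (9/10) ^ m"
   if "0 <= s" "s <= t" "t < real N" "t - s <= 1 / 2 ^ m" for s t
  proof -
   define i j where "i = nat (?B s m)" and "j = nat (?B t m)"
   have "s * 2 ^ m <= t * 2 ^ m" using that by simp
   moreover have "t * 2 ^ m <= s * 2 ^ m + 1" using that by (simp add: field_simps)
   ultimately have "?B t m = ?B s m | ?B t m = ?B s m + 1" by linarith
   moreover have "?B s m >= 0" using that by simp
   ultimately have ij: "j = i | j = Suc i" by (auto simp: i_def j_def nat_add_distrib)
   have "real i <= s * 2 ^ m" using that by (simp add: i_def)
   also have "... < real N * 2 ^ m" using that by simp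
   finally have "real i < real (N * 2 ^ m)" by simp
   then have "i < N * 2 ^ m" by (simp only: of_nat_less_iff)
   from m0'[OF m(1) this] ij show ?thesis by (auto simp: dyadic_path_def i_def[symmetric] j_def[symmetric])
  qed
  have close: "abs(?L t - ?L s) < e" if "0 <= s" "s <= t" "t < real N" "t - s <= 1 / 2 ^ m" for s t
   using near[OF that] L[of s] L[of t] that m by linarith
  show "EX d>0. ALL x':{0..}. dist x' x < d --> dist (?L x') (?L x) <= e"
  proof (intro exI[of _ "1 / 2 ^ m"] conjI ballI impI)
   fix y :: real assume y: "y : {0..}" "dist y x < 1 / 2 ^ m"
   have 1: "1 / 2 ^ m <= (1::real)" by (simp add: divide_le_eq_1)
   have "dist y x < 1" using less_le_trans[OF y(2) 1] .
   then have "y < real N" "x < real N" using N by (auto simp: dist_real_def abs_less_iff)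
   then show "dist (?L y) (?L x) <= e"
    using close[of x y] close[of y x] x y by (cases "x <= y") (auto simp: dist_real_def abs_minus_commute)
  qed simp
 qed
qed

end

end

text \<open>The probability space of the final coupling: one sequence of independent uniform
  variables, on the type over which the statement quantifies.\<close>

definition seed :: "(nat => real) measure" where "seed = (\<Pi>\<^sub>M i\<in>UNIV. U01)"

lemma sets_seed [measurable_cong, simp]: "sets seed = sets Hist" unfolding seed_def by (intro sets_PiM_cong) auto

lemma space_seed [simp]: "space seed = UNIV" by (simp add: seed_def space_PiM)

interpretation seed: prob_space seed unfolding seed_def by (intro prob_space_PiM prob_space_U01)

lemma distr_seed_component: "distr seed borel (%z. z c) = U01"
proof -
 interpret product_prob_space "%_::nat. U01" UNIV
  by (simp add: product_prob_space_def product_prob_space_axioms_def prob_space_U01 product_sigma_finite_def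
    prob_space_imp_sigma_finite)
 show ?thesis using PiM_component[of c] by (simp add: seed_def cong: distr_cong)
qed

lemma indep_seed: "seed.indep_vars (%_. borel) (%c z. z c) UNIV" by (subst seed.indep_vars_iff_distr_eq_PiM)
   (auto simp: distr_seed_component restrict_UNIV distr_id2 seed_def[symmetric])

definition seed_blk :: "nat set => (nat => real) measure" where
 "seed_blk C = sigma (space seed) (\<Union>c\<in>C. {(%z. z c) -` S \<inter> space seed | S. S : sets borel})"

lemma space_seed_blk [simp]: "space (seed_blk C) = UNIV" unfolding seed_blk_def by (subst space_measure_of) auto

lemma measurable_seed_blk: "c : C ==> (%z. z c) : borel_measurable (seed_blk C)"
 by (rule measurableI) (auto simp: seed_blk_def sets_measure_of)

lemma sets_seed_blk: "sets (seed_blk C) \<subseteq> sets seed" unfolding seed_blk_def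
proof (subst sets_measure_of)
 have "(%z. z c) -` S \<inter> space seed : sets seed" if "S : sets borel" for c :: nat and S :: "real set"
  by (rule measurable_sets[OF _ that]) simp
 then show "sigma_sets (space seed) (\<Union>c\<in>C. {(%z. z c) -` S \<inter> space seed |S. S
   : sets borel}) \<subseteq> sets seed"
  by (intro sets.sigma_sets_subset) auto
qed auto

lemma measurable_seed_blkD: "f : seed_blk C ->M N ==> f : seed ->M N"
 using sets_seed_blk[of C] by (auto simp: measurable_def)

lemma distr_seed_blocks:
 assumes "A \<inter> B = {}" "f : seed_blk A ->M N1" "g : seed_blk B ->M N2"
 shows "distr seed N1 f >< distr seed N2 g = distr seed (N1 >< N2) (%z. (f z, g z))"
 using seed.distr_pair_disjoint_blocks[OF indep_seed assms(1)] assms(2,3) unfolding seed_blk_def by blast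

text \<open>Even coordinates of the seed feed the midpoint construction of the Brownian motion; odd ones are
 left as independent uniform variables.\<close>

definition layer :: "nat => (nat => real) => nat => real" where
 "layer m z i = quantile (cdf (gauss 1)) (z (2 * prod_encode (m, i)))"

text \<open>Scaling the increments of every level to variance 1 gives all levels the same law
  \<open>gauss_seq 1\<close>; \<open>dyadic_incr\<close> restores their size.\<close>

primrec unit_incr :: "nat => (nat => real) => nat => real" where
 "unit_incr 0 z = layer 0 z"
| "unit_incr (Suc m) z = interleave (unit_incr m z) (layer (Suc m) z)"

definition dyadic_incr :: "(nat => real) => nat => nat => real" where
 "dyadic_incr z m i = unit_incr m z i / sqrt (2 ^ m)"

definition layers_upto :: "nat => nat set" where "layers_upto m = {2 * prod_encode (l, i) | l i. l <= m}"

lemma measurable_layer: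
 assumes "!!i. 2 * prod_encode (m, i) : C" shows "layer m : seed_blk C ->M Hist"
proof (rule measurable_PiM_single')
 fix i
 show "(%z. layer m z i) : borel_measurable (seed_blk C)" unfolding layer_def
  by (rule measurable_compose[OF measurable_seed_blk[OF assms]])
    (intro measurable_quantile_const real_distribution_gauss, simp)
qed auto

lemma measurable_unit_incr:
 assumes "layers_upto m \<subseteq> C" shows "unit_incr m : seed_blk C ->M Hist" using assms
proof (induction m)
 case 0
 have "layer 0 : seed_blk C ->M Hist" using 0 by (intro measurable_layer) (auto simp: layers_upto_def)
 then show ?case by (simp cong: measurable_cong)
next
 case (Suc m)
 have [measurable]: "unit_incr m : seed_blk C ->M Hist"
  using Suc.prems by (intro Suc.IH) (force simp: layers_upto_def)
 have [measurable]: "layer (Suc m) : seed_blk C ->M Hist"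
  using Suc.prems by (intro measurable_layer) (force simp: layers_upto_def)
 have "(%z. interleave (unit_incr m z) (layer (Suc m) z)) : seed_blk C ->M Hist" by measurable
 then show ?case by (simp cong: measurable_cong)
qed

lemma distr_layer: "distr seed Hist (layer m) = gauss_seq 1"
proof -
 have "seed.indep_vars (%_. borel) (%i z. z (2 * prod_encode (m, i))) UNIV"
  using seed.indep_vars_reindex_inj[OF indep_seed, of "%i. 2 * prod_encode (m, i)"] by (simp add: inj_def)
 then have ind: "seed.indep_vars (%_. borel) (%i z. layer m z i) UNIV" unfolding layer_def
  by (rule seed.indep_vars_compose2[of _ _ _ "%_. quantile (cdf (gauss 1))"])
    (intro measurable_quantile_const real_distribution_gauss, simp)
 have [measurable]: "(%z. layer m z i) : borel_measurable seed" for i using ind unfolding seed.indep_vars_def2 by auto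
 have "distr seed borel (%z. layer m z i) = gauss 1" for i
 proof -
  have "distr seed borel (%z. layer m z i) = distr (distr seed borel (%z. z (2 * prod_encode (m,
    i)))) borel (quantile (cdf (gauss 1)))"
   by (subst distr_distr) (auto simp: comp_def layer_def intro!: measurable_quantile_const real_distribution_gauss)
  then show ?thesis by (simp add: distr_seed_component distr_quantile real_distribution_gauss)
 qed
 then show ?thesis
  using seed.indep_vars_iff_distr_eq_PiM[THEN iffD1, OF _ _ ind] by (simp add: restrict_UNIV gauss_seq_def)
qed

lemma distr_unit_incr: "distr seed Hist (unit_incr m) = gauss_seq 1"
proof (induction m)
 case 0
 then show ?case using distr_layer[of 0] by (simp cong: distr_cong)
next
 let ?A = "%m Suc. distr seed (Hist >< Hist) (%w. (unit_incr m w, layer (Suc m) w))"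
 case (Suc m)
 have u: "unit_incr m : seed_blk (layers_upto m) ->M Hist" by (rule measurable_unit_incr) simp
 have l: "layer (Suc m) : seed_blk {2 * prod_encode (Suc m, i) | i. True} ->M Hist" by (rule measurable_layer) auto
 have "distr seed Hist (unit_incr m) >< distr seed Hist (layer (Suc m)) = ?A m Suc"
  by (rule distr_seed_blocks[OF _ u l]) (auto simp: layers_upto_def)
 then have eq: "?A m Suc = gauss_seq 1 >< gauss_seq 1"
  by (simp add: Suc.IH distr_layer)
 note [measurable] = measurable_seed_blkD[OF u] measurable_seed_blkD[OF l]
 have e: "unit_incr (Suc m) = (%w. interleave (unit_incr m w) (layer (Suc m) w))" by (simp add: fun_eq_iff)
 have "distr seed Hist (unit_incr (Suc m)) = distr (?A m Suc) Hist (%(x, z). interleave x z)"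
  unfolding e by (subst distr_distr) (auto simp: comp_def)
 then show ?case unfolding eq distr_interleave .
qed

lemma unit_incr_measurable [measurable]: "unit_incr m : seed ->M Hist"
 by (rule measurable_seed_blkD[OF measurable_unit_incr[OF subset_UNIV]])

lemma unit_incr_component [measurable]: "(%z. unit_incr m z i) : borel_measurable seed" by measurable

lemma indep_unit_incr: "seed.indep_vars (%_. borel) (%i z. unit_incr m z i) UNIV"
 and distr_unit_incr_component: "distr seed borel (%z. unit_incr m z i) = gauss 1"
proof -
 interpret product_prob_space "%_::nat. gauss 1" UNIV
  using sequence_space_gauss[of 1] by (simp add: sequence_space_def)
 show c: "distr seed borel (%z. unit_incr m z i) = gauss 1" for i
 proof -
  have "distr seed borel (%z. unit_incr m z i) = distr (distr seed Hist (unit_incr m)) borel (%x. x i)"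
   by (subst distr_distr) (auto simp: comp_def)
  also have "... = distr (\<Pi>\<^sub>M i\<in>UNIV. gauss 1) (gauss 1) (%x. x i)"
   unfolding distr_unit_incr gauss_seq_def by (rule distr_cong) auto
  finally show ?thesis using PiM_component[of i] by simp
 qed
 show "seed.indep_vars (%_. borel) (%i z. unit_incr m z i) UNIV"
  by (subst seed.indep_vars_iff_distr_eq_PiM) (auto simp: c restrict_UNIV distr_unit_incr gauss_seq_def[symmetric])
qed

lemma dyadic_incr_refine: "dyadic_incr w m i = dyadic_incr w (Suc m) (2 * i) + dyadic_incr w (Suc m) (Suc (2 * i))"
proof -
 have "(x + z) / sqrt 2 / (sqrt 2 * s) + (x - z) / sqrt 2 / (sqrt 2 * s) = x / s" for x z s :: real
  by (cases "s = 0") (auto simp: field_simps)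
 then show ?thesis by (simp add: dyadic_incr_def interleave_def real_sqrt_mult)
qed

lemma dyadic_incr_measurable [measurable]: "(%z. dyadic_incr z m i) : borel_measurable seed"
 unfolding dyadic_incr_def by measurable

lemma dyadic_incr_tail: "l >= 0 ==> measure seed {z. l < abs(dyadic_incr z m i)} <= 2 * exp (- (l^2 * 2 ^ m / 2))"
proof -
 let ?A = "{z. l * sqrt (2 ^ m) <= abs(unit_incr m z i)}"
 assume l: "l >= 0"
 interpret N: prob_space "gauss 1" by (rule prob_space_gauss) simp
 have "measure seed {z. l < abs(dyadic_incr z m i)} <= measure seed ?A"
 proof (rule seed.finite_measure_mono)
  show "?A : sets seed"
  proof -
   have "{z : space seed. l * sqrt (2 ^ m) <= abs(unit_incr m z i)} : sets seed" by measurable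
   then show ?thesis by simp
  qed
 qed (auto simp: dyadic_incr_def field_simps)
 also have "... = measure (distr seed borel (%z. unit_incr m z i)) {x. l * sqrt (2 ^ m) <= abs x}"
  by (subst measure_distr) (auto simp: vimage_def)
 also have "... <= 2 * exp (- (l * sqrt (2 ^ m))\<^sup>2 / (2 * 1))"
  unfolding distr_unit_incr_component using l by (intro gauss_tail) auto
 finally show ?thesis by (simp add: power_mult_distrib)
qed

text \<open>Here \<open>81/50\<close> is \<open>2 * (9/10)^2\<close>. The estimate
  \<open>exp (- y) <= 2 / y^2\<close> leaves the ratio \<open>2 / (81/50)^2 = 5000/6561\<close>,
  which is less than 1.\<close>

lemma dyadic_tail_bound: "2 ^ m * exp (- ((81/50) ^ m / 2)) <= 8 * (5000/6561 :: real) ^ m"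
proof -
 define y where "y = (81/50 :: real) ^ m / 2"
 have y: "y > 0" by (simp add: y_def)
 have "y^2 / 2 <= exp y" using exp_lower_Taylor_quadratic[of y] y by simp
 then have "exp (- y) <= 2 / y^2" using y by (simp add: exp_minus field_simps)
 then have "2 ^ m * exp (- y) <= 2 ^ m * (2 / y^2)" by (intro mult_left_mono) auto
 also have "2 / y^2 = 8 * (1 / ((81/50)^2) ^ m)"
 proof -
  have "((81/50 :: real) ^ m)^2 = ((81/50)^2) ^ m" by (simp only: power_mult[symmetric] mult.commute)
  moreover have "2 / y^2 = 8 * (1 / ((81/50 :: real) ^ m)^2)" unfolding y_def power_divide by simp
  ultimately show ?thesis by simp
 qed
 also have "2 ^ m * (8 * (1 / ((81/50)^2) ^ m)) = 8 * (2 / (81/50)^2 :: real) ^ m"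
  by (simp only: power_divide power_one) simp
 also have "2 / (81/50)^2 = (5000/6561 :: real)" by (simp add: power2_eq_square)
 finally show ?thesis by (simp add: y_def)
qed

text \<open>Borel-Cantelli over the levels, with a union bound over the \<open>N * 2 ^ m\<close>
  cells of level \<open>m\<close> up to time \<open>N\<close>.\<close>

lemma AE_dyadic_small: "AE z in seed. dyadic_small (dyadic_incr z)" unfolding dyadic_small_def AE_all_countable
proof
 let ?A = "%z m i. abs(dyadic_incr z m i)"
 fix N :: nat
 define A where "A m = {z. EX i<N * 2 ^ m. (9/10) ^ m < ?A z m i}" for m
 have A: "A m : sets seed" for m
 proof -
  have "{z : space seed. EX i<N * 2 ^ m. (9/10) ^ m < ?A z m i} : sets seed" by measurable
  then show ?thesis by (simp add: A_def)
 qed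
 have bound: "measure seed (A m) <= 16 * real N * (5000/6561) ^ m" for m
 proof -
  have "A m = (\<Union>i\<in>{..<N * 2 ^ m}. {z. (9/10) ^ m < ?A z m i})" by (auto simp: A_def)
  also have "measure seed ... <= (\<Sum>i<N * 2 ^ m. measure seed {z. (9/10) ^ m < ?A z m i})"
  proof (rule measure_UNION_le)
   fix i
   have "{z : space seed. (9/10) ^ m < ?A z m i} : sets seed" by measurable
   then show "{z. (9/10) ^ m < ?A z m i} : sets seed" by simp
  qed simp
  also have "... <= (\<Sum>i<N * 2 ^ m. 2 * exp (- (((9/10) ^ m)^2 * 2 ^ m / 2)))"
   by (intro sum_mono dyadic_incr_tail) simp
  also have "((9/10) ^ m)^2 * 2 ^ m = (81/50 :: real) ^ m"
  proof -
   have "((9/10 :: real) ^ m)^2 * 2 ^ m = ((9/10)^2 * 2) ^ m"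
    by (simp only: power_mult_distrib power_mult[symmetric] mult.commute)
   then show ?thesis by (simp add: power2_eq_square)
  qed
  also have "(\<Sum>i<N * 2 ^ m. 2 * exp (- ((81/50) ^ m / 2))) = 2 * real N * (2 ^ m * exp (- ((81/50) ^ m / 2 :: real)))"
   by simp
  also have "... <= 2 * real N * (8 * (5000/6561) ^ m)" by (intro mult_left_mono dyadic_tail_bound) simp
  finally show ?thesis by simp
 qed
 have "summable (%m. measure seed (A m))"
  by (rule summable_comparison_test_ev[where g="%m. 16 * real N * (5000/6561) ^ m"])
    (use bound in \<open>auto intro!: always_eventually summable_mult summable_geometric\<close>)
 from borel_cantelli_AE1[OF A _ this]
 have "AE z in seed. EV m. z : space seed - A m" by (simp add: less_top[symmetric])
 then show "AE z in seed. EX m0. ALL m>=m0. ALL i<N * 2 ^ m. ?A z m i <= (9/10) ^ m"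
 proof eventually_elim
  case (elim z)
  then obtain m0 where "!!m. m >= m0 ==> z ~: A m" by (auto simp: eventually_sequentially)
  show ?case
  proof (intro exI[of _ m0] allI impI)
   fix m i assume "m0 <= m" "i < N * 2 ^ m"
   then show "?A z m i <= (9/10) ^ m"
    using \<open>m \<ge> m0 \<Longrightarrow> z \<notin> A m\<close> unfolding A_def not_less[symmetric] by blast
  qed
 qed
qed

text \<open>Off the good event the path is constantly 0, because continuity is demanded at every
  point of the space and not just almost surely.\<close>

definition BM :: "real => (nat => real) => real" where
 "BM t z = (if dyadic_small (dyadic_incr z) then lim (%m. dyadic_path (dyadic_incr z) m t) else 0)"

lemma BM_zero: "BM 0 z = 0"
proof -
 have "lim (%m. dyadic_path (dyadic_incr z) m 0) = (0::real)" by (rule limI) (simp add: dyadic_path_def)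
 then show ?thesis by (simp add: BM_def)
qed

lemma BM_continuous: "continuous_on {0..} (%t. BM t z)"
 using continuous_on_dyadic_lim[where a="dyadic_incr z", OF dyadic_incr_refine] by (cases "dyadic_small (dyadic_incr z)")
   (simp_all add: BM_def)

definition even_blk :: "(nat => real) measure" where "even_blk = seed_blk {n. even n}"

text \<open>This keeps the motion independent of the odd coordinates, which serve as further
  noise.\<close>

lemma measurable_BM_even: "BM t : borel_measurable even_blk"
proof -
 have "layers_upto m \<subseteq> {n. even n}" for m by (auto simp: layers_upto_def)
 then have [measurable]: "unit_incr m : even_blk ->M Hist" for m unfolding even_blk_def by (rule measurable_unit_incr)
 have [measurable]: "(%z. dyadic_incr z m i) : borel_measurable even_blk" for m i
  unfolding dyadic_incr_def by measurable
 have [measurable]: "(%z. dyadic_path (dyadic_incr z) m t) : borel_measurable even_blk" for m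
  unfolding dyadic_path_def by measurable
 show ?thesis unfolding BM_def dyadic_small_def by measurable
qed

lemma BM_measurable [measurable]: "BM t : borel_measurable seed"
 using measurable_BM_even unfolding even_blk_def by (rule measurable_seed_blkD)

section \<open>Normality and independence of the increments of the limit\<close>

definition path_incr :: "nat => real => real => (nat => real) => real" where
 "path_incr m s t z = dyadic_path (dyadic_incr z) m t - dyadic_path (dyadic_incr z) m s"

lemma path_incr_measurable [measurable]: "path_incr m s t : borel_measurable seed"
 unfolding path_incr_def dyadic_path_def by measurable

lemma path_incr_sum:
 assumes "s <= t"
 shows "path_incr m s t z = (\<Sum>i\<in>{nat (floor(s * 2 ^ m))..<nat (floor(t * 2 ^ m))}. dyadic_incr z m i)"
proof -
 have "nat (floor(s * 2 ^ m)) <= nat (floor(t * 2 ^ m))" using assms by (intro nat_mono floor_mono) simp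
 then show ?thesis
  unfolding path_incr_def dyadic_path_def lessThan_atLeast0 by (subst sum_diff_nat_ivl[symmetric]) auto
qed

lemma AE_path_incr: "0 <= s ==> 0 <= t ==> AE z in seed. (%m. path_incr m s t z) ----> BM t z - BM s z"
 using AE_dyadic_small
proof eventually_elim
 case (elim z)
 then show ?case
  unfolding path_incr_def BM_def using dyadic_path_converges[where a="dyadic_incr z", OF dyadic_incr_refine]
  by (auto intro!: tendsto_diff)
qed

lemma path_incr_normal:
 assumes "0 <= s" "nat (floor(s * 2 ^ m)) < nat (floor(t * 2 ^ m))" "s <= t"
 defines "n == nat (floor(t * 2 ^ m)) - nat (floor(s * 2 ^ m))"
 shows "distributed seed lborel (%z. path_incr m s t z / sqrt (real n / 2 ^ m)) std_normal_density"
proof -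
 let ?I = "{nat (floor(s * 2 ^ m))..<nat (floor(t * 2 ^ m))}"
 let ?A = "%z. \<Sum>i\<in>?I. unit_incr m z i"
 let ?B = "distributed seed lborel"
 let ?C = "sqrt (real n)"
 let ?D = "?B (%z. \<Sum>i\<in>?I. unit_incr m z i)"
 have n: "n > 0" "card ?I = n" using assms by auto
 have d: "?B (%z. unit_incr m z i) (normal_density 0 1)" for i
  unfolding distributed_def using distr_unit_incr_component[of m i] by (simp add: gauss_1 cong: distr_cong)
 have "?D (normal_density (\<Sum>i\<in>?I. 0) (sqrt (\<Sum>i\<in>?I. 1^2)))"
  by (rule seed.sum_indep_normal) (use assms d in \<open>auto intro!: seed.indep_vars_subset[OF indep_unit_incr]\<close>)
 then have "?D (normal_density 0 (?C))"
  by (simp add: n_def)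
 from seed.normal_density_affine[OF this, of "1 / ?C" 0] n
 have "?B (%z. (?A z) / ?C) std_normal_density" by simp
 moreover have "(%z. (?A z) / ?C) = (%z. path_incr m s t z / sqrt (real n / 2 ^ m))"
 proof
  fix z
  have "path_incr m s t z = (?A z) / sqrt (2 ^ m)"
   by (simp add: path_incr_sum[OF assms(3)] dyadic_incr_def sum_divide_distrib)
  then show "(?A z) / ?C = path_incr m s t z / sqrt (real n / 2 ^ m)"
   by (simp add: real_sqrt_divide)
 qed
 ultimately show ?thesis by simp
qed

lemma floor_scaled_limit:
 fixes t :: real assumes "t >= 0" shows "(%m. real (nat (floor(t * 2 ^ m))) / 2 ^ m) ----> t"
proof (rule tendsto_sandwich)
 let ?A = "%m. real (nat (floor(t * 2 ^ m)))"
 show "EV m. t - (1/2) ^ m <= ?A m / 2 ^ m"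
 proof (intro always_eventually allI)
  fix m :: nat
  have "t * 2 ^ m - 1 <= ?A m" using assms by linarith
  then have "(t * 2 ^ m - 1) / 2 ^ m <= ?A m / 2 ^ m" by (intro divide_right_mono) auto
  then show "t - (1/2) ^ m <= ?A m / 2 ^ m" by (simp add: diff_divide_distrib power_one_over)
 qed
 show "EV m. ?A m / 2 ^ m <= t"
  using assms by (intro always_eventually allI) (simp add: divide_le_eq)
 show "(%m. t - (1/2) ^ m) ----> t" by (rule tendsto_eq_intros LIMSEQ_power_zero | simp)+
qed simp

text \<open>On a dyadic level the increment is a sum of independent normal variables. Divided by its
  own standard deviation it is exactly standard normal, and it converges almost surely; the
  characteristic function identifies the law of the limit.\<close>

lemma BM_increment_normal:
 assumes st: "0 <= s" "s < t" shows "distributed seed lborel (%z. BM t z - BM s z) (normal_density 0 (sqrt (t - s)))"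
proof -
 let ?A = "char std_normal_distribution"
 define n where "n m = nat (floor(t * 2 ^ m)) - nat (floor(s * 2 ^ m))" for m
 have le: "nat (floor(s * 2 ^ m)) <= nat (floor(t * 2 ^ m))" for m using st by (intro nat_mono floor_mono) simp
 have nlim: "(%m. real (n m) / 2 ^ m) ----> t - s"
 proof -
  have "real (n m) / 2 ^ m = real (nat (floor(t * 2 ^ m))) / 2 ^ m - real (nat (floor(s * 2 ^ m))) / 2 ^ m" for m
   using le[of m] by (simp add: n_def of_nat_diff diff_divide_distrib)
  then show ?thesis using tendsto_diff[OF floor_scaled_limit floor_scaled_limit, of t s] st by simp
 qed
 have ev: "eventually (%m. real (n m) / 2 ^ m > 0) sequentially" using order_tendstoD(1)[OF nlim, of 0] st by simp
 let ?Z = "%z. (BM t z - BM s z) / sqrt (t - s)"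
 let ?Zm = "%m z. path_incr m s t z / sqrt (real (n m) / 2 ^ m)"
 have lim: "AE z in seed. (%m. ?Zm m z) ----> ?Z z"
 proof -
  have "AE z in seed. (%m. path_incr m s t z) ----> BM t z - BM s z" using AE_path_incr st by auto
  then show ?thesis
  proof eventually_elim
   case (elim z)
   show ?case using st by (intro tendsto_divide tendsto_real_sqrt nlim elim) auto
  qed
 qed
 have Zrd: "real_distribution (distr seed borel ?Z)"
  unfolding real_distribution_def real_distribution_axioms_def by (auto intro!: seed.prob_space_distr)
 have "char (distr seed borel ?Z) = ?A"
 proof
  fix u
  have 1: "char (distr seed borel ?Z) u = (CLINT z|seed. iexp (u * ?Z z))"
   unfolding char_def by (subst integral_distr) auto
  have 2: "(%m. CLINT z|seed. iexp (u * ?Zm m z)) ----> (CLINT z|seed. iexp (u * ?Z z))"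
  proof (rule integral_dominated_convergence[where w="%_. 1"])
   show "AE z in seed. (%m. iexp (u * ?Zm m z)) ----> iexp (u * ?Z z)" using lim
   proof eventually_elim
    case (elim z)
    have "isCont (%x. iexp (u * x)) (?Z z)" by (intro continuous_intros)
    from isCont_tendsto_compose[OF this elim] show ?case .
   qed
  qed (auto simp: norm_mult)
  have 3: "eventually (%m. (CLINT z|seed. iexp (u * ?Zm m z)) = ?A u) sequentially" using ev
  proof eventually_elim
   case (elim m)
   then have "n m > 0" by (simp add: zero_less_divide_iff)
   then have "distributed seed lborel (?Zm m) std_normal_density"
    using path_incr_normal[of s m t] st by (simp add: n_def)
   then have d: "distr seed borel (?Zm m) = std_normal_distribution" by (simp add: distributed_def cong: distr_cong)
   show ?case unfolding d[symmetric] char_def by (subst integral_distr) auto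
  qed
  have "(%m. CLINT z|seed. iexp (u * ?Zm m z)) ----> ?A u"
   by (rule Lim_transform_eventually[OF tendsto_const]) (use 3 in \<open>auto elim: eventually_mono\<close>)
  then show "char (distr seed borel ?Z) u = ?A u" unfolding 1 using 2 LIMSEQ_unique by blast
 qed
 then have eq: "distr seed borel ?Z = std_normal_distribution" by (intro Levy_uniqueness Zrd real_dist_normal_dist)
 have "distributed seed lborel ?Z std_normal_density" using eq by (simp add: distributed_def cong: distr_cong)
 from seed.normal_density_affine[OF this, of "sqrt (t - s)" 0] st
 show ?thesis by simp
qed

lemma path_incr_indep:
 assumes "0 <= \<tau> 0" "!!i. i < k ==> \<tau> i <= \<tau> (Suc i)"
 shows "seed.indep_vars (%_. borel) (%i. path_incr m (\<tau> i) (\<tau> (Suc i))) {..<k}"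
proof -
 let ?A = "%i. nat (floor(\<tau> i * 2 ^ m))"
 define B where "B i = {?A i ..<nat (floor(\<tau> (Suc i) * 2 ^ m))}" for i
 have mono: "?A i <= ?A j" if "i <= j" "j <= k" for i j using that
 proof (induction j rule: dec_induct)
  case (step j)
  have "\<tau> j * 2 ^ m <= \<tau> (Suc j) * 2 ^ m" using assms(2)[of j] step.prems by simp
  then have "?A j <= nat (floor(\<tau> (Suc j) * 2 ^ m))" by (intro nat_mono floor_mono)
  then show ?case using step by simp
 qed simp
 have disj: "disjoint_family_on B {..<k}" unfolding disjoint_family_on_def
 proof (intro ballI impI)
  fix i j assume ij: "i : {..<k}" "j : {..<k}" "i ~= j"
  show "B i \<inter> B j = {}"
  proof (cases "i < j")
   case True
   then show ?thesis using mono[of "Suc i" j] ij by (auto simp: B_def)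
  next
   case False
   then show ?thesis using mono[of "Suc j" i] ij by (auto simp: B_def)
  qed
 qed
 have "seed.indep_vars (%i. \<Pi>\<^sub>M j\<in>B i. borel) (%i z. \<lambda>j\<in>B i. unit_incr m z j) {..<k}"
  by (rule seed.indep_vars_restrict[OF indep_unit_incr _ disj]) simp
 then have "seed.indep_vars (%_. borel) (%i z. (\<Sum>j\<in>B i. (\<lambda>j\<in>B i. unit_incr m z j) j / sqrt (2 ^ m))) {..<k}"
  by (rule seed.indep_vars_compose2[of _ _ _ "%i f. \<Sum>j\<in>B i. f j / sqrt (2 ^ m)"]) measurable
 then show ?thesis by (rule seed.indep_vars_cong[THEN iffD1, rotated -1])
    (auto simp: path_incr_sum assms(2) B_def[symmetric] dyadic_incr_def)
qed

text \<open>Independence holds on each dyadic level and passes to the limit through products of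
  half-lines. The indicators converge almost surely because a nondegenerate limiting increment has
  no atom; an increment over a trivial interval is 0 on every level.\<close>

lemma BM_increments_independent:
 assumes \<tau>: "0 <= \<tau> 0" "!!i. i < k ==> \<tau> i <= \<tau> (Suc i)"
 shows "seed.indep_vars (%_. borel) (%i z. BM (\<tau> (Suc i)) z - BM (\<tau> i) z) {..<k}"
proof -
 let ?D = "%i z. BM (\<tau> (Suc i)) z - BM (\<tau> i) z"
 let ?Dm = "%m i. path_incr m (\<tau> i) (\<tau> (Suc i))"
 let ?A = "%a i. indicator {x. x <= a i}"
 let ?B = "insert UNIV (range atMost)"
 let ?C = "%A seed. \<Prod>j\<in>{..<k}. seed.prob (?D j -` A j \<inter> space seed)"
 let ?E = "%J m a. {z. ALL i:J. ?Dm m i z <= a i}"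
 let ?F = "%J a. {z. ALL i:J. ?D i z <= a i}"
 let ?G = "%A seed. \<Inter>j\<in>{..<k}. ?D j -` A j \<inter> space seed"
 let ?H = "range (atMost :: real => real set)"
 let ?I = "%i x. ennreal (normal_density 0 (sqrt (\<tau> (Suc i) - \<tau> i)) x)"
 let ?J = "sigma_sets UNIV"
 have pos: "0 <= \<tau> i" if "i <= k" for i
  using that by (induction i) (use \<tau> in \<open>auto intro: order_trans\<close>)
 have conv: "AE z in seed. ALL i:{..<k}. (%m. ?A a i (?Dm m i z) :: real) ----> ?A a i (?D i z)" for a
 proof (rule AE_finite_allI)
  fix i assume i: "i : {..<k}"
  show "AE z in seed. (%m. ?A a i (?Dm m i z) :: real) ----> ?A a i (?D i z)"
  proof (cases "\<tau> i = \<tau> (Suc i)")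
   case True
   then show ?thesis by (simp add: path_incr_def)
  next
   case False
   then have lt: "0 <= \<tau> i" "\<tau> i < \<tau> (Suc i)" using \<tau>(2)[of i] i pos[of i] by auto
   have "AE x in density lborel (%x. ?I i x). x ~= a i"
   proof (subst AE_density)
    show "AE x in lborel. 0 < ?I i x --> x ~= a i"
     using AE_lborel_singleton[of "a i"] by eventually_elim simp
   qed simp
   then have "AE x in distr seed lborel (?D i). x ~= a i"
    unfolding distributed_distr_eq_density[OF BM_increment_normal[OF lt]] .
   then have "AE z in seed. ?D i z ~= a i" by (subst (asm) AE_distr_iff) auto
   moreover have "AE z in seed. (%m. ?Dm m i z) ----> ?D i z" using lt by (intro AE_path_incr) auto
   ultimately show ?thesis
   proof eventually_elim
    case (elim z)
    consider "?D i z < a i" | "?D i z > a i" using elim(1) by linarith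
    then show ?case
    proof cases
     case 1
     have "EV m. (?A a i (?D i z) :: real) = ?A a i (?Dm m i z)"
      using order_tendstoD(2)[OF elim(2) 1] by eventually_elim (use 1 in simp)
     from Lim_transform_eventually[OF tendsto_const this] show ?thesis .
    next
     case 2
     have "EV m. (?A a i (?D i z) :: real) = ?A a i (?Dm m i z)"
      using order_tendstoD(1)[OF elim(2) 2] by eventually_elim (use 2 in simp)
     from Lim_transform_eventually[OF tendsto_const this] show ?thesis .
    qed
   qed
  qed
 qed simp
 have joint: "(%m. measure seed (?E J m a)) ----> measure seed (?F J a)"
  if J: "J \<subseteq> {..<k}" for a J
 proof -
  have fin: "finite J" using J finite_subset by blast
  have ind: "(indicator {z. ALL i:J. f i z <= a i} z :: real) = (\<Prod>i\<in>J. ?A a i (f i z))" for f :: "nat => (nat => real)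
    => real" and z
   using fin by (auto simp: indicator_def prod_zero_iff)
  have S: "{z. ALL i:J. f i z <= a i} : sets seed" if [measurable]: "!!i. f i : borel_measurable seed" for f :: "nat => (nat
    => real) => real"
  proof -
   have "{z : space seed. ALL i:J. f i z <= a i} : sets seed" using fin by measurable
   then show ?thesis by simp
  qed
  have "(%m. LINT z|seed. indicator (?E J m a) z) ----> ((LINT z|seed. indicator (?F J a) z) :: real)"
  proof (rule integral_dominated_convergence[where w="%_. 1"])
   show "AE z in seed. (%m. indicator (?E J m a) z :: real) ----> indicator (?F J a) z"
    using conv[of a]
   proof eventually_elim
    case (elim z)
    show ?case unfolding ind using elim J by (intro tendsto_prod) auto
   qed
   show "(%z. indicator (?F J a) z :: real) : borel_measurable seed"
    "!!m. (%z. indicator (?E J m a) z :: real) : borel_measurable seed"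
    using S[of ?D] S[of "?Dm _"] by (auto intro!: borel_measurable_indicator)
  qed auto
  then show ?thesis using S[of ?D] S[of "?Dm _"] by simp
 qed
 show ?thesis
 proof (cases "k = 0")
  case True
  then show ?thesis by (auto simp: seed.indep_vars_def2 seed.indep_sets_def)
 next
  case False
  show ?thesis
  \<comment> \<open>The whole line joins the half-lines because the generator has to contain the
    space; \<open>J\<close> then collects the coordinates that are really constrained.\<close>
  proof (subst seed.indep_vars_finite[where E="%_. ?B"])
   fix i
   show "sets (borel :: real measure) = sigma_sets (space borel) (?B)"
   proof -
    have "?J (?B) = ?J (?H)"
    proof (rule antisym)
     show "?J (?B) \<subseteq> ?J (?H)"
      by (rule sigma_sets_mono) (auto intro: sigma_sets_top sigma_sets.Basic)
    qed (rule sigma_sets_mono, auto intro: sigma_sets.Basic)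
    then show ?thesis by (subst borel_eq_atMost) simp
   qed
   show "Int_stable (insert UNIV (?H))" by (auto simp: Int_stable_def)
  next
   show "ALL A:{..<k} \<rightarrow> ?B . seed.prob (?G A seed) = (?C A seed)"
   proof
    fix A :: "nat => real set" assume A: "A : {..<k} \<rightarrow> ?B"
    define J where "J = {j : {..<k}. A j ~= UNIV}"
    have J: "J \<subseteq> {..<k}" "finite J" by (auto simp: J_def)
    have "ALL j. EX c. j : J --> A j = {..c}" using A unfolding J_def by blast
    then obtain a where a: "!!j. j : J ==> A j = {..a j}" by metis
    have U: "A j = UNIV" if "j < k" "j ~: J" for j using that by (auto simp: J_def)
    have eq: "measure seed (?E J m a) = (\<Prod>j\<in>J. measure seed {z. ALL i:{j}. ?Dm m i z <= a i})" for m
    proof (cases "J = {}")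
     case True
     then show ?thesis using seed.prob_space by simp
    next
     case False
     have "seed.prob (\<Inter>j\<in>J. ?Dm m j -` {..a j} \<inter> space seed) = (\<Prod>j\<in>J.
       seed.prob (?Dm m j -` {..a j} \<inter> space seed))"
      by (rule seed.indep_varsD[OF path_incr_indep[OF \<tau>]]) (use False J in auto)
     moreover have "(\<Inter>j\<in>J. ?Dm m j -` {..a j} \<inter> space seed) = (?E J m a)"
      using False by auto
     ultimately show ?thesis by (simp add: vimage_def)
    qed
    have "(%m. \<Prod>j\<in>J. measure seed {z. ALL i:{j}. ?Dm m i z <= a i}) ----> (\<Prod>j\<in>J. measure seed {z. ALL i:{j}.
      ?D i z <= a i})"
     using J by (intro tendsto_prod joint) auto
    then have "measure seed (?F J a) = (\<Prod>j\<in>J. measure seed {z. ALL i:{j}. ?D i z <= a i})"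
     using joint[OF J(1), of a] unfolding eq using LIMSEQ_unique by blast
    moreover have "(?G A seed) = (?F J a)"
    proof -
     have "(ALL j<k. ?D j z : A j) \<longleftrightarrow> (ALL i:J. ?D i z <= a i)" for z
     proof
      assume "ALL i:J. ?D i z <= a i"
      then show "ALL j<k. ?D j z : A j" using a U by (metis UNIV_I atMost_iff)
     qed (use a J in force)
     then show ?thesis using False by auto
    qed
    moreover have "(?C A seed) = (\<Prod>j\<in>J. seed.prob (?D j -` A j \<inter> space seed))"
     by (rule prod.mono_neutral_right) (use J U seed.prob_space in auto)
    ultimately show "seed.prob (?G A seed) = (?C A seed)"
     by (simp add: vimage_def a)
   qed
  qed (use False in auto)
 qed
qed

lemma standard_brownian_motion_BM: "standard_brownian_motion seed BM"
 by unfold_locales (auto simp: BM_zero intro: BM_continuous BM_increment_normal BM_increments_independent)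

definition odd_coord :: "nat => (nat => real) => real" where "odd_coord n z = z (2 * n + 1)"

lemma odd_coord_measurable [measurable]: "odd_coord n : borel_measurable seed" unfolding odd_coord_def by measurable

text \<open>A finite set of sources splits into increments and uniform variables. These groups are
  functions of the even and of the odd coordinates, so their probabilities multiply, and each group
  is independent in itself.\<close>

lemma bm_noise_BM: "bm_noise seed BM odd_coord"
proof -
 let ?A = "%n z. odd_coord n z"
 let ?B = "distr seed Hist (%z n. ?A n z)"
 let ?C = "%J2 S. \<Inter>i\<in>J2. odd_coord i -` S (Inr i) \<inter> space seed"
 let ?D = "%T. {z. (%n. ?A n z) : T}"
 interpret B: standard_brownian_motion seed BM by (rule standard_brownian_motion_BM)
 show ?thesis
 proof
  show "distr seed borel (odd_coord n) = U01" for n unfolding odd_coord_def by (rule distr_seed_component)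
  fix h :: real assume h: "h > 0"
  let ?I = "%i z. BM (real (Suc i) * h) z - BM (real i * h) z"
  let ?X = "case_sum ?I odd_coord"
  have rv: "?X c : borel_measurable seed" for c by (cases c) auto
  have I: "seed.indep_vars (%_. borel) ?I {..<k}" for k
   using BM_increments_independent[of "%i. real i * h" k] h by auto
  have V: "seed.indep_vars (%_. borel) odd_coord UNIV"
   unfolding odd_coord_def using seed.indep_vars_reindex_inj[OF indep_seed, of "%n. 2 * n + 1"] by (simp add: inj_def)
  have f: "(%z i. ?I i z) : seed_blk {n. even n} ->M Hist"
   using measurable_BM_even by (intro measurable_PiM_single') (auto simp: even_blk_def)
  have g: "(%z n. ?A n z) : seed_blk {n. odd n} ->M Hist"
   by (intro measurable_PiM_single') (auto simp: odd_coord_def intro!: measurable_seed_blk)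
  note [measurable] = measurable_seed_blkD[OF f] measurable_seed_blkD[OF g]
  have fg: "distr seed Hist (%z i. ?I i z) >< ?B = distr seed (Hist >< Hist) (%z. (%i. ?I i z, %n. ?A n z))"
   by (rule distr_seed_blocks[OF _ f g]) auto
  interpret G: prob_space "?B" by (rule seed.prob_space_distr) measurable
  have prod: "seed.prob ({z. (%i. ?I i z) : S} \<inter> (?D T)) = seed.prob {z. (%i. ?I i z) : S} * seed.prob (?D T)"
   if [measurable]: "S : sets Hist" "T : sets Hist" for S T
  proof -
   have "emeasure (distr seed (Hist >< Hist) (%z. (%i. ?I i z, %n. ?A n z))) (S \<times> T) = emeasure (distr seed Hist (%z i.
     ?I i z)) S * emeasure (?B) T"
    unfolding fg[symmetric] by (rule G.emeasure_pair_measure_Times) auto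
   then have "emeasure seed {z. (%i. ?I i z) : S & (%n. ?A n z) : T} = emeasure seed {z. (%i. ?I i z) : S} * emeasure seed (?D T)"
    by (simp add: emeasure_distr vimage_def del: of_nat_Suc)
   then show ?thesis unfolding measure_def Collect_conj_eq by (simp only: enn2real_mult)
  qed
  show "seed.indep_vars (%_. borel) ?X UNIV" unfolding seed.indep_vars_def2 seed.indep_sets_def
  proof (intro conjI ballI allI impI)
   show "?X c : borel_measurable seed" for c by (rule rv)
   show "{?X c -` A \<inter> space seed |A. A : sets borel} \<subseteq> sets seed" for c
    using measurable_sets[OF rv] by blast
   fix J A assume J: "J \<subseteq> UNIV" "J ~= {}" "finite J" and A: "A : (\<Pi> c\<in>J. {?X c -` A \<inter> space seed |A. A
     : sets borel})"
   have "ALL c. EX S. c : J --> A c = ?X c -` S & S : sets borel" using A by (auto simp: Pi_iff)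
   from choice[OF this] obtain S where S': "ALL c. c : J --> A c = ?X c -` S c & S c : sets borel" ..
   have S: "!!c. c : J ==> A c = ?X c -` S c" "!!c. c : J ==> S c : sets borel" by (simp_all only: S'[rule_format])
   define J1 J2 where "J1 = Inl -` J" and "J2 = Inr -` J"
   have fin: "finite J1" "finite J2" using J unfolding J1_def J2_def by (auto intro!: finite_vimageI simp: inj_def)
   have JJ: "J = Inl ` J1 \<union> Inr ` J2" unfolding J1_def J2_def by (auto simp: image_iff) (metis old.sum.exhaust)
   define B1 where "B1 = {x. ALL i:J1. x i : S (Inl i)}"
   define B2 where "B2 = {x. ALL i:J2. x i : S (Inr i)}"
   have B: "B1 : sets Hist" "B2 : sets Hist"
   proof -
    have [measurable]: "!!i. i : J1 ==> S (Inl i) : sets borel" "!!i. i : J2 ==> S (Inr i) : sets borel"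
     using S(2) by (auto simp: J1_def J2_def)
    have "{x : space Hist. ALL i:J1. x i : S (Inl i)} : sets Hist" "{x : space Hist. ALL i:J2. x i : S (Inr i)} : sets Hist"
     using fin by measurable
    then show "B1 : sets Hist" "B2 : sets Hist" by (auto simp: B1_def B2_def)
   qed
   have P1: "seed.prob {z. (%i. ?I i z) : B1} = (\<Prod>i\<in>J1. seed.prob (A (Inl i)))"
   proof (cases "J1 = {}")
    case True
    then show ?thesis using seed.prob_space by (simp add: B1_def)
   next
    case False
    obtain k where k: "J1 \<subseteq> {..<k}" using finite_nat_bounded[OF fin(1)] by blast
    have "seed.prob (\<Inter>i\<in>J1. ?I i -` S (Inl i) \<inter> space seed) = (\<Prod>i\<in>J1.
      seed.prob (?I i -` S (Inl i) \<inter> space seed))"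
     by (rule seed.indep_varsD[OF I[of k]]) (use False fin k S(2) in \<open>auto simp: J1_def\<close>)
    moreover have "(\<Inter>i\<in>J1. ?I i -` S (Inl i) \<inter> space seed) = {z. (%i. ?I i z) : B1}"
     using False by (auto simp: B1_def)
    moreover have "A (Inl i) = ?I i -` S (Inl i)" if "i : J1" for i using S(1)[of "Inl i"] that by (simp add: J1_def)
    ultimately show ?thesis by simp
   qed
   have P2: "seed.prob {z. (%i. ?A i z) : B2} = (\<Prod>i\<in>J2. seed.prob (A (Inr i)))"
   proof (cases "J2 = {}")
    case True
    then show ?thesis using seed.prob_space by (simp add: B2_def)
   next
    case False
    have "seed.prob (?C J2 S) = (\<Prod>i\<in>J2. seed.prob (odd_coord i -` S (Inr i) \<inter> space seed))"
     by (rule seed.indep_varsD[OF V]) (use False fin S(2) in \<open>auto simp: J2_def\<close>)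
    moreover have "(?C J2 S) = {z. (%i. ?A i z) : B2}"
     using False by (auto simp: B2_def)
    moreover have "A (Inr i) = odd_coord i -` S (Inr i)" if "i : J2" for i using S(1)[of "Inr i"] that by (simp add: J2_def)
    ultimately show ?thesis by simp
   qed
   have AA: "(\<Inter>c\<in>J. A c) = {z. (%i. ?I i z) : B1} \<inter> (?D B2)"
   proof -
    have 0: "(\<Inter>c\<in>J. A c) = (\<Inter>i\<in>J1. A (Inl i)) \<inter> (\<Inter>i\<in>J2. A (Inr i))" unfolding JJ by blast
    have "(\<Inter>i\<in>J1. A (Inl i)) = (\<Inter>i\<in>J1. ?I i -` S (Inl i))"
     using S(1)[of "Inl _"] by (intro INF_cong refl) (simp add: J1_def)
    moreover have "(\<Inter>i\<in>J2. A (Inr i)) = (\<Inter>i\<in>J2. odd_coord i -` S (Inr i))"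
     using S(1)[of "Inr _"] by (intro INF_cong refl) (simp add: J2_def)
    ultimately show ?thesis unfolding 0 B1_def B2_def by auto
   qed
   have "(\<Prod>c\<in>J. seed.prob (A c)) = (\<Prod>i\<in>J1. seed.prob (A (Inl i))) * (\<Prod>i\<in>J2. seed.prob (A (Inr i)))"
    unfolding JJ by (subst prod.union_disjoint) (auto simp: fin prod.reindex)
   then show "seed.prob (\<Inter>c\<in>J. A c) = (\<Prod>c\<in>J. seed.prob (A c))"
    unfolding AA prod[OF B] P1 P2 by simp
  qed
 qed
qed

section \<open>Chaining, tails of suprema and oscillation of Brownian motion\<close>

lemma nat_floor_bounds:
 fixes x :: real
 assumes "0 <= x" shows "real (nat (floor x)) <= x" "x < real (nat (floor x)) + 1" "x < real (Suc (nat (floor x)))"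
proof -
 let ?A = "nat (floor x)"
 have "real ?A = of_int (floor x)" using assms by simp
 then show "real ?A <= x" "x < real ?A + 1" "x < real (Suc ?A)"
  using of_int_floor_le[of x] real_of_int_floor_add_one_gt[of x] unfolding of_nat_Suc by linarith+
qed

text \<open>Chaining for a single path: the value at \<open>t\<close> is the limit of its values at
  dyadic points, each level adds at most one increment, and the geometric series yields 10.\<close>

lemma dyadic_chain:
 fixes f :: "real => real"
 assumes cont: "continuous_on {0..1} f" and f0: "f 0 = 0" and c: "c >= 0"
  and small: "!!m i. i < 2 ^ m ==> abs(f (real (Suc i) / 2 ^ m) - f (real i / 2 ^ m)) <= c * (9/10) ^ m"
  and t: "0 <= t" "t <= 1" shows "abs(f t) <= 10 * c"
proof (cases "t = 1")
 case True
 then show ?thesis using small[of 0 0] f0 c by simp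
next
 let ?A = "%m. real (nat (floor(t * 2 ^ m)))"
 let ?B = "%a. dyadic_path a"
 case False
 with t have t1: "t < 1" by simp
 define a where "a m i = f (real (Suc i) / 2 ^ m) - f (real i / 2 ^ m)" for m i
 have ref: "a m i = a (Suc m) (2 * i) + a (Suc m) (Suc (2 * i))" for m i
 proof -
  have "real (Suc (Suc (2 * i))) / 2 ^ Suc m = real (Suc i) / 2 ^ m" "real (2 * i) / 2 ^ Suc m = real i / 2 ^ m"
   by (simp_all add: field_simps)
  then show ?thesis unfolding a_def by simp
 qed
 have path: "?B a m t = f (?A m / 2 ^ m)" for m
  unfolding dyadic_path_def a_def by (subst sum_lessThan_telescope) (simp add: f0)
 have fl: "nat (floor(t * 2 ^ m)) < 2 ^ m" for m
 proof -
  have "?A m <= t * 2 ^ m" using t by simp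
  also have "... < 2 ^ m" using t1 by simp
  finally have "?A m < real (2 ^ m)" by simp
  then show ?thesis by (simp only: of_nat_less_iff)
 qed
 \<comment> \<open>Strengthened for the induction: level \<open>Suc m\<close> adds
   \<open>c * (9/10) ^ Suc m\<close>, exactly the decrease of the subtracted term.\<close>
 have bound: "abs(?B a m t) <= 10 * c - 9 * c * (9/10) ^ m" for m
 proof (induction m)
  case 0
  have "nat (floor(t * 2 ^ 0)) = 0" using t t1 by (simp add: floor_eq_iff)
  then show ?case using c by (simp add: dyadic_path_def)
 next
  case (Suc m)
  have "2 * nat (floor(t * 2 ^ m)) < 2 ^ Suc m" using fl[of m] by simp
  then have "abs(a (Suc m) (2 * nat (floor(t * 2 ^ m)))) <= c * (9/10) ^ Suc m" unfolding a_def by (rule small)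
  moreover have "0 <= c * (9/10) ^ Suc m" using c by simp
  ultimately have "abs(?B a (Suc m) t - ?B a m t) <= c * (9/10) ^ Suc m"
   using dyadic_path_Suc[where a=a, OF ref t(1), of m] by auto
  moreover have "9 * c * (9/10) ^ m - 9 * c * (9/10) ^ Suc m = c * (9/10) ^ Suc m" by simp
  ultimately show ?case using Suc.IH by linarith
 qed
 have "(%m. ?B a m t) ----> f t"
 proof -
  have "(%m. ?A m / 2 ^ m) ----> t"
  proof (rule tendsto_sandwich)
   show "EV m. t - (1/2) ^ m <= ?A m / 2 ^ m"
   proof (intro always_eventually allI)
    fix m :: nat
    have "t * 2 ^ m - 1 <= ?A m" using t by linarith
    then have "(t * 2 ^ m - 1) / 2 ^ m <= ?A m / 2 ^ m" by (intro divide_right_mono) auto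
    then show "t - (1/2) ^ m <= ?A m / 2 ^ m" by (simp add: diff_divide_distrib power_one_over)
   qed
   show "EV m. ?A m / 2 ^ m <= t"
    using t by (intro always_eventually allI) (simp add: divide_le_eq)
   show "(%m. t - (1/2) ^ m) ----> t" by (rule tendsto_eq_intros LIMSEQ_power_zero | simp)+
  qed simp
  then show ?thesis unfolding path
   by (intro continuous_on_tendsto_compose[OF cont]) (use t fl in \<open>auto intro!: always_eventually simp: divide_le_eq
     less_imp_le\<close>)
 qed
 then have "(%m. abs(?B a m t)) ----> abs(f t)" by (rule tendsto_rabs)
 moreover have "abs(?B a m t) <= 10 * c" for m
  using bound[of m] c by (smt (verit) mult_nonneg_nonneg zero_le_power divide_nonneg_nonneg)
 ultimately show ?thesis by (intro LIMSEQ_le_const2) auto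
qed

context standard_brownian_motion
begin

lemma increment_tail:
 assumes "0 <= s" "s < t" "l >= 0"
 shows "prob {z : space M. l < abs(W t z - W s z)} <= 2 * exp (- (l^2 / (2 * (t - s))))"
proof -
 have [measurable]: "W t : borel_measurable M" "W s : borel_measurable M" using assms by (auto intro: W_measurable)
 have d: "distr M borel (%z. W t z - W s z) = gauss (t - s)"
  using W_increment_normal[OF assms(1,2)] by (simp add: distributed_def gauss_def cong: distr_cong)
 have "prob {z : space M. l < abs(W t z - W s z)} <= prob {z : space M. l <= abs(W t z - W s z)}"
  by (intro finite_measure_mono) auto
 also have "... = measure (distr M borel (%z. W t z - W s z)) {x. l <= abs x}"
  by (subst measure_distr) (auto simp: vimage_def Int_def conj_commute)
 also have "... <= 2 * exp (- l\<^sup>2 / (2 * (t - s)))" unfolding d using assms by (intro gauss_tail) auto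
 finally show ?thesis by simp
qed

text \<open>Increments of chaining level \<open>m\<close> may reach \<open>c * (9/10) ^ m\<close>
  with \<open>c = l * sqrt L / 10\<close>, and then \<open>c^2 / (2 * L)\<close> is
  \<open>l^2 / 200\<close>. The exceptional set is a countable union over grid points, which avoids
  the measurability of a supremum over an interval.\<close>

lemma sup_tail:
 assumes u: "0 <= u" and L: "0 < L" and l: "0 <= l"
 shows "EX B:events. prob B <= exp (4 - l^2 / 200) & (ALL z:space M - B. ALL t:{u..u + L}. abs(W t z - W u z) <= l * sqrt L)"
proof -
 let ?A = "%m E. prob (\<Union>i<2 ^ m. E m i)"
 let ?B = "%x m. exp (- (x * (81/50) ^ m))"
 define p where "p m i = u + L * (real i / 2 ^ m)" for m i :: nat
 have p: "0 <= p m i" for m i using u L by (auto simp: p_def)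
 define c where "c = l * sqrt L / 10"
 have c: "c >= 0" using l L by (auto simp: c_def)
 define E where "E m i = {z : space M. c * (9/10) ^ m < abs(W (p m (Suc i)) z - W (p m i) z)}" for m i
 have [measurable]: "W (p m i) : borel_measurable M" for m i using p by (intro W_measurable)
 have E [measurable]: "E m i : events" for m i unfolding E_def by measurable
 define B where "B = (\<Union>m. \<Union>i<2 ^ m. E m i)"
 have B: "B : events" unfolding B_def by measurable
 define x where "x = l^2 / 200"
 have x: "x >= 0" by (simp add: x_def)
 have EP: "prob (E m i) <= 2 * ?B x m" for m i
 proof -
  have d: "p m (Suc i) - p m i = L / 2 ^ m" by (simp add: p_def field_simps)
  then have lt: "p m i < p m (Suc i)" using L by (smt (verit) divide_pos_pos zero_less_power)
  have "(c * (9/10) ^ m)^2 / (2 * (p m (Suc i) - p m i)) = x * (81/50) ^ m"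
  proof -
   have "((9/10 :: real) ^ m)^2 * 2 ^ m = ((9/10)^2 * 2) ^ m"
    by (simp only: power_mult_distrib power_mult[symmetric] mult.commute)
   also have "(9/10 :: real)^2 * 2 = 81/50" by (simp add: power2_eq_square)
   finally have e: "((9/10 :: real) ^ m)^2 * 2 ^ m = (81/50) ^ m" .
   have "(c * (9/10) ^ m)^2 / (2 * (L / 2 ^ m)) = c^2 / (2 * L) * (((9/10) ^ m)^2 * 2 ^ m)"
    by (simp add: power_mult_distrib)
   also have "c^2 / (2 * L) = x" using L by (simp add: c_def x_def power_mult_distrib power_divide)
   finally show ?thesis unfolding d e .
  qed
  then show ?thesis using increment_tail[OF p lt, of "c * (9/10) ^ m"] c by (simp add: E_def)
 qed
 have "prob B <= exp (4 - x)"
 \<comment> \<open>For \<open>x < 4\<close> the bound exceeds 1. For \<open>x >= 4\<close>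
   Bernoulli's inequality applied to \<open>(81/50) ^ m\<close> gains the factor
   \<open>exp (- 2 * m)\<close>, which beats the number \<open>2 ^ m\<close> of cells.\<close>
 proof (cases "x >= 4")
  case False
  then have "1 <= exp (4 - x)" by simp
  then show ?thesis using prob_le_1 order_trans by blast
 next
  case True
  have bm: "?A m E <= 2 * exp (- x) * (1/2) ^ m" for m
  proof -
   have "?A m E <= (\<Sum>i<2 ^ m. prob (E m i))" by (intro measure_UNION_le) auto
   also have "... <= (\<Sum>i<(2::nat) ^ m. 2 * ?B x m)" by (intro sum_mono EP)
   also have "... = 2 * (2 ^ m * ?B x m)" by simp
   also have "... <= 2 * (2 ^ m * (exp (- x) * exp (- (2 * real m))))"
   proof -
    have "1 + real m * (31/50) <= (1 + 31/50 :: real) ^ m" by (rule Bernoulli_inequality) simp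
    then have "x * (1 + real m * (31/50)) <= x * (81/50) ^ m" using x by (intro mult_left_mono) auto
    moreover have "2 * real m <= x * (real m * (31/50))"
    proof -
     have "2 * real m <= 4 * (real m * (31/50))" by simp
     also have "... <= x * (real m * (31/50))" using True by (intro mult_right_mono) auto
     finally show ?thesis .
    qed
    ultimately have "- (x * (81/50) ^ m) <= - x + - (2 * real m)" by (simp add: algebra_simps)
    then have "?B x m <= exp (- x) * exp (- (2 * real m))" unfolding exp_add[symmetric] by simp
    then show ?thesis by simp
   qed
   also have "... = 2 * exp (- x) * (2 * exp (- 2)) ^ m"
   proof -
    have "exp (- (2 * real m)) = exp (- 2) ^ m" by (simp add: exp_of_nat_mult[symmetric] mult.commute)
    then show ?thesis by (simp add: power_mult_distrib)
   qed
   also have "... <= 2 * exp (- x) * (1/2) ^ m"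
   proof (intro mult_left_mono power_mono)
    have "(4::real) <= exp 2" using exp_lower_Taylor_quadratic[of 2] by simp
    then show "2 * exp (- 2) <= (1/2 :: real)" by (simp add: exp_minus field_simps)
   qed auto
   finally show ?thesis .
  qed
  have sm: "summable (%m. 2 * exp (- x) * (1/2 :: real) ^ m)" by (intro summable_mult summable_geometric) simp
  have "prob B <= (\<Sum>m. ?A m E)" unfolding B_def
  proof (rule finite_measure_subadditive_countably)
   show "summable (%m. ?A m E)"
    by (rule summable_comparison_test_ev[OF _ sm]) (auto intro!: always_eventually bm)
  qed (auto intro!: sets.finite_UN)
  also have "... <= (\<Sum>m. 2 * exp (- x) * (1/2 :: real) ^ m)"
   by (rule suminf_le[OF bm summable_comparison_test_ev[OF _ sm] sm]) (auto intro!: always_eventually bm)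
  also have "... = 4 * exp (- x)" by (subst suminf_mult) (auto simp: suminf_geometric summable_geometric)
  also have "... <= exp 4 * exp (- x)" using exp_ge_add_one_self[of 4] by (intro mult_right_mono) auto
  also have "... = exp (4 - x)" by (simp add: exp_add[symmetric])
  finally show ?thesis .
 qed
 moreover have "abs(W t z - W u z) <= l * sqrt L" if z: "z : space M - B" and t: "t : {u..u + L}" for z t
 proof -
  have "abs((%r. W (u + L * r) z - W u z) ((t - u) / L)) <= 10 * c"
  proof (rule dyadic_chain[where f="%r. W (u + L * r) z - W u z" and t="(t - u) / L"])
   have "(%r. u + L * r) ` {0..1} \<subseteq> {0..}" using u L by auto
   then show "continuous_on {0..1} (%r. W (u + L * r) z - W u z)"
    using z by (intro continuous_intros continuous_on_compose2[OF W_continuous[of z]]) auto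
   show "abs(W (u + L * (real (Suc i) / 2 ^ m)) z - W u z - (W (u + L * (real i / 2 ^ m)) z - W u z)) <= c * (9/10) ^ m"
    if "i < 2 ^ m" for m i using z that by (auto simp: B_def E_def p_def not_less)
  qed (use c t L in \<open>auto simp: divide_le_eq\<close>)
  then show ?thesis using L by (simp add: c_def)
 qed
 ultimately show ?thesis using B by (auto simp: x_def)
qed

text \<open>The level solves \<open>exp (4 - l^2 / 200) = 1 / k^2\<close>, so the exceptional
  probabilities are summable.\<close>

lemma AE_sup_blocks:
 assumes "!!k. 0 <= u k" "!!k. 0 < L k"
 shows "AE z in M. EV k. ALL t:{u k..u k + L k}. abs(W t z - W (u k) z) <= sqrt (200 * (4 + 2 * ln (real k))) * sqrt (L k)"
proof -
 let ?A = "%k. sqrt (200 * (4 + 2 * ln (real k)))"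
 let ?B = "%M B k. ALL z:space M - B. ALL t:{u k..u k + L k}. abs(W t z - W (u k) z) <= ?A k * sqrt (L k)"
 have "EX B. ALL k>0. B k : events & prob (B k) <= 1 / (real k)^2 & (ALL z:space M - B k. ALL t:{u k..u k + L k}.
   abs(W t z - W (u k) z) <= ?A k * sqrt (L k))"
 proof (rule choice, rule allI)
  fix k
  have "EX B. B : events & prob B <= 1 / (real k)^2 & (?B M B k)" if k: "k > 0"
  proof -
   have ln: "ln (real k) >= 0" using k by simp
   have "exp (4 - (?A k)^2 / 200) = 1 / (real k)^2"
   proof -
    have "(?A k)^2 = 200 * (4 + 2 * ln (real k))"
     using ln by (intro real_sqrt_pow2) simp
    then have "4 - (?A k)^2 / 200 = - (2 * ln (real k))"
     by (simp add: diff_divide_distrib add_divide_distrib)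
    then show ?thesis using k by (simp only: exp_minus exp_double) (simp add: inverse_eq_divide)
   qed
   moreover have "?A k >= 0" using ln by simp
   ultimately show ?thesis
    using sup_tail[OF assms(1)[of k] assms(2)[of k], of "?A k"] unfolding Bex_def by metis
  qed
  then show "EX B. 0 < k --> B : events & prob B <= 1 / (real k)^2 & (?B M B k)" by blast
 qed
 then obtain B where B: "!!k. k > 0 ==> B k : events" "!!k. k > 0 ==> prob (B k) <= 1 / (real k)^2"
  "!!k z t. k > 0 ==> z : space M - B k ==> t : {u k..u k + L k} ==> abs(W t z - W (u k) z) <= ?A k * sqrt (L k)"
  by blast
 define B' where "B' k = (if k > 0 then B k else {})" for k
 have "summable (%k. prob (B' k))" by (rule summable_comparison_test_ev[OF _ inverse_power_summable[of 2]])
    (use B(2) in \<open>auto intro!: always_eventually simp: B'_def inverse_eq_divide\<close>)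
 then have "AE z in M. EV k. z : space M - B' k"
  by (intro borel_cantelli_AE1) (auto simp: B'_def B(1) less_top[symmetric])
 then show ?thesis
 proof eventually_elim
  case (elim z)
  then show ?case using eventually_gt_at_top[of 0] by eventually_elim (use B(3) in \<open>auto simp: B'_def\<close>)
 qed
qed

text \<open>Blocks from \<open>\<alpha> ^ k / \<alpha>\<close> to
  \<open>\<alpha> ^ k * \<alpha>^2\<close> are used, with \<open>\<alpha>\<close> close to 1. If
  \<open>\<alpha> ^ k <= t < \<alpha> ^ Suc k\<close>, then \<open>t\<close> and every
  \<open>s\<close> within \<open>\<delta> * t\<close> of it lie in block \<open>k\<close>. The
  oscillation there is of order \<open>sqrt (ln k)\<close> times the root of the block length, and
  \<open>ln k\<close> is comparable to \<open>ln (ln t)\<close>.\<close>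

lemma AE_oscillation:
 assumes \<epsilon>: "\<epsilon> > 0"
 shows "EX \<delta>>0. AE z in M. \<forall>\<^sub>F t in at_top. ALL s. abs(s - t) <= \<delta> * t --> abs(W s z - W t z)
   <= \<epsilon> * sqrt (t * ln (ln t))"
proof -
 let ?A = "%k. 4 + 2 * ln (real k)"
 let ?B = "%k. sqrt (200 * (?A k))"
 \<comment> \<open>The relative length \<open>\<alpha> ^ 3 - 1 = \<epsilon>^2 / 4000\<close> fits
   the final estimate: doubling the block bound and squaring gives
   \<open>4 * 200 * 5 / 4000 = 1\<close>, the 5 coming from the comparison of
   \<open>4 + 2 * ln k\<close> with \<open>5 * ln (k * ln \<alpha>)\<close>.\<close>
 define \<alpha> where "\<alpha> = root 3 (1 + \<epsilon>^2 / 4000)"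
 have \<alpha>3: "\<alpha> ^ 3 = 1 + \<epsilon>^2 / 4000" unfolding \<alpha>_def by (rule real_root_pow_pos2) auto
 have \<alpha>: "\<alpha> > 1"
 proof (rule ccontr)
  assume "~ \<alpha> > 1"
  moreover have "\<alpha> >= 0" unfolding \<alpha>_def by simp
  ultimately have "\<alpha> ^ 3 <= 1" by (intro power_le_one) auto
  then show False using \<alpha>3 \<epsilon> by simp
 qed
 define \<delta> where "\<delta> = 1 - 1 / \<alpha>"
 have \<delta>: "\<delta> > 0" "1 - \<delta> = 1 / \<alpha>" "1 + \<delta> <= \<alpha>"
 proof -
  show "\<delta> > 0" using \<alpha> by (simp add: \<delta>_def)
  have "2 <= \<alpha> + 1 / \<alpha>"
  proof -
   have "0 <= (\<alpha> - 1)^2 / \<alpha>" using \<alpha> by simp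
   also have "... = \<alpha> + 1 / \<alpha> - 2" using \<alpha> by (simp add: power2_eq_square field_simps)
   finally show ?thesis by simp
  qed
  then show "1 + \<delta> <= \<alpha>" by (simp add: \<delta>_def)
 qed (simp add: \<delta>_def)
 have g: "2 * (sqrt a * sqrt b) = sqrt (4 * (a * b))" for a b :: real by (simp add: real_sqrt_mult)
 let ?u = "%k::nat. \<alpha> ^ k / \<alpha>" and ?L = "%k::nat. \<alpha> ^ k / \<alpha> * (\<epsilon>^2 / 4000)"
 have uL: "?u k + ?L k = \<alpha> ^ k * \<alpha>^2" for k
 proof -
  have "?u k + ?L k = \<alpha> ^ k / \<alpha> * \<alpha> ^ 3" unfolding \<alpha>3 by (simp add: algebra_simps)
  then show ?thesis using \<alpha> by (simp add: power3_eq_cube power2_eq_square)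
 qed
 have "AE z in M. EV k. ALL t:{?u k..?u k + ?L k}. abs(W t z - W (?u k) z) <= ?B k * sqrt (?L k)"
  by (rule AE_sup_blocks) (use \<alpha> \<epsilon> in auto)
 then have "AE z in M. \<forall>\<^sub>F t in at_top. ALL s. abs(s - t) <= \<delta> * t --> abs(W s z - W t z)
   <= \<epsilon> * sqrt (t * ln (ln t))"
 proof eventually_elim
  case (elim z)
  have la: "ln \<alpha> > 0" using \<alpha> by simp
  have "EV k. (?A k) / 5 <= ln (real k * ln \<alpha>)" using la by real_asymp
  with elim have "EV k. (ALL t:{?u k..?u k + ?L k}. abs(W t z - W (?u k) z) <= ?B k * sqrt (?L k)) & (?A k) / 5
    <= ln (real k * ln \<alpha>) & k > 0"
   using eventually_gt_at_top[of 0] by eventually_elim auto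
  then obtain k0 where k0': "ALL k>=k0. (ALL t:{?u k..\<alpha> ^ k * \<alpha>^2}. abs(W t z - W (?u k) z) <= ?B k * sqrt (?L k))
    & (?A k) / 5 <= ln (real k * ln \<alpha>) & k > 0"
   unfolding uL eventually_sequentially by blast
  have k0: "k >= k0 ==> t : {?u k..\<alpha> ^ k * \<alpha>^2} ==> abs(W t z - W (?u k) z) <= ?B k * sqrt (?L k)"
   "k >= k0 ==> (?A k) / 5 <= ln (real k * ln \<alpha>)" "k >= k0 ==> k > 0" for k t
   using k0' by blast+
  have "abs(W s z - W t z) <= \<epsilon> * sqrt (t * ln (ln t))" if t: "t >= \<alpha> ^ k0" and s: "abs(s - t)
    <= \<delta> * t" for s t
  proof -
   have t1: "t >= 1" using t one_le_power[of \<alpha> k0] \<alpha> by linarith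
   define k where "k = nat (floor(log \<alpha> t))"
   have k: "\<alpha> ^ k <= t" "t < \<alpha> ^ Suc k"
   proof -
    have l: "log \<alpha> t >= 0" using t1 \<alpha> by simp
    have "real k <= log \<alpha> t" "log \<alpha> t < real (Suc k)" using nat_floor_bounds(1,3)[OF l] unfolding k_def .
    then show "\<alpha> ^ k <= t" "t < \<alpha> ^ Suc k"
     using t1 \<alpha> by (auto simp: le_log_iff log_less_iff powr_realpow simp del: of_nat_Suc power_Suc)
   qed
   have "\<alpha> ^ k0 < \<alpha> ^ Suc k" using t k by linarith
   then have kk: "k >= k0" using \<alpha> by (simp add: power_strict_increasing_iff del: power_Suc)
   have lnt: "real k * ln \<alpha> <= ln t"
   proof -
    have "ln (\<alpha> ^ k) <= ln t" using k t1 \<alpha> by (subst ln_le_cancel_iff) auto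
    then show ?thesis using \<alpha> by (simp add: ln_realpow)
   qed
   have kp: "k > 0" using k0(3)[OF kk] .
   have su: "s <= \<alpha> * t"
   proof -
    have "s <= (1 + \<delta>) * t" using s by (simp add: algebra_simps abs_le_iff)
    also have "... <= \<alpha> * t" using \<delta> t1 by (intro mult_right_mono) auto
    finally show ?thesis .
   qed
   have sl: "t / \<alpha> <= s"
   proof -
    have "(1 - \<delta>) * t <= s" using s by (simp add: algebra_simps abs_le_iff)
    then show ?thesis using \<delta> by simp
   qed
   have "\<alpha> ^ k / \<alpha> <= t / \<alpha>" using k \<alpha> by (intro divide_right_mono) auto
   moreover have "\<alpha> * t <= \<alpha> ^ k * \<alpha>^2"
   proof -
    have "\<alpha> * t <= \<alpha> * \<alpha> ^ Suc k" using k \<alpha> by (intro mult_left_mono) auto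
    then show ?thesis by (simp add: power2_eq_square ac_simps)
   qed
   moreover have "t / \<alpha> <= t" "t <= \<alpha> * t" using \<alpha> t1 by (simp_all add: divide_le_eq)
   ultimately have "s : {?u k..\<alpha> ^ k * \<alpha>^2}" "t : {?u k..\<alpha> ^ k * \<alpha>^2}" using su sl by auto
   from k0(1)[OF kk this(1)] k0(1)[OF kk this(2)]
   have "abs(W s z - W t z) <= 2 * (?B k * sqrt (?L k))" by linarith
   also have "... = sqrt (4 * (200 * (?A k) * ?L k))" by (rule g)
   also have "4 * (200 * (?A k) * ?L k) = \<epsilon>^2 * (?u k * ((?A k) / 5))" using \<alpha> by (simp add: field_simps)
   also have "sqrt ... <= sqrt (\<epsilon>^2 * (t * ln (ln t)))"
   proof (rule real_sqrt_le_mono, rule mult_left_mono, rule mult_mono)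
    show "?u k <= t" using \<open>\<alpha> ^ k / \<alpha> \<le> t / \<alpha>\<close> \<open>t / \<alpha> \<le> t\<close>
      by linarith
    have "(?A k) / 5 <= ln (real k * ln \<alpha>)" by (rule k0(2)[OF kk])
    also have "... <= ln (ln t)" using lnt kp la by (intro ln_mono) auto
    finally show "(?A k) / 5 <= ln (ln t)" .
   qed (use t1 kp in auto)
   also have "... = \<epsilon> * sqrt (t * ln (ln t))" using \<epsilon> by (simp add: real_sqrt_mult)
   finally show ?thesis .
  qed
  then show ?case by (intro eventually_at_top_linorderI[of "\<alpha> ^ k0"]) blast
 qed
 with \<delta> show ?thesis by blast
qed

text \<open>\<open>\<delta>\<close> does not depend on \<open>T\<close> because
  \<open>sup_tail\<close> is scale invariant. The interval is cut into about
  \<open>2 / \<delta>\<close> cells of length \<open>\<delta> * T\<close>. With the level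
  \<open>\<delta> powr (- 1/4)\<close> the total failure probability tends to 0, and so does the
  bound, of order \<open>\<delta> powr (1/4) * sqrt T\<close>.\<close>

lemma modulus_in_probability:
 assumes \<epsilon>: "\<epsilon> > 0"
 shows "EX \<delta>>0. \<delta> < 1 & (ALL T>0. EX B:events. prob B <= \<epsilon> & (ALL z:space M - B. ALL s t. 0 <= s & s
   <= 2 * T & 0 <= t & t <= 2 * T & abs(s - t) <= \<delta> * T --> abs(W s z - W t z) <= \<epsilon> * sqrt T))"
proof -
 let ?A = "%d. exp (4 - (1 / sqrt (sqrt d))^2 / 200)"
 let ?B = "%j. real (Suc j)"
 let ?C = "%l. exp (4 - l^2 / 200)"
 have "((%d. (2 / d + 2) * ?A d) \<longlongrightarrow> 0) (at_right (0::real))"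
  by real_asymp
 then have e1: "\<forall>\<^sub>F d in at_right 0. (2 / d + 2) * ?A d < \<epsilon>"
  using \<epsilon> by (auto dest: order_tendstoD(2))
 have "((%d. 3 * (1 / sqrt (sqrt d)) * sqrt d) \<longlongrightarrow> 0) (at_right (0::real))" by real_asymp
 then have e2: "\<forall>\<^sub>F d in at_right 0. 3 * (1 / sqrt (sqrt d)) * sqrt d < \<epsilon>"
  using \<epsilon> by (auto dest: order_tendstoD(2))
 have e3: "\<forall>\<^sub>F d in at_right (0::real). 0 < d & d < 1"
  by (auto simp: eventually_at_right_field intro!: exI[of _ 1])
 from eventually_happens[OF eventually_conj[OF e1 eventually_conj[OF e2 e3]]] obtain \<delta> where
  \<delta>: "(2 / \<delta> + 2) * ?A \<delta> < \<epsilon>" "3 * (1 / sqrt (sqrt \<delta>)) * sqrt \<delta> < \<epsilon>" "0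
    < \<delta>" "\<delta> < 1"
  by auto
 define l where "l = 1 / sqrt (sqrt \<delta>)"
 show ?thesis
 proof (intro exI[of _ \<delta>] conjI allI impI \<delta>(3,4))
  fix T :: real assume T: "T > 0"
  let ?h = "\<delta> * T"
  have h: "?h > 0" using \<delta> T by simp
  have l: "l >= 0" using \<delta> by (simp add: l_def)
  have "ALL j. EX B:events. prob B <= ?C l & (ALL z:space M - B. ALL t:{real j * ?h..real j * ?h + ?h}.
    abs(W t z - W (real j * ?h) z) <= l * sqrt ?h)"
   using sup_tail[OF _ h l] h by auto
  then obtain B where B: "!!j. B j : events" "!!j. prob (B j) <= ?C l"
   "!!j z t. z : space M - B j ==> t : {real j * ?h..real j * ?h + ?h} ==> abs(W t z - W (real j * ?h) z) <= l * sqrt ?h"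
   by metis
  define N where "N = Suc (nat (floor(2 / \<delta>)))"
  have N: "real N <= 2 / \<delta> + 2"
  proof -
   have "0 <= 2 / \<delta>" using \<delta>(3) by simp
   from nat_floor_bounds(1)[OF this] show ?thesis unfolding N_def of_nat_Suc by linarith
  qed
  show "EX B:events. prob B <= \<epsilon> & (ALL z:space M - B. ALL s t. 0 <= s & s <= 2 * T & 0 <= t & t <= 2 * T & abs(s - t)
    <= \<delta> * T --> abs(W s z - W t z) <= \<epsilon> * sqrt T)"
  proof (intro bexI[of _ "\<Union>j<N. B j"] conjI ballI allI impI)
   have "prob (\<Union>j<N. B j) <= (\<Sum>j<N. prob (B j))" using B by (intro measure_UNION_le) auto
   also have "... <= (\<Sum>j<N. ?C l)" by (intro sum_mono B)
   also have "... <= (2 / \<delta> + 2) * ?C l" using N by (simp add: mult_right_mono)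
   finally show "prob (\<Union>j<N. B j) <= \<epsilon>" using \<delta>(1) by (simp add: l_def)
  next
   fix z s t assume z: "z : space M - (\<Union>j<N. B j)"
    and st: "0 <= s & s <= 2 * T & 0 <= t & t <= 2 * T & abs(s - t) <= \<delta> * T"
   \<comment> \<open>Times at distance at most \<open>?h\<close> lie in the same cell or in adjacent
     ones, so at most three cell oscillations are involved.\<close>
   have *: "abs(W s z - W t z) <= 3 * l * sqrt ?h" if st: "0 <= s" "s <= t" "t <= 2 * T" "t - s <= ?h" for s t
   proof -
    define j where "j = nat (floor(s / ?h))"
    have sh: "s / ?h >= 0" using st h by simp
    have j: "real j <= s / ?h" "s / ?h < real j + 1" using nat_floor_bounds(1,2)[OF sh] unfolding j_def .
    have sj: "s : {real j * ?h..real j * ?h + ?h}" using j h by (auto simp: field_simps)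
    have "s / ?h <= 2 / \<delta>" using st T \<delta> by (simp add: field_simps)
    then have jN: "j < N" unfolding N_def j_def by (intro le_imp_less_Suc nat_mono floor_mono)
    have b1: "abs(W s z - W (real j * ?h) z) <= l * sqrt ?h" using B(3)[of z j s] z jN sj by auto
    show ?thesis
    proof (cases "t <= real j * ?h + ?h")
     case True
     then have "t : {real j * ?h..real j * ?h + ?h}" using sj st by auto
     then have "abs(W t z - W (real j * ?h) z) <= l * sqrt ?h" using B(3)[of z j t] z jN by auto
     moreover have "0 <= l * sqrt ?h" using l h by simp
     ultimately show ?thesis using b1 by linarith
    next
     case False
     have e: "?B j * ?h = real j * ?h + ?h" by (simp add: algebra_simps)
     have "t : {?B j * ?h..?B j * ?h + ?h}" unfolding e atLeastAtMost_iff
      using False st(4) sj[unfolded atLeastAtMost_iff] by (intro conjI; linarith)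
     moreover have "Suc j < N"
     proof -
      have "?B j * ?h <= 2 * T" using False st e by linarith
      then have "?B j <= 2 / \<delta>" using \<delta> T by (simp add: field_simps del: of_nat_Suc)
      then have "Suc j <= nat (floor(2 / \<delta>))" by (simp add: le_nat_floor del: of_nat_Suc)
      then show ?thesis by (simp add: N_def)
     qed
     ultimately have b2: "abs(W t z - W (?B j * ?h) z) <= l * sqrt ?h" using B(3)[of z "Suc j" t] z by auto
     have "abs(W (?B j * ?h) z - W (real j * ?h) z) <= l * sqrt ?h"
      unfolding e using B(3)[of z j "real j * ?h + ?h"] z jN h by auto
     then show ?thesis using b1 b2 by linarith
    qed
   qed
   have "abs(W s z - W t z) <= 3 * l * sqrt ?h"
    using *[of s t] *[of t s] st by (cases "s <= t") (auto simp: abs_minus_commute)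
   also have "... = (3 * l * sqrt \<delta>) * sqrt T" by (simp add: real_sqrt_mult)
   also have "... <= \<epsilon> * sqrt T" using \<delta>(2) T by (intro mult_right_mono) (auto simp: l_def)
   finally show "abs(W s z - W t z) <= \<epsilon> * sqrt T" .
  qed (use B in auto)
 qed
qed

lemma sup_in_probability:
 assumes \<epsilon>: "\<epsilon> > 0"
 shows "EX C>0. ALL T>0. EX B:events. prob B <= \<epsilon> & (ALL z:space M - B. ALL t. 0 <= t & t <= T --> abs(W t z)
   <= C * sqrt T)"
proof -
 have "((%l. exp (4 - l^2 / 200)) \<longlongrightarrow> 0) (at_top :: real filter)" by real_asymp
 then have "\<forall>\<^sub>F l in at_top. exp (4 - (l::real)^2 / 200) < \<epsilon>" using \<epsilon>
   by (auto dest: order_tendstoD(2))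
 from eventually_happens[OF eventually_conj[OF this eventually_gt_at_top[of 0]]] obtain C where
  C: "exp (4 - C^2 / 200) < \<epsilon>" "C > 0" by auto
 show ?thesis
 proof (intro exI[of _ C] conjI C allI impI)
  fix T :: real assume T: "T > 0"
  obtain B where B: "B : events" "prob B <= exp (4 - C^2 / 200)" "!!z t. z : space M - B ==> t : {0..0 + T}
    ==> abs(W t z - W 0 z) <= C * sqrt T"
   using sup_tail[of 0 T C] T C by auto
  show "EX B:events. prob B <= \<epsilon> & (ALL z:space M - B. ALL t. 0 <= t & t <= T --> abs(W t z) <= C * sqrt T)"
   using B(1,2) C(1) B(3) W_zero by (intro bexI[of _ B] conjI) force+
 qed
qed

end

section \<open>Martingale convergence and the clock\<close>

lemma toeplitz:
 fixes w y :: "nat => real"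
 assumes w: "!!i. w i >= 0" and W: "filterlim (%n. \<Sum>i<n. w i) at_top sequentially" and y: "y ----> l"
 shows "(%n. (\<Sum>i<n. w i * y i) / (\<Sum>i<n. w i)) ----> l"
proof -
 let ?W = "%n. \<Sum>i<n. w i"
 let ?A = "%n. \<Sum>i<n. w i * (y i - l)"
 have "(%n. (?A n) / ?W n) ----> 0"
 proof (rule LIMSEQ_I)
  fix e :: real assume e: "e > 0"
  obtain N where N: "!!i. i >= N ==> abs(y i - l) < e / 2" using LIMSEQ_D[OF y, of "e / 2"] e by auto
  define C where "C = (\<Sum>i<N. w i * abs(y i - l))"
  have C: "C >= 0" unfolding C_def using w by (intro sum_nonneg) auto
  have "eventually (%n. ?W n > 2 * C / e + 1) sequentially" using W by (simp add: filterlim_at_top_dense)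
  then obtain N' where N': "!!n. n >= N' ==> ?W n > 2 * C / e + 1" by (auto simp: eventually_sequentially)
  show "EX no. ALL n>=no. norm ((?A n) / ?W n - 0) < e"
  proof (intro exI[of _ "max N N'"] allI impI)
   fix n assume n: "max N N' <= n"
   have Wn: "?W n > 2 * C / e + 1" using N' n by simp
   moreover have "2 * C / e >= 0" using C e by simp
   ultimately have Wp: "?W n > 0" by linarith
   have "abs(?A n) <= (\<Sum>i<n. abs(w i * (y i - l)))" by (rule sum_abs)
   also have "... = (\<Sum>i<n. w i * abs(y i - l))" using w by (simp add: abs_mult)
   also have "... = C + (\<Sum>i=N..<n. w i * abs(y i - l))"
    unfolding C_def lessThan_atLeast0 using n by (simp add: sum.atLeastLessThan_concat)
   also have "(\<Sum>i=N..<n. w i * abs(y i - l)) <= (\<Sum>i=N..<n. w i * (e / 2))"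
    using N w by (intro sum_mono mult_left_mono) (auto simp: less_imp_le)
   also have "... <= (\<Sum>i<n. w i * (e / 2))" using w e by (intro sum_mono2) auto
   also have "... = ?W n * (e / 2)" by (simp add: sum_distrib_right)
   also have "C < ?W n * (e / 2)"
   proof -
    have "2 * C / e < ?W n" using Wn by linarith
    then show ?thesis using e by (simp add: field_simps)
   qed
   finally have "abs(?A n) < ?W n * e" by (simp add: mult.commute)
   then show "norm ((?A n) / ?W n - 0) < e" using Wp by (simp add: divide_less_eq mult.commute)
  qed
 qed
 then have "(%n. (?A n) / ?W n + l) ----> 0 + l" by (intro tendsto_intros)
 moreover have "eventually (%n. (?A n) / ?W n + l = (\<Sum>i<n. w i * y i) / ?W n) sequentially"
 proof -
  have "eventually (%n. ?W n > 0) sequentially" using W by (simp add: filterlim_at_top_dense)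
  then show ?thesis
  proof eventually_elim
   case (elim n)
   have "(?A n) = (\<Sum>i<n. w i * y i) - ?W n * l"
    by (simp add: right_diff_distrib sum_subtractf sum_distrib_right)
   then show ?case using elim by (simp add: field_simps)
  qed
 qed
 ultimately show ?thesis by (simp add: Lim_transform_eventually)
qed

text \<open>Summation by parts writes the weighted sum as \<open>c n * s n\<close> minus a sum of
  the \<open>s (Suc i)\<close> weighted by the increments of \<open>c\<close>; by
  \<open>toeplitz\<close> the corresponding average has the same limit as
  \<open>s n\<close>.\<close>

lemma kronecker:
 fixes x c :: "nat => real"
 assumes conv: "convergent (%n. \<Sum>i<n. x i)" and mono: "incseq c" and c: "filterlim c at_top sequentially"
 shows "(%n. (\<Sum>i<n. c i * x i) / c n) ----> 0"
proof -
 define s where "s n = (\<Sum>i<n. x i)" for n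
 obtain l where l: "s ----> l" using conv by (auto simp: convergent_def s_def[abs_def])
 let ?w = "%i. c (Suc i) - c i"
 have tel: "(\<Sum>i<n. ?w i) = c n - c 0" for n by (rule sum_lessThan_telescope)
 have abel: "(\<Sum>i<n. c i * x i) = c n * s n - (\<Sum>i<n. ?w i * s (Suc i))" for n
  by (induction n) (auto simp: s_def algebra_simps)
 have W: "filterlim (%n. \<Sum>i<n. ?w i) at_top sequentially"
  unfolding tel using filterlim_tendsto_add_at_top[OF tendsto_const[of "- c 0"] c] by (simp add: algebra_simps)
 have t: "(%n. (\<Sum>i<n. ?w i * s (Suc i)) / (\<Sum>i<n. ?w i)) ----> l"
  by (rule toeplitz[OF _ W LIMSEQ_Suc[OF l]]) (use mono in \<open>auto simp: incseq_Suc_iff\<close>)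
 have r: "(%n. (c n - c 0) / c n) ----> 1"
 proof -
  have "(%n. 1 - c 0 / c n) ----> 1 - 0"
   by (intro tendsto_diff tendsto_const real_tendsto_divide_at_top[OF tendsto_const c])
  moreover have "eventually (%n. 1 - c 0 / c n = (c n - c 0) / c n) sequentially"
  proof -
   have "eventually (%n. c n > 0) sequentially" using c by (simp add: filterlim_at_top_dense)
   then show ?thesis by eventually_elim (simp add: field_simps)
  qed
  ultimately show ?thesis by (simp add: Lim_transform_eventually)
 qed
 have "(%n. s n - (\<Sum>i<n. ?w i * s (Suc i)) / (\<Sum>i<n. ?w i) * ((c n - c 0) / c n)) ----> l - l * 1"
  by (intro tendsto_diff tendsto_mult l t r)
 moreover have "eventually (%n. s n - (\<Sum>i<n. ?w i * s (Suc i)) / (\<Sum>i<n. ?w i) * ((c n - c 0) / c n) = (\<Sum>i<n.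
   c i * x i) / c n) sequentially"
 proof -
  have "eventually (%n. c n > 0) sequentially" using c by (simp add: filterlim_at_top_dense)
  moreover have "eventually (%n. c n > c 0) sequentially" using c by (simp add: filterlim_at_top_dense)
  ultimately show ?thesis
  proof eventually_elim
   case (elim n)
   then show ?case unfolding abel tel by (simp add: field_simps)
  qed
 qed
 ultimately show ?thesis by (simp add: Lim_transform_eventually)
qed

section \<open>Martingale differences and their strong law\<close>

definition initial :: "nat => (nat => 'a => real) => 'a => nat => real" where
 "initial n \<xi> z i = (if i < n then \<xi> i z else 0)"

lemma measurable_initial [measurable (raw)]:
 assumes [measurable]: "!!i. i < n ==> \<xi> i : borel_measurable M" shows "initial n \<xi> : M ->M Hist"
proof (rule measurable_PiM_single')
 show "(%z. initial n \<xi> z i) : borel_measurable M" for i by (cases "i < n") (auto simp: initial_def)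
qed (auto simp: space_PiM)

lemma measurable_initial_at [measurable (raw)]:
 assumes "!!i. i < n ==> \<xi> i : borel_measurable M" shows "(%z. initial n \<xi> z i) : borel_measurable M"
 using assms by (cases "i < n") (auto simp: initial_def)

text \<open>Conditional expectations are replaced by orthogonality to functions of the own past,
  asked only for integrable products. The past is coded by \<open>initial\<close> as a sequence
  padded with 0, so that one space of test functions serves all \<open>n\<close>.\<close>

locale martingale_differences = prob_space M for M :: "'a measure" +
 fixes \<xi> :: "nat => 'a => real"
 assumes square: "!!n. integrable M (%z. (\<xi> n z)^2)" and meas [measurable]: "!!n. \<xi> n : borel_measurable M"
  and orth: "!!n \<psi>. \<psi> : borel_measurable Hist ==> integrable M (%z. \<psi> (initial n \<xi> z) * \<xi> n z)
    ==> (LINT z|M. \<psi> (initial n \<xi> z) * \<xi> n z) = 0"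
begin

definition psum :: "nat => 'a => real" where "psum n z = (\<Sum>i<n. \<xi> i z)"

lemma psum_measurable [measurable]: "psum n : borel_measurable M" unfolding psum_def by measurable

lemma integrable_mult_squares:
 assumes "integrable M (%z. (f z)^2)" "integrable M (%z. (g z)^2)" and [measurable]: "f : borel_measurable M" "g
   : borel_measurable M"
 shows "integrable M (%z. f z * g z :: real)"
proof (rule bint_bound)
 show "integrable M (%z. (f z)^2 + (g z)^2)" using assms by auto
 have "abs(x * y) <= x^2 + y^2" for x y :: real
 proof -
  have "2 * (abs x * abs y) <= abs x^2 + abs y^2" using sum_squares_bound[of "abs x" "abs y"] by simp
  moreover have "0 <= abs x * abs y" by simp
  ultimately show ?thesis unfolding abs_mult by (simp del: mult_nonneg_nonneg)
 qed
 then show "AE z in M. norm (f z * g z) <= norm ((f z)^2 + (g z)^2)" by simp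
qed measurable

lemma psum_square: "integrable M (%z. (psum n z)^2)"
proof (induction n)
 case 0 then show ?case by (simp add: psum_def)
next
 case (Suc n)
 have "integrable M (%z. (psum n z)^2 + (\<xi> n z)^2 + 2 * (psum n z * \<xi> n z))"
  using Suc square integrable_mult_squares[OF Suc square] by (intro bint_add integrable_mult_right) auto
 then show ?case by (simp add: psum_def power2_sum mult.assoc)
qed

lemma orth_past:
 assumes \<psi>: "\<psi> : borel_measurable Hist" and k: "k <= n"
  and sq: "integrable M (%z. (\<psi> (initial k \<xi> z))^2)"
 shows "(LINT z|M. \<psi> (initial k \<xi> z) * \<xi> n z) = 0"
proof -
 define r where "r x = (%i. if i < k then x i else 0 :: real)" for x :: "nat => real"
 have [measurable]: "r : Hist ->M Hist"
 proof (rule measurable_PiM_single')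
  show "(%x. r x i) : borel_measurable Hist" for i by (cases "i < k") (auto simp: r_def)
 qed (auto simp: space_PiM)
 note [measurable] = \<psi>
 have e: "initial k \<xi> z = r (initial n \<xi> z)" for z using k by (auto simp: initial_def r_def fun_eq_iff)
 have m: "(%z. \<psi> (initial k \<xi> z)) : borel_measurable M" by measurable
 have "(LINT z|M. (\<psi> \<circ> r) (initial n \<xi> z) * \<xi> n z) = 0"
  using integrable_mult_squares[OF sq square[of n] m] by (intro orth) (auto simp: e comp_def)
 then show ?thesis by (simp add: e)
qed

lemma orth_event:
 assumes \<psi> [measurable]: "\<psi> : borel_measurable Hist" and b: "!!x. abs(\<psi> x) <= 1" and k: "k <= n"
 shows "(LINT z|M. \<psi> (initial k \<xi> z) * (psum k z * (psum n z - psum k z))) = 0"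
  "integrable M (%z. \<psi> (initial k \<xi> z) * (psum k z * (psum n z - psum k z)))"
proof -
 let ?\<phi> = "%x. \<psi> x * (\<Sum>i<k. x i)"
 let ?A = "initial k \<xi>"
 let ?B = "%z. psum k z * (psum n z - psum k z)"
 have p: "(\<Sum>i<k. ?A z i) = psum k z" for z by (simp add: initial_def psum_def)
 have sq: "integrable M (%z. (?\<phi> (?A z))^2)"
 proof (rule bint_bound[OF psum_square[of k]])
  show "AE z in M. norm ((?\<phi> (?A z))^2) <= norm ((psum k z)^2)"
  proof (intro AE_I2)
   fix z
   have "(\<psi> (?A z))^2 <= 1" using b by (simp add: abs_square_le_1)
   then show "norm ((?\<phi> (?A z))^2) <= norm ((psum k z)^2)"
    unfolding p by (simp add: power_mult_distrib mult_left_le_one_le)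
  qed
 qed measurable
 have int: "integrable M (%z. ?\<phi> (?A z) * \<xi> i z)" for i
  by (rule integrable_mult_squares[OF sq square]) measurable
 have e: "\<psi> (?A z) * (?B z) = (\<Sum>i=k..<n. ?\<phi> (?A z) * \<xi> i z)" for z
 proof -
  have "psum n z - psum k z = (\<Sum>i=k..<n. \<xi> i z)"
   unfolding psum_def lessThan_atLeast0 using k by (simp add: sum_diff_nat_ivl)
  then show ?thesis unfolding p by (simp add: sum_distrib_left mult.assoc)
 qed
 show "integrable M (%z. \<psi> (?A z) * (?B z))"
  unfolding e by (intro Bochner_Integration.integrable_sum int)
 show "(LINT z|M. \<psi> (?A z) * (?B z)) = 0"
  unfolding e by (subst Bochner_Integration.integral_sum[OF int]) (auto intro!: sum.neutral orth_past sq)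
qed

lemma psum_variance: "(LINT w|M. (psum n w)^2) = (\<Sum>i<n. LINT w|M. (\<xi> i w)^2)"
proof (induction n)
 case 0 then show ?case by (simp add: psum_def)
next
 case (Suc n)
 have int: "integrable M (%w. psum n w * \<xi> n w)"
  by (rule integrable_mult_squares[OF psum_square square]) measurable
 have "(LINT w|M. (%x. \<Sum>i<n. x i) (initial n \<xi> w) * \<xi> n w) = 0"
  by (rule orth_past) (use psum_square[of n] in \<open>auto simp: initial_def psum_def\<close>)
 then have z: "(LINT w|M. psum n w * \<xi> n w) = 0" by (simp add: initial_def psum_def)
 have "(LINT w|M. (psum (Suc n) w)^2) = (LINT w|M. (psum n w)^2 + ((\<xi> n w)^2 + 2 * (psum n w * \<xi> n w)))"
  by (simp add: psum_def power2_sum mult.assoc add.assoc)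
 also have "... = (LINT w|M. (psum n w)^2) + ((LINT w|M. (\<xi> n w)^2) + 2 * (LINT w|M. psum n w * \<xi> n w))"
  using int psum_square square by simp
 finally show ?case using Suc z by simp
qed

text \<open>Kolmogorov's inequality: the event is split by the first index at which the bound is
  reached. That splitting depends on the past only, so the cross term with the later increment has
  mean 0.\<close>

lemma maximal_inequality:
 assumes l: "l > 0"
 shows "prob {z : space M. EX k<=n. l <= abs(psum k z)} <= (\<Sum>i<n. LINT z|M. (\<xi> i z)^2) / l^2"
proof -
 let ?A = "%A k z. if A k z then 1 else 0"
 let ?B = "{z : space M. EX k<=n. l <= abs(psum k z)}"
 let ?C = "%A k. {z : space M. A k z}"
 let ?D = "%k z. psum k z * (psum n z - psum k z)"
 let ?E = "%k z. abs(psum k z)"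
 let ?F = "%k. initial k \<xi>"
 define \<psi> where "\<psi> k x = (if l <= abs(\<Sum>i<k. x i) & (ALL j<k. abs(\<Sum>i<j. x i) < l) then 1 else 0 :: real)"
   for k and x :: "nat => real"
 have \<psi> [measurable]: "\<psi> k : borel_measurable Hist" for k unfolding \<psi>_def by measurable
 have p: "(\<Sum>i<j. ?F k z i) = psum j z" if "j <= k" for j k z using that by (auto simp: initial_def psum_def intro!: sum.cong)
 define A where "A k z \<longleftrightarrow> l <= ?E k z & (ALL j<k. ?E j z < l)" for k z
 have \<psi>A: "\<psi> k (?F k z) = (?A A k z)" for k z
  unfolding \<psi>_def A_def using p[of _ k z] by auto
 have iA: "integrable M (%z. (?A A k z) * (psum m z)^2)" for k m
 proof (rule bint_bound[OF psum_square[of m]])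
  show "(%z. (?A A k z) * (psum m z)^2) : borel_measurable M" unfolding A_def by measurable
 qed auto
 have step: "l^2 * prob (?C A k) <= (LINT z|M. (?A A k z) * (psum n z)^2)" if k: "k <= n" for k
 proof -
  have "l^2 * prob (?C A k) = (LINT z|M. l^2 * indicator (?C A k) z)" unfolding A_def by simp
  also have "... <= (LINT z|M. (?A A k z) * (psum k z)^2)"
  proof (rule integral_mono[OF _ iA])
   have [measurable]: "(?C A k) : events" unfolding A_def by measurable
   show "integrable M (%z. l^2 * indicator (?C A k) z)"
    by (intro integrable_mult_right integrable_real_indicator) (auto simp: less_top[symmetric])
   fix z
   have "l <= ?E k z ==> l^2 <= (psum k z)^2" using l by (metis abs_le_square_iff abs_of_pos)
   then show "l^2 * indicator (?C A k) z <= (?A A k z) * (psum k z)^2"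
    by (auto simp: indicator_def A_def)
  qed
  also have "... = (LINT z|M. (?A A k z) * (psum k z)^2 + 2 * (\<psi> k (?F k z) * (?D k z)))"
   using orth_event[OF \<psi>, of k k n] k iA by (subst bochner_add) (auto simp: \<psi>_def)
  also have "... <= (LINT z|M. (?A A k z) * (psum n z)^2)"
  proof (rule integral_mono[OF _ iA])
   show "integrable M (%z. (?A A k z) * (psum k z)^2 + 2 * (\<psi> k (?F k z) * (?D k z)))"
    using orth_event(2)[OF \<psi>, of k k n] k iA by (intro bint_add integrable_mult_right) (auto simp: \<psi>_def)
   fix z
   have "(psum k z)^2 + 2 * (?D k z) + (psum n z - psum k z)^2 = (psum n z)^2"
    by (simp add: power2_eq_square algebra_simps)
   then have "(psum k z)^2 + 2 * (?D k z) <= (psum n z)^2"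
    using zero_le_power2[of "psum n z - psum k z"] by linarith
   then show "(?A A k z) * (psum k z)^2 + 2 * (\<psi> k (?F k z) * (?D k z)) <= (?A A k z) * (psum n z)^2"
    unfolding \<psi>A by simp
  qed
  finally show ?thesis .
 qed
 have "?B \<subseteq> (\<Union>k\<le>n. (?C A k))"
 proof
  fix z assume "z : ?B"
  then have z: "z : space M" "EX k. k <= n & l <= ?E k z" by auto
  define k where "k = (LEAST k. k <= n & l <= ?E k z)"
  have k: "k <= n" "l <= ?E k z" using LeastI_ex[OF z(2)] by (auto simp: k_def)
  have "?E j z < l" if "j < k" for j
   using not_less_Least[of j "%k. k <= n & l <= ?E k z"] that k unfolding k_def by auto
  then show "z : (\<Union>k\<le>n. (?C A k))" using z k by (auto simp: A_def)
 qed
 then have "prob ?B <= prob (\<Union>k\<le>n. (?C A k))"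
  by (intro finite_measure_mono) (auto simp: A_def)
 also have "... <= (\<Sum>k\<le>n. prob (?C A k))" by (intro measure_UNION_le) (auto simp: A_def)
 finally have "l^2 * prob ?B <= (\<Sum>k\<le>n. l^2 * prob (?C A k))"
  by (simp add: sum_distrib_left[symmetric] mult_left_mono)
 also have "... <= (\<Sum>k\<le>n. LINT z|M. (?A A k z) * (psum n z)^2)" by (intro sum_mono step) simp
 also have "... = (LINT z|M. (\<Sum>k\<le>n. (?A A k z) * (psum n z)^2))"
  by (rule Bochner_Integration.integral_sum[symmetric]) (rule iA)
 also have "... <= (LINT z|M. (psum n z)^2)"
 proof (rule integral_mono[OF Bochner_Integration.integrable_sum[OF iA] psum_square])
  fix z
  have "(\<Sum>k\<le>n. if A k z then 1 else 0 :: real) <= 1"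
  proof (cases "EX k. A k z")
   case True
   then obtain k where k: "A k z" by blast
   have uniq: "j = k" if "A j z" for j
   proof (rule ccontr)
    assume "j ~= k"
    then consider "j < k" | "k < j" by linarith
    then show False using k that unfolding A_def by cases (auto simp: not_le[symmetric])
   qed
   have "(\<Sum>k\<le>n. if A k z then 1 else 0 :: real) <= (\<Sum>j\<le>n. if j = k then 1 else 0)"
   proof (rule sum_mono)
    fix i show "(if A i z then 1 else 0 :: real) <= (if i = k then 1 else 0)"
     using uniq[of i] by (cases "A i z") simp_all
   qed
   also have "... <= 1" by (simp add: sum.delta)
   finally show ?thesis .
  qed auto
  then have "(\<Sum>k\<le>n. if A k z then 1 else 0 :: real) * (psum n z)^2 <= 1 * (psum n z)^2" by (intro mult_right_mono) auto
  then show "(\<Sum>k\<le>n. (?A A k z) * (psum n z)^2) <= (psum n z)^2" by (simp add: sum_distrib_right)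
 qed
 finally show ?thesis unfolding psum_variance using l by (simp add: field_simps)
qed

lemma shifted: "martingale_differences M (%n. \<xi> (m + n))"
proof
 let ?A = "%n. \<xi> (m + n)"
 fix n and \<psi> :: "(nat => real) => real"
 assume \<psi> [measurable]: "\<psi> : borel_measurable Hist"
  and int: "integrable M (%z. \<psi> (initial n (%n. ?A n) z) * ?A n z)"
 define r where "r x = (%i. x (m + i))" for x :: "nat => real"
 have [measurable]: "r : Hist ->M Hist" unfolding r_def by (rule measurable_PiM_single') (auto simp: space_PiM)
 have e: "initial n (%n. ?A n) z = r (initial (m + n) \<xi> z)" for z by (auto simp: initial_def r_def fun_eq_iff)
 have "(LINT z|M. (\<psi> \<circ> r) (initial (m + n) \<xi> z) * ?A n z) = 0"
  using int by (intro orth) (auto simp: e comp_def)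
 then show "(LINT z|M. \<psi> (initial n (%n. ?A n) z) * ?A n z) = 0" by (simp add: e)
qed (auto intro: square)

lemma scaled:
 assumes c: "!!n. c n ~= 0" shows "martingale_differences M (%n z. \<xi> n z / c n)"
proof
 let ?A = "%n z. \<xi> n z / c n"
 fix n and \<psi> :: "(nat => real) => real"
 assume \<psi> [measurable]: "\<psi> : borel_measurable Hist"
  and int: "integrable M (%z. \<psi> (initial n ?A z) * (\<xi> n z / c n))"
 define r where "r x = (%i. x i / c i)" for x :: "nat => real"
 have [measurable]: "r : Hist ->M Hist" unfolding r_def by (rule measurable_PiM_single') (auto simp: space_PiM)
 have e: "initial n ?A z = r (initial n \<xi> z)" for z by (auto simp: initial_def r_def fun_eq_iff)
 have "integrable M (%z. c n * (\<psi> (initial n ?A z) * (\<xi> n z / c n)))"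
  using int by (rule integrable_mult_right)
 then have "(LINT z|M. (\<psi> \<circ> r) (initial n \<xi> z) * \<xi> n z) = 0"
  using c[of n] by (intro orth) (auto simp: e comp_def)
 then show "(LINT z|M. \<psi> (initial n ?A z) * (\<xi> n z / c n)) = 0" by (simp add: e)
next
 show "integrable M (%z. (\<xi> n z / c n)^2)" for n using square[of n] by (simp add: power_divide)
qed auto

text \<open>Applied after index \<open>m\<close>, the maximal inequality is governed by the tail of
  the variance series. Letting \<open>m\<close> grow, for each tolerance \<open>1 / (j + 1)\<close>,
  makes the partial sums Cauchy almost surely.\<close>

lemma AE_convergent:
 assumes sm: "summable (%i. LINT z|M. (\<xi> i z)^2)" shows "AE z in M. convergent (%n. \<Sum>i<n. \<xi> i z)"
proof -
 let ?v = "%i. LINT z|M. (\<xi> i z)^2"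
 let ?A = "%j. real (Suc j)"
 let ?B = "%m. \<Sum>i. ?v (i + m)"
 have v: "?v i >= 0" for i by simp
 define D where "D j m = {z : space M. EX k. inverse (?A j) <= abs(psum (m + k) z - psum m z)}" for j m
 have D [measurable]: "D j m : events" for j m unfolding D_def by measurable
 have bound: "prob (D j m) <= (?B m) * (?A j)^2" for j m
 proof -
  interpret sh: martingale_differences M "%n. \<xi> (m + n)" by (rule shifted)
  have ps: "sh.psum k z = psum (m + k) z - psum m z" for k z by (induction k) (auto simp: sh.psum_def psum_def)
  define Dn where "Dn n = {z : space M. EX k<=n. inverse (?A j) <= abs(sh.psum k z)}" for n
  have Dn: "Dn n : events" for n unfolding Dn_def by measurable
  have le: "prob (Dn n) <= (?B m) * (?A j)^2" for n
  proof -
   have "prob (Dn n) <= (\<Sum>i<n. ?v (m + i)) / (inverse (?A j))^2"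
    unfolding Dn_def by (rule sh.maximal_inequality) simp
   also have "... = (\<Sum>i<n. ?v (i + m)) * (?A j)^2"
    by (simp add: power_inverse divide_inverse add.commute del: of_nat_Suc)
   also have "... <= (?B m) * (?A j)^2"
    using sm by (intro mult_right_mono sum_le_suminf) (auto intro: summable_ignore_initial_segment)
   finally show ?thesis .
  qed
  have U: "D j m = (\<Union>n. Dn n)" by (auto simp: D_def Dn_def ps)
  have "incseq Dn" by (auto simp: incseq_def Dn_def) (meson order_trans)
  then have "(%n. prob (Dn n)) ----> prob (D j m)" unfolding U using Dn by (intro finite_Lim_measure_incseq) auto
  then show ?thesis using le by (intro LIMSEQ_le_const2) auto
 qed
 have "AE z in M. EX m. z ~: D j m" for j
 proof -
  have lim: "(%m. (?B m) * (?A j)^2) ----> 0 * (?A j)^2"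
   by (intro tendsto_mult tendsto_const suminf_exist_split2 sm)
  have I: "(\<Inter>m. D j m) : events" by measurable
  have "prob (\<Inter>m. D j m) <= (?B m) * (?A j)^2" for m
   by (rule order_trans[OF finite_measure_mono bound[of j m]]) auto
  then have "prob (\<Inter>m. D j m) <= 0 * (?A j)^2" by (intro LIMSEQ_le_const[OF lim]) auto
  then have "prob (\<Inter>m. D j m) = 0" using measure_nonneg[of M "\<Inter>m. D j m"] by linarith
  then have "(\<Inter>m. D j m) : null_sets M" using I by (auto simp: null_sets_def emeasure_eq_measure)
  then show ?thesis by (rule AE_not_in[THEN AE_mp]) auto
 qed
 then have "AE z in M. ALL j. EX m. z ~: D j m" by (simp add: AE_all_countable)
 then show ?thesis using AE_space
 proof eventually_elim
  case (elim z)
  have "Cauchy (%n. psum n z)"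
  proof (rule CauchyI')
   fix e :: real assume "e > 0"
   then obtain j where j: "inverse (?A j) < e / 2" using reals_Archimedean[of "e / 2"] by auto
   obtain m where "z ~: D j m" using elim by blast
   then have m: "abs(psum (m + k) z - psum m z) < e / 2" for k
   proof -
    have "~ inverse (?A j) <= abs(psum (m + k) z - psum m z)"
     using \<open>z \<notin> D j m\<close> elim(2) unfolding D_def by blast
    then show ?thesis using j by linarith
   qed
   have "abs(psum n z - psum m z) < e / 2" if "n >= m" for n using m[of "n - m"] that by simp
   then have "dist (psum n z) (psum n' z) < e" if "n >= m" "n' > n" for n n'
    using that by (smt (verit) dist_real_def field_sum_of_halves order_less_imp_le order_trans)
   then show "EX M. ALL m>=M. ALL n>m. dist (psum m z) (psum n z) < e" by blast
  qed
  then show ?case unfolding psum_def by (rule Cauchy_convergent)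
 qed
qed

theorem strong_law:
 assumes c: "!!n. c n > 0" "incseq c" "filterlim c at_top sequentially"
  and sm: "summable (%i. (LINT z|M. (\<xi> i z)^2) / (c i)^2)"
 shows "AE z in M. (%n. (\<Sum>i<n. \<xi> i z) / c n) ----> 0"
proof -
 have c0: "c n ~= 0" for n using c(1)[of n] by simp
 interpret sc: martingale_differences M "%n z. \<xi> n z / c n" by (rule scaled[OF c0])
 have "AE z in M. convergent (%n. \<Sum>i<n. \<xi> i z / c i)"
  by (rule sc.AE_convergent) (use sm in \<open>simp add: power_divide\<close>)
 then show ?thesis
 proof eventually_elim
  case (elim z)
  from kronecker[OF this c(2,3)] show ?case by (simp add: c0)
 qed
qed

end

section \<open>The recursion behind averages of reinforced steps\<close>

lemma eventually_eq_sum_ratio: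
 fixes a b :: "nat => real"
 assumes eq: "EV i. a i = b i" and c: "filterlim c at_top sequentially"
  and lim: "(%n. (\<Sum>i<n. a i) / c n) ----> l" shows "(%n. (\<Sum>i<n. b i) / c n) ----> l"
proof -
 obtain N where N: "!!i. i >= N ==> a i = b i" using eq by (auto simp: eventually_sequentially)
 define D where "D = (\<Sum>i<N. b i - a i)"
 have D: "(\<Sum>i<n. b i) = (\<Sum>i<n. a i) + D" if "n >= N" for n using that
 proof (induction n rule: dec_induct)
  case base
  then show ?case by (simp add: D_def sum_subtractf)
 next
  case (step n)
  then show ?case using N[of n] by simp
 qed
 have "(%n. (\<Sum>i<n. a i) / c n + D / c n) ----> l + 0"
  by (intro tendsto_add lim real_tendsto_divide_at_top[OF tendsto_const c])
 moreover have "EV n. (\<Sum>i<n. a i) / c n + D / c n = (\<Sum>i<n. b i) / c n"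
  using eventually_ge_at_top[of N] by eventually_elim (simp add: D add_divide_distrib)
 ultimately show ?thesis by (simp add: Lim_transform_eventually)
qed

text \<open>The infimum of the eventual bounds is at most \<open>p\<close> times itself up to an
  arbitrarily small error, hence it is 0.\<close>

lemma tendsto_0_contraction:
 fixes D :: "nat => real"
 assumes p: "0 <= p" "p < 1" and B: "!!n. abs(D n) <= B"
  and contr: "!!L e. L >= 0 ==> EV n. abs(D n) <= L ==> e > 0 ==> EV n. abs(D n) <= p * L + e" shows "D ----> 0"
proof -
 define S where "S = {L. L >= 0 & (EV n. abs(D n) <= L)}"
 have BS: "abs B : S" using B by (auto simp: S_def intro!: always_eventually order_trans[OF B])
 have bdd: "bdd_below S" by (auto simp: S_def intro!: bdd_belowI[of _ 0])
 have I0: "Inf S = 0"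
 proof (rule ccontr)
  assume "Inf S ~= 0"
  moreover have "Inf S >= 0" using BS by (intro cInf_greatest) (blast, simp add: S_def)
  ultimately have pos: "Inf S > 0" by simp
  define e where "e = (1 - p) * Inf S / 4"
  have e: "e > 0" using p pos by (simp add: e_def)
  have "Inf S < Inf S + e" using e by simp
  then obtain L where L: "L : S" "L < Inf S + e" using BS cInf_lessD[of S "Inf S + e"] by blast
  have "p * L + e : S" using L contr[of L e] e p by (auto simp: S_def)
  then have "Inf S <= p * L + e" using bdd by (rule cInf_lower)
  also have "p * L <= p * (Inf S + e)" using L p by (intro mult_left_mono) auto
  also have "p * e <= 1 * e" using e p by (intro mult_right_mono) auto
  then have "p * (Inf S + e) + e <= p * Inf S + 2 * e" by (simp add: algebra_simps)
  also have "... = (1 + p) / 2 * Inf S" by (simp add: e_def field_simps)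
  also have "... < 1 * Inf S" using pos p by (intro mult_strict_right_mono) auto
  finally show False by simp
 qed
 show ?thesis
 proof (rule LIMSEQ_I)
  fix r :: real assume "r > 0"
  then have "Inf S < r" using I0 by simp
  then obtain L where "L : S" "L < r" using BS cInf_lessD[of S r] by blast
  then show "EX no. ALL n>=no. norm (D n - 0) < r" by (auto simp: S_def eventually_sequentially) (metis le_less_trans)
 qed
qed

text \<open>In summed form, \<open>G n / n\<close> is the average of the \<open>\<eta>\<close> plus
  \<open>p\<close> times the average of the earlier \<open>G k / k\<close>. Averaging preserves an
  eventual bound up to a vanishing term, so the bound contracts by the factor
  \<open>p < 1\<close>.\<close>

lemma reinforced_recursion:
 fixes G \<eta> :: "nat => real"
 assumes p: "0 <= p" "p < 1" and G0: "G 0 = 0"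
  and rec: "!!n. G (Suc n) = G n * (1 + p / real n) + \<eta> n"
  and lim: "(%n. (\<Sum>i<n. \<eta> i) / real n) ----> 0" shows "(%n. G n / real n) ----> 0"
proof -
 let ?A = "%n D. \<Sum>k<n. abs(D k)"
 define D where "D n = G n / real n" for n
 define H where "H n = (\<Sum>i<n. \<eta> i)" for n
 have G: "G n = H n + p * (\<Sum>k<n. D k)" for n
 proof (induction n)
  case (Suc n)
  have "G (Suc n) = G n + p * D n + \<eta> n" by (simp add: rec D_def algebra_simps)
  then show ?case using Suc by (simp add: H_def algebra_simps)
 qed (simp add: G0 H_def)
 have D: "abs(D n) <= abs(H n / real n) + p * ((?A n D) / real n)" for n
 proof -
  have "D n = H n / real n + p * ((\<Sum>k<n. D k) / real n)" unfolding D_def[of n] G[of n] by (simp add: add_divide_distrib)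
  then have "abs(D n) <= abs(H n / real n) + abs(p * ((\<Sum>k<n. D k) / real n))" using abs_triangle_ineq by metis
  also have "abs(p * ((\<Sum>k<n. D k) / real n)) = p * (abs(\<Sum>k<n. D k) / real n)" using p by (simp add: abs_mult)
  also have "... <= p * ((?A n D) / real n)" using p by (intro mult_left_mono divide_right_mono sum_abs) auto
  finally show ?thesis by simp
 qed
 have "convergent (%n. H n / real n)" using lim by (auto simp: H_def convergent_def)
 then obtain h where h: "!!n. abs(H n / real n) <= h" using convergent_imp_Bseq[THEN BseqD] by (metis real_norm_def)
 have h0: "h >= 0" using h[of 0] by simp
 have bound: "abs(D n) <= h / (1 - p)" for n
 proof (induction n rule: less_induct)
  case (less n)
  have "(?A n D) / real n <= h / (1 - p)"
  proof (cases "n = 0")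
   case False
   have "(?A n D) <= (\<Sum>k<n. h / (1 - p))" using less by (intro sum_mono) auto
   then show ?thesis using False by (simp add: divide_le_eq mult.commute)
  qed (use h0 p in auto)
  then have "p * ((?A n D) / real n) <= p * (h / (1 - p))" using p by (intro mult_left_mono) auto
  then have "abs(D n) <= h + p * (h / (1 - p))" using D[of n] h[of n] by linarith
  also have "... = h / (1 - p)" using p by (simp add: field_simps)
  finally show ?case .
 qed
 have "D ----> 0"
 proof (rule tendsto_0_contraction[OF p bound])
  fix L e :: real assume L: "L >= 0" "EV n. abs(D n) <= L" and e: "e > 0"
  obtain N where N: "!!n. n >= N ==> abs(D n) <= L" using L by (auto simp: eventually_sequentially)
  define C where "C = (?A N D)"
  have C: "(?A n D) <= C + real n * L" for n
  proof -
   have "(?A n D) <= (\<Sum>k<n. (if k < N then abs(D k) else 0) + L)"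
    using N L by (intro sum_mono) (auto simp: not_less)
   also have "... = (\<Sum>k<n. if k < N then abs(D k) else 0) + real n * L" by (simp add: sum.distrib)
   also have "(\<Sum>k<n. if k < N then abs(D k) else 0) = (\<Sum>k\<in>{..<n} \<inter> {..<N}. abs(D k))"
    by (subst sum.inter_restrict) auto
   also have "... <= C" unfolding C_def by (intro sum_mono2) auto
   finally show ?thesis by simp
  qed
  have "(%n. abs(H n / real n) + p * (C / real n)) ----> abs(0) + p * 0"
  proof (intro tendsto_add tendsto_rabs tendsto_mult)
   show "(%n. C / real n) ----> 0" by (rule real_tendsto_divide_at_top[OF tendsto_const filterlim_real_sequentially])
  qed (use lim in \<open>simp_all add: H_def\<close>)
  then have "EV n. abs(H n / real n) + p * (C / real n) < e" using e by (auto dest: order_tendstoD(2))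
  then show "EV n. abs(D n) <= p * L + e" using eventually_gt_at_top[of 0]
  proof eventually_elim
   case (elim n)
   have "(?A n D) / real n <= (C + real n * L) / real n" by (intro divide_right_mono C) auto
   also have "... = C / real n + L" using elim by (simp add: add_divide_distrib)
   finally have "p * ((?A n D) / real n) <= p * (C / real n + L)" using p by (intro mult_left_mono)
   then have "p * ((?A n D) / real n) <= p * (C / real n) + p * L" by (simp add: algebra_simps)
   then show ?case using D[of n] elim by linarith
  qed
 qed
 then show ?thesis by (simp add: D_def[abs_def])
qed

section \<open>Sums of truncation terms, and the clock\<close>

lemma sum_indicator_below:
 fixes y :: real
 assumes "y >= 0" shows "(\<Sum>k<n. if real (Suc k) < y then 1 else 0) <= y"
proof -
 have "(\<Sum>k<n. if real (Suc k) < y then 1 else 0) <= min (real n) y"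
  using assms by (induction n) (auto simp: min_def split: if_splits)
 then show ?thesis by simp
qed

text \<open>With \<open>y = x^2\<close>, and after multiplication by \<open>abs x\<close>, the bound
  becomes \<open>2 * x^2\<close>, so that a finite second moment suffices to sum the truncation
  errors of the mean. The terms are compared with the increments of \<open>2 * sqrt\<close>.\<close>

lemma sum_sqrt_below:
 fixes y :: real
 assumes "y >= 0" shows "(\<Sum>k<n. if real (Suc k) < y then 1 / sqrt (real (Suc k)) else 0) <= 2 * sqrt y"
proof -
 let ?A = "%n Suc. \<Sum>k<n. if real (Suc k) < y then 1 / sqrt (real (Suc k)) else 0"
 have "(?A n Suc) <= 2 * min (sqrt (real n)) (sqrt y)"
 proof (induction n)
  case (Suc n)
  let ?a = "sqrt (real n)" and ?b = "sqrt (real (Suc n))"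
  have ab: "?a < ?b" "0 <= ?a" "?b^2 - ?a^2 = 1" by simp_all
  have "1 = (?b - ?a) * (?b + ?a)" using ab(3) by (simp add: power2_eq_square algebra_simps)
  also have "... <= (?b - ?a) * (2 * ?b)" using ab by (intro mult_left_mono) auto
  finally have le1: "1 <= (?b - ?a) * (2 * ?b)" .
  have "1 / ?b <= 2 * (?b - ?a)"
  proof -
   have b: "?b > 0" by simp
   have e: "(?b - ?a) * (2 * ?b) = 2 * (?b - ?a) * ?b" by (simp only: ac_simps)
   from le1 show ?thesis unfolding pos_divide_le_eq[OF b] e .
  qed
  note 1 = this
  show ?case
  proof (cases "real (Suc n) < y")
   case True
   then have "?b < sqrt y" by (simp only: real_sqrt_less_iff)
   then have m: "min ?a (sqrt y) = ?a" "min ?b (sqrt y) = ?b" using ab(1) by linarith+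
   have "(?A n Suc) + 1 / ?b <= 2 * ?a + 2 * (?b - ?a)"
    using Suc 1 unfolding m by (rule add_mono)
   also have "... = 2 * ?b" by (simp only: right_diff_distrib)
   finally show ?thesis using True unfolding m by (simp only: sum.lessThan_Suc if_True)
  next
   case False
   have "min ?a (sqrt y) <= min ?b (sqrt y)" using ab(1) by (intro min.mono) auto
   with Suc have "(?A n Suc) + 0 <= 2 * min ?b (sqrt y)" by linarith
   then show ?thesis using False by (simp only: sum.lessThan_Suc if_False)
  qed
 qed (use assms in simp)
 then show ?thesis by simp
qed

text \<open>The terms are compared with \<open>1 / n - 1 / (n + 1)\<close>. Passing to
  \<open>max y 1\<close> changes nothing in the sum and keeps the bound \<open>2 / z\<close> finite
  for small \<open>y\<close>. With \<open>y = x^2\<close> this controls truncated fourth moments by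
  the second moment.\<close>

lemma sum_inverse_squares_above:
 fixes y :: real
 assumes "y >= 0" shows "y^2 * (\<Sum>k<n. if y <= real (Suc k) then 1 / (real (Suc k))^2 else 0) <= 2 * y"
proof -
 let ?A = "%Suc k. real (Suc k)"
 define z where "z = max y 1"
 have z: "z >= 1" "y <= z" by (auto simp: z_def)
 have yz: "y <= ?A Suc k \<longleftrightarrow> z <= ?A Suc k" for k by (auto simp: z_def)
 have "(\<Sum>k<n. if z <= ?A Suc k then 1 / (?A Suc k)^2 else 0) <= (if z <= real n then 2 / z - 1 / real n else 0)"
 proof (induction n)
  case (Suc n)
  consider "z <= real n" | "real n < z" "z <= ?A Suc n" | "?A Suc n < z" by linarith
  then show ?case
  proof cases
   case 1
   then have n: "real n > 0" using z by linarith
   have "1 / (?A Suc n)^2 <= 1 / (real n * ?A Suc n)"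
    using n unfolding power2_eq_square by (intro divide_left_mono mult_right_mono) auto
   also have "... = 1 / real n - 1 / ?A Suc n" using n by (simp add: field_simps)
   finally have "1 / (?A Suc n)^2 <= 1 / real n - 1 / ?A Suc n" .
   then show ?thesis using Suc 1 by (auto simp del: of_nat_Suc)
  next
   case 2
   have "1 / (?A Suc n)^2 <= 1 / ?A Suc n"
    by (intro divide_left_mono) (simp_all add: power2_eq_square del: of_nat_Suc)
   moreover have "1 / ?A Suc n <= 1 / z" using 2 z by (intro divide_left_mono) auto
   ultimately show ?thesis using Suc 2 by (simp del: of_nat_Suc)
  next
   case 3
   then show ?thesis using Suc by simp
  qed
 qed (use z in simp)
 also have "... <= 2 / z" using z by auto
 finally have "y^2 * (\<Sum>k<n. if y <= ?A Suc k then 1 / (?A Suc k)^2 else 0) <= y^2 * (2 / z)"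
  unfolding yz by (intro mult_left_mono) auto
 also have "... = 2 * y * (y / z)" by (simp add: power2_eq_square)
 also have "... <= 2 * y * 1" using z assms by (intro mult_left_mono) (auto simp: divide_le_eq)
 finally show ?thesis by simp
qed

text \<open>The time of the Brownian motion at which the walk is at step \<open>x\<close>.\<close>

definition clock :: "real => real => real" where
 "clock p x = (if p < 1/2 then x powr (1 - 2*p) else ln x)"

text \<open>For \<open>p <= 1/2\<close> this is the constant for which
  \<open>speed p * x powr (- 2*p)\<close> is the derivative of \<open>clock p\<close>, in both
  regimes.\<close>

definition speed :: "real => real" where
 "speed p = (if p < 1/2 then 1 - 2*p else 1)"

lemma speed_pos: "speed p > 0" by (simp add: speed_def)

lemma clock_mono: "1 <= x ==> x <= y ==> clock p x <= clock p y" by (auto simp: clock_def intro!: powr_mono2)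

lemma clock_nonneg: "1 <= x ==> 0 <= clock p x" by (auto simp: clock_def)

lemma clock_at_top: "filterlim (clock p) at_top at_top"
proof (cases "p < 1/2")
 case True
 then have "1 - 2*p > 0" by simp
 then have "filterlim (%x::real. x powr (1 - 2*p)) at_top at_top" by real_asymp
 then show ?thesis using True by (simp add: clock_def[abs_def])
qed (simp add: clock_def[abs_def] ln_at_top)

lemma clock_seq_at_top: "filterlim (%n. clock p (real n)) at_top sequentially"
 by (rule filterlim_compose[OF clock_at_top filterlim_real_sequentially])

lemma clock_3_seq_at_top: "filterlim (%n. clock p (real (n + 3))) at_top sequentially"
 using filterlim_compose[OF clock_seq_at_top filterlim_add_const_nat_at_top[of 3]] by simp

lemma ln_3_ge_1: "1 <= ln (3::real)" using exp_le by (simp add: ln_ge_iff)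

text \<open>The reason for the shift by 3: as \<open>ln 3 >= 1\<close>, the shifted clock is bounded
  away from 0 from the first index on and can serve as a normaliser.\<close>

lemma clock_3_ge_1: "0 < p ==> 1 <= clock p (real (k + 3))"
proof (cases "p < 1/2")
 case True
 then show ?thesis by (simp add: clock_def ge_one_powr_ge_zero)
next
 case False
 have "ln 3 <= ln (real (k + 3))" by (subst ln_le_cancel_iff) auto
 then have "1 <= ln (real (k + 3))" using ln_3_ge_1 by linarith
 then show ?thesis using False by (simp add: clock_def)
qed

lemma power_le_clock: "0 < p ==> p <= 1/2 ==> real (Suc k) powr (1 - 2*p) <= clock p (real (k + 3))"
proof (cases "p < 1/2")
 case True
 then show ?thesis by (auto simp: clock_def intro!: powr_mono2)
next
 case False
 moreover assume "p <= 1/2" "0 < p"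
 ultimately have "1 - 2*p = 0" by simp
 then show ?thesis using clock_3_ge_1[OF \<open>0 < p\<close>, of k] by (simp only: powr_zero_eq_one) simp
qed

text \<open>The slope of the clock is at most 1 beyond 1. Hence rounding a time down to an integer
  changes the clock by at most 1.\<close>

lemma clock_step:
 assumes p: "0 < p" and x: "1 <= x" and u: "0 <= u" "u <= 1" shows "clock p (x + u) <= clock p x + 1"
proof (cases "p < 1/2")
 case True
 have "(x + u) powr (1 - 2*p) = x powr (1 - 2*p) * (1 + u / x) powr (1 - 2*p)"
  using x u by (subst powr_mult[symmetric]) (auto simp: distrib_left)
 also have "(1 + u / x) powr (1 - 2*p) <= (1 + u / x) powr 1" using x u p by (intro powr_mono) auto
 also have "x powr (1 - 2*p) * (1 + u / x) powr 1 = x powr (1 - 2*p) + x powr (1 - 2*p) * u / x"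
  using x u by (simp add: add_nonneg_nonneg algebra_simps)
 also have "x powr (1 - 2*p) * u / x <= x powr 1 * 1 / x"
  using x u p by (intro divide_right_mono mult_mono powr_mono) auto
 finally show ?thesis using True x by (simp add: clock_def)
next
 case False
 have "ln (x + u) = ln x + ln (1 + u / x)"
 proof -
  have "0 <= u / x" using x u by simp
  then have "1 + u / x > 0" by linarith
  then have "ln (x * (1 + u / x)) = ln x + ln (1 + u / x)" using x by (intro ln_mult_pos) auto
  then show ?thesis using x by (simp add: distrib_left)
 qed
 also have "ln (1 + u / x) <= u / x" using x u by (intro ln_add_one_self_le_self) auto
 also have "u / x <= 1" using x u by (simp add: divide_le_eq)
 finally show ?thesis using False by (simp add: clock_def)
qed

lemma clock_shift: "0 < p ==> (%n. clock p (real (n + 3)) / clock p (real n)) ----> 1"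
proof (cases "p < 1/2")
 case True
 moreover from this have "1 - 2*p > 0" by simp
 moreover from this have "(%n. real (n + 3) powr (1 - 2*p) / real n powr (1 - 2*p)) ----> 1" by real_asymp
 ultimately show ?thesis by (simp add: clock_def)
next
 case False
 have "(%n. ln (real (n + 3)) / ln (real n)) ----> 1" by real_asymp
 then show ?thesis using False by (simp add: clock_def)
qed

text \<open>The increments of the shifted clock serve as Toeplitz weights; each summand is
  asymptotic to the corresponding increment because it is essentially the derivative of the
  clock.\<close>

lemma clock_sum:
 assumes p: "0 < p" "p <= 1/2"
 shows "(%n. (\<Sum>k<n. speed p * real (Suc k) powr (- 2*p)) / clock p (real (n + 3))) ----> 1"
proof -
 let ?A = "%k. clock p (real (k + 3))"
 let ?B = "%n. \<Sum>k<n. speed p * real (Suc k) powr (- 2*p)"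
 define w where "w k = clock p (real (k + 4)) - ?A k" for k
 define y where "y k = speed p * real (Suc k) powr (- 2*p) / w k" for k
 have W: "(\<Sum>k<n. w k) = ?A n - clock p 3" for n
  by (induction n) (auto simp: w_def algebra_simps)
 have w: "w k > 0" for k using p by (auto simp: w_def clock_def intro!: powr_less_mono2)
 have y: "y ----> 1"
 proof (cases "p < 1/2")
  case True
  define a where "a = 1 - 2*p"
  have a: "a > 0" "a < 1" and pa: "- 2*p = a - 1" using True p by (auto simp: a_def)
  have "(%k. a * real (Suc k) powr (a - 1) / (real (k + 4) powr a - real (k + 3) powr a)) ----> 1"
   using a by real_asymp
  then show ?thesis using True unfolding y_def w_def clock_def speed_def pa a_def[symmetric] by simp
 next
  case False
  then have p: "p = 1/2" using p by simp
  have "(%k. 1 / real (Suc k) / (ln (real (k + 4)) - ln (real (k + 3)))) ----> 1" by real_asymp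
  then show ?thesis unfolding p y_def w_def clock_def speed_def by (simp add: powr_minus inverse_eq_divide del: of_nat_Suc)
 qed
 have "filterlim (%n. \<Sum>k<n. w k) at_top sequentially"
  unfolding W using filterlim_tendsto_add_at_top[OF tendsto_const[of "- clock p 3"] clock_3_seq_at_top] by simp
 from toeplitz[OF less_imp_le[OF w] this y]
 have "(%n. (?B n) / (?A n - clock p 3)) ----> 1"
  using w unfolding W by (simp add: y_def less_imp_neq[THEN not_sym])
 moreover have "(%n. 1 - clock p 3 / ?A n) ----> 1 - 0"
  by (intro tendsto_diff tendsto_const real_tendsto_divide_at_top[OF tendsto_const clock_3_seq_at_top])
 ultimately have "(%n. (?B n) / (?A n - clock p 3) * (1 - clock p 3 / ?A n)) ----> 1 * (1 - 0)"
  by (rule tendsto_mult)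
 moreover have "EV n. (?B n) / (?A n - clock p 3) * (1 - clock p 3 / ?A n) = (?B n) / ?A n"
 proof -
  have "EV n. ?A n > clock p 3" using clock_3_seq_at_top by (simp add: filterlim_at_top_dense)
  then show ?thesis
  proof eventually_elim
   case (elim n)
   moreover have "?A n >= 1" using p clock_3_ge_1 by blast
   ultimately show ?case by (simp add: field_simps)
  qed
 qed
 ultimately show ?thesis by (simp add: Lim_transform_eventually)
qed

text \<open>To first order \<open>(k + 1) powr (- p)\<close> is
  \<open>k powr (- p) * (1 - p / k)\<close>, and the factor \<open>1 + p / k\<close> cancels the
  term in \<open>1 / k\<close>. This is the choice of the scale \<open>n powr (- p)\<close>.\<close>

lemma scale_step:
 assumes p: "0 < p"
 shows "EX C. ALL k>=1. abs(real (Suc k) powr (- p) * (1 + p / real k) - real k powr (- p)) <= C * real k powr (- p - 2)"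
proof -
 define f where "f k = real (Suc k) powr (- p) * (1 + p / real k) - real k powr (- p)" for k
 have "f : O(%k. real k powr (- p - 2))" unfolding f_def using p by real_asymp
 then obtain c where "EV k. norm (f k) <= c * norm (real k powr (- p - 2))" by (auto elim: landau_o.bigE)
 then obtain N where N: "!!k. k >= N ==> abs(f k) <= c * real k powr (- p - 2)" by (auto simp: eventually_sequentially)
 \<comment> \<open>The maximum over the finitely many early indices extends the asymptotic bound to
   every \<open>k >= 1\<close>.\<close>
 define C where "C = Max (insert c ((%k. abs(f k) / real k powr (- p - 2)) ` {1..N}))"
 show ?thesis unfolding f_def[symmetric]
 proof (intro exI[of _ C] allI impI)
  fix k :: nat assume k: "k >= 1"
  show "abs(f k) <= C * real k powr (- p - 2)"
  proof (cases "k >= N")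
   case True
   have "c <= C" unfolding C_def by (intro Max_ge) auto
   then have "c * real k powr (- p - 2) <= C * real k powr (- p - 2)" by (intro mult_right_mono) auto
   then show ?thesis using N[OF True] by linarith
  next
   case False
   have "abs(f k) / real k powr (- p - 2) <= C" unfolding C_def using False k by (intro Max_ge) auto
   then show ?thesis using k by (simp add: divide_le_eq)
  qed
 qed
qed

section \<open>The law of the reinforced steps\<close>

text \<open>Index \<open>k\<close> is the number of steps already made; the first step has nothing
  to copy.\<close>

definition copy_prob :: "real => nat => real" where
 "copy_prob p k = (if k = 0 then 0 else p)"

text \<open>One uniform variable decides both whether to copy and what: given \<open>u0 < p\<close>,
  the quotient \<open>u0 * k / p\<close> is uniform between 0 and \<open>k\<close>, and its integer
  part selects the earlier step. The \<open>Suc\<close> is there because histories start at index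
  1.\<close>

definition reinforced_cand :: "real => real measure => nat => (nat => real) => real => real => real" where
 "reinforced_cand p \<mu> k w u0 u1 = (if u0 < copy_prob p k then w (Suc (nat (floor(u0 * real k / p)))) else quantile (cdf
   \<mu>) u1)"

lemma measurable_reinforced_cand [measurable]:
 assumes "real_distribution \<mu>"
 shows "(%(w, u0, u1). reinforced_cand p \<mu> k w u0 u1) : borel_measurable (Hist >< borel >< borel)"
proof -
 interpret real_distribution \<mu> by fact
 have [measurable]: "quantile (cdf \<mu>) : borel_measurable borel" by (rule measurable_quantile_const) fact
 have "(%x. fst x (Suc (nat (floor(fst (snd x) * real k / p))))) : borel_measurable (Hist >< borel >< (borel :: real measure))"
  by (rule measurable_compose_countable[where g="%x. Suc (nat (floor(fst (snd x) * real k / p)))"]) measurable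
 then show ?thesis unfolding reinforced_cand_def case_prod_beta by measurable
qed

lemma emeasure_U01_Ico:
 assumes "0 <= a" "a <= b" "b <= 1" shows "emeasure U01 {a..<b} = ennreal (b - a)"
proof -
 interpret prob_space U01 by (rule prob_space_U01)
 have "{a..<b} = {..<b} - {..<a}" by auto
 then have "emeasure U01 {a..<b} = emeasure U01 {..<b} - emeasure U01 {..<a}"
  using assms emeasure_Diff[of U01 "{..<a}" "{..<b}"] by (auto simp: emeasure_U01_less)
 then show ?thesis using assms by (simp add: emeasure_U01_less ennreal_minus)
qed

lemma nn_integral_reinforced_cand:
 assumes \<mu>: "real_distribution \<mu>" and p: "0 < p" "p <= 1" and f [measurable]: "f : borel_measurable borel"
 shows "nn_integral U01 (%u0. nn_integral U01 (%u1. f (reinforced_cand p \<mu> k w u0 u1)))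
   = ennreal (1 - copy_prob p k) * nn_integral \<mu> f + ennreal (copy_prob p k / real k) * (\<Sum>i<k. f (w (Suc i)))"
proof -
 let ?A = "%i. {real i * p / real k..<real (Suc i) * p / real k}"
 let ?B = "%i. f (w (Suc i))"
 let ?C = "nn_integral \<mu> f"
 interpret real_distribution \<mu> by fact
 interpret U: prob_space U01 by (rule prob_space_U01)
 have [measurable]: "quantile (cdf \<mu>) : borel_measurable borel" by (rule measurable_quantile_const) fact
 let ?c = "copy_prob p k"
 have c: "0 <= ?c" "?c <= 1" using p by (auto simp: copy_prob_def)
 have m: "nn_integral U01 (%u1. f (quantile (cdf \<mu>) u1)) = ?C"
  by (subst distr_quantile[OF \<mu>, symmetric], subst nn_integral_distr) auto
 have "nn_integral U01 (%u1. f (reinforced_cand p \<mu> k w u0 u1)) = (\<Sum>i<k. ?B i * indicator (?A i) u0)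
   + ?C * indicator (- {..<?c}) u0"
  if u0: "u0 : {0<..<1}" for u0
 proof (cases "u0 < ?c")
  case True
  then have k: "k > 0" and up: "u0 < p" using u0 by (auto simp: copy_prob_def split: if_splits)
  define i where "i = nat (floor(u0 * real k / p))"
  have "0 <= u0 * real k / p" using u0 p by simp
  then have i: "real i <= u0 * real k / p" "u0 * real k / p < real i + 1" unfolding i_def by linarith+
  have "u0 * real k / p < real k" using k up p by (simp add: divide_less_eq)
  then have ik: "i < k" using i by linarith
  have u: "u0 : (?A j) \<longleftrightarrow> real j <= u0 * real k / p & u0 * real k / p < real j + 1" for j
   using k p by (auto simp: field_simps)
  have "u0 : (?A j) \<longleftrightarrow> j = i" for j
   unfolding u using i by (auto; linarith)
  then have "(\<Sum>j<k. ?B j * indicator (?A j) u0) = (\<Sum>j<k. if j = i then ?B i else 0)"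
   by (intro sum.cong) (auto simp: indicator_def)
  then show ?thesis using True ik by (simp add: reinforced_cand_def U.emeasure_space_1[simplified] i_def)
 next
  case False
  have "u0 ~: (?A j)" if "j < k" for j
  proof -
   have "real (Suc j) * p / real k <= p" using that p by (simp add: divide_le_eq mult.commute del: of_nat_Suc)
   moreover have "p <= u0" using False that by (simp add: copy_prob_def split: if_splits)
   ultimately show ?thesis by auto
  qed
  then have "(\<Sum>j<k. ?B j * indicator (?A j) u0) = 0"
   by (intro sum.neutral) auto
  then show ?thesis using False by (simp add: reinforced_cand_def m)
 qed
 moreover have "AE u0 in U01. u0 : {0<..<1}" unfolding U01_def by (rule AE_uniform_measureI) auto
 ultimately have "nn_integral U01 (%u0. nn_integral U01 (%u1. f (reinforced_cand p \<mu> k w u0 u1))) = nn_integral U01 (%u0.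
   (\<Sum>i<k. ?B i * indicator (?A i) u0) + ?C * indicator (- {..<?c}) u0)"
  by (intro nn_integral_cong_AE) auto
 also have "... = (\<Sum>i<k. ?B i * emeasure U01 (?A i)) + ?C * emeasure U01 (- {..<?c})"
  by (subst nn_integral_add, measurable, subst nn_integral_sum, measurable)
    (simp add: nn_integral_cmult_indicator del: of_nat_Suc)
 also have "(\<Sum>i<k. ?B i * emeasure U01 (?A i)) = (\<Sum>i<k. ?B i * ennreal (?c / real k))"
 proof (intro sum.cong refl)
  fix i assume i: "i : {..<k}"
  then have k: "k > 0" by auto
  have "real (Suc i) * p / real k <= 1 * 1"
  proof -
   have "real (Suc i) / real k * p <= 1 * 1" using i p k by (intro mult_mono) (auto simp: divide_le_eq)
   then show ?thesis by simp
  qed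
  moreover have "real i * p / real k <= real (Suc i) * p / real k" using p by (intro divide_right_mono mult_right_mono) auto
  ultimately have "emeasure U01 (?A i) = ennreal (real (Suc i) * p / real k - real i * p / real k)"
   using p by (intro emeasure_U01_Ico) auto
  also have "real (Suc i) * p / real k - real i * p / real k = ?c / real k"
   using k by (simp add: copy_prob_def field_simps)
  finally show "?B i * emeasure U01 (?A i) = ?B i * ennreal (?c / real k)" by simp
 qed
 also have "emeasure U01 (- {..<?c}) = ennreal (1 - ?c)"
  using emeasure_compl[of "{..<?c}" U01] c U.emeasure_space_1 by (simp add: Compl_eq_Diff_UNIV emeasure_U01_less ennreal_minus
    flip: ennreal_1)
 finally show ?thesis by (simp add: sum_distrib_left mult.commute add.commute)
qed

text \<open>The conditional law of a reinforced step: a fresh value with weight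
  \<open>1 - c\<close>, otherwise one of the \<open>k\<close> earlier values chosen uniformly. In
  the applications \<open>c\<close> is 0 when \<open>k\<close> is.\<close>

locale empirical_mixture = prob_space K for K :: "real measure" +
 fixes \<mu> :: "real measure" and c :: real and k :: nat and y :: "nat => real"
 assumes sets_K [measurable_cong, simp]: "sets K = sets borel" and \<mu>: "real_distribution \<mu>"
  and c: "0 <= c" "c <= 1"
  and nn: "!!f. f : borel_measurable borel ==> nn_integral K f = ennreal (1 - c) * nn_integral \<mu> f
    + ennreal (c / real k) * (\<Sum>i<k. f (y i))"
begin

sublocale \<mu>: real_distribution \<mu> by (rule \<mu>)

lemma integrable_mixture:
 assumes [measurable]: "f : borel_measurable borel" and "integrable \<mu> f" shows "integrable K (f :: real => real)"
proof (rule integrableI_bounded)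
 let ?A = "%x. ennreal (norm (f x))"
 have "nn_integral K ?A = ennreal (1 - c) * nn_integral \<mu> ?A + ennreal (c / real k) * (\<Sum>i<k. ennreal (norm (f (y i))))"
  by (rule nn) measurable
 also have "... < \<infinity>" using assms(2) by (auto simp: integrable_iff_bounded ennreal_mult_less_top)
 finally show "nn_integral K ?A < \<infinity>" .
qed measurable

lemma integral_mixture_nonneg:
 assumes [measurable]: "f : borel_measurable borel" and int: "integrable \<mu> f" and pos: "!!x. f x >= 0"
 shows "(LINT x|K. f x) = (1 - c) * (LINT x|\<mu>. f x) + c / real k * (\<Sum>i<k. f (y i))"
proof -
 let ?A = "LINT x|\<mu>. f x"
 let ?B = "\<Sum>i<k. f (y i)"
 let ?C = "%x. ennreal (f x)"
 have "ennreal (LINT x|K. f x) = nn_integral K ?C"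
  by (rule nn_integral_eq_integral[symmetric]) (use pos integrable_mixture[OF _ int] in auto)
 also have "... = ennreal (1 - c) * nn_integral \<mu> ?C + ennreal (c / real k) * (\<Sum>i<k. ennreal (f (y i)))"
  by (rule nn) measurable
 also have "nn_integral \<mu> ?C = ennreal ?A"
  by (rule nn_integral_eq_integral) (use pos int in auto)
 also have "ennreal (1 - c) * ennreal ?A + ennreal (c / real k) * (\<Sum>i<k. ennreal (f (y i))) = ennreal ((1 - c) * ?A
   + c / real k * ?B)"
  using c pos by (simp add: ennreal_mult[symmetric] ennreal_plus[symmetric] sum_nonneg del: ennreal_plus)
 finally show ?thesis
 proof (subst (asm) ennreal_inj)
  show "0 <= (LINT x|K. f x)" using pos by simp
  have "0 <= ?A" "0 <= ?B" using pos by (auto intro: sum_nonneg)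
  then show "0 <= (1 - c) * ?A + c / real k * ?B"
   using c by (intro add_nonneg_nonneg mult_nonneg_nonneg divide_nonneg_nonneg) auto
 qed
qed

lemma integral_mixture:
 assumes [measurable]: "f : borel_measurable borel" and int: "integrable \<mu> f"
 shows "(LINT x|K. f x) = (1 - c) * (LINT x|\<mu>. f x) + c / real k * (\<Sum>i<k. f (y i))"
proof -
 let ?p = "%x. max (f x) 0" and ?m = "%x. max (- f x) 0"
 let ?A = "\<Sum>i<k. ?p (y i)"
 let ?B = "\<Sum>i<k. ?m (y i)"
 let ?C = "LINT x|\<mu>. ?p x"
 let ?D = "LINT x|\<mu>. ?m x"
 have i: "integrable \<mu> ?p" "integrable \<mu> ?m" using int by auto
 have e: "f = (%x. ?p x - ?m x)" by (auto simp: fun_eq_iff max_def)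
 have iK: "integrable K ?p" "integrable K ?m" using i by (auto intro!: integrable_mixture)
 have \<mu>f: "(LINT x|\<mu>. f x) = ?C - ?D"
  by (subst e) (rule Bochner_Integration.integral_diff[OF i])
 have "(LINT x|K. f x) = (LINT x|K. ?p x) - (LINT x|K. ?m x)"
  by (subst e) (rule Bochner_Integration.integral_diff[OF iK])
 also have "(LINT x|K. ?p x) = (1 - c) * ?C + c / real k * ?A"
  by (rule integral_mixture_nonneg[OF _ i(1)]) auto
 also have "(LINT x|K. ?m x) = (1 - c) * ?D + c / real k * ?B"
  by (rule integral_mixture_nonneg[OF _ i(2)]) auto
 also have "(1 - c) * ?C + c / real k * ?A - ((1 - c) * ?D + c / real k * ?B) = (1 - c) * (LINT x|\<mu>. f x)
   + c / real k * (?A - ?B)"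
  unfolding \<mu>f by (simp only: right_diff_distrib)
 also have "?A - ?B = (\<Sum>i<k. f (y i))"
  unfolding sum_subtractf[symmetric] by (intro sum.cong) (auto simp: max_def)
 finally show ?thesis .
qed

end

text \<open>A characterisation of the law by one-step probabilities on boxes, in place of
  conditional expectations. The given walk and the embedded one are both shown to satisfy
  it.\<close>

definition reinforced_process :: "real => real measure => 'a measure => (nat => 'a => real) => bool" where
 "reinforced_process p \<mu> N Y \<longleftrightarrow> prob_space N & (ALL i. Y i : borel_measurable N) & (ALL k B C.
   range B \<subseteq> sets borel --> C : sets borel --> measure N {z : space N. (ALL i<k. Y i z : B i) & Y k z : C}
   = (1 - copy_prob p k) * measure \<mu> C * measure N {z : space N. ALL i<k. Y i z : B i} + copy_prob p k / real k * (\<Sum>j<k.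
   measure N {z : space N. (ALL i<k. Y i z : B i) & Y j z : C}))"

text \<open>The recursion closes on boxes: asking in addition that an earlier value lie in
  \<open>B k\<close> only shrinks its side \<open>B j\<close> to
  \<open>B j \<inter> B k\<close>.\<close>

lemma reinforced_process_boxes:
 assumes Y: "reinforced_process p \<mu> N Y" and Y': "reinforced_process p \<mu> N' Y'" and B: "range B \<subseteq> sets borel"
 shows "measure N {z : space N. ALL i<k. Y i z : B i} = measure N' {z : space N'. ALL i<k. Y' i z : B i}" using B
proof (induction k arbitrary: B)
 case 0
 interpret N: prob_space N using Y by (simp add: reinforced_process_def)
 interpret N': prob_space N' using Y' by (simp add: reinforced_process_def)
 show ?case by (simp add: N.prob_space N'.prob_space)
next
 let ?A = "%k B j. measure N' {z : space N'. (ALL i<k. Y' i z : B i) & Y' j z : B k}"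
 let ?B = "%k B j. measure N {z : space N. (ALL i<k. Y i z : B i) & Y j z : B k}"
 case (Suc k)
 have s: "(ALL i<Suc k. Z i : B i) \<longleftrightarrow> (ALL i<k. Z i : B i) & Z k : B k" for Z
  by (auto simp: less_Suc_eq)
 have u: "(ALL i<k. Z i : B i) & Z j : B k \<longleftrightarrow> (ALL i<k. Z i : (B(j := B j \<inter> B k)) i)" if "j < k" for Z
   :: "nat => real" and j
  using that by auto
 have Bj: "range (B(j := B j \<inter> B k)) \<subseteq> sets borel" for j
  using Suc.prems by (auto simp: image_subset_iff)
 have "?B k B j = ?A k B j"
  if "j < k" for j using Suc.IH[OF Bj[of j]] u[OF that, of "%i. Y i _"] u[OF that, of "%i. Y' i _"] by presburger
 then have "(\<Sum>j<k. ?B k B j) = (\<Sum>j<k. ?A k B j)"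
  by (intro sum.cong) auto
 moreover have "B k : sets borel" using Suc.prems by auto
 ultimately show ?case unfolding s using Y Y' Suc.IH[OF Suc.prems] Suc.prems unfolding reinforced_process_def by simp
qed

lemma reinforced_process_unique:
 assumes Y: "reinforced_process p \<mu> N Y" and Y': "reinforced_process p \<mu> N' Y'"
 shows "distr N Hist (%z n. Y n z) = distr N' Hist (%z n. Y' n z)"
proof (rule measure_eqI_PiM_infinite)
 let ?A = "prod_emb UNIV"
 let ?B = "distr N Hist (%z n. Y n z)"
 let ?C = "emeasure (distr N' Hist (%z n. Y' n z))"
 interpret N: prob_space N using Y by (simp add: reinforced_process_def)
 interpret N': prob_space N' using Y' by (simp add: reinforced_process_def)
 have [measurable]: "Y i : borel_measurable N" "Y' i : borel_measurable N'" for i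
  using Y Y' by (auto simp: reinforced_process_def)
 have mY [measurable]: "(%z n. Y n z) : N ->M Hist" "(%z n. Y' n z) : N' ->M Hist"
  by (auto intro!: measurable_PiM_single' simp: space_PiM)
 show "finite_measure ?B" by (rule N.finite_measure_distr) measurable
 fix A :: "nat => real set" and J :: "nat set" assume J: "finite J" "J \<subseteq> UNIV" and A: "!!i. i : J ==> A i : sets borel"
 define B where "B i = (if i : J then A i else UNIV)" for i
 have B: "range B \<subseteq> sets borel" using A by (auto simp: B_def)
 define k where "k = Suc (Max (insert 0 J))"
 have kJ: "i < k" if "i : J" for i using that J by (auto simp: k_def less_Suc_eq_le)
 have emb: "?A (%_. borel) J (Pi\<^sub>E J A) = {x. ALL i<k. x i : B i}"
  using kJ by (auto simp: prod_emb_def space_PiM B_def PiE_iff extensional_def restrict_def)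
 have "?A (%_. borel) J (Pi\<^sub>E J A) : sets Hist" using J A by (intro sets_PiM_I) auto
 then have [measurable]: "{x. ALL i<k. x i : B i} : sets Hist" unfolding emb .
 have "emeasure ?B (?A (%_. borel) J (Pi\<^sub>E J A)) = measure N {z : space N. ALL i<k. Y i z : B i}"
  by (subst emeasure_distr) (auto simp: emb N.emeasure_eq_measure intro!: arg_cong[where f="measure N"])
 also have "... = measure N' {z : space N'. ALL i<k. Y' i z : B i}" using reinforced_process_boxes[OF Y Y' B] by simp
 also have "... = ?C (?A (%_. borel) J (Pi\<^sub>E J A))"
  by (subst emeasure_distr) (auto simp: emb N'.emeasure_eq_measure intro!: arg_cong[where f="measure N'"])
 finally show "emeasure ?B (?A (%_. borel) J (Pi\<^sub>E J A)) = ?C (?A (%_. borel) J (Pi\<^sub>E J A))" .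
qed auto

lemma reinforced_process_same_law:
 assumes Y: "reinforced_process p \<mu> N Y" and Y': "reinforced_process p \<mu> N' Y'"
 shows "same_process_law N (%n z. \<Sum>i<n. Y i z) N' (%n z. \<Sum>i<n. Y' i z)"
proof -
 let ?A = "%x n. \<Sum>i<n. x i"
 have [measurable]: "Y i : borel_measurable N" "Y' i : borel_measurable N'" for i
  using Y Y' by (auto simp: reinforced_process_def)
 have mY: "(%z n. Y n z) : N ->M Hist" "(%z n. Y' n z) : N' ->M Hist"
  by (auto intro!: measurable_PiM_single' simp: space_PiM)
 have s: "?A : Hist ->M Hist" by (auto intro!: measurable_PiM_single' simp: space_PiM)
 have "distr (distr N Hist (%z n. Y n z)) Hist ?A = distr (distr N' Hist (%z n. Y' n z)) Hist ?A"
  by (simp only: reinforced_process_unique[OF Y Y'])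
 then show ?thesis unfolding same_process_law_def by (simp add: distr_distr[OF s] mY comp_def)
qed

section \<open>The given walk satisfies the characterisation\<close>

lemma reinforced_step_1: "reinforced_step x e u (Suc 0) = x (Suc 0)" by (subst reinforced_step.simps) simp

lemma reinforced_step_cong:
 assumes "1 <= n" "!!i. 1 <= i ==> i <= n ==> x i = x' i" "!!i. 2 <= i ==> i <= n ==> e i = e' i" "!!i. 2 <= i ==> i <= n
   ==> u i = u' i"
 shows "reinforced_step x e u n = reinforced_step x' e' u' n" using assms
proof (induction n rule: less_induct)
 case (less n)
 show ?case
 proof (cases "n = 1")
  case True
  then show ?thesis using less.prems by (simp add: reinforced_step_1)
 next
  case False
  then have n: "2 <= n" using less.prems by simp
  have "reinforced_step x e u (u n) = reinforced_step x' e' u' (u n)" if "u n : {1..n - 1}"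
   using that less.prems n by (intro less.IH) auto
  then show ?thesis using less.prems n by (auto simp: reinforced_step.simps[of _ _ _ n])
 qed
qed

lemma measurable_reinforced_step:
 assumes "1 <= n" and x: "!!i. 1 <= i ==> i <= n ==> (%z. x i z) : borel_measurable N"
  and e: "!!i. 2 <= i ==> i <= n ==> Measurable.pred N (%z. e i z)"
  and u: "!!i. 2 <= i ==> i <= n ==> (%z. u i z) : N ->M count_space UNIV"
 shows "(%z. reinforced_step (%i. x i z) (%i. e i z) (%i. u i z) n) : borel_measurable N" using assms
proof (induction n rule: less_induct)
 let ?A = "%z. reinforced_step (%i. x i z) (%i. e i z) (%i. u i z)"
 let ?B = "borel_measurable N"
 case (less n)
 have xn [measurable]: "(%z. x n z) : ?B" using less.prems by auto
 show ?case
 proof (cases "n = 1")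
  case True
  then show ?thesis using xn by (simp add: reinforced_step_1)
 next
  case False
  then have n: "2 <= n" using less.prems by simp
  have [measurable]: "Measurable.pred N (%z. e n z)" "(%z. u n z) : N ->M count_space UNIV" using less.prems n by auto
  have IH: "(%z. ?A z j) : ?B" if "j : {1..n - 1}" for j
   using that n by (intro less.IH less.prems) auto
  have eq: "(%z. ?A z n) = (%z. if e n z & u n z : {1..n - 1} then (\<Sum>j\<in>{1..n - 1}. if u n z
    = j then ?A z j else 0) else x n z)"
   (is "_ = (%z. if ?Q z then ?S z else x n z)")
  proof
   fix z
   show "?A z n = (if ?Q z then ?S z else x n z)"
    unfolding reinforced_step.simps[of _ _ _ n] by (cases "?Q z") (simp_all only: if_True
      if_False simp_thms sum.delta' finite_atLeastAtMost)
  qed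
  have S: "?S : ?B"
  proof (rule borel_measurable_sum)
   fix j assume j: "j : {1..n - 1}"
   have "{z : space N. u n z = j} : sets N"
    using measurable_sets[of "u n" N "count_space UNIV" "{j}"] less.prems n by (simp add: vimage_def Int_def conj_commute)
   then show "(%z. if u n z = j then ?A z j else 0) : ?B"
    by (rule measurable_If[OF IH[OF j] measurable_const, rotated]) simp
  qed
  show ?thesis unfolding eq
  proof (rule measurable_If[OF S xn])
   have "Measurable.pred N (%z. u n z : {1..n - 1})" by (rule pred_sets2[where N="count_space UNIV"]) auto
   then show "{z : space N. ?Q z} : sets N" by measurable
  qed
 qed
qed

context step_reinforcement
begin

text \<open>Indexed from 0, like \<open>incoming\<close> for the embedded walk:
  \<open>copied k\<close> is step \<open>k + 1\<close>.\<close>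

definition copied :: "nat => 'a => real" where
 "copied k z = reinforced_step (%i. X i z) (%i. \<epsilon> i z) (%i. U i z) (Suc k)"

lemma copied_measurable [measurable]: "copied k : borel_measurable M"
 unfolding copied_def by (rule measurable_reinforced_step) (use X_measurable \<epsilon>_measurable U_measurable in auto)

definition past_index :: "nat => (nat + nat + nat) set" where
 "past_index k = {1..k} <+> ({2..k} <+> {2..k})"

definition source :: "nat + nat + nat => 'a => real" where
 "source = case_sum X (case_sum (%n z. of_bool (\<epsilon> n z)) (%n z. real (U n z)))"

lemma source_simps [simp]: "source (Inl n) z = X n z" "source (Inr (Inl n)) z = of_bool (\<epsilon> n z)" "source (Inr (Inr n)) z
  = real (U n z)"
 by (simp_all add: source_def)

text \<open>A step recomputed from the real-valued sources; \<open>= 1\<close> and the integer part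
  undo the encodings of coin and index. It exhibits the past as a function of sources that are
  independent of the next triple.\<close>

definition replay :: "(nat + nat + nat => real) => nat => real" where
 "replay z i = reinforced_step (%i. z (Inl i)) (%i. z (Inr (Inl i)) = 1) (%i. nat (floor(z (Inr (Inr i))))) (Suc i)"

lemma measurable_replay:
 assumes "i < k" shows "(%z. replay z i) : borel_measurable (\<Pi>\<^sub>M c\<in>past_index k. borel)"
proof -
 let ?A = "\<Pi>\<^sub>M c\<in>past_index k. borel"
 let ?B = "borel_measurable ?A"
 have [measurable]: "(%z. z c) : ?B" if "c : past_index k" for c
  using that by (rule measurable_component_singleton)
 show ?thesis unfolding replay_def
 proof (rule measurable_reinforced_step)
  fix j :: nat assume j: "2 <= j" "j <= Suc i"
  have [measurable]: "(%z. z (Inr (Inl j))) : ?B"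
   "(%z. z (Inr (Inr j))) : ?B"
   using j assms by (intro measurable_component_singleton; auto simp: past_index_def)+
  show "Measurable.pred ?A (%z. z (Inr (Inl j)) = (1::real))" by measurable
  show "(%z. nat (floor(z (Inr (Inr j)) :: real))) : ?A ->M count_space UNIV" by measurable
 next
  fix j :: nat assume j: "1 <= j" "j <= Suc i"
  show "(%z. z (Inl j)) : ?B"
   using j assms by (intro measurable_component_singleton) (auto simp: past_index_def)
 qed simp
qed

lemma replay_source:
 assumes "i < k" shows "replay (\<lambda>c\<in>past_index k. source c z) i = copied i z"
 unfolding replay_def copied_def
 by (rule reinforced_step_cong) (use assms in \<open>auto simp: past_index_def\<close>)

text \<open>The sources of the first \<open>k\<close> steps and the triple driving step
  \<open>k + 1\<close> are disjoint groups of one independent family, and the triple is independent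
  in itself.\<close>

lemma prob_past_new:
 assumes k: "1 <= k" and P: "{z : space (\<Pi>\<^sub>M c\<in>past_index k. borel). P z} : sets (\<Pi>\<^sub>M c\<in>past_index k.
   borel)" and C: "C : sets borel"
 shows "prob {w : space M. P (\<lambda>c\<in>past_index k. source c w) & X (Suc k) w : C
   & (\<epsilon> (Suc k) w \<longleftrightarrow> b) & U (Suc k) w : V} = prob {w : space M. P (\<lambda>c\<in>past_index k.
   source c w)} * (prob {w : space M. X (Suc k) w : C} * prob {w : space M. \<epsilon> (Suc k) w \<longleftrightarrow> b} * prob
   {w : space M. U (Suc k) w : V})"
proof -
 let ?n = "Suc k" and ?I = "{1..} <+> ({2..} <+> {2..})"
 let ?J = "{Inl ?n, Inr (Inl ?n), Inr (Inr ?n)} :: (nat + nat + nat) set"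
 let ?A = "%w b. \<epsilon> ?n w \<longleftrightarrow> b"
 let ?B = "%w. restrict (%i. source i w)"
 let ?C = "{z : space (\<Pi>\<^sub>M c\<in>past_index k. borel). P z}"
 let ?D = "past_index k"
 let ?E = "%A. \<Inter>c\<in>?J. source c -` A c \<inter> space M"
 let ?F = "%c b. {w : space M. P (\<lambda>c\<in> ?D . source c w) & X ?n w : C & (?A w b) & U ?n w : V}"
 let ?G = "Inr (Inl ?n)"
 let ?H = "Inr (Inr ?n)"
 let ?K = "%b. {w : space M. \<epsilon> ?n w \<longleftrightarrow> b}"
 have ind: "indep_vars (%_. borel) source ?I" using independent by (simp add: source_def)
 have sub: "?D \<subseteq> ?I" "?J \<subseteq> ?I" "?D \<inter> ?J = {}"
  using k by (auto simp: past_index_def)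
 define A where "A c = (case c of Inl _ => C | Inr (Inl _) => {of_bool b} | Inr (Inr _) => real ` V)" for c :: "nat + nat + nat"
 have A: "A c : sets borel" for c
 proof -
  have "countable (real ` V)" by simp
  then have "real ` V : sets borel" by (rule sets.countable[rotated]) simp
  then show ?thesis using C by (simp add: A_def split: sum.split)
 qed
 have 1: "prob (?E A) = (\<Prod>c\<in>?J. prob (source c -` A c \<inter> space M))"
  by (rule indep_varsD[OF ind]) (use sub(2) A in auto)
 have ball3: "(ALL c:{a, b, d}. Q c) \<longleftrightarrow> Q a & Q b & Q d" for a b d :: "nat + nat + nat" and Q by blast
 have m: "source (Inl ?n) w : A (Inl ?n) \<longleftrightarrow> X ?n w : C"
  "source ?G w : A ?G \<longleftrightarrow> (?A w b)"
  "source ?H w : A ?H \<longleftrightarrow> U ?n w : V" for w by (auto simp: A_def)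
 have e: "{w : space M. X ?n w : C} = source (Inl ?n) -` A (Inl ?n) \<inter> space M"
  "(?K b) = source ?G -` A ?G \<inter> space M"
  "{w : space M. U ?n w : V} = source ?H -` A ?H \<inter> space M"
  by (rule set_eqI, simp only: vimage_eq Int_iff mem_Collect_eq m, rule conj_commute)+
 have e3: "{w : space M. X ?n w : C & (?A w b) & U ?n w : V} = (?E A)"
 proof -
  have "{w : space M. X ?n w : C & (?A w b) & U ?n w : V} = {w : space M. X ?n w : C} \<inter> ((?K b) \<inter> ({w : space M.
    U ?n w : V} \<inter> UNIV))"
   by blast
  then show ?thesis unfolding e INT_insert INT_empty .
 qed
 have pr: "(\<Prod>c\<in>?J. f c) = f (Inl ?n) * f ?G * f ?H" for f :: "nat + nat + nat => real" by simp
 define F where "F = Pi\<^sub>E ?J A"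
 have F: "F : sets (\<Pi>\<^sub>M c\<in>?J. borel)" unfolding F_def by (rule sets_PiM_I_finite) (simp, rule A)
 have JF: "(\<lambda>c\<in>?J. source c w) : F \<longleftrightarrow> X ?n w : C & (?A w b) & U ?n w : V" for w
  unfolding F_def restrict_PiE_iff ball3 m ..
 have s: "(\<lambda>c\<in> ?D . source c w) : space (\<Pi>\<^sub>M c\<in> ?D . (borel :: real measure))" for w
  by (auto simp: space_PiM)
 have iv: "indep_var (PiM (?D) (%_. borel)) (%w. ?B w (?D)) (PiM ?J (%_. borel)) (%w. ?B w ?J)"
  by (rule indep_var_restrict[OF ind]) (use sub in auto)
 have "prob (?F c b) = prob ((%w. (?B w (?D), ?B w ?J)) -` (?C \<times> F) \<inter> space M)"
 proof (rule arg_cong[where f=prob], rule set_eqI)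
  fix w
  have "(\<lambda>c\<in>?J. source c w) : F \<longleftrightarrow> X ?n w : C & (?A w b) & U ?n w : V" by (rule JF)
  then show "w : (?F c b) \<longleftrightarrow> w : (%w. (?B w (?D), ?B w ?J)) -` (?C \<times> F) \<inter> space M"
   using s[of w] by (simp only: vimage_eq Int_iff mem_Collect_eq mem_Sigma_iff) auto
 qed
 also have "... = prob ((%w. ?B w (?D)) -` ?C \<inter> space M) * prob ((%w. ?B w ?J) -` F \<inter> space M)"
  by (rule indep_varD[OF iv P F])
 also have "(%w. ?B w (?D)) -` ?C \<inter> space M = {w : space M. P (\<lambda>c\<in> ?D . source c w)}"
  using s by auto
 also have "(%w. ?B w ?J) -` F \<inter> space M = (?E A)"
  by (rule set_eqI) (simp only: vimage_eq Int_iff JF e3[symmetric] mem_Collect_eq, auto)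
 finally show ?thesis unfolding 1 pr e by (simp only: mult.assoc)
qed

lemma prob_\<epsilon>: "2 <= n ==> prob {z : space M. \<epsilon> n z \<longleftrightarrow> b} = (if b then p else 1 - p)"
proof -
 assume n: "2 <= n"
 have "prob {z : space M. \<epsilon> n z \<longleftrightarrow> b} = measure (distr M (count_space UNIV) (\<epsilon> n)) {b}"
  using \<epsilon>_measurable[OF n] by (subst measure_distr) (auto intro!: arg_cong[where f=prob])
 also have "... = pmf (bernoulli_pmf p) b" by (simp add: \<epsilon>_bernoulli[OF n] measure_pmf_single)
 also have "... = (if b then p else 1 - p)" using p_range by auto
 finally show ?thesis .
qed

lemma prob_U: "2 <= n ==> prob {z : space M. U n z : V} = real (card ({1..n - 1} \<inter> V)) / real (n - 1)"
proof -
 assume n: "2 <= n"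
 have "prob {z : space M. U n z : V} = measure (distr M (count_space UNIV) (U n)) V"
  using U_measurable[OF n] by (subst measure_distr) (auto intro!: arg_cong[where f=prob])
 also have "... = measure (measure_pmf (pmf_of_set {1..n - 1})) V" by (simp add: U_uniform[OF n])
 also have "... = real (card ({1..n - 1} \<inter> V)) / real (n - 1)" using n by (subst measure_pmf_of_set) auto
 finally show ?thesis .
qed

lemma prob_X: "1 <= n ==> C : sets borel ==> prob {z : space M. X n z : C} = measure (distr M borel (X 1)) C"
proof -
 assume n: "1 <= n" and C: "C : sets borel"
 have "measure (distr M borel (X n)) C = prob {z : space M. X n z : C}"
  using X_measurable[OF n] C by (subst measure_distr) (auto intro!: arg_cong[where f=prob])
 then show ?thesis using X_identically_distributed[OF n] by simp
qed

text \<open>Either the coin shows \<open>False\<close> and the fresh variable is taken, or it shows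
  \<open>True\<close> and the index selects one of the \<open>k\<close> earlier steps. These
  \<open>k + 1\<close> events are disjoint and cover almost everything.\<close>

lemma prob_copied_new:
 assumes B: "range B \<subseteq> sets borel" and C: "C : sets borel"
 shows "prob {w : space M. (ALL i<k. copied i w : B i) & copied k w : C} = (1 - copy_prob p k) * measure (distr M borel (X 1)) C
   * prob {w : space M. ALL i<k. copied i w : B i} + copy_prob p k / real k * (\<Sum>j<k. prob {w : space M. (ALL i<k.
   copied i w : B i) & copied j w : C})"
proof (cases "k = 0")
 case True
 then show ?thesis using prob_X[of 1 C] C by (simp add: copy_prob_def copied_def reinforced_step_1 prob_space)
next
 let ?B = "%M. \<Pi>\<^sub>M c\<in>past_index k. borel"
 let ?C = "%M. measure (distr M borel (X 1))"
 let ?D = "%M. Measurable.pred M"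
 let ?E = "%D. \<Union>j<k. D j"
 case False
 then have k: "1 <= k" by simp
 let ?n = "Suc k" and ?A = "%w. ALL i<k. copied i w : B i"
 have [measurable]: "B i : sets borel" "C : sets borel" for i using B C by auto
 have [measurable]: "X ?n : borel_measurable M" "?D M (\<epsilon> ?n)" "U ?n : M ->M count_space UNIV"
  using X_measurable[of ?n] \<epsilon>_measurable[of ?n] U_measurable[of ?n] k by auto
 have cp: "copied k w = (if \<epsilon> ?n w & U ?n w : {1..k} then copied (U ?n w - 1) w else X ?n w)" for w
  by (auto simp: copied_def reinforced_step.simps[of _ _ _ ?n])
 have [measurable]: "(%z. replay z i) : borel_measurable (?B M)" if "i < k" for i
  using that by (rule measurable_replay)
 have new: "prob {w : space M. (?A w & (ALL j:J. copied j w : C)) & X ?n w : D & (\<epsilon> ?n w \<longleftrightarrow> b)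
   & U ?n w : V} = prob {w : space M. ?A w & (ALL j:J. copied j w : C)} * (?C M D * (if b then p else 1 - p) * (real (card
   ({1..k} \<inter> V)) / real k))"
  if J: "J \<subseteq> {..<k}" and D: "D : sets borel" for J D b V
 proof -
  let ?P = "%z. (ALL i<k. replay z i : B i) & (ALL j:J. replay z j : C)"
  have J': "finite J" "!!j. j : J ==> j < k" using J finite_subset by auto
  have P: "{z : space (?B M) . ?P z} : sets (?B M)"
  proof -
   have "{z : space (?B M) . ?P z} = {z : space (?B M) . (ALL i:{..<k}. replay z i : B i) & (ALL j:J. replay z j : C)}"
    by auto
   also have "... : sets (?B M)"
    using J' by (intro sets.sets_Collect_conj sets.sets_Collect_finite_All) auto
   finally show ?thesis .
  qed
  have "?P (\<lambda>c\<in>past_index k. source c w) \<longleftrightarrow> ?A w & (ALL j:J. copied j w : C)" for w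
   using J' by (auto simp: replay_source)
  with prob_past_new[OF k P D, of b V] show ?thesis
   using k D prob_X[of ?n D] prob_\<epsilon>[of ?n b] prob_U[of ?n V] by simp
 qed
 have total: "?C M UNIV = 1"
 proof -
  interpret D: prob_space "distr M borel (X 1)" by (rule prob_space_distr[OF X_measurable]) simp
  show ?thesis using D.prob_space by (simp only: space_distr space_borel)
 qed
 define D0 where "D0 = {w : space M. ?A w & X ?n w : C & ~ \<epsilon> ?n w}"
 define D where "D j = {w : space M. ?A w & copied j w : C & \<epsilon> ?n w & U ?n w : {Suc j}}" for j
 have pD0: "prob D0 = prob {w : space M. ?A w} * (?C M C * (1 - p))"
  using new[of "{}" C False UNIV] k C unfolding D0_def by simp
 have pD: "prob (D j) = prob {w : space M. ?A w & copied j w : C} * (p / real k)" if "j < k" for j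
 proof -
  have "{1..k} \<inter> {Suc j} = {Suc j}" using that by auto
  then show ?thesis using new[of "{j}" UNIV True "{Suc j}"] that total unfolding D_def by (simp add: conj_assoc)
 qed
 have "?D M (%w. ALL i:{..<k}. copied i w : B i)"
  by (intro pred_intros_finite finite_lessThan) measurable
 then have pA [measurable]: "?D M ?A" unfolding Ball_def lessThan_iff .
 have pU [measurable]: "?D M (%w. U ?n w : V)" for V
  by (rule pred_sets2[where N="count_space UNIV"]) auto
 have pC [measurable]: "?D M (%w. copied j w : C)" for j by measurable
 have pX [measurable]: "?D M (%w. X ?n w : C)" by measurable
 have D0 [measurable]: "D0 : events" unfolding D0_def by measurable
 have D [measurable]: "D j : events" for j unfolding D_def by measurable
 have "prob {w : space M. U ?n w : - {1..k}} = 0" using prob_U[of ?n "- {1..k}"] k by simp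
 then have null: "emeasure M {w : space M. U ?n w : - {1..k}} = 0" by (simp add: emeasure_eq_measure)
 \<comment> \<open>Indices outside \<open>1..k\<close>, for which the pathwise recursion falls back
   on the fresh variable, have probability 0.\<close>
 have AEU: "AE w in M. U ?n w : {1..k}"
  by (rule AE_I[OF _ null]) (use pU[of "- {1..k}"] in \<open>auto simp: pred_def\<close>)
 have "prob {w : space M. ?A w & copied k w : C} = prob (D0 \<union> (?E D))"
 proof (intro finite_measure_eq_AE)
  show "AE w in M. w : {w : space M. ?A w & copied k w : C} \<longleftrightarrow> w : D0 \<union> (?E D)"
   using AEU
  proof eventually_elim
   case (elim w)
   then obtain i where i: "U ?n w = Suc i" "i < k"
    using not0_implies_Suc[of "U ?n w"] by (metis Suc_le_eq atLeastAtMost_iff not_one_le_zero)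
   have D: "w : (?E D) \<longleftrightarrow> w : space M & ?A w & copied i w : C & \<epsilon> ?n w"
   proof -
    have "w : D j \<longleftrightarrow> w : space M & ?A w & copied j w : C & \<epsilon> ?n w & i = j" for j
     unfolding D_def mem_Collect_eq i(1) singleton_iff nat.inject ..
    moreover have "(EX j:{..<k}. S & T & Q j & E & i = j) \<longleftrightarrow> S & T & Q i & E" for S T E Q using i(2) by auto
    ultimately show ?thesis by (simp only: UN_iff)
   qed
   have D0: "w : D0 \<longleftrightarrow> w : space M & ?A w & X ?n w : C & ~ \<epsilon> ?n w"
    unfolding D0_def mem_Collect_eq ..
   have "copied k w = (if \<epsilon> ?n w then copied i w else X ?n w)" unfolding cp i(1) using i(2) by simp
   then show ?case unfolding Un_iff D D0 mem_Collect_eq by (cases "\<epsilon> ?n w") (simp_all only: if_True if_False simp_thms)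
  qed
  show "{w : space M. ?A w & copied k w : C} : events" by (intro sets.sets_Collect_conj) (use pA pC in \<open>auto simp:
    pred_def\<close>)
 qed (use D0 D in auto)
 also have "... = prob D0 + prob (?E D)" by (rule finite_measure_Union) (auto simp: D0_def D_def)
 also have "prob (?E D) = (\<Sum>j<k. prob (D j))"
  by (rule finite_measure_finite_Union) (auto simp: D_def disjoint_family_on_def)
 also have "prob D0 = (1 - copy_prob p k) * ?C M C * prob {w : space M. ?A w}"
  unfolding pD0 using k by (simp add: copy_prob_def)
 also have "(\<Sum>j<k. prob (D j)) = (\<Sum>j<k. copy_prob p k / real k * prob {w : space M. ?A w & copied j w : C})"
  using k by (intro sum.cong refl) (simp add: pD copy_prob_def)
 finally show ?thesis by (simp add: sum_distrib_left)
qed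

lemma reinforced_walk_eq: "reinforced_walk X \<epsilon> U n z = (\<Sum>i<n. copied i z)"
 unfolding reinforced_walk_def copied_def by (simp add: sum.atLeast1_atMost_eq atLeast0LessThan)

end

section \<open>The embedded reinforced walk\<close>

context embedded_walk
begin

definition incoming :: "nat => 'a => real" where "incoming k z = hist (Suc k) z (Suc k)"
definition elapsed :: "nat => 'a => real" where "elapsed k z = h k * counts (Suc k) z k"
definition time :: "nat => 'a => real" where "time k z = real (pos k z) * h k"

lemma incoming_eq: "incoming k z = step.step_value k (hist k z) (noise k z)" by (simp add: incoming_def hist_Suc)

lemma elapsed_eq: "elapsed k z = h k * real (step.step_count k (hist k z) (noise k z))"
 by (simp add: elapsed_def counts_Suc)

lemma time_0 [simp]: "time 0 z = 0" and time_Suc: "time (Suc k) z = time k z + elapsed k z"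
 using time_step[of k z] by (simp_all add: time_def elapsed_eq)

lemma time_nonneg: "0 <= time k z" using h_pos[of k] by (simp add: time_def)

lemma time_sum: "time n z = (\<Sum>k<n. elapsed k z)" by (induction n) (simp_all add: time_Suc)

lemma hist_incoming: "hist n z (Suc i) = (if i < n then incoming i z else 0)"
 by (induction n) (auto simp: hist_Suc incoming_eq less_Suc_eq)

lemma hist_at_0: "hist n z 0 = 0" by (induction n) (auto simp: hist_Suc)

lemma counts_elapsed: "i < n ==> h i * counts n z i = elapsed i z"
 by (induction n) (auto simp: counts_Suc elapsed_eq less_Suc_eq)

text \<open>Histories only grow, so the earlier ones, and with them the earlier martingale
  differences, can be read off from the latest.\<close>

lemma hist_cut: "k <= n ==> hist k z = (%i. if i <= k then hist n z i else 0)"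
proof
 fix i assume "k <= n"
 then show "hist k z i = (if i <= k then hist n z i else 0)" by (cases i) (auto simp: hist_incoming hist_at_0)
qed

lemma measurable_elapsed [measurable]: "elapsed k : borel_measurable M" unfolding elapsed_def[abs_def] by measurable

lemma measurable_incoming [measurable]: "incoming k : borel_measurable M"
 unfolding incoming_def[abs_def] by measurable

lemma nn_integral_past_noise:
 assumes [measurable]: "(%(w, y). f w y) : borel_measurable (Hist >< Noise)"
 shows "nn_integral M (%q. f (hist k q) (noise k q)) = nn_integral M (%q. nn_integral (step_noise (h k)) (%y. f (hist k q) y))"
 using past_noise_nn_integral[of "%z. f (fst (fst z)) (snd z)" k] by (simp add: past_def)

lemma nn_integral_incoming:
 assumes f [measurable]: "(%(w, x). f w x) : borel_measurable (Hist >< borel)"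
 shows "nn_integral M (%z. f (hist k z) (incoming k z)) = nn_integral M (%z. nn_integral (step.kern k (hist k z)) (%x.
   f (hist k z) x))"
 unfolding incoming_eq by (subst nn_integral_past_noise) (auto simp: step.step_value_law intro!: nn_integral_cong)

lemma initial_past:
 "initial n (%k z. g k (hist k z) (incoming k z) (elapsed k z)) z = (%i. if i < n then g i (%j. if j
   <= i then fst (past n z) j else 0) (fst (past n z) (Suc i)) (h i * snd (past n z) i) else 0)"
proof
 fix i
 show "initial n (%k z. g k (hist k z) (incoming k z) (elapsed k z)) z i = (if i < n then g i (%j. if j
   <= i then fst (past n z) j else 0) (fst (past n z) (Suc i)) (h i * snd (past n z) i) else 0)"
  using hist_cut[of i n z] unfolding past_def fst_conv snd_conv by (simp add: initial_def hist_incoming counts_elapsed)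
qed

text \<open>It suffices that the mean over the noise of a step vanishes for each fixed history: by
  \<open>distr_past_noise\<close> this noise is independent of the past, and the earlier differences
  are functions of the past.\<close>

lemma martingale:
 assumes g [measurable]: "!!k. (%(w, x, t). g k w x t) : borel_measurable (Hist >< borel >< borel)"
  and zero: "!!k w. (LINT y|step_noise (h k). g k w (step.step_value k w y) (h k * real (step.step_count k w y))) = 0"
  and sq: "!!k. integrable M (%q. (g k (hist k q) (incoming k q) (elapsed k q))^2)"
 shows "martingale_differences M (%k q. g k (hist k q) (incoming k q) (elapsed k q))"
proof
 let ?A = "%k q. g k (hist k q) (incoming k q) (elapsed k q)"
 let ?B = "%i z. g i (%j. if j <= i then fst z j else 0) (fst z (Suc i)) (h i * snd z i)"
 let ?C = "borel_measurable (Hist >< Hist)"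
 let ?D = "Hist >< Hist"
 have g' [measurable (raw)]: "(%x. g k (a x) (b x) (c x)) : borel_measurable N"
  if [measurable]: "a : N ->M Hist" "b : borel_measurable N" "c : borel_measurable N" for k a b c and N :: "'z measure"
  using measurable_compose[OF _ g[of k], of "%x. (a x, b x, c x)" N] by simp
 show "(%q. ?A k q) : borel_measurable M" for k
  by (rule measurable_compose[OF _ g[of k], of "%q. (hist k q, incoming k q, elapsed k q)", simplified]) measurable
 fix n and \<psi> :: "(nat => real) => real"
 assume \<psi> [measurable]: "\<psi> : borel_measurable Hist"
  and int: "integrable M (%q. \<psi> (initial n (%k q. ?A k q) q) * ?A n q)"
 let ?Z = "distr M ?D (past n)" and ?Y = "step_noise (h n)"
 define F where "F z = \<psi> (%i. if i < n then ?B i z else 0)" for z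
 have cutm: "(%z j. if j <= i then fst z j else 0) : ?D ->M Hist" for i :: nat
 proof (rule measurable_PiM_single')
  show "(%z. if j <= i then fst z j else 0) : ?C" for j by (cases "j <= i") auto
 qed (auto simp: space_PiM)
 have Fm [measurable]: "F : ?C" unfolding F_def
 proof (rule measurable_compose[OF _ \<psi>], rule measurable_PiM_single')
  fix i
  have [measurable]: "(%z. ?B i z) : ?C"
   by (rule measurable_compose[OF _ g[of i], of "%z. (%j. if j <= i then fst z j else 0, fst z (Suc i), h i * snd z i)",
     simplified])
     (intro measurable_Pair cutm; measurable)
  show "(%z. if i < n then ?B i z else 0) : ?C"
   by measurable
 qed (auto simp: space_PiM)
 define G where "G zy = F (fst zy) * g n (fst (fst zy)) (step.step_value n (fst (fst zy)) (snd zy)) (h n * real (step.step_count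
   n (fst (fst zy)) (snd zy)))" for zy
 have Gm [measurable]: "G : borel_measurable (?D >< Noise)" unfolding G_def
  by (intro borel_measurable_times measurable_compose[OF _ Fm] measurable_compose[OF _ g[of n], of "%zy. (fst (fst zy),
    step.step_value n (fst (fst zy)) (snd zy), h n * real (step.step_count n (fst (fst zy)) (snd zy)))", simplified]) measurable
 interpret Y: prob_space ?Y by (rule prob_space_step_noise[OF h_pos])
 interpret Z: prob_space ?Z by (rule prob_space_distr) measurable
 interpret ZY: pair_sigma_finite ?Z ?Y ..
 have e: "\<psi> (initial n (%k q. ?A k q) q) * ?A n q = G (past n q, noise n q)" for q
  unfolding initial_past G_def F_def incoming_eq[of n] elapsed_eq[of n] past_def fst_conv snd_conv ..
 have pn [measurable]: "(%q. (past n q, noise n q)) : M ->M (?D >< Noise)" by measurable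
 have iG: "integrable (?Z >< ?Y) G"
  unfolding distr_past_noise[symmetric] using int unfolding e by (subst integrable_distr_eq) auto
 have "(LINT q|M. G (past n q, noise n q)) = (LINT p|(?Z >< ?Y). G p)"
  unfolding distr_past_noise[symmetric] by (subst integral_distr) auto
 also have "... = (LINT z|?Z. (LINT y|?Y. G (z, y)))" by (rule ZY.integral_fst'[symmetric, OF iG])
 also have "... = 0" by (simp add: G_def zero)
 finally show "(LINT q|M. \<psi> (initial n (%k q. ?A k q) q) * ?A n q) = 0"
  unfolding e .
qed (rule sq)

text \<open>The discrepancies have means at most \<open>\<epsilon> k\<close>, so their sum has
  finite mean and is finite almost surely.\<close>

lemma AE_summable_gain_error:
 assumes "summable \<epsilon>"
 shows "AE z in M. summable (%k. abs(d k (hist k z) (incoming k z) - (W (time (Suc k) z) z - W (time k z) z)))"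
proof -
 let ?f = "%k z. abs(d k (hist k z) (step.step_value k (hist k z) (noise k z)) - step.step_gain k (hist k z) (noise k z))"
 let ?A = "%M k. nn_integral M (%z. ennreal (?f k z))"
 have m [measurable]: "?f k : borel_measurable M" for k by measurable
 have le: "?A M k <= ennreal (\<epsilon> k)" for k
 proof -
  have "?A M k = nn_integral M (%z. nn_integral (step_noise (h k)) (%y. ennreal (abs(d k (hist k z) (step.step_value k (hist k z)
    y) - step.step_gain k (hist k z) y))))"
   by (rule nn_integral_past_noise[of "%w y. ennreal (abs(d k w (step.step_value k w y) - step.step_gain k w y))"]) measurable
  also have "... <= nn_integral M (%z. ennreal (\<epsilon> k))" by (intro nn_integral_mono step.step_gain_close)
  finally show ?thesis by (simp add: emeasure_space_1)
 qed
 have "nn_integral M (%z. (\<Sum>k. ennreal (?f k z))) = (\<Sum>k. ?A M k)"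
  by (rule nn_integral_suminf) measurable
 also have "... <= (\<Sum>k. ennreal (\<epsilon> k))" by (intro suminf_le le) auto
 also have "... < \<infinity>" using assms step.\<epsilon>_nonneg by (simp add: suminf_ennreal2)
 finally have "AE z in M. (\<Sum>k. ennreal (?f k z)) ~= \<infinity>" by (intro nn_integral_noteq_infinite) auto
 then show ?thesis using AE_space
 proof eventually_elim
  case (elim z)
  then have "summable (%k. ?f k z)" by (intro summable_suminf_not_top) auto
  then show ?case using W_step[OF elim(2)] by (simp add: time_def incoming_eq)
 qed
qed

section \<open>Elapsed time against conditional variance\<close>

definition mean_elapsed :: "nat => (nat => real) => real" where
 "mean_elapsed k w = (LINT y|step_noise (h k). h k * real (step.step_count k w y))"

definition variation :: "nat => (nat => real) => real" where
 "variation k w = (LINT x|step.kern k w. (d k w x)^2)"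

lemma d_square_bound: "(d k w x)^2 <= (R k)^2"
 using step.d_bound[of k w x] by (metis abs_ge_zero power2_abs power_mono)

lemma count_square_integrable: "integrable (step_noise (h k)) (%y. (h k * real (step.step_count k w y))^2)"
proof (rule integrableI_bounded)
 let ?A = "nn_integral (step_noise (h k)) (%y. ennreal (norm ((h k * real (step.step_count k w y))^2)))"
 let ?B = "nn_integral (step.kern k w) (%x. ennreal ((d k w x)^4))"
 interpret \<kappa>: prob_space "step.kern k w" by (rule step.prob_space_kern)
 have "?A <= 6 * ?B + ennreal (\<epsilon> k)"
  using step.step_count_square[of k w] by simp
 also have "?B <= nn_integral (step.kern k w) (%x. ennreal ((R k)^4))"
 proof (intro nn_integral_mono ennreal_leI)
  fix x
  have "((d k w x)^2)^2 <= ((R k)^2)^2" by (intro power_mono d_square_bound) auto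
  then show "(d k w x)^4 <= (R k)^4" by simp
 qed
 finally show "?A < \<infinity>"
  by (simp add: \<kappa>.emeasure_space_1[simplified] add_left_mono mult_left_mono ennreal_mult_less_top less_top[symmetric])
    (auto simp: top_unique ennreal_mult_eq_top_iff)
qed measurable

lemma count_integrable: "integrable (step_noise (h k)) (%y. h k * real (step.step_count k w y))"
proof -
 interpret Y: prob_space "step_noise (h k)" by (rule prob_space_step_noise[OF h_pos])
 show ?thesis by (rule Y.square_integrable_imp_integrable[OF _ count_square_integrable]) measurable
qed

lemma mean_elapsed_close: "abs(mean_elapsed k w - variation k w) <= \<epsilon> k"
proof -
 let ?A = "mean_elapsed k w"
 interpret \<kappa>: prob_space "step.kern k w" by (rule step.prob_space_kern)
 have 1: "nn_integral (step_noise (h k)) (%y. ennreal (h k * real (step.step_count k w y))) = ennreal (?A)"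
  unfolding mean_elapsed_def using h_pos[of k] by (intro nn_integral_eq_integral count_integrable) auto
 have "integrable (step.kern k w) (%x. (d k w x)^2)"
  by (rule \<kappa>.integrable_const_bound[of _ "(R k)^2"]) (auto simp: d_square_bound)
 then have 2: "nn_integral (step.kern k w) (%x. ennreal ((d k w x)^2)) = ennreal (variation k w)"
  unfolding variation_def by (intro nn_integral_eq_integral) auto
 have nn: "0 <= ?A" "0 <= variation k w" using h_pos[of k] by (auto simp: mean_elapsed_def variation_def)
 have "?A <= variation k w + \<epsilon> k" "variation k w <= ?A + \<epsilon> k"
  using step.step_count_mean[of k w] nn step.\<epsilon>_nonneg[of k] unfolding 1 2 by (auto simp flip: ennreal_plus)
 then show ?thesis by linarith
qed

lemma measurable_mean_elapsed [measurable (raw)]: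
 assumes [measurable]: "a : N ->M Hist" shows "(%x. mean_elapsed k (a x)) : borel_measurable N"
proof -
 interpret Y: prob_space "step_noise (h k)" by (rule prob_space_step_noise[OF h_pos])
 show ?thesis unfolding mean_elapsed_def by measurable
qed

text \<open>Elapsed times minus their conditional means are martingale differences with mean squares
  at most \<open>6 * B k + \<epsilon> k\<close>, so the strong law applies. The conditional means
  differ from the conditional variances of the jumps by at most the summable
  \<open>\<epsilon> k\<close>.\<close>

lemma AE_time_variation:
 assumes c: "!!n. 0 < c n" "incseq c" "filterlim c at_top sequentially" and \<epsilon>: "summable \<epsilon>"
  and B: "!!k. nn_integral M (%z. nn_integral (step.kern k (hist k z)) (%x. ennreal ((d k (hist k z) x)^4))) <= ennreal (B k)"
  and B0: "!!k. 0 <= B k" and sm: "summable (%k. B k / (c k)^2)"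
 shows "AE z in M. (%n. (time n z - (\<Sum>k<n. variation k (hist k z))) / c n) ----> 0"
proof -
 let ?A = "%g k z. g k (hist k z) (incoming k z) (elapsed k z)"
 let ?B = "%k z. nn_integral (step.kern k (hist k z)) (%x. ennreal ((d k (hist k z) x)^4))"
 let ?C = "%k. \<epsilon> k"
 let ?D = "%k. step_noise (h k)"
 let ?E = "%k z. mean_elapsed k (hist k z)"
 let ?F = "%M g k. LINT z|M. (?A g k z)^2"
 let ?G = "%M. nn_integral M"
 let ?H = "%k z. variation k (hist k z)"
 let ?I = "%k. nn_integral (?D k)"
 define g where "g k w (x::real) t = t - mean_elapsed k w" for k w and x t :: real
 have gm [measurable]: "(%(w, x, t). g k w x t) : borel_measurable (Hist >< borel >< borel)" for k
  unfolding g_def by measurable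
 have bound: "?G M (%z. ennreal ((?A g k z)^2)) <= ennreal (6 * B k + ?C k)" for k
 proof -
  interpret Y: prob_space "?D k" by (rule prob_space_step_noise[OF h_pos])
  have "?G M (%z. ennreal ((?A g k z)^2)) = ?G M (%z. ?I k (%y. ennreal ((h k * real (step.step_count k (hist k z) y) - ?E k
    z)^2)))"
   unfolding g_def elapsed_eq
   by (rule nn_integral_past_noise[of "%w y. ennreal ((h k * real (step.step_count k w y) - mean_elapsed k w)^2)"]) measurable
  also have "... <= ?G M (%z. 6 * ?B k z + ennreal (?C k))"
  proof (rule nn_integral_mono)
   fix z
   let ?\<theta> = "%y. h k * real (step.step_count k (hist k z) y)" and ?m = "?E k z"
   have m: "?m = Y.expectation ?\<theta>" by (simp add: mean_elapsed_def)
   have i: "integrable (?D k) (%y. (?\<theta> y)^2)" "integrable (?D k) ?\<theta>"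
    by (rule count_square_integrable, rule count_integrable)
   have iv: "integrable (?D k) (%y. (?\<theta> y - ?m)^2)"
   proof -
    have "(?\<theta> y - ?m)^2 = (?\<theta> y)^2 - 2 * ?m * ?\<theta> y + ?m^2" for y by (simp add: power2_diff)
    then show ?thesis using i by (simp only:) (intro bint_add bint_diff integrable_mult_right; simp)
   qed
   have "?I k (%y. ennreal ((?\<theta> y - ?m)^2)) = ennreal (Y.variance ?\<theta>)"
    unfolding m[symmetric] by (rule nn_integral_eq_integral[OF iv]) auto
   also have "Y.variance ?\<theta> <= Y.expectation (%y. (?\<theta> y)^2)" using Y.variance_eq[OF i(2,1)] by simp
   then have "ennreal (Y.variance ?\<theta>) <= ennreal (Y.expectation (%y. (?\<theta> y)^2))" by (rule ennreal_leI)
   also have "... = ?I k (%y. ennreal ((?\<theta> y)^2))"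
    by (rule nn_integral_eq_integral[OF i(1), symmetric]) auto
   also have "... <= 6 * ?B k z + ennreal (?C k)"
    by (rule step.step_count_square)
   finally show "?I k (%y. ennreal ((?\<theta> y - ?m)^2)) <= 6 * ?B k z + ennreal (?C k)" .
  qed
  also have "... = 6 * ?G M (%z. ?B k z) + ennreal (?C k)"
   by (subst nn_integral_add, measurable, subst nn_integral_cmult, measurable) (simp add: emeasure_space_1)
  also have "... <= 6 * ennreal (B k) + ennreal (?C k)" by (intro add_right_mono mult_left_mono B) auto
  also have "... = ennreal (6 * B k + ?C k)"
   using B0[of k] step.\<epsilon>_nonneg[of k] by (simp add: ennreal_plus ennreal_mult)
  finally show ?thesis .
 qed
 have sq: "integrable M (%z. (?A g k z)^2)" for k
 proof (rule integrableI_bounded)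
  show "(%z. (?A g k z)^2) : borel_measurable M" unfolding g_def by measurable
  show "?G M (%z. ennreal (norm ((?A g k z)^2))) < \<infinity>"
   using bound[of k] by (simp add: less_top[symmetric]) (metis ennreal_less_top infinity_ennreal_def leD less_top
     top.not_eq_extremum)
 qed
 have "martingale_differences M (%k z. ?A g k z)"
 proof (rule martingale[OF gm _ sq])
  fix k w
  interpret Y: prob_space "?D k" by (rule prob_space_step_noise[OF h_pos])
  show "(LINT y|?D k . g k w (step.step_value k w y) (h k * real (step.step_count k w y))) = 0"
   unfolding g_def using count_integrable[of k w] by (simp add: mean_elapsed_def Y.prob_space[simplified])
 qed
 then interpret D: martingale_differences M "%k z. ?A g k z" .
 \<comment> \<open>A positive lower bound of the normaliser, so that
   \<open>\<epsilon> k / (c k)^2\<close> inherits summability.\<close>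
 have c1: "EX a>0. ALL k. a <= (c k)^2"
 proof (intro exI[of _ "(c 0)^2"] conjI allI)
  show "(c 0)^2 > 0" using c(1)[of 0] by simp
  show "(c 0)^2 <= (c k)^2" for k using c(1)[of 0] c(2) by (intro power_mono) (auto simp: incseq_def)
 qed
 then obtain a where a: "a > 0" "!!k. a <= (c k)^2" by blast
 have "summable (%k. (?F M g k) / (c k)^2)"
 proof (rule summable_comparison_test'[of "%k. 6 * (B k / (c k)^2) + ?C k / a"])
  show "summable (%k. 6 * (B k / (c k)^2) + ?C k / a)"
   by (intro summable_add summable_mult summable_divide sm \<epsilon>)
  fix k
  have "ennreal (?F M g k) <= ennreal (6 * B k + ?C k)"
   using bound[of k] nn_integral_eq_integral[OF sq[of k]] by simp
  then have "(?F M g k) <= 6 * B k + ?C k"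
   using B0[of k] step.\<epsilon>_nonneg[of k] by (subst (asm) ennreal_le_iff) auto
  then have "(?F M g k) / (c k)^2 <= (6 * B k + ?C k) / (c k)^2"
   by (intro divide_right_mono) auto
  also have "... = 6 * (B k / (c k)^2) + ?C k / (c k)^2" by (simp add: add_divide_distrib)
  also have "?C k / (c k)^2 <= ?C k / a" using a(1) a(2)[of k] step.\<epsilon>_nonneg[of k] c(1)[of k]
    by (intro divide_left_mono) auto
  finally show "norm ((?F M g k) / (c k)^2) <= 6 * (B k / (c k)^2) + ?C k / a" by simp
 qed
 from D.strong_law[OF c this] show ?thesis
 proof eventually_elim
  case (elim z)
  have sm': "summable (%k. ?E k z - ?H k z)"
   by (rule summable_comparison_test'[OF \<epsilon>]) (use mean_elapsed_close in auto)
  then have "(%n. \<Sum>k<n. ?E k z - ?H k z) ----> (\<Sum>k. ?E k z - ?H k z)"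
   by (rule summable_LIMSEQ)
  then have "(%n. (\<Sum>k<n. ?E k z - ?H k z) / c n) ----> 0"
   by (rule real_tendsto_divide_at_top[OF _ c(3)])
  from tendsto_add[OF elim this]
  show ?case by (simp add: g_def time_sum sum_subtractf add_divide_distrib[symmetric])
 qed
qed

end

section \<open>Truncation and the centred, scaled jumps\<close>

lemma summable_integrals:
 fixes f :: "nat => 'a => real"
 assumes F: "integrable N F" and f [measurable]: "!!k. f k : borel_measurable N"
  and nn: "!!k x. 0 <= f k x" and le: "!!n x. (\<Sum>k<n. f k x) <= F x"
 shows "integrable N (f k)" "summable (%k. LINT x|N. f k x)"
proof -
 have fF: "f k x <= F x" for k x
 proof -
  have "f k x <= (\<Sum>j<Suc k. f j x)" using nn by (intro member_le_sum) auto
  then show ?thesis using le[where n="Suc k"] order_trans by blast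
 qed
 have i: "integrable N (f k)" for k
 proof (rule bint_bound[OF F])
  show "AE x in N. norm (f k x) <= norm (F x)" using fF nn by (auto intro!: AE_I2 order_trans[OF fF])
 qed measurable
 then show "integrable N (f k)" .
 show "summable (%k. LINT x|N. f k x)"
 proof (rule summableI_nonneg_bounded)
  show "0 <= (LINT x|N. f k x)" for k using nn by simp
  fix n
  have "(\<Sum>k<n. LINT x|N. f k x) = (LINT x|N. (\<Sum>k<n. f k x))"
   using i by (subst Bochner_Integration.integral_sum) auto
  also have "... <= (LINT x|N. F x)" by (intro integral_mono F Bochner_Integration.integrable_sum i le)
  finally show "(\<Sum>k<n. LINT x|N. f k x) <= (LINT x|N. F x)" .
 qed
qed

lemma (in prob_space) nn_variance_le:
 fixes f :: "'a => real"
 assumes [measurable]: "f : borel_measurable M" and sq: "integrable M (%x. (f x)^2)"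
 shows "nn_integral M (%x. ennreal ((f x - expectation f)^2)) <= nn_integral M (%x. ennreal ((f x)^2))"
proof -
 let ?A = "expectation f"
 have f: "integrable M f" by (rule square_integrable_imp_integrable[OF _ sq]) measurable
 have "(f x - ?A)^2 = (f x)^2 - 2 * ?A * f x + (?A)^2" for x by (simp add: power2_diff)
 then have iv: "integrable M (%x. (f x - ?A)^2)"
  using f sq by (simp only:) (intro bint_add bint_diff integrable_mult_right; simp)
 have "nn_integral M (%x. ennreal ((f x - ?A)^2)) = ennreal (variance f)"
  by (rule nn_integral_eq_integral[OF iv]) auto
 also have "... <= ennreal (expectation (%x. (f x)^2))" using variance_eq[OF f sq] by (intro ennreal_leI) simp
 also have "... = nn_integral M (%x. ennreal ((f x)^2))" by (rule nn_integral_eq_integral[OF sq, symmetric]) auto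
 finally show ?thesis .
qed

lemma (in prob_space) expectation_square_le:
 fixes f :: "'a => real"
 assumes [measurable]: "f : borel_measurable M" and sq: "integrable M (%x. (f x)^2)"
 shows "(expectation f)^2 <= expectation (%x. (f x)^2)"
proof -
 have f: "integrable M f" by (rule square_integrable_imp_integrable[OF _ sq]) measurable
 have "0 <= variance f" by simp
 then show ?thesis using variance_eq[OF f sq] by simp
qed

text \<open>The cut is on the argument, at \<open>abs x <= sqrt (k + 1)\<close>, and the same for
  each \<open>g\<close>; one almost sure statement then removes the truncation of values and of
  squares alike.\<close>

definition trunc :: "nat => (real => real) => real => real" where
 "trunc k g x = (if x^2 <= real (Suc k) then g x else 0)"

lemma measurable_trunc [measurable]:
 assumes [measurable]: "g : borel_measurable borel" shows "trunc k g : borel_measurable borel"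
 unfolding trunc_def[abs_def] by measurable

lemma abs_trunc_le: "abs(trunc k g x) <= abs(g x)" by (simp add: trunc_def)

locale square_integrable_law = real_distribution \<mu> for \<mu> +
 fixes p :: real
 assumes p: "0 < p" "p <= 1/2" and square: "integrable \<mu> (%x. x^2)"
  and variance_pos: "variance (%x. x) > 0"
begin

lemma borel_measurable_\<mu> [measurable_dest]: "g : borel_measurable borel ==> g : borel_measurable \<mu>" by simp

definition m :: real where "m = expectation (%x. x)"
definition v :: real where "v = variance (%x. x)"
text \<open>Turns the limiting conditional variances \<open>(s (Suc k))^2 * v\<close> into
  \<open>speed p * (k + 1) powr (- 2*p)\<close>, whose sums are asymptotic to the clock.\<close>

definition b :: real where "b = sqrt (speed p / v)"
definition s :: "nat => real" where "s n = b * real n powr (- p)"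
text \<open>The mean of the truncated next value under its conditional law. The earlier values,
  being possible outcomes, are truncated at the current level too, which makes the jump bounded and
  exactly centred.\<close>

definition tmean :: "nat => (nat => real) => real" where
 "tmean k w = (1 - copy_prob p k) * (LINT x|\<mu>. trunc k (%x. x) x) + copy_prob p k / real k * (\<Sum>i<k. trunc k (%x.
   x) (w (Suc i)))"
definition jump :: "nat => (nat => real) => real => real" where
 "jump k w x = s (Suc k) * (trunc k (%x. x) x - tmean k w)"
definition jump_bound :: "nat => real" where "jump_bound k = s (Suc k) * (2 * sqrt (real (Suc k)))"

lemma identity_integrable: "integrable \<mu> (%x. x)"
 by (rule square_integrable_imp_integrable[OF _ square]) measurable

lemma v_pos: "v > 0" and b_pos: "b > 0" using variance_pos speed_pos[of p] by (simp_all add: v_def b_def)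

lemma s_nonneg: "s n >= 0" and s_pos: "n > 0 ==> s n > 0" using b_pos by (simp_all add: s_def)

lemma copy_prob_range: "0 <= copy_prob p k" "copy_prob p k <= 1" using p by (auto simp: copy_prob_def)

lemma integrable_trunc: "g : borel_measurable borel ==> integrable \<mu> g ==> integrable \<mu> (trunc k g)"
 by (rule bint_bound) (auto simp: abs_trunc_le)

lemma integral_trunc_tendsto:
 assumes [measurable]: "g : borel_measurable borel" and g: "integrable \<mu> g"
 shows "(%k. LINT x|\<mu>. trunc k g x) ----> (LINT x|\<mu>. g x)"
proof (rule integral_dominated_convergence[where w="%x. abs(g x)"])
 show "AE x in \<mu>. (%k. trunc k g x) ----> g x"
 proof (intro AE_I2 tendsto_eventually)
  fix x
  show "EV k. trunc k g x = g x"
   using eventually_ge_at_top[of "nat \<lceil>x^2\<rceil>"] by eventually_elim (auto simp: trunc_def nat_ceiling_le_eq)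
 qed
 show "AE x in \<mu>. norm (trunc k g x) <= abs(g x)" for k by (simp add: abs_trunc_le)
qed (use g in auto)

lemma empirical_mixture_cand:
 assumes [measurable_cong]: "sets K = sets borel" and "prob_space K"
  and "!!f. f : borel_measurable borel ==> nn_integral K f = nn_integral U01 (%u0. nn_integral U01 (%u1.
    f (reinforced_cand p \<mu> k w u0 u1)))"
 shows "empirical_mixture K \<mu> (copy_prob p k) k (%i. w (Suc i))"
proof -
 interpret K: prob_space K by fact
 show ?thesis
 proof (intro empirical_mixture.intro empirical_mixture_axioms.intro)
  show "prob_space K" by fact
  show "sets K = sets borel" by fact
  show "real_distribution \<mu>" by (rule real_distribution_axioms)
  show "0 <= copy_prob p k" "copy_prob p k <= 1" by (rule copy_prob_range)+
  fix f :: "real => ennreal" assume "f : borel_measurable borel"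
  then show "nn_integral K f = ennreal (1 - copy_prob p k) * nn_integral \<mu> f + ennreal (copy_prob p k / real k) * (\<Sum>i<k.
    f (w (Suc i)))"
   using assms(3)[of f] p by (subst nn_integral_reinforced_cand[symmetric]) (auto intro: real_distribution_axioms)
 qed
qed

lemma measurable_tmean [measurable (raw)]:
 assumes [measurable]: "a : N ->M Hist" shows "(%x. tmean k (a x)) : borel_measurable N"
 unfolding tmean_def by measurable

lemma abs_trunc_bound: "abs(trunc k (%x. x) x) <= sqrt (real (Suc k))"
 using real_le_rsqrt[of "abs x" "real (Suc k)"] by (auto simp: trunc_def)

text \<open>The meshes are powers of \<open>1/2\<close> whose exponents are partial sums of the
  \<open>n j\<close>. They fall below the admissible \<open>v0 k\<close>, and the ratio of
  neighbours is the integer \<open>2 ^ n (Suc k)\<close>, as nested grids require.\<close>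

lemma reinforced_embedding_exists:
 "EX h K q. embedded_walk seed BM odd_coord (reinforced_cand p \<mu>) jump jump_bound (%k. (1/2) ^ k) h K q"
proof -
 let ?A = "reinforced_cand p \<mu>"
 let ?B = "%k. trunc k (%x. x)"
 let ?C = "%k. jump_bound k"
 let ?D = "%k. exit_good ((1/2) ^ k)"
 let ?E = "%k w. LINT u|(U01 >< U01). jump k w (?A k w (fst u) (snd u))"
 have R: "0 <= ?C k" for k using s_nonneg by (simp add: jump_bound_def)
 have "ALL k. EX v0>0. ALL v. 0 < v & v <= v0 --> (EX K. ALL a b. 0 <= a & a <= ?C k & 0 <= b & b <= ?C k --> ?D k v K a b)"
  using exit_good_eventually R by simp
 then obtain v0 where v0: "!!k. v0 k > 0"
  "!!k v. 0 < v ==> v <= v0 k ==> EX K. ALL a b. 0 <= a & a <= ?C k & 0 <= b & b <= ?C k --> ?D k v K a b"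
  by metis
 have "ALL k. EX n. (1/2 :: real) ^ n < v0 k" using v0(1) by (auto intro!: real_arch_pow_inv)
 then obtain n where n: "!!k. (1/2 :: real) ^ n k < v0 k" by metis
 define h :: "nat => real" where "h k = (1/2) ^ (\<Sum>j\<le>k. n j)" for k
 have h: "0 < h k" "h k <= v0 k" for k
 proof -
  have "h k <= (1/2) ^ n k" unfolding h_def by (intro power_decreasing member_le_sum) auto
  then show "h k <= v0 k" using n[of k] by linarith
 qed (simp add: h_def)
 from v0(2)[OF h] obtain K where K: "!!k a b. 0 <= a ==> a <= ?C k ==> 0 <= b ==> b <= ?C k ==> ?D k (h k) (K k) a b"
  by metis
 have rd: "real_distribution \<mu>" by (rule real_distribution_axioms)
 have "embedding_step (?A k) (jump k) (?C k) ((1/2) ^ k) (h k) (K k)" for k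
 proof
  show [measurable]: "(%(w, u0, u1). ?A k w u0 u1) : borel_measurable (Hist >< borel >< borel)"
   by (rule measurable_reinforced_cand[OF rd])
  show "(%(w, x). jump k w x) : borel_measurable (Hist >< borel)" unfolding jump_def by measurable
  have tm: "abs(tmean k w) <= sqrt (real (Suc k))" for w
  proof -
   let ?c = "copy_prob p k" and ?q = "sqrt (real (Suc k))"
   have "abs((LINT x|\<mu>. ?B k x)) <= ?q"
   proof -
    have "abs((LINT x|\<mu>. ?B k x)) <= (LINT x|\<mu>. abs(?B k x))"
     using integral_norm_bound[of \<mu> "?B k"] by simp
    also have "... <= (LINT x|\<mu>. ?q)"
     using integrable_trunc[OF _ identity_integrable, of k] by (intro integral_mono integrable_abs abs_trunc_bound) auto
    also have "... = ?q" using prob_space by simp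
    finally show ?thesis .
   qed
   then have 1: "abs((1 - ?c) * (LINT x|\<mu>. ?B k x)) <= (1 - ?c) * ?q"
    using copy_prob_range[of k] by (simp add: abs_mult mult_left_mono)
   have "abs(\<Sum>i<k. ?B k (w (Suc i))) <= (\<Sum>i<k. ?q)"
    by (rule order_trans[OF sum_abs]) (intro sum_mono abs_trunc_bound)
   then have "abs(?c / real k * (\<Sum>i<k. ?B k (w (Suc i)))) <= ?c / real k * (real k * ?q)"
    using copy_prob_range[of k] unfolding abs_mult by (intro mult_mono) auto
   also have "... <= ?c * ?q" using copy_prob_range[of k] by (cases "k = 0") auto
   finally have "abs(tmean k w) <= (1 - ?c) * ?q + ?c * ?q" unfolding tmean_def using 1 by linarith
   then show ?thesis by (simp add: algebra_simps)
  qed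
  show "abs(jump k w x) <= ?C k" for w x using tm[of w] abs_trunc_bound[of k x] s_nonneg[of "Suc k"]
   unfolding jump_def jump_bound_def abs_mult by (intro mult_mono) auto
  show "(?E k w) = 0" for w
  proof -
   interpret U: prob_space U01 by (rule prob_space_U01)
   interpret UU: prob_space "U01 >< U01" by (intro prob_space_pair prob_space_U01)
   have [measurable]: "(%u. ?A k w (fst u) (snd u)) : borel_measurable (U01 >< U01)"
    using measurable_compose[of "%u. (w, fst u, snd u)" "U01 >< U01", OF _ measurable_reinforced_cand[OF rd, of p k]] by simp
   let ?K = "distr (U01 >< U01) borel (%u. ?A k w (fst u) (snd u))"
   interpret K: empirical_mixture ?K \<mu> "copy_prob p k" k "%i. w (Suc i)"
   proof (rule empirical_mixture_cand)
    show "prob_space ?K" by (rule UU.prob_space_distr) measurable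
    show "nn_integral ?K f = nn_integral U01 (%u0. nn_integral U01 (%u1. f (?A k w u0 u1)))" if [measurable]: "f
      : borel_measurable borel" for f
     by (subst nn_integral_distr) (auto simp: U.nn_integral_fst[symmetric])
   qed simp
   have "(?E k w) = (LINT x|?K. jump k w x)"
    unfolding jump_def by (subst integral_distr) auto
   also have "... = s (Suc k) * ((LINT x|?K. ?B k x) - tmean k w)"
   proof -
    have "integrable ?K (?B k)"
     by (rule K.integrable_mixture) (auto intro!: integrable_trunc identity_integrable)
    then show ?thesis unfolding jump_def using K.prob_space by simp
   qed
   also have "(LINT x|?K. ?B k x) = tmean k w"
    unfolding tmean_def by (rule K.integral_mixture) (auto intro!: integrable_trunc identity_integrable)
   finally show ?thesis by simp
  qed
  show "0 < h k" by (rule h)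
  show "?D k (h k) (K k) a b" if "0 <= a" "a <= ?C k" "0 <= b" "b <= ?C k" for a b
   by (rule K[OF that])
 qed
 moreover have "h k = real (2 ^ n (Suc k)) * h (Suc k)" for k
 proof -
  have "(2::real) ^ j * (1/2) ^ j = 1" for j by (simp flip: power_mult_distrib)
  then show ?thesis by (simp add: h_def power_add mult.left_commute)
 qed
 ultimately have "embedded_walk_axioms (?A) jump jump_bound (%k. (1/2) ^ k) h K (%k. 2 ^ n (Suc k))"
  by (rule embedded_walk_axioms.intro)
 with bm_noise_BM have "embedded_walk seed BM odd_coord (?A) jump jump_bound (%k. (1/2) ^ k) h K (%k. 2 ^ n (Suc k))"
  by (rule embedded_walk.intro)
 then show ?thesis by blast
qed

end

section \<open>Law and averages of the embedded steps\<close>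

locale reinforced_embedding =
 law: square_integrable_law \<mu> p +
 embedded_walk M W V "reinforced_cand p \<mu>" "square_integrable_law.jump \<mu> p" "square_integrable_law.jump_bound \<mu> p"
   "%k. (1/2) ^ k" h K q
 for \<mu> p and M :: "'a measure" and W V h K q
begin

lemma mixture: "empirical_mixture (step.kern k w) \<mu> (copy_prob p k) k (%i. w (Suc i))"
 by (rule law.empirical_mixture_cand) (auto intro: step.prob_space_kern step.nn_integral_kern)

lemma nn_integral_kern_mixture:
 assumes "f : borel_measurable borel"
 shows "nn_integral (step.kern k w) f = ennreal (1 - copy_prob p k) * nn_integral \<mu> f
   + ennreal (copy_prob p k / real k) * (\<Sum>i<k. f (w (Suc i)))"
 using mixture[of k w] assms by (rule empirical_mixture.nn)

lemma copy_prob_sum: "ennreal (1 - copy_prob p k) * I + ennreal (copy_prob p k / real k) * (\<Sum>i<k. I) = I"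
proof (cases "k = 0")
 case False
 have "ennreal (copy_prob p k / real k) * (of_nat k * I) = ennreal (copy_prob p k) * I"
  using False law.copy_prob_range[of k]
  by (simp add: mult.assoc[symmetric] ennreal_of_nat_eq_real_of_nat ennreal_mult[symmetric])
 then show ?thesis
  using law.copy_prob_range[of k] by (simp add: distrib_right[symmetric] ennreal_plus[symmetric] del: ennreal_plus)
qed (simp add: copy_prob_def)

text \<open>Strong induction: a fresh value has law \<open>\<mu>\<close>, and so has each earlier
  value from which a copy may be taken.\<close>

lemma nn_integral_incoming_law:
 assumes f [measurable]: "f : borel_measurable borel"
 shows "nn_integral M (%z. f (incoming k z)) = nn_integral \<mu> f"
proof (induction k rule: less_induct)
 let ?A = "nn_integral \<mu> f"
 case (less k)
 let ?c = "copy_prob p k"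
 have "nn_integral M (%z. f (incoming k z)) = nn_integral M (%z. nn_integral (step.kern k (hist k z)) f)"
  by (rule nn_integral_incoming[of "%w. f"]) measurable
 also have "... = nn_integral M (%z. ennreal (1 - ?c) * ?A + ennreal (?c / real k) * (\<Sum>i<k. f (incoming i z)))"
  by (simp add: nn_integral_kern_mixture hist_incoming)
 also have "... = ennreal (1 - ?c) * ?A + ennreal (?c / real k) * (\<Sum>i<k. nn_integral M (%z. f (incoming i z)))"
  by (subst nn_integral_add, measurable, subst nn_integral_cmult, measurable, subst nn_integral_sum, measurable)
    (simp add: emeasure_space_1)
 also have "... = ennreal (1 - ?c) * ?A + ennreal (?c / real k) * (\<Sum>i<k. ?A)"
  using less by simp
 also have "... = ?A" by (rule copy_prob_sum)
 finally show ?case .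
qed

lemma nn_integral_kern_law:
 assumes f [measurable]: "f : borel_measurable borel"
 shows "nn_integral M (%z. nn_integral (step.kern k (hist k z)) f) = nn_integral \<mu> f"
 using nn_integral_incoming[of "%w. f" k] by (simp add: nn_integral_incoming_law)

text \<open>The exactness of \<open>step_value_law\<close>, which enters through
  \<open>nn_integral_incoming\<close>, pays off here: the overshoot leaves no trace in the law of
  the embedded values.\<close>

lemma reinforced_process_incoming: "reinforced_process p \<mu> M incoming" unfolding reinforced_process_def
proof (intro conjI allI impI)
 let ?A = "%k z P C. nn_integral (step.kern k (hist k z)) (%x. indicator {w. P w} (hist k z) * indicator C x)"
 let ?B = "%P k j C. {z : space M. P (hist k z) & incoming j z : C}"
 let ?C = "%i z. incoming i z"
 let ?D = "%P k C. nn_integral M (%z. indicator {w. P w} (hist k z) * indicator C (?C k z))"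
 let ?E = "%P k. {z : space M. P (hist k z)}"
 let ?F = "%P k C. {z : space M. P (hist k z) & ?C k z : C}"
 let ?G = "emeasure \<mu>"
 show "prob_space M" by (rule prob_space_axioms)
 show "incoming i : borel_measurable M" for i by measurable
 fix k and B :: "nat => real set" and C :: "real set" assume B: "range B \<subseteq> sets borel" and C [measurable]: "C
   : sets borel"
 have [measurable]: "B i : sets borel" for i :: nat using B by auto
 define P where "P w \<longleftrightarrow> (ALL i:{..<k}. w (Suc i) : B i)" for w :: "nat => real"
 have P [measurable]: "Measurable.pred Hist P"
  unfolding P_def by (intro pred_intros_finite finite_lessThan) measurable
 have Pe: "P (hist k z) \<longleftrightarrow> (ALL i<k. ?C i z : B i)" for z by (auto simp: P_def hist_incoming)
 let ?c = "copy_prob p k"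
 have PM [measurable]: "Measurable.pred M (%z. P (hist k z))" by measurable
 have "emeasure M (?F P k C) = ?D P k C"
 proof -
  have "emeasure M (?F P k C) = nn_integral M (%z. indicator (?F P k C) z)"
   by (rule nn_integral_indicator[symmetric]) measurable
  also have "... = ?D P k C"
   by (intro nn_integral_cong) (simp add: indicator_def)
  finally show ?thesis .
 qed
 also have "... = nn_integral M (%z. ?A k z P C)"
  by (rule nn_integral_incoming[of "%w x. indicator {w. P w} w * indicator C x"]) (use P in \<open>auto simp: pred_def\<close>)
 also have "... = nn_integral M (%z. ennreal (1 - ?c) * ?G C * indicator (?E P k) z + ennreal (?c / real k) * (\<Sum>j<k.
   indicator (?B P k j C) z))"
 proof (rule nn_integral_cong)
  fix z assume z: "z : space M"
  have "?A k z P C = indicator {w. P w} (hist k z) * (ennreal (1 - ?c) * ?G C + ennreal (?c / real k) * (\<Sum>j<k.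
    indicator C (?C j z)))"
   by (subst nn_integral_cmult) (simp_all add: nn_integral_kern_mixture hist_incoming del: nn_integral_indicator, simp)
  also have "... = ennreal (1 - ?c) * ?G C * indicator (?E P k) z + ennreal (?c / real k) * (\<Sum>j<k. indicator (?B P k j C) z)"
   using z by (cases "P (hist k z)") (simp_all add: indicator_def)
  finally show "?A k z P C = ..." .
 qed
 also have "... = ennreal (1 - ?c) * ?G C * emeasure M (?E P k) + ennreal (?c / real k) * (\<Sum>j<k. emeasure M (?B P k j C))"
  by (subst nn_integral_add, measurable, subst (1 2) nn_integral_cmult, measurable, subst nn_integral_sum, measurable)
 also have "... = ennreal ((1 - ?c) * measure \<mu> C * prob (?E P k) + ?c / real k * (\<Sum>j<k. prob (?B P k j C)))"
  using law.copy_prob_range[of k]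
  by (simp add: emeasure_eq_measure law.emeasure_eq_measure ennreal_mult[symmetric] ennreal_plus[symmetric] sum_nonneg del:
    ennreal_plus)
 finally show "prob {z : space M. (ALL i<k. ?C i z : B i) & ?C k z : C} = (1 - ?c) * measure \<mu> C * prob {z : space M.
   ALL i<k. ?C i z : B i} + ?c / real k * (\<Sum>j<k. prob {z : space M. (ALL i<k. ?C i z : B i) & ?C j z : C})"
  unfolding Pe emeasure_eq_measure
  by (subst (asm) ennreal_inj) (use law.copy_prob_range[of k] in \<open>auto intro!: add_nonneg_nonneg mult_nonneg_nonneg
    divide_nonneg_nonneg sum_nonneg\<close>)
qed

text \<open>The probabilities that \<open>x^2\<close> exceeds \<open>k + 1\<close> sum to at most
  the mean of \<open>x^2\<close>, so Borel-Cantelli applies.\<close>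

lemma AE_untruncated: "AE z in M. EV k. (incoming k z)^2 <= real (Suc k)"
proof -
 let ?f = "%k x. if real (Suc k) < x^2 then 1 else 0 :: real"
 let ?A = "%M k. {z : space M. real (Suc k) < (incoming k z)^2}"
 have sm: "summable (%k. LINT x|\<mu>. ?f k x)"
  by (rule summable_integrals(2)[OF law.square]) (auto intro: sum_indicator_below simp del: of_nat_Suc)
 have p: "prob (?A M k) = (LINT x|\<mu>. ?f k x)" for k
 proof -
  have i: "integrable \<mu> (?f k)" by (rule law.integrable_const_bound[of _ 1]) auto
  have "emeasure M (?A M k) = nn_integral M (%z. ennreal (?f k (incoming k z)))"
  proof -
   have "emeasure M (?A M k) = nn_integral M (%z. indicator (?A M k) z)"
    by (rule nn_integral_indicator[symmetric]) measurable
   also have "... = nn_integral M (%z. ennreal (?f k (incoming k z)))"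
    by (intro nn_integral_cong) (simp add: indicator_def del: of_nat_Suc)
   finally show ?thesis .
  qed
  also have "... = nn_integral \<mu> (%x. ennreal (?f k x))" by (rule nn_integral_incoming_law) measurable
  also have "... = ennreal (LINT x|\<mu>. ?f k x)" by (rule nn_integral_eq_integral[OF i]) auto
  finally show ?thesis by (simp add: emeasure_eq_measure del: of_nat_Suc)
 qed
 have "AE z in M. EV k. z : space M - (?A M k)"
  by (rule borel_cantelli_AE1) (use sm in \<open>simp_all add: p less_top[symmetric] del: of_nat_Suc\<close>)
 then show ?thesis by (rule AE_mp) (auto intro!: AE_I2 elim!: eventually_mono simp: not_less)
qed

text \<open>At step \<open>k\<close> all earlier values are cut at the current level. The finitely
  many that were once too large are bounded, so they too pass the test eventually.\<close>

lemma eventually_untruncated: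
 assumes "EV k. (incoming k z)^2 <= real (Suc k)" shows "EV k. ALL i<=k. (incoming i z)^2 <= real (Suc k)"
proof -
 obtain N where N: "!!k. k >= N ==> (incoming k z)^2 <= real (Suc k)" using assms by (auto simp: eventually_sequentially)
 define C where "C = Max (insert 0 ((%i. (incoming i z)^2) ` {..<N}))"
 have C: "(incoming i z)^2 <= C" if "i < N" for i unfolding C_def using that by (intro Max_ge) auto
 show ?thesis using eventually_ge_at_top[of "nat \<lceil>C\<rceil>"]
 proof eventually_elim
  case (elim k)
  show ?case
  proof (intro allI impI)
   fix i assume i: "i <= k"
   show "(incoming i z)^2 <= real (Suc k)"
   proof (cases "i < N")
    case True
    then show ?thesis using C[OF True] elim by (simp add: nat_ceiling_le_eq)
   next
    case False
    then have "(incoming i z)^2 <= real (Suc i)" by (intro N) simp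
    also have "... <= real (Suc k)" using i by simp
    finally show ?thesis .
   qed
  qed
 qed
qed

lemma distr_step_value: "distr (step_noise (h k)) borel (step.step_value k w) = step.kern k w"
proof (rule measure_eqI)
 let ?A = "distr (step_noise (h k)) borel (step.step_value k w)"
 fix A assume "A : sets ?A"
 then have [measurable]: "A : sets borel" by simp
 have "emeasure ?A A = nn_integral ?A (%x. indicator A x)"
  by simp
 also have "... = nn_integral (step_noise (h k)) (%y. indicator A (step.step_value k w y))"
  by (rule nn_integral_distr) measurable
 also have "... = emeasure (step.kern k w) A" by (subst step.step_value_law) auto
 finally show "emeasure ?A A = emeasure (step.kern k w) A" .
qed simp

text \<open>Given the past, the mean of \<open>g\<close> at the next step mixes its mean under
  \<open>\<mu>\<close> with the average so far. The centred sum therefore obeys a recursion with the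
  factor \<open>1 + p / n\<close>, whose noise averages to 0 by the strong law and the vanishing
  truncation bias.\<close>

lemma AE_average:
 assumes g [measurable]: "g : borel_measurable borel" and gi: "integrable \<mu> g"
  and sq: "!!k. integrable \<mu> (%x. (trunc k g x)^2)"
  and sm: "summable (%k. (LINT x|\<mu>. (trunc k g x)^2) / (real (Suc k))^2)"
 shows "AE q in M. (%n. (\<Sum>i<n. g (incoming i q)) / real n) ----> (LINT x|\<mu>. g x)"
proof -
 let ?A = "%D k q. D k (hist k q) (incoming k q) (elapsed k q)"
 let ?B = "%k. LINT x|\<mu>. (trunc k g x)^2"
 let ?C = "%k D w. LINT y|step_noise (h k). D k w (step.step_value k w y) (h k * real (step.step_count k w y))"
 define \<gamma> where "\<gamma> k = (LINT x|\<mu>. trunc k g x)" for k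
 define A where "A k w = (1 - copy_prob p k) * \<gamma> k + copy_prob p k / real k * (\<Sum>i<k. trunc k g (w (Suc i)))"
   for k and w :: "nat => real"
 have ti: "integrable \<mu> (trunc k g)" for k by (rule law.integrable_trunc[OF g gi])
 have A: "(LINT x|step.kern k w. trunc k g x) = A k w" for k w
  unfolding A_def \<gamma>_def by (rule empirical_mixture.integral_mixture[OF mixture]) (auto simp: ti)
 have ik: "integrable (step.kern k w) (%x. (trunc k g x)^2)" "integrable (step.kern k w) (trunc k g)" for k w
  by (rule empirical_mixture.integrable_mixture[OF mixture]; use ti sq in auto)+
 define D where "D k w x (t::real) = trunc k g x - A k w" for k w and x t :: real
 have Am [measurable (raw)]: "(%x. A k (a x)) : borel_measurable N"
  if [measurable]: "a : N ->M Hist" for k a and N :: "'z measure" unfolding A_def by measurable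
 have Dm [measurable]: "(%(w, x, t). D k w x t) : borel_measurable (Hist >< borel >< borel)" for k
  unfolding D_def by measurable
 have bound: "nn_integral M (%q. ennreal ((?A D k q)^2)) <= ennreal (?B k)" for k
 proof -
  have "nn_integral M (%q. ennreal ((?A D k q)^2)) = nn_integral M (%q. nn_integral (step.kern k (hist k q)) (%x.
    ennreal ((trunc k g x - A k (hist k q))^2)))"
   unfolding D_def by (rule nn_integral_incoming[of "%w x. ennreal ((trunc k g x - A k w)^2)"]) measurable
  also have "... <= nn_integral M (%q. nn_integral (step.kern k (hist k q)) (%x. ennreal ((trunc k g x)^2)))"
   unfolding A[symmetric] by (intro nn_integral_mono prob_space.nn_variance_le[OF step.prob_space_kern] ik) measurable
  also have "... = nn_integral \<mu> (%x. ennreal ((trunc k g x)^2))" by (rule nn_integral_kern_law) measurable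
  also have "... = ennreal (?B k)" by (rule nn_integral_eq_integral[OF sq]) auto
  finally show ?thesis .
 qed
 have sqM: "integrable M (%q. (?A D k q)^2)" for k
 proof (rule integrableI_bounded)
  show "(%q. (?A D k q)^2) : borel_measurable M" unfolding D_def by measurable
  show "nn_integral M (%q. ennreal (norm ((?A D k q)^2))) < \<infinity>"
   using le_less_trans[OF bound[of k] ennreal_less_top] by simp
 qed
 interpret D: martingale_differences M "%k q. ?A D k q"
 proof (rule martingale[OF Dm _ sqM])
  fix k w
  interpret \<kappa>: prob_space "step.kern k w" by (rule step.prob_space_kern)
  have "(?C k D w) = (LINT x|step.kern k w. trunc k g x - A k w)"
   unfolding D_def distr_step_value[symmetric] by (subst integral_distr) auto
  also have "... = 0" using ik(2)[of k w] \<kappa>.prob_space by (simp add: A)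
  finally show "(?C k D w) = 0" .
 qed
 have "summable (%k. (LINT q|M. (?A D k q)^2) / (real (Suc k))^2)"
 proof (rule summable_comparison_test'[OF sm])
  fix k
  have "ennreal (LINT q|M. (?A D k q)^2) <= ennreal (?B k)"
   using bound[of k] nn_integral_eq_integral[OF sqM[of k]] by simp
  then have "(LINT q|M. (?A D k q)^2) <= (?B k)"
   by (subst (asm) ennreal_le_iff) auto
  then show "norm ((LINT q|M. (?A D k q)^2) / (real (Suc k))^2) <= (?B k) / (real (Suc k))^2"
   by (simp add: divide_right_mono del: of_nat_Suc)
 qed
 then have "AE q in M. (%n. (\<Sum>k<n. ?A D k q) / real (Suc n)) ----> 0"
  using filterlim_compose[OF filterlim_real_sequentially filterlim_Suc]
  by (intro D.strong_law) (auto simp: incseq_def simp del: of_nat_Suc)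
 then show ?thesis using AE_untruncated
 proof eventually_elim
  case (elim q)
  let ?x = "%i. incoming i q" and ?\<mu>g = "LINT x|\<mu>. g x"
  let ?\<xi> = "%k. ?A D k q"
  define G where "G n = (\<Sum>i<n. g (?x i) - ?\<mu>g)" for n
  define \<eta> where "\<eta> n = G (Suc n) - G n * (1 + p / real n)" for n
  have \<xi>0: "(%n. (\<Sum>k<n. ?\<xi> k) / real n) ----> 0"
  proof -
   have "(%n. real (Suc n) / real n) ----> 1" by real_asymp
   from tendsto_mult[OF elim(1) this]
   show ?thesis by (simp del: of_nat_Suc)
  qed
  have cs: "(%n. (\<Sum>k<n. (1 - p) * (\<gamma> k - ?\<mu>g)) / real n) ----> 0"
  proof -
   have "\<gamma> ----> ?\<mu>g" unfolding \<gamma>_def by (rule law.integral_trunc_tendsto[OF g gi])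
   then have "(%k. (1 - p) * (\<gamma> k - ?\<mu>g)) ----> (1 - p) * (?\<mu>g - ?\<mu>g)" by (intro tendsto_intros)
   from toeplitz[of "%_. 1", OF _ _ this] show ?thesis by (simp add: filterlim_real_sequentially)
  qed
  have "EV k. ?\<xi> k + (1 - p) * (\<gamma> k - ?\<mu>g) = \<eta> k"
   using eventually_untruncated[OF elim(2)] eventually_gt_at_top[of 0]
  proof eventually_elim
   case (elim k)
   have "trunc k g (?x i) = g (?x i)" if "i <= k" for i using elim that by (simp add: trunc_def)
   then have t: "trunc k g (?x k) = g (?x k)" "(\<Sum>i<k. trunc k g (hist k q (Suc i))) = (\<Sum>i<k. g (?x i))"
    by (auto simp: hist_incoming)
   have Gk: "(\<Sum>i<k. g (?x i)) = G k + real k * ?\<mu>g" by (simp add: G_def sum_subtractf)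
   have "?\<xi> k = g (?x k) - ((1 - p) * \<gamma> k + p / real k * (G k + real k * ?\<mu>g))"
    using elim by (simp add: D_def A_def t Gk copy_prob_def)
   moreover have "\<eta> k = g (?x k) - ?\<mu>g - p / real k * G k" by (simp add: \<eta>_def G_def algebra_simps)
   moreover have "p / real k * (G k + real k * ?\<mu>g) = p / real k * G k + p * ?\<mu>g"
    using elim by (simp add: field_simps)
   ultimately show ?case by (simp add: algebra_simps)
  qed
  moreover have "(%n. (\<Sum>k<n. ?\<xi> k + (1 - p) * (\<gamma> k - ?\<mu>g)) / real n) ----> 0"
   using tendsto_add[OF \<xi>0 cs] unfolding sum.distrib add_divide_distrib add_0_right .
  ultimately have "(%n. (\<Sum>i<n. \<eta> i) / real n) ----> 0"
   by (rule eventually_eq_sum_ratio[OF _ filterlim_real_sequentially])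
  then have "(%n. G n / real n) ----> 0"
   using law.p by (intro reinforced_recursion[of p G \<eta>]) (auto simp: \<eta>_def G_def)
  then have "(%n. G n / real n + ?\<mu>g) ----> 0 + ?\<mu>g" by (intro tendsto_intros)
  moreover have "EV n. G n / real n + ?\<mu>g = (\<Sum>i<n. g (?x i)) / real n"
   using eventually_gt_at_top[of 0] by eventually_elim (simp add: G_def sum_subtractf field_simps)
  ultimately show ?case by (simp add: Lim_transform_eventually)
 qed
qed

end

section \<open>Size of the scale and of the truncation errors\<close>

context square_integrable_law
begin

definition c :: "nat => real" where "c k = clock p (real (k + 3))"
text \<open>Bounds the bias that truncation causes in the mean.\<close>

definition \<delta> :: "nat => real" where "\<delta> k = (LINT x|\<mu>. (if real (Suc k) < x^2 then abs x else 0))"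

lemma c_ge_1: "1 <= c k" and c_pos: "0 < c k" using clock_3_ge_1[of p k] p by (simp_all add: c_def)

lemma c_incseq: "incseq c" unfolding incseq_def c_def by (auto intro!: clock_mono)

lemma c_at_top: "filterlim c at_top sequentially" unfolding c_def by (rule clock_3_seq_at_top)

lemma sqrt_c_at_top: "filterlim (%k. sqrt (c k)) at_top sequentially"
 by (rule filterlim_compose[OF sqrt_at_top c_at_top])

lemma s_square: "(s (Suc k))^2 = speed p / v * real (Suc k) powr (- 2*p)"
proof -
 have "(real (Suc k) powr (- p))^2 = real (Suc k) powr (- 2*p)" by (simp add: power2_eq_square powr_add[symmetric])
 then show ?thesis using v_pos speed_pos[of p] by (simp add: s_def power_mult_distrib b_def)
qed

lemma s_square_le: "(s (Suc k))^2 <= b^2 * (c k / real (Suc k))"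
proof -
 let ?A = "real (Suc k)"
 have "?A powr (- 2*p) = ?A powr (1 - 2*p) / ?A"
  by (simp add: powr_diff powr_minus_divide del: of_nat_Suc)
 also have "... <= c k / ?A" unfolding c_def using p by (intro divide_right_mono power_le_clock) auto
 finally have "speed p / v * ?A powr (- 2*p) <= speed p / v * (c k / ?A)"
  using speed_pos[of p] v_pos by (intro mult_left_mono) auto
 then show ?thesis unfolding s_square using speed_pos[of p] v_pos by (simp add: b_def)
qed

lemma s_le: "s (Suc k) <= b * (sqrt (c k) / sqrt (real (Suc k)))"
proof (rule power2_le_imp_le)
 show "(s (Suc k))^2 <= (b * (sqrt (c k) / sqrt (real (Suc k))))^2"
  using s_square_le[of k] c_pos[of k] by (simp add: power_mult_distrib power_divide)
 show "0 <= b * (sqrt (c k) / sqrt (real (Suc k)))" using b_pos c_pos[of k] by simp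
qed

lemma sum_s_square: "(%n. (\<Sum>k<n. (s (Suc k))^2) / c n) ----> 1 / v"
proof -
 let ?A = "%n. (\<Sum>k<n. speed p * real (Suc k) powr (- 2*p)) / c n"
 have "(%n. 1 / v * (?A n)) ----> 1 / v * 1"
  unfolding c_def by (intro tendsto_mult tendsto_const clock_sum p)
 moreover have "1 / v * (?A n) = (\<Sum>k<n. (s (Suc k))^2) / c n" for n
  unfolding s_square by (simp add: sum_distrib_left sum_divide_distrib)
 ultimately show ?thesis by simp
qed

lemma sum_s_square_at_top: "filterlim (%n. \<Sum>k<n. (s (Suc k))^2) at_top sequentially"
proof -
 have "filterlim (%n. (\<Sum>k<n. (s (Suc k))^2) / c n * c n) at_top sequentially"
  using v_pos by (intro filterlim_tendsto_pos_mult_at_top[OF sum_s_square _ c_at_top]) simp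
 then show ?thesis using c_pos by (simp add: less_imp_neq[THEN not_sym])
qed

lemma trunc_mean_close: "abs((LINT x|\<mu>. trunc k (%x. x) x) - m) <= \<delta> k"
proof -
 let ?A = "trunc k (%x. x)"
 have t: "integrable \<mu> (?A)" by (rule integrable_trunc[OF _ identity_integrable]) simp
 have "(LINT x|\<mu>. ?A x) - m = (LINT x|\<mu>. ?A x - x)"
  unfolding m_def by (rule Bochner_Integration.integral_diff[symmetric, OF t identity_integrable])
 then have "abs((LINT x|\<mu>. ?A x) - m) <= (LINT x|\<mu>. abs(?A x - x))"
  using integral_norm_bound[of \<mu> "%x. ?A x - x"] by simp
 also have "... = \<delta> k" unfolding \<delta>_def by (intro Bochner_Integration.integral_cong) (auto simp: trunc_def)
 finally show ?thesis .
qed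

text \<open>Sum and mean are exchanged, and \<open>sum_sqrt_below\<close> with
  \<open>y = x^2\<close> leaves \<open>2 * x^2\<close>.\<close>

lemma summable_\<delta>: "summable (%k. \<delta> k / sqrt (real (Suc k)))"
proof -
 let ?f = "%k x :: real. abs x * (if real (Suc k) < x^2 then 1 / sqrt (real (Suc k)) else 0)"
 have "summable (%k. LINT x|\<mu>. ?f k x)"
 proof (rule summable_integrals(2)[where F="%x. 2 * x^2"])
  show "integrable \<mu> (%x. 2 * x^2)" using square by simp
  fix n and x :: real
  have "(\<Sum>k<n. ?f k x) = abs x * (\<Sum>k<n. if real (Suc k) < x^2 then 1 / sqrt (real (Suc k)) else 0)"
   by (rule sum_distrib_left[symmetric])
  also have "... <= abs x * (2 * sqrt (x^2))" by (intro mult_left_mono sum_sqrt_below) auto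
  also have "... = 2 * x^2" by (simp add: power2_eq_square)
  finally show "(\<Sum>k<n. ?f k x) <= 2 * x^2" .
 qed auto
 moreover have "(LINT x|\<mu>. ?f k x) = \<delta> k / sqrt (real (Suc k))" for k
 proof -
  have "(LINT x|\<mu>. ?f k x) = (LINT x|\<mu>. (if real (Suc k) < x^2 then abs x else 0) / sqrt (real (Suc k)))"
   by (intro Bochner_Integration.integral_cong) auto
  then show ?thesis by (simp add: \<delta>_def del: of_nat_Suc)
 qed
 ultimately show ?thesis by simp
qed

lemma trunc_power: "(trunc k (%x. x) x)^2 = trunc k (%x. x^2) x" by (simp add: trunc_def)

lemma fourth_moments:
 "integrable \<mu> (%x. (trunc k (%x. x^2) x)^2)"
 "summable (%k. (LINT x|\<mu>. (trunc k (%x. x^2) x)^2) / (real (Suc k))^2)"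
proof -
 let ?f = "%k x :: real. (x^2)^2 * (if x^2 <= real (Suc k) then 1 / (real (Suc k))^2 else 0)"
 let ?A = "%k. trunc k (%x. x^2)"
 have f: "?f k = (%x. (?A k x)^2 / (real (Suc k))^2)" for k
  by (auto simp: fun_eq_iff trunc_def simp del: of_nat_Suc)
 have sq2: "integrable \<mu> (%x. 2 * x^2)" using square by simp
 have *: "(\<Sum>k<n. ?f k x) <= 2 * x^2" for n x
  using sum_inverse_squares_above[of "x^2" n] by (simp only: sum_distrib_left) simp
 have nn: "0 <= ?f k x" for k x by simp
 have fm: "?f k : borel_measurable \<mu>" for k by measurable
 note i = summable_integrals[of \<mu> "%x. 2 * x^2" ?f, OF sq2 fm nn *]
 have "integrable \<mu> (%x. (real (Suc k))^2 * ?f k x)" by (intro integrable_mult_right i)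
 moreover have "(%x. (real (Suc k))^2 * ?f k x) = (%x. (?A k x)^2)"
  by (auto simp: fun_eq_iff trunc_def simp del: of_nat_Suc)
 ultimately show "integrable \<mu> (%x. (?A k x)^2)" by (simp only:)
 have "(LINT x|\<mu>. ?f k x) = (LINT x|\<mu>. (?A k x)^2) / (real (Suc k))^2" for k
  unfolding f by (rule integral_divide_zero)
 then show "summable (%k. (LINT x|\<mu>. (?A k x)^2) / (real (Suc k))^2)" using i(2) by simp
qed

lemma second_moment: "(LINT x|\<mu>. x^2) - m^2 = v"
 unfolding v_def m_def by (rule variance_eq[symmetric, OF identity_integrable square])

end

section \<open>Almost sure coupling at the random time\<close>

context reinforced_embedding
begin

lemma AE_mean: "AE z in M. (%n. (\<Sum>i<n. incoming i z) / real n) ----> law.m"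
proof -
 let ?A = "%k. LINT x|\<mu>. (trunc k (%x. x) x)^2"
 let ?B = "%k. inverse ((real (Suc k))^2)"
 let ?C = "LINT x|\<mu>. x^2"
 have sq: "integrable \<mu> (%x. (trunc k (%x. x) x)^2)" for k
  unfolding law.trunc_power by (rule law.integrable_trunc[OF _ law.square]) simp
 have "summable (%k. (?A k) / (real (Suc k))^2)"
 proof (rule summable_comparison_test')
  have "summable (%k. ?B k)" using inverse_power_summable[of 2] by (subst summable_Suc_iff) auto
  then show "summable (%k. ?C * ?B k)" by (rule summable_mult)
  fix k
  have "(?A k) <= ?C"
   by (intro integral_mono sq law.square) (simp add: trunc_def)
  then show "norm ((?A k) / (real (Suc k))^2) <= ?C * ?B k"
   by (simp add: divide_inverse mult_right_mono del: of_nat_Suc)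
 qed
 then show ?thesis unfolding law.m_def using AE_average[of "%x. x", OF _ law.identity_integrable sq] by simp
qed

lemma AE_second_moment: "AE z in M. (%n. (\<Sum>i<n. (incoming i z)^2) / real n) ----> (LINT x|\<mu>. x^2)"
 by (rule AE_average[of "%x. x^2", OF _ law.square law.fourth_moments]) simp

lemma kern_trunc:
 assumes "g : borel_measurable borel" "integrable \<mu> (trunc k g)"
 shows "(LINT x|step.kern k w. trunc k g x) = (1 - copy_prob p k) * (LINT x|\<mu>. trunc k g x)
   + copy_prob p k / real k * (\<Sum>i<k. trunc k g (w (Suc i)))"
  "integrable (step.kern k w) (trunc k g)" by (rule empirical_mixture.integral_mixture[OF mixture]; use assms in simp)
   (rule empirical_mixture.integrable_mixture[OF mixture]; use assms in simp)

lemma kern_tmean: "(LINT x|step.kern k w. trunc k (%x. x) x) = law.tmean k w"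
 unfolding law.tmean_def by (rule kern_trunc) (auto intro: law.integrable_trunc law.identity_integrable)

text \<open>The 16 comes from \<open>(a - b)^4 <= 8 * (a^4 + b^4)\<close> together with Jensen's
  inequality, used twice to bound the fourth power of the mean by the mean fourth power.\<close>

lemma fourth_variation:
 "nn_integral M (%z. nn_integral (step.kern k (hist k z)) (%x. ennreal ((law.jump k (hist k z) x)^4)))
   <= ennreal (16 * (law.s (Suc k))^4 * (LINT x|\<mu>. (trunc k (%x. x^2) x)^2))"
proof -
 let ?t = "trunc k (%x. x)" and ?s = "law.s (Suc k)"
 let ?A = "trunc k (%x. x^2)"
 let ?B = "%w. step.kern k w"
 let ?C = "%x. ennreal ((?A x)^2)"
 let ?D = "%w. LINT x|?B w . (?A x)^2"
 let ?E = "%w. law.tmean k w"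
 let ?F = "ennreal (16 * ?s^4)"
 let ?G = "%z. nn_integral (step.kern k (hist k z))"
 let ?H = "%w. nn_integral (?B w)"
 let ?I = "%w. LINT x|?B w . 8 * ?s^4 * ((?A x)^2 + (?E w)^4)"
 have t4: "(?t x)^4 = (?A x)^2" for x by (simp add: trunc_def)
 have m4: "(a - b)^4 <= 8 * (a^4 + b^4)" for a b :: real
 proof -
  have sq: "(x + y)^2 <= 2 * (x^2 + y^2)" for x y :: real using sum_squares_bound[of x y] by (simp add: power2_sum)
  have "(a - b)^4 = ((a + (- b))^2)^2" by simp
  also have "... <= (2 * (a^2 + (- b)^2))^2" by (intro power_mono sq) auto
  also have "... = 4 * (a^2 + b^2)^2" unfolding power_mult_distrib[of 2] by simp
  also have "... <= 4 * (2 * ((a^2)^2 + (b^2)^2))" by (intro mult_left_mono sq) auto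
  finally show ?thesis by simp
 qed
 have inner: "?H w (%x. ennreal ((law.jump k w x)^4)) <= ?F * ?H w ?C" for w
 proof -
  interpret \<kappa>: prob_space "?B w" by (rule step.prob_space_kern)
  have i4: "integrable (?B w) (%x. (?A x)^2)"
   by (rule empirical_mixture.integrable_mixture[OF mixture _ law.fourth_moments(1)]) simp
  have i2: "integrable (?B w) (%x. (?t x)^2)"
   unfolding law.trunc_power by (rule kern_trunc) (auto intro: law.integrable_trunc law.square)
  have "(?E w)^2 <= (LINT x|?B w . (?t x)^2)"
   unfolding kern_tmean[symmetric] by (rule \<kappa>.expectation_square_le[OF _ i2]) simp
  then have "((?E w)^2)^2 <= (LINT x|?B w . (?t x)^2)^2" by (intro power_mono) auto
  also have "... <= (LINT x|?B w . ((?t x)^2)^2)"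
   by (rule \<kappa>.expectation_square_le) (use i4 in \<open>auto simp: law.trunc_power\<close>)
  finally have tm: "(?E w)^4 <= (?D w)" by (simp add: law.trunc_power)
  have "?H w (%x. ennreal ((law.jump k w x)^4)) <= ?H w (%x. ennreal (8 * ?s^4 * ((?A x)^2 + (?E w)^4)))"
  proof (intro nn_integral_mono ennreal_leI)
   fix x
   have "(law.jump k w x)^4 = ?s^4 * (?t x - ?E w)^4" by (simp add: law.jump_def power_mult_distrib)
   also have "... <= ?s^4 * (8 * ((?t x)^4 + (?E w)^4))" by (intro mult_left_mono m4) simp
   finally show "(law.jump k w x)^4 <= 8 * ?s^4 * ((?A x)^2 + (?E w)^4)"
    unfolding t4 by (simp only: ac_simps)
  qed
  also have "... = ennreal (?I w)"
   using i4 by (intro nn_integral_eq_integral) auto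
  also have "(?I w) = 8 * ?s^4 * ((?D w) + (?E w)^4)"
   using i4 \<kappa>.prob_space by simp
  also have "... <= 8 * ?s^4 * ((?D w) + (?D w))"
   by (intro mult_left_mono add_left_mono tm) auto
  also have "... = 16 * ?s^4 * (?D w)" by simp
  also have "ennreal ... = ?F * ennreal (?D w)"
   by (intro ennreal_mult) auto
  also have "ennreal (?D w) = ?H w ?C"
   by (rule nn_integral_eq_integral[OF i4, symmetric]) auto
  finally show ?thesis by (simp add: ennreal_leI)
 qed
 have "nn_integral M (%z. ?G z (%x. ennreal ((law.jump k (hist k z) x)^4))) <= nn_integral M (%z. ?F * ?G z ?C)"
  by (intro nn_integral_mono inner)
 also have "... = ?F * nn_integral M (%z. ?G z ?C)"
  by (rule nn_integral_cmult) measurable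
 also have "... = ?F * nn_integral \<mu> ?C"
  by (subst nn_integral_kern_law) auto
 also have "nn_integral \<mu> ?C = ennreal (LINT x|\<mu>. (?A x)^2)"
  by (rule nn_integral_eq_integral[OF law.fourth_moments(1)]) auto
 finally show ?thesis by (simp add: ennreal_mult)
qed

lemma summable_half: "summable (%k. (1/2 :: real) ^ k)" by (rule summable_geometric) simp

text \<open>Since \<open>(s (Suc k))^4 / (c k)^2\<close> is at most \<open>b^4 / (k + 1)^2\<close>,
  the strong law needs just the summability in \<open>fourth_moments\<close>.\<close>

lemma AE_time_variation': "AE z in M. (%n. (time n z - (\<Sum>k<n. variation k (hist k z))) / law.c n) ----> 0"
proof (rule AE_time_variation[OF law.c_pos law.c_incseq law.c_at_top summable_half fourth_variation])
 let ?I = "%k. LINT x|\<mu>. (trunc k (%x. x^2) x)^2"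
 let ?A = "%k. law.s (Suc k)"
 show "0 <= 16 * (?A k)^4 * ?I k" for k by simp
 show "summable (%k. 16 * (?A k)^4 * ?I k / (law.c k)^2)"
 proof (rule summable_comparison_test')
  show "summable (%k. 16 * law.b^4 * (?I k / (real (Suc k))^2))" by (intro summable_mult law.fourth_moments)
  fix k
  have "((?A k)^2)^2 <= (law.b^2 * (law.c k / real (Suc k)))^2" by (intro power_mono law.s_square_le) auto
  then have "(?A k)^4 <= law.b^4 * ((law.c k)^2 / (real (Suc k))^2)"
   by (simp add: power_mult_distrib power_divide)
  then have "16 * (?A k)^4 * ?I k / (law.c k)^2 <= 16 * (law.b^4 * ((law.c k)^2 / (real (Suc k))^2)) * ?I k / (law.c k)^2"
   by (intro divide_right_mono mult_right_mono mult_left_mono) auto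
  also have "... = 16 * law.b^4 * (?I k / (real (Suc k))^2)"
   using law.c_pos[of k] by (simp add: field_simps del: of_nat_Suc)
  finally show "norm (16 * (?A k)^4 * ?I k / (law.c k)^2) <= 16 * law.b^4 * (?I k / (real (Suc k))^2)"
   by simp
 qed
qed

lemma variation_eq: "variation k w = (law.s (Suc k))^2 * ((LINT x|step.kern k w. trunc k (%x. x^2) x) - (law.tmean k w)^2)"
proof -
 let ?t = "trunc k (%x. x)"
 let ?A = "step.kern k w"
 interpret \<kappa>: prob_space "?A" by (rule step.prob_space_kern)
 have i1: "integrable (?A) ?t"
  by (rule kern_trunc) (auto intro: law.integrable_trunc law.identity_integrable)
 have i2: "integrable (?A) (%x. (?t x)^2)"
  unfolding law.trunc_power by (rule kern_trunc) (auto intro: law.integrable_trunc law.square)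
 have "variation k w = (LINT x|?A . (law.s (Suc k))^2 * (?t x - law.tmean k w)^2)"
  by (simp add: variation_def law.jump_def power_mult_distrib)
 also have "... = (law.s (Suc k))^2 * \<kappa>.variance ?t" by (simp add: kern_tmean)
 also have "\<kappa>.variance ?t = (LINT x|?A . (?t x)^2) - (law.tmean k w)^2"
  unfolding kern_tmean[symmetric] by (rule \<kappa>.variance_eq[OF i1 i2])
 finally show ?thesis by (simp add: law.trunc_power)
qed

text \<open>The averages of values and squares make the conditional variance of the next value
  converge to \<open>v\<close>. Toeplitz averaging with the weights \<open>(s (Suc k))^2\<close>
  then makes the total variation asymptotic to the clock.\<close>

lemma AE_time: "AE z in M. (%n. time n z / law.c n) ----> 1"
 using AE_time_variation' AE_untruncated AE_mean AE_second_moment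
proof eventually_elim
 let ?A = "%n. \<Sum>k<n. (law.s (Suc k))^2"
 let ?B = "%k g z. \<Sum>i<k. trunc k g (hist k z (Suc i))"
 let ?C = "%k g. LINT x|\<mu>. trunc k g x"
 let ?D = "%n y. \<Sum>k<n. (law.s (Suc k))^2 * y k"
 let ?E = "%n g z. \<Sum>i<n. g (incoming i z)"
 case (elim z)
 let ?m2 = "LINT x|\<mu>. x^2"
 have lim: "(%k. (1 - copy_prob p k) * (?C k g) + copy_prob p k / real k * (?B k g z)) ----> l"
  if [measurable]: "g : borel_measurable borel" and gi: "integrable \<mu> g" and gl: "(LINT x|\<mu>. g x) = l"
   and av: "(%n. (?E n g z) / real n) ----> l" for g l
 proof -
  have "(%k. (1 - p) * (?C k g) + p * ((?E k g z) / real k)) ----> (1 - p) * l + p * l"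
   using law.integral_trunc_tendsto[OF _ gi] by (intro tendsto_add tendsto_mult tendsto_const av) (auto simp: gl)
  moreover have "EV k. (1 - p) * (?C k g) + p * ((?E k g z) / real k) = (1 - copy_prob p k) * (?C k g)
    + copy_prob p k / real k * (?B k g z)"
   using eventually_untruncated[OF elim(2)] eventually_gt_at_top[of 0]
  proof eventually_elim
   case (elim k)
   have "(?B k g z) = (?E k g z)"
    using elim by (intro sum.cong) (auto simp: trunc_def hist_incoming)
   then show ?case using elim by (simp add: copy_prob_def)
  qed
  ultimately show ?thesis by (simp add: Lim_transform_eventually algebra_simps)
 qed
 define y where "y k = (LINT x|step.kern k (hist k z). trunc k (%x. x^2) x) - (law.tmean k (hist k z))^2" for k
 have "(%k. LINT x|step.kern k (hist k z). trunc k (%x. x^2) x) ----> ?m2" using lim[OF _ law.square refl elim(4)]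
  by (subst kern_trunc(1)) (auto intro: law.integrable_trunc law.square)
 moreover have "(%k. law.tmean k (hist k z)) ----> law.m"
  unfolding law.tmean_def by (rule lim[OF _ law.identity_integrable law.m_def[symmetric] elim(3)]) simp
 ultimately have "y ----> ?m2 - law.m^2" unfolding y_def by (intro tendsto_intros)
 then have y: "y ----> law.v" by (simp add: law.second_moment)
 have "(%n. (?D n y) / (?A n)) ----> law.v"
  by (rule toeplitz[OF _ law.sum_s_square_at_top y]) simp
 from tendsto_mult[OF this law.sum_s_square]
 have "(%n. (?D n y) / (?A n) * ((?A n) / law.c n)) ----> 1"
  using law.v_pos by simp
 moreover have "EV n. (?D n y) / (?A n) * ((?A n) / law.c n) = (\<Sum>k<n. variation k (hist k z)) / law.c n"
 proof -
  have "EV n. (?A n) > 0" using law.sum_s_square_at_top by (simp add: filterlim_at_top_dense)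
  then show ?thesis by eventually_elim (simp add: variation_eq y_def)
 qed
 ultimately have "(%n. (\<Sum>k<n. variation k (hist k z)) / law.c n) ----> 1" by (rule Lim_transform_eventually)
 from tendsto_add[OF elim(1) this] show ?case by (simp add: add_divide_distrib[symmetric])
qed

definition scaled :: "nat => 'a => real" where
 "scaled n z = law.s n * (\<Sum>i<n. incoming i z - law.m)"

text \<open>The difference telescopes into the embedding error \<open>G\<close>, the truncation bias
  \<open>r1\<close>, and \<open>r2\<close>, the imperfect cancellation of \<open>1 + p / k\<close>
  by the scale. \<open>G\<close> is summable, and so is \<open>r2\<close> because \<open>S k\<close>
  is of order \<open>k\<close> by the law of large numbers; \<open>r1\<close> is handled by
  Kronecker's lemma.\<close>

lemma AE_scaled: "AE z in M. (%n. (scaled n z - W (time n z) z) / sqrt (law.c n)) ----> 0"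
 using AE_summable_gain_error[OF summable_half] AE_untruncated AE_mean AE_space
proof eventually_elim
 let ?A = "%k. real (Suc k) powr (- p) * (1 + p / real k) - real k powr (- p)"
 let ?B = "%n. sqrt (law.c n)"
 let ?C = "%G. %n. (\<Sum>k<n. G k) / ?B n"
 let ?D = "%k. law.\<delta> k / sqrt (real (Suc k))"
 let ?E = "%i z. incoming i z"
 let ?F = "%k. trunc k (%x. x)"
 case (elim z)
 define S where "S n = (\<Sum>i<n. ?E i z - law.m)" for n
 define G where "G k = law.jump k (hist k z) (?E k z) - (W (time (Suc k) z) z - W (time k z) z)" for k
 define r where "r k = scaled (Suc k) z - scaled k z - law.jump k (hist k z) (?E k z)" for k
 define r1 where "r1 k = law.s (Suc k) * ((1 - p) * ((LINT x|\<mu>. ?F k x) - law.m))" for k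
 define r2 where "r2 k = S k * (law.s (Suc k) * (1 + p / real k) - law.s k)" for k
 have sc: "scaled n z = law.s n * S n" for n by (simp add: scaled_def S_def)
 have tel: "scaled n z - W (time n z) z = (\<Sum>k<n. r k) + (\<Sum>k<n. G k)" for n
  by (induction n) (auto simp: scaled_def r_def G_def W_zero[OF elim(4)])
 have "summable G" using elim(1) unfolding G_def by (rule summable_rabs_cancel)
 then have G0: "(?C G) ----> 0"
  by (intro real_tendsto_divide_at_top[OF summable_LIMSEQ law.sqrt_c_at_top])
 have r1_0: "(?C r1) ----> 0"
 proof -
  have "summable (%k. r1 k / ?B k)"
  proof (rule summable_comparison_test')
   show "summable (%k. law.b * (?D k))" by (intro summable_mult law.summable_\<delta>)
   fix k
   have c: "?B k > 0" using law.c_pos[of k] by simp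
   have "abs(r1 k) <= law.b * (?B k / sqrt (real (Suc k))) * (1 * law.\<delta> k)" unfolding r1_def abs_mult
    using law.s_le[of k] law.s_nonneg[of "Suc k"] law.p law.trunc_mean_close[of k] law.b_pos law.c_pos[of k]
    by (intro mult_mono) auto
   also have "... = law.b * (?D k) * ?B k" by simp
   finally show "norm (r1 k / ?B k) <= law.b * (?D k)"
    using c by (simp add: abs_divide pos_divide_le_eq)
  qed
  then have "convergent (%n. \<Sum>k<n. r1 k / ?B k)" by (simp add: summable_iff_convergent)
  from kronecker[OF this _ law.sqrt_c_at_top]
  show ?thesis using law.c_incseq law.c_pos by (simp add: incseq_def less_imp_neq[THEN not_sym])
 qed
 have r2_0: "(?C r2) ----> 0"
 proof -
  have "(%n. (\<Sum>i<n. ?E i z) / real n - law.m) ----> law.m - law.m" by (intro tendsto_intros elim)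
  moreover have "EV n. (\<Sum>i<n. ?E i z) / real n - law.m = S n / real n"
   using eventually_gt_at_top[of 0] by eventually_elim (simp add: S_def sum_subtractf field_simps)
  ultimately have "(%n. S n / real n) ----> law.m - law.m" by (rule Lim_transform_eventually)
  then have "Bseq (%n. S n / real n)" by (intro convergent_imp_Bseq) (auto simp: convergent_def)
  then obtain B where B': "B > 0" "ALL n. norm (S n / real n) <= B" by (rule BseqE)
  then have B: "abs(S n / real n) <= B" "B > 0" for n by (simp_all only: real_norm_def)
  obtain C where C: "!!k. k >= 1 ==> abs(?A k) <= C * real k powr (- p - 2)"
   using scale_step[OF law.p(1)] by blast
  have "summable r2"
  proof (rule summable_comparison_test'[where N=1])
   show "summable (%k. B * law.b * C * real k powr (- p - 1))"
    using law.p by (intro summable_mult) (simp add: summable_real_powr_iff)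
   fix k :: nat assume k: "k >= 1"
   have "law.s (Suc k) * (1 + p / real k) - law.s k = law.b * (?A k)"
    by (simp add: law.s_def algebra_simps)
   then have "abs(r2 k) = abs(S k) * (law.b * abs(?A k))"
    using law.b_pos by (simp add: r2_def abs_mult)
   also have "... <= (B * real k) * (law.b * (C * real k powr (- p - 2)))"
    using B(1)[of k] B(2) C[OF k] law.b_pos k by (intro mult_mono mult_left_mono) (auto simp: divide_le_eq)
   also have "... = B * law.b * C * (real k powr 1 * real k powr (- p - 2))" by simp
   also have "real k powr 1 * real k powr (- p - 2) = real k powr (- p - 1)"
    unfolding powr_add[symmetric] by (rule arg_cong[where f="%e. real k powr e"]) simp
   finally show "norm (r2 k) <= B * law.b * C * real k powr (- p - 1)" by simp
  qed
  then show ?thesis by (intro real_tendsto_divide_at_top[OF summable_LIMSEQ law.sqrt_c_at_top])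
 qed
 have "EV k. r1 k + r2 k = r k" using eventually_untruncated[OF elim(2)] eventually_gt_at_top[of 0]
 proof eventually_elim
  case (elim k)
  have "?F k (?E i z) = ?E i z" if "i <= k" for i using elim that by (simp add: trunc_def)
  then have t: "?F k (?E k z) = ?E k z" "(\<Sum>i<k. ?F k (hist k z (Suc i))) = (\<Sum>i<k. ?E i z)"
   by (auto simp: hist_incoming)
  have Sk: "(\<Sum>i<k. ?E i z) = S k + real k * law.m" by (simp add: S_def sum_subtractf)
  have tm: "law.tmean k (hist k z) = (1 - p) * (LINT x|\<mu>. ?F k x) + (p / real k * S k + p * law.m)"
   using elim unfolding law.tmean_def t Sk by (simp add: copy_prob_def field_simps)
  have SS: "S (Suc k) = S k + ?E k z - law.m" by (simp add: S_def)
  show ?case unfolding r_def sc law.jump_def t tm SS r1_def r2_def by (simp add: algebra_simps)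
 qed
 moreover have "(%n. (\<Sum>k<n. r1 k + r2 k) / ?B n) ----> 0"
  using tendsto_add[OF r1_0 r2_0] unfolding sum.distrib add_divide_distrib add_0_right .
 ultimately have "(?C r) ----> 0"
  by (rule eventually_eq_sum_ratio[OF _ law.sqrt_c_at_top])
 from tendsto_add[OF this G0] show ?case unfolding tel add_divide_distrib add_0_right .
qed

theorem AE_coupling:
 "AE z in M. (%n. time n z / clock p (real n)) ----> 1 & (%n. (scaled n z - W (time n z) z) / sqrt (clock p (real n))) ----> 0"
 using AE_time AE_scaled
proof eventually_elim
 case (elim z)
 have cs: "(%n. law.c n / clock p (real n)) ----> 1" unfolding law.c_def by (rule clock_shift[OF law.p(1)])
 have c0: "law.c n ~= 0" for n using law.c_pos[of n] by simp
 from tendsto_mult[OF elim(1) cs] have "(%n. time n z / clock p (real n)) ----> 1" by (simp add: c0)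
 moreover from tendsto_mult[OF elim(2) tendsto_real_sqrt[OF cs]]
 have "(%n. (scaled n z - W (time n z) z) / sqrt (clock p (real n))) ----> 0" by (simp add: c0 real_sqrt_divide)
 ultimately show ?case by blast
qed

end

section \<open>The two approximations\<close>

lemma ratio_tendsto_0_uniform:
 fixes a c :: "nat => real"
 assumes lim: "(%n. a n / c n) ----> 0" and mono: "!!k n. 1 <= k ==> k <= n ==> c k <= c n"
  and c: "filterlim c at_top sequentially" and e: "e > 0" shows "EV n. ALL k:{1..n}. abs(a k) <= e * c n"
proof -
 have "EV n. abs(a n / c n) < e" using lim e by (auto dest!: tendstoD[of _ _ _ e] simp: dist_real_def)
 moreover have "EV n. c n > 0" using c by (simp add: filterlim_at_top_dense)
 ultimately have "EV n. abs(a n) <= e * c n" by eventually_elim (auto simp: abs_divide divide_less_eq)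
 then obtain N where N: "!!n. n >= N ==> abs(a n) <= e * c n" by (auto simp: eventually_sequentially)
 define C where "C = Max (insert 0 ((%k. abs(a k)) ` {..<N}))"
 have C: "abs(a k) <= C" if "k < N" for k unfolding C_def using that by (intro Max_ge) auto
 have "EV n. c n >= C / e" using c by (simp add: filterlim_at_top)
 then show ?thesis
 proof eventually_elim
  case (elim n)
  show ?case
  proof
   fix k assume k: "k : {1..n}"
   show "abs(a k) <= e * c n"
   proof (cases "k < N")
    case True
    have "C <= e * c n" using elim e by (simp add: divide_le_eq mult.commute)
    then show ?thesis using C[OF True] by linarith
   next
    case False
    then have "abs(a k) <= e * c k" by (intro N) simp
    also have "... <= e * c n" using k mono[of k n] e by (intro mult_left_mono) auto
    finally show ?thesis .
   qed
  qed
 qed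
qed

lemma (in prob_space) prob_tendsto_0:
 assumes [measurable]: "!!n. E n : events" and AE: "AE z in M. EV n. z ~: E n" shows "(%n. prob (E n)) ----> 0"
proof -
 have "(%n. LINT z|M. indicator (E n) z) ----> (LINT z|M. (0::real))"
 proof (rule integral_dominated_convergence[where w="%_. 1"])
  show "AE z in M. (%n. indicator (E n) z :: real) ----> 0" using AE
  proof eventually_elim
   case (elim z)
   then show ?case by (intro tendsto_eventually) (auto elim: eventually_mono)
  qed
 qed auto
 then show ?thesis by simp
qed

section \<open>From the random time to the deterministic clock\<close>

context standard_brownian_motion
begin

context
 fixes Q T :: "nat => 'a => real" and p :: real
 assumes p: "0 < p" and Q [measurable]: "!!n. Q n : borel_measurable M" and T [measurable]: "!!n. T n : borel_measurable M"
  and WT [measurable]: "!!n. (%z. W (T n z) z) : borel_measurable M" and T0: "!!n z. 0 <= T n z"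
  and coupling: "AE z in M. (%n. T n z / clock p (real n)) ----> 1 & (%n. (Q n z - W (T n z) z) / sqrt (clock p (real n)))
    ----> 0"
begin

lemma sqrt_clock_at_top: "filterlim (%n. sqrt (clock p (real n))) at_top sequentially"
 by (rule filterlim_compose[OF sqrt_at_top clock_seq_at_top])

lemma time_difference:
 assumes "(%n. T n z / clock p (real n)) ----> 1" shows "(%n. (T n z - clock p (real n)) / clock p (real n)) ----> 0"
proof -
 let ?A = "%n. clock p (real n)"
 have "(%n. T n z / ?A n - 1) ----> 1 - 1" by (intro tendsto_intros assms)
 moreover have "EV n. ?A n > 0" using clock_seq_at_top[of p] by (simp add: filterlim_at_top_dense)
 then have "EV n. T n z / ?A n - 1 = (T n z - ?A n) / ?A n"
  by eventually_elim (simp add: diff_divide_distrib)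
 ultimately show ?thesis by (simp add: Lim_transform_eventually)
qed

text \<open>The random time is asymptotic to the clock, so for each tolerance
  \<open>1 / (j + 1)\<close> it eventually falls within the range of \<open>AE_oscillation\<close>.
  Only countably many tolerances are used, which keeps the exceptional set null.\<close>

lemma AE_iterated_log:
 "AE z in M. (%n. 1 / sqrt (clock p (real n) * ln (ln (clock p (real n)))) * abs(Q n z - W (clock p (real n)) z)) ----> 0"
proof -
 let ?A = "%j. inverse (real (Suc j))"
 let ?B = "%t. sqrt (t * ln (ln t))"
 have "ALL j. EX \<delta>>0. AE z in M. \<forall>\<^sub>F t in at_top. ALL s. abs(s - t) <= \<delta> * t --> abs(W s z - W t z)
   <= ?A j * ?B t"
  by (intro allI AE_oscillation) simp
 from choice[OF this] obtain \<delta> where \<delta>': "ALL j. \<delta> j > 0 & (AE z in M. \<forall>\<^sub>F t in at_top. ALL s.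
   abs(s - t) <= \<delta> j * t --> abs(W s z - W t z) <= ?A j * ?B t)"
  by (rule exE)
 have \<delta>: "\<delta> j > 0"
  "AE z in M. \<forall>\<^sub>F t in at_top. ALL s. abs(s - t) <= \<delta> j * t --> abs(W s z - W t z) <= ?A j * ?B t" for j
  using \<delta>'[rule_format, of j] by (rule conjunct1, rule conjunct2)
 have "AE z in M. ALL j. \<forall>\<^sub>F t in at_top. ALL s. abs(s - t) <= \<delta> j * t --> abs(W s z - W t z) <= ?A j * ?B t"
  using \<delta>(2) by (simp add: AE_all_countable)
 then show ?thesis using coupling
 proof eventually_elim
  case (elim z)
  let ?\<tau> = "%n. clock p (real n)" and ?L = "%n. sqrt (clock p (real n) * ln (ln (clock p (real n))))"
  show ?case
  proof (rule LIMSEQ_I)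
   fix e :: real assume e: "e > 0"
   then obtain j where j: "?A j < e / 2" using reals_Archimedean[of "e / 2"] by auto
   have "EV n. ALL s. abs(s - ?\<tau> n) <= \<delta> j * ?\<tau> n --> abs(W s z - W (?\<tau> n) z) <= ?A j * ?L n"
    using eventually_compose_filterlim[OF elim(1)[rule_format, of j] clock_seq_at_top] .
   moreover have "EV n. abs((T n z - ?\<tau> n) / ?\<tau> n) < \<delta> j"
    using time_difference[OF elim(2)[THEN conjunct1]] \<delta>(1)[of j] by (auto dest!: tendstoD simp: dist_real_def)
   moreover have "EV n. abs((Q n z - W (T n z) z) / sqrt (?\<tau> n)) < e / 2"
    using elim(2)[THEN conjunct2] e by (auto dest!: tendstoD[of _ _ _ "e / 2"] simp: dist_real_def)
   moreover have "EV n. 1 <= ln (ln (?\<tau> n)) & 1 <= ?\<tau> n"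
   proof -
    have "\<forall>\<^sub>F t::real in at_top. 1 <= ln (ln t)" by real_asymp
    then have "\<forall>\<^sub>F t::real in at_top. 1 <= ln (ln t) & 1 <= t" using eventually_ge_at_top by (rule eventually_conj)
    then show ?thesis by (rule eventually_compose_filterlim[OF _ clock_seq_at_top])
   qed
   ultimately have "EV n. norm (1 / ?L n * abs(Q n z - W (?\<tau> n) z) - 0) < e"
   proof eventually_elim
    case (elim n)
    have L: "sqrt (?\<tau> n) <= ?L n" using elim by simp
    have \<tau>: "sqrt (?\<tau> n) > 0" "?\<tau> n > 0" using elim by auto
    have "abs(T n z - ?\<tau> n) <= \<delta> j * ?\<tau> n" using elim(2) \<tau> by (simp add: abs_divide divide_less_eq)
    then have 1: "abs(W (T n z) z - W (?\<tau> n) z) <= ?A j * ?L n" using elim(1) by blast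
    have "abs(Q n z - W (T n z) z) <= e / 2 * sqrt (?\<tau> n)" using elim(3) \<tau> by (simp add: abs_divide divide_less_eq)
    also have "... <= e / 2 * ?L n" using L e by (intro mult_left_mono) auto
    finally have 2: "abs(Q n z - W (T n z) z) <= e / 2 * ?L n" .
    have Lp: "?L n > 0" using L \<tau> by linarith
    have "?A j * ?L n < e / 2 * ?L n" using j Lp by (rule mult_strict_right_mono)
    then have "abs(Q n z - W (?\<tau> n) z) < e / 2 * ?L n + e / 2 * ?L n" using 1 2 by linarith
    then have "abs(Q n z - W (?\<tau> n) z) < e * ?L n" by (simp add: algebra_simps)
    then have "abs(Q n z - W (?\<tau> n) z) / ?L n < e" using Lp by (simp only: pos_divide_less_eq)
    moreover have "0 <= abs(Q n z - W (?\<tau> n) z) / ?L n" using Lp by (intro divide_nonneg_nonneg) auto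
    ultimately show ?case by (simp add: real_norm_def)
   qed
   then show "EX no. ALL n>=no. norm (1 / ?L n * abs(Q n z - W (?\<tau> n) z) - 0) < e"
    by (simp only: eventually_sequentially)
  qed
 qed
qed

text \<open>The window of length 1 after \<open>clock p k\<close> absorbs the rounding of
  \<open>n * t\<close> to an integer. All errors are measured on the scale of \<open>n\<close>,
  where an almost sure ratio tending to 0 becomes uniform in \<open>k <= n\<close>.\<close>

lemma uniform_in_probability:
 assumes \<epsilon>: "\<epsilon> > 0"
 shows "EV n. EX B:events. prob B <= \<epsilon> & (ALL z:space M - B. ALL k:{1..n}. ALL t. clock p (real k) <= t & t
   <= clock p (real k) + 1 --> abs(Q k z - W t z) <= \<epsilon> * sqrt (clock p (real n)))"
proof -
 let ?\<tau> = "%n. clock p (real n)"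
 let ?A = "%n. sqrt (?\<tau> n)"
 have mono: "1 <= k ==> k <= n ==> ?\<tau> k <= ?\<tau> n" for k n by (intro clock_mono) auto
 obtain \<delta> where \<delta>: "\<delta> > 0" "\<delta> < 1" and mod: "!!T. T > 0 ==> EX B:events. prob B <= \<epsilon> / 2
   & (ALL z:space M - B. ALL s t. 0 <= s & s <= 2 * T & 0 <= t & t <= 2 * T & abs(s - t) <= \<delta> * T --> abs(W s z - W t z)
   <= \<epsilon> / 2 * sqrt T)"
  using modulus_in_probability[of "\<epsilon> / 2"] \<epsilon> by auto
 define E1 where "E1 n = {z : space M. EX k:{1..n}. \<epsilon> / 2 * ?A n < abs(Q k z - W (T k z) z)}" for n
 define E2 where "E2 n = {z : space M. EX k:{1..n}. \<delta> / 2 * ?\<tau> n < abs(T k z - ?\<tau> k)}" for n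
 have [measurable]: "E1 n : events" "E2 n : events" for n unfolding E1_def E2_def by measurable
 have "(%n. prob (E1 n)) ----> 0"
 proof (rule prob_tendsto_0)
  show "AE z in M. EV n. z ~: E1 n" using coupling
  proof eventually_elim
   case (elim z)
   have "EV n. ALL k:{1..n}. abs(Q k z - W (T k z) z) <= \<epsilon> / 2 * ?A n"
    by (rule ratio_tendsto_0_uniform[OF elim[THEN conjunct2] _ sqrt_clock_at_top]) (use \<epsilon> mono in auto)
   then show ?case by eventually_elim (auto simp: E1_def not_less)
  qed
 qed measurable
 moreover have "(%n. prob (E2 n)) ----> 0"
 proof (rule prob_tendsto_0)
  show "AE z in M. EV n. z ~: E2 n" using coupling
  proof eventually_elim
   case (elim z)
   have "EV n. ALL k:{1..n}. abs(T k z - ?\<tau> k) <= \<delta> / 2 * ?\<tau> n"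
    by (rule ratio_tendsto_0_uniform[OF time_difference[OF elim[THEN conjunct1]] mono clock_seq_at_top]) (use \<delta> in auto)
   then show ?case by eventually_elim (auto simp: E2_def not_less)
  qed
 qed measurable
 ultimately have "EV n. prob (E1 n) < \<epsilon> / 4" "EV n. prob (E2 n) < \<epsilon> / 4"
  using \<epsilon> by (simp_all only: order_tendstoD(2)[of _ 0 _ "\<epsilon> / 4"] half_gt_zero zero_less_divide_iff
    zero_less_numeral simp_thms)
 \<comment> \<open>With the clock at least \<open>2 / \<delta>\<close>, the window of length 1 takes
   up half of the admissible time difference, and the error of the random time the other
   half.\<close>
 moreover have "EV n. max 1 (2 / \<delta>) <= ?\<tau> n" using clock_seq_at_top[of p] by (simp only: filterlim_at_top)
 ultimately show ?thesis
 proof eventually_elim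
  case (elim n)
  have \<tau>: "1 <= ?\<tau> n" "1 <= \<delta> / 2 * ?\<tau> n"
  proof -
   show "1 <= ?\<tau> n" using elim(3) by simp
   have "2 / \<delta> <= ?\<tau> n" using elim(3) by simp
   then show "1 <= \<delta> / 2 * ?\<tau> n" using \<delta> by (simp add: divide_le_eq mult.commute)
  qed
  obtain B where B: "B : events" "prob B <= \<epsilon> / 2"
   "!!z s t. z : space M - B ==> 0 <= s ==> s <= 2 * ?\<tau> n ==> 0 <= t ==> t <= 2 * ?\<tau> n ==> abs(s - t)
     <= \<delta> * ?\<tau> n ==> abs(W s z - W t z) <= \<epsilon> / 2 * ?A n"
   using mod[of "?\<tau> n"] \<tau>(1) by fastforce
  show ?case
  proof (intro bexI[of _ "B \<union> (E1 n \<union> E2 n)"] conjI ballI allI impI)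
   have "prob (B \<union> (E1 n \<union> E2 n)) <= prob B + prob (E1 n \<union> E2 n)" using B by (intro measure_Un_le) auto
   also have "prob (E1 n \<union> E2 n) <= prob (E1 n) + prob (E2 n)" by (intro measure_Un_le) auto
   finally show "prob (B \<union> (E1 n \<union> E2 n)) <= \<epsilon>" using B(2) elim by linarith
   fix z k t assume z: "z : space M - (B \<union> (E1 n \<union> E2 n))" and k: "k : {1..n}" and t: "?\<tau> k <= t & t
     <= ?\<tau> k + 1"
   have 1: "abs(Q k z - W (T k z) z) <= \<epsilon> / 2 * ?A n" using z k by (auto simp: E1_def not_less)
   have 2: "abs(T k z - ?\<tau> k) <= \<delta> / 2 * ?\<tau> n" using z k by (auto simp: E2_def not_less)
   have \<tau>k: "0 <= ?\<tau> k" "?\<tau> k <= ?\<tau> n" using k mono by (auto intro: clock_nonneg)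
   have "\<delta> / 2 * ?\<tau> n <= 1 * ?\<tau> n" using \<delta> \<tau> by (intro mult_right_mono) auto
   then have "T k z <= 2 * ?\<tau> n" "t <= 2 * ?\<tau> n" using 2 \<tau>k \<tau>(1) t by linarith+
   moreover have "abs(T k z - t) <= \<delta> * ?\<tau> n"
   proof -
    have "abs(T k z - t) <= \<delta> / 2 * ?\<tau> n + 1" using 2 t by linarith
    then show ?thesis using \<tau>(2) by simp
   qed
   ultimately have "abs(W (T k z) z - W t z) <= \<epsilon> / 2 * ?A n"
    using B(3)[of z "T k z" t] z T0[of k z] \<tau>k t by auto
   then have "abs(Q k z - W t z) <= \<epsilon> / 2 * ?A n + \<epsilon> / 2 * ?A n" using 1 by linarith
   then show "abs(Q k z - W t z) <= \<epsilon> * ?A n" by simp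
  qed (use B in auto)
 qed
qed

end

end

text \<open>The function is right-continuous, so its supremum is attained along the rationals.\<close>

lemma cSUP_floor_rationals:
 fixes A :: "int => real" and g :: "real => real"
 assumes g: "continuous_on {a..b} g" and r: "0 <= r" and ab: "a <= b"
 shows "bdd_above ((%t. abs(A (floor(r * t)) - g t)) ` {a..b})"
  and "(SUP t\<in>{a..b}. abs(A (floor(r * t)) - g t)) = (SUP t\<in>{a..b} \<inter> insert b \<rat>. abs(A (floor(r * t)) - g t))"
proof -
 let ?f = "%t. abs(A (floor(r * t)) - g t)"
 show bdd: "bdd_above (?f ` {a..b})"
 proof -
  define C where "C = Max ((%j. abs(A j)) ` {floor(r * a)..floor(r * b)})"
  have C: "abs(A (floor(r * t))) <= C" if "t : {a..b}" for t
   unfolding C_def using that r by (intro Max_ge) (auto intro!: imageI floor_mono mult_left_mono)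
  have "bounded (g ` {a..b})" using g by (intro compact_imp_bounded compact_continuous_image) auto
  then obtain D where D: "ALL t:{a..b}. abs(g t) <= D" by (auto simp: bounded_iff)
  show ?thesis
  proof (rule bdd_aboveI2)
   fix t assume "t : {a..b}"
   then show "?f t <= C + D" using C[of t] D by fastforce
  qed
 qed
 show "(SUP t\<in>{a..b}. ?f t) = (SUP t\<in>{a..b} \<inter> insert b \<rat>. ?f t)" (is "?L = ?R")
 proof (rule antisym)
  have bdd': "bdd_above (?f ` ({a..b} \<inter> insert b \<rat>))" by (rule bdd_above_mono[OF bdd]) auto
  show "?R <= ?L" using ab by (intro cSUP_subset_mono bdd) auto
  show "?L <= ?R"
  proof (rule cSUP_least)
   fix t assume t: "t : {a..b}"
   show "?f t <= ?R"
   proof (cases "t = b")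
    case True
    then show ?thesis using ab by (intro cSUP_upper bdd') auto
   next
    case False
    show ?thesis
    proof (rule field_le_epsilon)
     fix e :: real assume e: "e > 0"
     obtain d where d: "d > 0" "!!t'. t' : {a..b} ==> abs(t' - t) < d ==> abs(g t' - g t) < e"
      using g t e unfolding continuous_on_iff dist_real_def by blast
     define j where "j = floor(r * t)"
     have j: "of_int j <= r * t" "r * t < of_int j + 1" unfolding j_def by linarith+
     have r1: "r + 1 > 0" using r by simp
     \<comment> \<open>To the left of \<open>u\<close> the integer part of \<open>r * t'\<close> is
       still \<open>j\<close>. Dividing by \<open>r + 1\<close> instead of \<open>r\<close> covers
       \<open>r = 0\<close>.\<close>
     define u where "u = min b (min (t + d) (t + (of_int j + 1 - r * t) / (r + 1)))"
     have "t < u" using t False d j r1 by (auto simp: u_def)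
     then obtain t' where t': "t' : \<rat>" "t < t'" "t' < u" using Rats_dense_in_real by blast
     have in': "t' : {a..b}" "abs(t' - t) < d" using t' t by (auto simp: u_def)
     have "(t' - t) * (r + 1) < of_int j + 1 - r * t"
      using t' r1 by (auto simp: u_def less_divide_eq[symmetric] pos_less_divide_eq[symmetric])
     moreover have "(t' - t) * r <= (t' - t) * (r + 1)" using t' by (intro mult_left_mono) auto
     ultimately have "r * t' < of_int j + 1" by (simp add: algebra_simps)
     moreover have "of_int j <= r * t'" using j(1) r t' by (meson less_imp_le mult_left_mono order_trans)
     ultimately have "floor(r * t') = j" by (intro floor_unique) auto
     then have "?f t <= ?f t' + e" using d(2)[OF in'] unfolding j_def by (auto simp: abs_if split: if_splits)
     also have "?f t' <= ?R" using in' t' by (intro cSUP_upper bdd') auto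
     finally show "?f t <= ?R + e" by simp
    qed
   qed
  qed (use ab in auto)
 qed
qed

lemma measurable_cSUP_floor:
 fixes A :: "int => 'a => real" and g :: "real => 'a => real"
 assumes A [measurable]: "!!j. A j : borel_measurable M" and gm: "!!t. t : {a..b} ==> g t : borel_measurable M"
  and g: "!!z. z : space M ==> continuous_on {a..b} (%t. g t z)" and r: "0 <= r" and ab: "a <= b"
 shows "(%z. SUP t\<in>{a..b}. abs(A (floor(r * t)) z - g t z)) : borel_measurable M"
proof -
 let ?A = "%t z. abs(A (floor(r * t)) z - g t z)"
 have "(%z. SUP t\<in>{a..b} \<inter> insert b \<rat>. ?A t z) : borel_measurable M"
 proof (rule borel_measurable_cSUP)
  show "countable ({a..b} \<inter> insert b \<rat>)" by (intro countable_Int2 countable_insert countable_rat)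
  fix t assume "t : {a..b} \<inter> insert b \<rat>"
  then have [measurable]: "g t : borel_measurable M" by (intro gm) auto
  show "(%z. ?A t z) : borel_measurable M" by measurable
 next
  fix z assume z: "z : space M"
  show "bdd_above ((%t. ?A t z) ` ({a..b} \<inter> insert b \<rat>))"
   using cSUP_floor_rationals(1)[OF g[OF z] r ab, of "%j. A j z"] by (rule bdd_above_mono) auto
 qed
 then show ?thesis
 proof (rule measurable_cong[THEN iffD1, rotated])
  fix z assume "z : space M"
  from cSUP_floor_rationals(2)[OF g[OF this] r ab, of "%j. A j z"]
  show "(SUP t\<in>{a..b} \<inter> insert b \<rat>. ?A t z) = (SUP t\<in>{a..b}. ?A t z)"
   by (rule sym)
 qed
qed

lemma abs_cSUP_le:
 fixes f :: "'i => real"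
 assumes "I ~= {}" "!!i. i : I ==> 0 <= f i" "!!i. i : I ==> f i <= B" shows "abs(SUP i\<in>I. f i) <= B"
proof -
 obtain i where i: "i : I" using assms(1) by blast
 have "bdd_above (f ` I)" using assms(3) by (rule bdd_aboveI2)
 then have "0 <= (SUP i\<in>I. f i)" using i assms(2)[OF i] by (meson cSUP_upper2)
 moreover have "(SUP i\<in>I. f i) <= B" using assms by (intro cSUP_least) auto
 ultimately show ?thesis by simp
qed

lemma (in prob_space) tendsto_zero_in_probabilityI:
 assumes [measurable]: "!!n. Z n : borel_measurable M"
  and *: "!!e. e > 0 ==> EV n. EX B:events. prob B <= e & (ALL z:space M - B. abs(Z n z) <= e)"
 shows "tendsto_zero_in_probability M Z" unfolding tendsto_zero_in_probability_def
proof (intro conjI allI impI)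
 let ?A = "%e n. prob {z : space M. e < abs(Z n z)}"
 show "Z n : borel_measurable M" for n by measurable
 fix e :: real assume e: "e > 0"
 show "(%n. ?A e n) ----> 0"
 proof (rule LIMSEQ_I)
  fix d :: real assume d: "d > 0"
  define r where "r = min e (d / 2)"
  have r: "r > 0" "r <= e" "r < d" using e d by (auto simp: r_def)
  have "EV n. norm (?A e n - 0) < d" using *[OF r(1)]
  proof eventually_elim
   case (elim n)
   then obtain B where B: "B : events" "prob B <= r" "!!z. z : space M - B ==> abs(Z n z) <= r" by blast
   have "{z : space M. e < abs(Z n z)} \<subseteq> B" using B(3) r(2) by fastforce
   then have "?A e n <= prob B" using B(1) by (rule finite_measure_mono)
   then show ?case using B(2) r(3) by simp
  qed
  then show "EX no. ALL n>=no. norm (?A e n - 0) < d" by (simp only: eventually_sequentially)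
 qed
qed

text \<open>The power with exponent \<open>a\<close> is the clock with parameter
  \<open>(1 - a) / 2\<close>.\<close>

lemma powr_step:
 fixes a x u :: real
 assumes a: "0 < a" "a < 1" and x: "1 <= x" and u: "0 <= u" "u <= 1" shows "(x + u) powr a <= x powr a + 1"
proof -
 have q: "1 - 2 * ((1 - a) / 2) = a" "(1 - a) / 2 < 1/2" using a by (simp_all add: field_simps)
 then show ?thesis using clock_step[of "(1 - a) / 2" x u] a x u by (simp add: clock_def)
qed

section \<open>The approximations in the two regimes\<close>

context reinforced_embedding
begin

definition walk :: "nat => 'a => real" where "walk n z = (\<Sum>i<n. incoming i z)"

lemma walk_measurable [measurable]: "walk n : borel_measurable M" unfolding walk_def[abs_def] by measurable

lemma W_time_measurable: "(%z. W (time n z) z) : borel_measurable M"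
proof (induction n)
 case 0
 then show ?case using W_measurable[of 0] by simp
next
 case (Suc n)
 have "(%z. W (time n z) z + step.step_gain n (hist n z) (noise n z)) : borel_measurable M" using Suc by measurable
 then show ?case
 proof (rule measurable_cong[THEN iffD1, rotated])
  fix z assume "z : space M"
  from W_step[OF this, of n]
  show "W (time n z) z + step.step_gain n (hist n z) (noise n z) = W (time (Suc n) z) z"
   unfolding time_def by linarith
 qed
qed

lemma scaled_eq: "scaled n z = sqrt (speed p / law.v) * ((walk n z - law.m * real n) / real n powr p)"
 by (simp add: scaled_def law.s_def law.b_def walk_def sum_subtractf powr_minus_divide mult.commute)

lemma scaled_measurable [measurable]: "scaled n : borel_measurable M" unfolding scaled_def[abs_def] by measurable

lemma time_measurable [measurable]: "time n : borel_measurable M" unfolding time_sum[abs_def] by measurable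

lemmas coupled = law.p(1) scaled_measurable time_measurable W_time_measurable time_nonneg AE_coupling
lemmas AE_strong_approximation = AE_iterated_log[OF coupled]
lemmas uniform_approximation = uniform_in_probability[OF coupled]

lemma clock_between:
 assumes "1 <= x"
 shows "clock p (real (nat (floor x))) <= clock p x" "clock p x <= clock p (real (nat (floor x))) + 1" "1 <= nat (floor x)"
proof -
 let ?A = "real (nat (floor x))"
 have k: "?A <= x" "x <= ?A + 1" using nat_floor_bounds[of x] assms by auto
 show k1: "1 <= nat (floor x)" using assms by (simp add: le_nat_iff le_floor_iff)
 then have k1': "1 <= ?A" by linarith
 show "clock p (?A) <= clock p x" using k k1' by (intro clock_mono)
 have "clock p (?A + (x - ?A)) <= clock p (?A) + 1"
  by (rule clock_step[OF law.p(1) k1']) (use k in linarith)+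
 then show "clock p x <= clock p (?A) + 1" by (simp only: add_diff_eq add_diff_cancel_left')
qed

text \<open>The general estimate is normalised with the iterated logarithm of
  \<open>n powr (1 - 2*p)\<close>, which eventually is at most that of \<open>n\<close>; the
  normaliser claimed here is the larger one.\<close>

lemma subcritical_as:
 assumes p: "p < 1/2" and \<sigma>: "\<sigma> > 0" "\<sigma>^2 = law.v"
 shows "AE z in M. (%n. 1 / sqrt (real n powr (1 - 2*p) * ln (ln (real n))) * abs(sqrt (1 - 2*p) / \<sigma> * ((walk n z - law.m
   * real n) / real n powr p) - W (real n powr (1 - 2*p)) z)) ----> 0"
 using AE_strong_approximation
proof eventually_elim
 let ?A = "%n. sqrt (real n powr (1 - 2*p) * ln (ln (real n)))"
 let ?B = "%n a. ln (real n powr a)"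
 case (elim z)
 have sp: "sqrt (speed p / law.v) = sqrt (1 - 2*p) / \<sigma>"
  using p \<sigma> by (simp add: speed_def real_sqrt_divide flip: \<sigma>(2))
 let ?D = "%n. abs(scaled n z - W (clock p (real n)) z)"
 have "(%n. 1 / ?A n * ?D n) ----> 0"
 proof (rule tendsto_sandwich[OF _ _ tendsto_const elim])
  define a where "a = 1 - 2*p"
  have a: "0 < a" "a <= 1" using p law.p by (auto simp: a_def)
  have cl: "clock p (real n) = real n powr a" for n using p by (simp add: clock_def a_def)
  have "EV n. 1 < ?B n a" using a by real_asymp
  then have ev: "EV n. 1 < ?B n a & 1 < n" using eventually_gt_at_top[of 1] by (rule eventually_conj)
  show "EV n. 0 <= 1 / ?A n * ?D n" using ev
  proof eventually_elim
   case (elim n)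
   have "?B n a <= ln (real n)" using elim a by (simp add: ln_powr mult_left_le_one_le)
   then have "1 < ln (real n)" using elim by linarith
   then have "0 < ln (ln (real n))" by simp
   then show ?case by simp
  qed
  show "EV n. 1 / ?A n * ?D n <= 1 / sqrt (clock p (real n) * ln (ln (clock p (real n)))) * ?D n"
   using ev
  proof eventually_elim
   case (elim n)
   have "?B n a <= ln (real n)" using elim a by (simp add: ln_powr mult_left_le_one_le)
   then have "ln (?B n a) <= ln (ln (real n))" by (rule ln_mono) (use elim in linarith)+
   moreover have "0 < ln (?B n a)" using elim by simp
   moreover have "0 < real n powr a" using elim by simp
   ultimately show ?case unfolding cl a_def[symmetric]
    by (intro mult_right_mono divide_left_mono real_sqrt_le_mono mult_left_mono mult_pos_pos) auto
  qed
 qed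
 then show ?case unfolding scaled_eq sp using p by (simp add: clock_def)
qed

lemma critical_scaled:
 assumes p: "p = 1/2" and \<sigma>: "\<sigma> > 0" "\<sigma>^2 = law.v"
 shows "scaled n z = (walk n z - law.m * real n) / (\<sigma> * sqrt (real n))"
proof -
 have "real n powr p = sqrt (real n)" by (subst p) (simp add: powr_half_sqrt)
 moreover have "sqrt (speed p / law.v) = 1 / \<sigma>"
  using p \<sigma> by (simp add: speed_def real_sqrt_divide flip: \<sigma>(2))
 ultimately show ?thesis unfolding scaled_eq by simp
qed

lemma critical_as:
 assumes p: "p = 1/2" and \<sigma>: "\<sigma> > 0" "\<sigma>^2 = law.v"
 shows "AE z in M. (%n. 1 / sqrt (ln (real n) * ln (ln (ln (real n)))) * abs((walk n z - law.m * real n) / (\<sigma> * sqrt (real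
   n)) - W (ln (real n)) z)) ----> 0"
 using AE_strong_approximation
proof eventually_elim
 case (elim z)
 have "scaled n z = (walk n z - law.m * real n) / (\<sigma> * sqrt (real n))" for n
  by (rule critical_scaled[OF p \<sigma>])
 moreover have "clock p x = ln x" for x using p by (simp add: clock_def)
 ultimately show ?case using elim by (simp only:)
qed

lemma critical_probability:
 assumes p: "p = 1/2" and \<sigma>: "\<sigma> > 0" "\<sigma>^2 = law.v"
 shows "tendsto_zero_in_probability M (%n z. 1 / sqrt (ln (real n)) * (SUP t\<in>{1 / real n..1}.
   abs((walk (nat (floor(real n * t))) z - law.m * real_of_int (floor(real n * t))) / (\<sigma> * sqrt (real_of_int (floor(real n
   * t)))) - W (ln (real n * t)) z)))"
 (is "tendsto_zero_in_probability _ (%n z. 1 / sqrt (ln (real n)) * ?Z n z)")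
proof (rule tendsto_zero_in_probabilityI)
 let ?A = "%n. {1 / real n..1}"
 fix n :: nat
 show "(%z. 1 / sqrt (ln (real n)) * ?Z n z) : borel_measurable M"
 \<comment> \<open>For \<open>n = 0\<close> the factor \<open>1 / sqrt (ln 0)\<close> is 0 by the
   conventions for \<open>ln\<close> and division.\<close>
 proof (cases "n = 0")
  case False
  have pos: "1 <= real n * t" if "t : (?A n)" for t using that False by (auto simp: divide_le_eq mult.commute)
  have "(%z. SUP t\<in>(?A n) . abs((%j z. (walk (nat j) z - law.m * real_of_int j) / (\<sigma> * sqrt (real_of_int j)))
    (floor(real n * t)) z - W (ln (real n * t)) z)) : borel_measurable M"
  proof (rule measurable_cSUP_floor)
   show "W (ln (real n * t)) : borel_measurable M" if "t : (?A n)" for t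
    using pos[OF that] by (intro W_measurable) simp
   show "continuous_on (?A n) (%t. W (ln (real n * t)) z)" if "z : space M" for z
   proof (rule continuous_on_compose2[OF W_continuous[OF that]])
    show "continuous_on (?A n) (%t. ln (real n * t))" using pos by (intro continuous_intros) force
    show "(%t. ln (real n * t)) ` (?A n) \<subseteq> {0..}" using pos by force
   qed
  qed (use False in auto)
  then show ?thesis by measurable
 qed simp
next
 let ?B = "%n. sqrt (ln (real n))"
 fix e :: real assume e: "e > 0"
 show "EV n. EX B:events. prob B <= e & (ALL z:space M - B. abs(1 / ?B n * ?Z n z) <= e)"
  using uniform_approximation[OF e] eventually_gt_at_top[of 1]
 proof eventually_elim
  case (elim n)
  then obtain B where B: "B : events" "prob B <= e" and
   bound: "!!z k t. z : space M - B ==> k : {1..n} ==> clock p (real k) <= t ==> t <= clock p (real k) + 1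
     ==> abs(scaled k z - W t z) <= e * sqrt (clock p (real n))"
   by blast
  show ?case
  proof (intro bexI[of _ B] conjI ballI B)
   fix z assume z: "z : space M - B"
   have cl: "clock p x = ln x" for x using p by (simp add: clock_def)
   have ln: "ln (real n) > 0" using elim by simp
   have "abs(?Z n z) <= e * ?B n"
   proof (rule abs_cSUP_le)
    fix t assume t: "t : {1 / real n..1}"
    let ?x = "real n * t" and ?k = "nat (floor(real n * t))"
    have x: "1 <= ?x" "?x <= real n" using t elim by (auto simp: divide_le_eq mult.commute mult_left_le)
    have k: "?k : {1..n}" using clock_between(3)[OF x(1)] x by (auto simp: floor_le_iff nat_le_iff)
    have fl: "real_of_int (floor(?x)) = real ?k" using x by simp
    have "scaled ?k z = (walk ?k z - law.m * real ?k) / (\<sigma> * sqrt (real ?k))"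
     by (rule critical_scaled[OF p \<sigma>])
    then show "abs((walk ?k z - law.m * real_of_int (floor(?x))) / (\<sigma> * sqrt (real_of_int (floor(?x)))) - W (ln ?x) z)
      <= e * ?B n"
     using bound[OF z k clock_between(1,2)[OF x(1)]] unfolding fl cl by simp
   qed (use elim in auto)
   then have "1 / ?B n * abs(?Z n z) <= 1 / ?B n * (e * ?B n)"
    using ln by (intro mult_left_mono) auto
   also have "... = e" using ln by simp
   finally show "abs(1 / ?B n * ?Z n z) <= e" using ln by (simp add: abs_mult)
  qed
 qed
qed

text \<open>The norm is \<open>sqrt n\<close>, whereas \<open>scaled k\<close> is divided by
  \<open>k powr p\<close> for the integer part \<open>k\<close> of \<open>n * t\<close>. This
  produces the factor \<open>(k / n) powr p\<close>, which differs from \<open>t powr p\<close> by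
  at most \<open>1 / n powr p\<close>; against the supremum of the motion the difference is
  negligible.\<close>

lemma subcritical_probability:
 assumes p: "p < 1/2" and \<sigma>: "\<sigma> > 0" "\<sigma>^2 = law.v"
 shows "tendsto_zero_in_probability M (%n q. SUP t\<in>{0..1}. abs(sqrt (1 - 2*p) / \<sigma> * ((walk (nat (floor(real n * t))) q
   - law.m * real_of_int (floor(real n * t))) / sqrt (real n)) - t powr p * W ((real n * t) powr (1 - 2*p)) q / sqrt (real n powr
   (1 - 2*p))))"
 (is "tendsto_zero_in_probability _ ?Z")
proof (rule tendsto_zero_in_probabilityI)
 let ?B = "%n t q. t powr p * W ((real n * t) powr (1 - 2*p)) q / sqrt (real n powr (1 - 2*p))"
 let ?A = "continuous_on {0..1}"
 let ?C = "borel_measurable M"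
 fix n :: nat
 have "(%q. SUP t\<in>{0..1}. abs((%j q. sqrt (1 - 2*p) / \<sigma> * ((walk (nat j) q - law.m * real_of_int j) / sqrt (real n)))
   (floor(real n * t)) q - ?B n t q)) : ?C"
 proof (rule measurable_cSUP_floor)
  fix t :: real
  have [measurable]: "W ((real n * t) powr (1 - 2*p)) : ?C" by (intro W_measurable) simp
  show "(%q. ?B n t q) : ?C" by measurable
 next
  fix q assume q: "q : space M"
  have "?A (%t. W ((real n * t) powr (1 - 2*p)) q)"
  proof (rule continuous_on_compose2[OF W_continuous[OF q]])
   show "?A (%t. (real n * t) powr (1 - 2*p))"
    using p by (intro continuous_on_powr' continuous_intros) auto
  qed auto
  moreover have "?A (%t::real. t powr p)"
   using law.p by (intro continuous_on_powr' continuous_intros) auto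
  ultimately show "?A (%t. ?B n t q)"
   unfolding divide_inverse by (intro continuous_on_mult continuous_on_const)
 qed auto
 then show "(%q. ?Z n q) : ?C" .
next
 let ?D = "sqrt (1 - 2*p)"
 fix e :: real assume e: "e > 0"
 \<comment> \<open>There are three exceptional events of probability at most \<open>r\<close> each,
   and off them the error is at most \<open>2 * r\<close>.\<close>
 define r where "r = e / 3"
 have r: "r > 0" using e by (simp add: r_def)
 obtain C where C: "C > 0" and sup: "!!T. T > 0 ==> EX B:events. prob B <= r & (ALL q:space M - B. ALL t. 0 <= t & t <= T
   --> abs(W t q) <= C * sqrt T)"
  using sup_in_probability[OF r] by blast
 obtain B1 where B1: "B1 : events" "prob B1 <= r" "!!q t. q : space M - B1 ==> 0 <= t ==> t <= 1 ==> abs(W t q) <= C"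
  using sup[of 1] by (metis real_sqrt_one mult.right_neutral zero_less_one)
 have cl: "clock p x = x powr (1 - 2*p)" for x using p by (simp add: clock_def)
 have "EV n. C / r <= real n powr p"
 proof -
  have "filterlim (%n. real n powr p) at_top sequentially" using law.p(1) by real_asymp
  then show ?thesis by (simp add: filterlim_at_top)
 qed
 moreover have "EV n. C / r <= sqrt (clock p (real n))"
  using filterlim_compose[OF sqrt_at_top clock_seq_at_top[of p]] by (simp add: filterlim_at_top)
 ultimately show "EV n. EX B:events. prob B <= e & (ALL q:space M - B. abs(?Z n q) <= e)"
  using uniform_approximation[OF r] eventually_gt_at_top[of 0]
 proof eventually_elim
  case (elim n)
  then obtain B where B: "B : events" "prob B <= r" and
   bound: "!!q k t. q : space M - B ==> k : {1..n} ==> clock p (real k) <= t ==> t <= clock p (real k) + 1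
     ==> abs(scaled k q - W t q) <= r * sqrt (clock p (real n))"
   by blast
  let ?\<tau> = "real n powr (1 - 2*p)"
  have n: "real n > 0" using elim by simp
  have \<tau>: "?\<tau> > 0" "sqrt ?\<tau> > 0" using n by auto
  obtain B2 where B2: "B2 : events" "prob B2 <= r" "!!q t. q : space M - B2 ==> 0 <= t ==> t <= ?\<tau> ==> abs(W t q)
    <= C * sqrt ?\<tau>"
   using sup[OF \<tau>(1)] by blast
  have sn: "sqrt (real n) = real n powr p * sqrt ?\<tau>"
  proof -
   have "sqrt ?\<tau> = real n powr ((1 - 2*p) / 2)" using n by (simp add: powr_half_sqrt[symmetric] powr_powr)
   then have "real n powr p * sqrt ?\<tau> = real n powr (p + (1 - 2*p) / 2)" by (simp add: powr_add)
   also have "p + (1 - 2*p) / 2 = 1 / 2" by (simp add: field_simps)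
   finally show ?thesis using n by (simp add: powr_half_sqrt)
  qed
  show ?case
  proof (intro bexI[of _ "B \<union> (B1 \<union> B2)"] conjI ballI)
   show "B \<union> (B1 \<union> B2) : events" using B B1 B2 by auto
   have "prob (B \<union> (B1 \<union> B2)) <= prob B + prob (B1 \<union> B2)" using B B1 B2 by (intro measure_Un_le) auto
   also have "prob (B1 \<union> B2) <= prob B1 + prob B2" using B1 B2 by (intro measure_Un_le) auto
   finally show "prob (B \<union> (B1 \<union> B2)) <= e" using B(2) B1(2) B2(2) by (simp add: r_def)
   fix q assume q': "q : space M - (B \<union> (B1 \<union> B2))"
   then have q: "q : space M - B" "q : space M - B1" "q : space M - B2" by auto
   show "abs(?Z n q) <= e"
   proof (rule abs_cSUP_le)
    fix t :: real assume t: "t : {0..1}"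
    let ?x = "real n * t" and ?k = "nat (floor(real n * t))"
    have x: "0 <= ?x" "?x <= real n" using t by (auto simp: mult_left_le)
    have fl: "real_of_int (floor(?x)) = real ?k" using x by simp
    show "abs(?D / \<sigma> * ((walk ?k q - law.m * real_of_int (floor(?x))) / sqrt (real n)) - t powr p * W (?x powr (1 - 2*p))
      q / sqrt ?\<tau>) <= e"
    \<comment> \<open>Before the first step the walk is 0, and the motion has run for at most time
      1, where it is bounded by \<open>C\<close>; the norm makes this small.\<close>
    proof (cases "?x < 1")
     case True
     have k0: "?k = 0" using True x by (simp add: floor_less_iff)
     have "?x powr (1 - 2*p) <= 1" using True x p by (intro powr_le1) auto
     then have w: "abs(W (?x powr (1 - 2*p)) q) <= C" using B1(3)[OF q(2)] by simp
     have "t powr p <= 1" using t law.p by (intro powr_le1) auto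
     then have "t powr p * abs(W (?x powr (1 - 2*p)) q) <= 1 * C" using w by (intro mult_mono) auto
     then have "t powr p * abs(W (?x powr (1 - 2*p)) q) / sqrt ?\<tau> <= C / sqrt ?\<tau>" using \<tau>
       by (intro divide_right_mono) auto
     also have "... <= r" using elim(2) \<tau> r unfolding cl by (simp add: divide_le_eq mult.commute)
     also have "r <= e" using e by (simp add: r_def)
     finally show ?thesis unfolding fl k0 using \<tau> by (simp add: walk_def abs_mult abs_divide)
    next
     case False
     then have x1: "1 <= ?x" by simp
     have k: "?k : {1..n}" using clock_between(3)[OF x1] x by (auto simp: floor_le_iff nat_le_iff)
     have kp: "real ?k > 0" using clock_between(3)[OF x1] by linarith
     let ?w = "W (?x powr (1 - 2*p)) q"
     have 1: "abs(scaled ?k q - ?w) <= r * sqrt ?\<tau>"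
      using bound[OF q(1) k clock_between(1,2)[OF x1]] unfolding cl .
     have 2: "abs(?w) <= C * sqrt ?\<tau>" using x p by (intro B2(3)[OF q(3)] powr_mono2) auto
     have sp: "sqrt (speed p / law.v) = ?D / \<sigma>"
      using p \<sigma> by (simp add: speed_def real_sqrt_divide flip: \<sigma>(2))
     define a where "a = real ?k powr p / real n powr p"
     have np: "real n powr p > 0" using n by simp
     have kx: "real ?k <= ?x" "?x < real ?k + 1" using nat_floor_bounds[OF x(1)] by auto
     have tx: "t powr p = ?x powr p / real n powr p" using t n by (simp add: powr_mult)
     have a: "0 <= a" "a <= 1" "abs(a - t powr p) <= 1 / real n powr p"
     proof -
      show "0 <= a" by (simp add: a_def)
      show "a <= 1" using k np law.p by (auto simp: a_def divide_le_eq intro!: powr_mono2)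
      have "1 <= real ?k" using k unfolding atLeastAtMost_iff by linarith
      then have "(real ?k + (?x - real ?k)) powr p <= real ?k powr p + 1"
       by (intro powr_step) (use law.p kx in linarith)+
      then have "?x powr p <= real ?k powr p + 1" by (simp only: add_diff_eq add_diff_cancel_left')
      moreover have "real ?k powr p <= ?x powr p" using kx law.p by (intro powr_mono2) auto
      ultimately have "abs(real ?k powr p - ?x powr p) <= 1" by simp
      then have "abs(real ?k powr p - ?x powr p) / real n powr p <= 1 / real n powr p" using np by (intro divide_right_mono) auto
      moreover have "a - t powr p = (real ?k powr p - ?x powr p) / real n powr p"
       unfolding a_def tx by (simp add: diff_divide_distrib)
      ultimately show "abs(a - t powr p) <= 1 / real n powr p" by (simp add: abs_divide)
     qed
     have "?D / \<sigma> * ((walk ?k q - law.m * real ?k) / sqrt (real n)) = a * scaled ?k q / sqrt ?\<tau>"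
     proof -
      have kp': "real ?k powr p ~= 0" using kp unfolding powr_eq_0_iff by linarith
      have alg: "c * (D / (N * y)) = z / N * (c * (D / z)) / y" if "z ~= 0" for c D N y z :: real using that by simp
      show ?thesis unfolding scaled_eq sp a_def sn by (rule alg[OF kp'])
     qed
     then have "?D / \<sigma> * ((walk ?k q - law.m * real_of_int (floor(?x))) / sqrt (real n)) - t powr p * ?w / sqrt ?\<tau>
       = (a * (scaled ?k q - ?w) + (a - t powr p) * ?w) / sqrt ?\<tau>"
      unfolding fl by (simp add: diff_divide_distrib add_divide_distrib algebra_simps)
     moreover have "abs(a * (scaled ?k q - ?w) + (a - t powr p) * ?w) <= 1 * (r * sqrt ?\<tau>)
       + 1 / real n powr p * (C * sqrt ?\<tau>)"
     proof -
      have "abs(a * (scaled ?k q - ?w)) <= 1 * (r * sqrt ?\<tau>)" unfolding abs_mult using a 1 by (intro mult_mono) auto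
      moreover have "abs((a - t powr p) * ?w) <= 1 / real n powr p * (C * sqrt ?\<tau>)" unfolding abs_mult using a 2 np
        by (intro mult_mono) auto
      ultimately show ?thesis using abs_triangle_ineq[of "a * (scaled ?k q - ?w)" "(a - t powr p) * ?w"] by linarith
     qed
     moreover have "1 / real n powr p * (C * sqrt ?\<tau>) <= r * sqrt ?\<tau>"
     proof -
      have "C / real n powr p <= r" using elim(1) r np by (simp add: divide_le_eq mult.commute)
      then have "C / real n powr p * sqrt ?\<tau> <= r * sqrt ?\<tau>" using \<tau> by (intro mult_right_mono) auto
      then show ?thesis by simp
     qed
     ultimately have "abs(?D / \<sigma> * ((walk ?k q - law.m * real_of_int (floor(?x))) / sqrt (real n)) - t powr p * ?w / sqrt
       ?\<tau>) <= (2 * r * sqrt ?\<tau>) / sqrt ?\<tau>"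
      using \<tau> by (simp only: abs_divide abs_of_pos) (intro divide_right_mono; linarith)
     also have "... = 2 * r" using \<tau> by simp
     also have "... <= e" using e by (simp add: r_def)
     finally show ?thesis .
    qed
   qed auto
  qed
 qed
qed

end

theorem theorem1p2:
  fixes M :: "'a measure"
    and X :: "nat \<Rightarrow> 'a \<Rightarrow> real"
    and \<epsilon> :: "nat \<Rightarrow> 'a \<Rightarrow> bool"
    and U :: "nat \<Rightarrow> 'a \<Rightarrow> nat"
    and p m\<^sub>1 \<sigma> :: real
  assumes "step_reinforcement M X \<epsilon> U p"
    and "integrable M (\<lambda>\<omega>. (X 1 \<omega>)\<^sup>2)"
    and "m\<^sub>1 = prob_space.expectation M (X 1)"
    and "\<sigma>\<^sup>2 = prob_space.variance M (X 1)"
    and "\<sigma> > 0"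
  shows
    "(0 < p \<and> p < 1/2 \<longrightarrow>
       (\<exists>(M' :: (nat \<Rightarrow> real) measure) S W.
          standard_brownian_motion M' W \<and>
          same_process_law M (reinforced_walk X \<epsilon> U) M' S \<and>
          (AE \<omega> in M'.
             (\<lambda>n. 1 / sqrt (real n powr (1 - 2*p) * ln (ln (real n))) *
                  \<bar>sqrt (1 - 2*p) / \<sigma> * ((S n \<omega> - m\<^sub>1 * real n) / real n powr p)
                    - W (real n powr (1 - 2*p)) \<omega>\<bar>) \<longlonglongrightarrow> 0) \<and>
          tendsto_zero_in_probability M'
            (\<lambda>n \<omega>. SUP t\<in>{0..1}.
               \<bar>sqrt (1 - 2*p) / \<sigma> *
                  ((S (nat \<lfloor>real n * t\<rfloor>) \<omega> - m\<^sub>1 * real_of_int \<lfloor>real n * t\<rfloor>) / sqrt (real n))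
                 - t powr p * W ((real n * t) powr (1 - 2*p)) \<omega>
                     / sqrt (real n powr (1 - 2*p))\<bar>)))
   \<and>
     (p = 1/2 \<longrightarrow>
       (\<exists>(M' :: (nat \<Rightarrow> real) measure) S W.
          standard_brownian_motion M' W \<and>
          same_process_law M (reinforced_walk X \<epsilon> U) M' S \<and>
          (AE \<omega> in M'.
             (\<lambda>n. 1 / sqrt (ln (real n) * ln (ln (ln (real n)))) *
                  \<bar>(S n \<omega> - m\<^sub>1 * real n) / (\<sigma> * sqrt (real n))
                    - W (ln (real n)) \<omega>\<bar>) \<longlonglongrightarrow> 0) \<and>
          tendsto_zero_in_probability M'
            (\<lambda>n \<omega>. 1 / sqrt (ln (real n)) *
               (SUP t\<in>{1 / real n..1}.
                  \<bar>(S (nat \<lfloor>real n * t\<rfloor>) \<omega> - m\<^sub>1 * real_of_int \<lfloor>real n * t\<rfloor>)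
                     / (\<sigma> * sqrt (real_of_int \<lfloor>real n * t\<rfloor>))
                    - W (ln (real n * t)) \<omega>\<bar>))))"
proof -
 interpret X: step_reinforcement M X \<epsilon> U p by fact
 define \<mu> where "\<mu> = distr M borel (X 1)"
 have X1: "X 1 : borel_measurable M" using X.X_measurable[of 1] by simp
 interpret \<mu>: real_distribution \<mu> unfolding \<mu>_def by (rule X.real_distribution_distr[OF X1])
 have square: "integrable \<mu> (%x. x^2)"
  unfolding \<mu>_def using assms(2) by (subst integrable_distr_eq[OF X1]) simp_all
 have mean: "\<mu>.expectation (%x. x) = m\<^sub>1"
  unfolding \<mu>_def assms(3) by (subst integral_distr[OF X1]) simp_all
 have var: "\<mu>.variance (%x. x) = \<sigma>^2"
  unfolding mean assms(4) assms(3)[symmetric] unfolding \<mu>_def by (subst integral_distr[OF X1]) simp_all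
 \<comment> \<open>Both regimes use the same embedding on the seed space; \<open>p\<close> enters
   through the copying and the scale, and then through the clock.\<close>
 have main: "EX h K q. reinforced_embedding \<mu> p seed BM odd_coord h K q" and
  v: "square_integrable_law.m \<mu> = m\<^sub>1" "square_integrable_law.v \<mu> = \<sigma>^2" if p: "0 < p" "p <= 1/2"
 proof -
  interpret law: square_integrable_law \<mu> p by unfold_locales (use p square var assms(5) in auto)
  show "EX h K q. reinforced_embedding \<mu> p seed BM odd_coord h K q"
   using law.reinforced_embedding_exists law.square_integrable_law_axioms unfolding reinforced_embedding_def by blast
  show "law.m = m\<^sub>1" "law.v = \<sigma>^2" using mean var by (simp_all add: law.m_def law.v_def)
 qed
 have source: "reinforced_process p \<mu> M X.copied"
  unfolding reinforced_process_def \<mu>_def using X.prob_copied_new X.prob_space_axioms by auto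
 have walk: "reinforced_walk X \<epsilon> U = (%n \<omega>. \<Sum>i<n. X.copied i \<omega>)"
  by (intro ext) (rule X.reinforced_walk_eq)
 show ?thesis
 proof (intro conjI impI, goal_cases)
  case p: 1
  then obtain h K q where "reinforced_embedding \<mu> p seed BM odd_coord h K q" using main by fastforce
  then interpret E: reinforced_embedding \<mu> p seed BM odd_coord h K q .
  have same: "same_process_law M (reinforced_walk X \<epsilon> U) seed E.walk"
   unfolding walk E.walk_def[abs_def] by (rule reinforced_process_same_law[OF source E.reinforced_process_incoming])
  have mv: "E.law.m = m\<^sub>1" "\<sigma>^2 = E.law.v" using v p by auto
  show ?case using E.subcritical_as[OF _ assms(5) mv(2)] E.subcritical_probability[OF _ assms(5) mv(2)] same p
   by (intro exI[of _ seed] exI[of _ E.walk] exI[of _ BM]) (simp add: mv(1) E.standard_brownian_motion_axioms)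
 next
  case p: 2
  then obtain h K q where "reinforced_embedding \<mu> p seed BM odd_coord h K q" using main by fastforce
  then interpret E: reinforced_embedding \<mu> p seed BM odd_coord h K q .
  have same: "same_process_law M (reinforced_walk X \<epsilon> U) seed E.walk"
   unfolding walk E.walk_def[abs_def] by (rule reinforced_process_same_law[OF source E.reinforced_process_incoming])
  have mv: "E.law.m = m\<^sub>1" "\<sigma>^2 = E.law.v" using v p by auto
  show ?case using E.critical_as[OF p assms(5) mv(2)] E.critical_probability[OF p assms(5) mv(2)] same
   unfolding mv(1) using E.standard_brownian_motion_axioms by blast
 qed
qed

end
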